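(* There is a fixed MSO$_1$ formula $\phi(X)$ with one free vertex-set variable such that \textsc{MSO$_1$ Reconfiguration} (MSOR$_1$) with this formula $\phi$ is PSPACE-complete on uncolored forests of depth $3$.
   Context: MSO$_1$ formulas over graphs use vertex and vertex-set variables, atomic formulas $x=y$, $E(x,y)$ (adjacency), $X(x)$ ($x\in X$), closed under Boolean connectives and quantification over vertices and vertex sets. For such a formula $\phi(X)$ and a graph $G$, a $\mathsf{TJ}(\phi)$-sequence from $S_0$ to $S_\ell$ is a sequence $S_0,\dots,S_\ell$ of vertex subsets with $|S_{i-1}\setminus S_i|=|S_i\setminus S_{i-1}|=1$ for all $i\in[\ell]$ and $G\models\phi(S_i)$ for all $i$. MSOR$_1$ with formula $\phi$: given a graph $G=(V,E)$ and $S,S'\subseteq V$ with $|S|=|S'|$, $G\models\phi(S)$, $G\models\phi(S')$, decide whether a $\mathsf{TJ}(\phi)$-sequence from $S$ to $S'$ exists. A forest of depth $3$ is a forest each of whose components can be rooted so that every root-to-leaf path has at most $3$ vertices (equivalently, a forest of treedepth at most $3$, where the depth of a rooted forest is the maximum distance between a root and a leaf plus $1$). *)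

theory Defs
  imports Main "HOL-Computational_Algebra.Polynomial"
begin

section \<open>Finite simple graphs and forests of bounded depth\<close>

record 'a graph =
  verts :: "'a set"
  edges :: "'a set set"

definition simple_graph :: "'a graph \<Rightarrow> bool" where
  "simple_graph G \<longleftrightarrow> finite (verts G) \<and> (\<forall>e\<in>edges G. e \<subseteq> verts G \<and> card e = 2)"

definition adj :: "'a graph \<Rightarrow> 'a \<Rightarrow> 'a \<Rightarrow> bool" where
  "adj G u v \<longleftrightarrow> {u, v} \<in> edges G"

definition is_path :: "'a graph \<Rightarrow> 'a list \<Rightarrow> bool" where
  "is_path G p \<longleftrightarrow> p \<noteq> [] \<and> distinct p \<and> set p \<subseteq> verts G \<and> successively (adj G) p"

definition is_cycle :: "'a graph \<Rightarrow> 'a list \<Rightarrow> bool" where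
  "is_cycle G p \<longleftrightarrow> is_path G p \<and> length p \<ge> 3 \<and> adj G (last p) (hd p)"

definition forest :: "'a graph \<Rightarrow> bool" where
  "forest G \<longleftrightarrow> simple_graph G \<and> (\<nexists>p. is_cycle G p)"

definition component :: "'a graph \<Rightarrow> 'a \<Rightarrow> 'a set" where
  "component G v = {u. \<exists>p. is_path G p \<and> hd p = v \<and> last p = u}"

text \<open>In a tree rooted at \<open>r\<close>, the children of the last vertex of a path from \<open>r\<close> are the vertices
  by which that path can be prolonged; so the path ends in a leaf iff it cannot be prolonged.\<close>

definition root_leaf_path :: "'a graph \<Rightarrow> 'a \<Rightarrow> 'a list \<Rightarrow> bool" where
  "root_leaf_path G r p \<longleftrightarrow> is_path G p \<and> hd p = r \<and> (\<nexists>w. is_path G (p @ [w]))"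

definition forest_of_depth :: "nat \<Rightarrow> 'a graph \<Rightarrow> bool" where
  "forest_of_depth d G \<longleftrightarrow> forest G \<and>
     (\<forall>v\<in>verts G. \<exists>r\<in>component G v. \<forall>p. root_leaf_path G r p \<longrightarrow> length p \<le> d)"


section \<open>MSO1 over graphs\<close>

text \<open>Vertex variables and set variables are two separate families, both indexed by \<open>nat\<close>.
  The remaining connectives and the universal quantifiers are definable by negation.
  \<open>Mem X x\<close> is the atomic formula \<open>X(x)\<close>.\<close>

datatype mso1 =
    Eq nat nat
  | Edge nat nat
  | Mem nat nat
  | Neg mso1
  | Conj mso1 mso1
  | ExV nat mso1
  | ExS nat mso1

primrec sat :: "'a graph \<Rightarrow> (nat \<Rightarrow> 'a) \<Rightarrow> (nat \<Rightarrow> 'a set) \<Rightarrow> mso1 \<Rightarrow> bool" where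
  "sat G \<nu> \<sigma> (Eq x y) \<longleftrightarrow> \<nu> x = \<nu> y"
| "sat G \<nu> \<sigma> (Edge x y) \<longleftrightarrow> adj G (\<nu> x) (\<nu> y)"
| "sat G \<nu> \<sigma> (Mem X x) \<longleftrightarrow> \<nu> x \<in> \<sigma> X"
| "sat G \<nu> \<sigma> (Neg \<phi>) \<longleftrightarrow> \<not> sat G \<nu> \<sigma> \<phi>"
| "sat G \<nu> \<sigma> (Conj \<phi> \<psi>) \<longleftrightarrow> sat G \<nu> \<sigma> \<phi> \<and> sat G \<nu> \<sigma> \<psi>"
| "sat G \<nu> \<sigma> (ExV x \<phi>) \<longleftrightarrow> (\<exists>v\<in>verts G. sat G (\<nu>(x := v)) \<sigma> \<phi>)"
| "sat G \<nu> \<sigma> (ExS X \<phi>) \<longleftrightarrow> (\<exists>A\<subseteq>verts G. sat G \<nu> (\<sigma>(X := A)) \<phi>)"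

primrec free_vertex_vars :: "mso1 \<Rightarrow> nat set" where
  "free_vertex_vars (Eq x y) = {x, y}"
| "free_vertex_vars (Edge x y) = {x, y}"
| "free_vertex_vars (Mem X x) = {x}"
| "free_vertex_vars (Neg \<phi>) = free_vertex_vars \<phi>"
| "free_vertex_vars (Conj \<phi> \<psi>) = free_vertex_vars \<phi> \<union> free_vertex_vars \<psi>"
| "free_vertex_vars (ExV x \<phi>) = free_vertex_vars \<phi> - {x}"
| "free_vertex_vars (ExS X \<phi>) = free_vertex_vars \<phi>"

primrec free_set_vars :: "mso1 \<Rightarrow> nat set" where
  "free_set_vars (Eq x y) = {}"
| "free_set_vars (Edge x y) = {}"
| "free_set_vars (Mem X x) = {X}"
| "free_set_vars (Neg \<phi>) = free_set_vars \<phi>"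
| "free_set_vars (Conj \<phi> \<psi>) = free_set_vars \<phi> \<union> free_set_vars \<psi>"
| "free_set_vars (ExV x \<phi>) = free_set_vars \<phi>"
| "free_set_vars (ExS X \<phi>) = free_set_vars \<phi> - {X}"

lemma sat_cong_free:
  assumes "\<And>x. x \<in> free_vertex_vars \<phi> \<Longrightarrow> \<nu> x = \<nu>' x"
    and "\<And>X. X \<in> free_set_vars \<phi> \<Longrightarrow> \<sigma> X = \<sigma>' X"
  shows "sat G \<nu> \<sigma> \<phi> \<longleftrightarrow> sat G \<nu>' \<sigma>' \<phi>"
  using assms
proof (induction \<phi> arbitrary: \<nu> \<nu>' \<sigma> \<sigma>')
  case (Conj \<phi> \<psi>)
  have "sat G \<nu> \<sigma> \<phi> \<longleftrightarrow> sat G \<nu>' \<sigma>' \<phi>"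
    using Conj.prems by (intro Conj.IH(1)) auto
  moreover have "sat G \<nu> \<sigma> \<psi> \<longleftrightarrow> sat G \<nu>' \<sigma>' \<psi>"
    using Conj.prems by (intro Conj.IH(2)) auto
  ultimately show ?case by simp
next
  case (ExV x \<phi>)
  have "sat G (\<nu>(x := v)) \<sigma> \<phi> \<longleftrightarrow> sat G (\<nu>'(x := v)) \<sigma>' \<phi>" for v
    using ExV.prems by (intro ExV.IH) auto
  then show ?case by simp
next
  case (ExS X \<phi>)
  have "sat G \<nu> (\<sigma>(X := A)) \<phi> \<longleftrightarrow> sat G \<nu>' (\<sigma>'(X := A)) \<phi>" for A
    using ExS.prems by (intro ExS.IH) auto
  then show ?case by simp
next
  case (Neg \<phi>)
  have "sat G \<nu> \<sigma> \<phi> \<longleftrightarrow> sat G \<nu>' \<sigma>' \<phi>"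
    using Neg.prems by (intro Neg.IH) auto
  then show ?case by simp
qed auto

text \<open>For a formula whose only free variable is the set variable \<open>X\<close>, the values given to the other
  variables below play no role, by the preceding lemma.\<close>

definition models :: "'a graph \<Rightarrow> mso1 \<Rightarrow> nat \<Rightarrow> 'a set \<Rightarrow> bool" where
  "models G \<phi> X S \<longleftrightarrow> sat G (\<lambda>_. undefined) ((\<lambda>_. {})(X := S)) \<phi>"


section \<open>MSO1 reconfiguration under token jumping\<close>

definition TJ_sequence ::
  "'a graph \<Rightarrow> mso1 \<Rightarrow> nat \<Rightarrow> 'a set \<Rightarrow> 'a set \<Rightarrow> 'a set list \<Rightarrow> bool" where
  "TJ_sequence G \<phi> X S S' Ss \<longleftrightarrow>
     Ss \<noteq> [] \<and> hd Ss = S \<and> last Ss = S' \<and>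
     (\<forall>A\<in>set Ss. A \<subseteq> verts G \<and> models G \<phi> X A) \<and>
     successively (\<lambda>A B. card (A - B) = 1 \<and> card (B - A) = 1) Ss"

definition msor1_instance :: "mso1 \<Rightarrow> nat \<Rightarrow> 'a graph \<Rightarrow> 'a set \<Rightarrow> 'a set \<Rightarrow> bool" where
  "msor1_instance \<phi> X G S S' \<longleftrightarrow>
     simple_graph G \<and> S \<subseteq> verts G \<and> S' \<subseteq> verts G \<and> card S = card S' \<and>
     models G \<phi> X S \<and> models G \<phi> X S'"

text \<open>For string encodings, the vertices of an \<open>n\<close>-vertex graph are \<open>0, \<dots>, n - 1\<close>. The encoding is
  \<open>n\<close> in unary, a separator, the characteristic vectors of \<open>S\<close> and \<open>S'\<close>, and the adjacency matrix
  row by row.\<close>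

definition encode_instance :: "nat \<Rightarrow> nat graph \<Rightarrow> nat set \<Rightarrow> nat set \<Rightarrow> bool list" where
  "encode_instance n G S S' =
     replicate n True @ [False] @
     map (\<lambda>i. i \<in> S) [0..<n] @ map (\<lambda>i. i \<in> S') [0..<n] @
     concat (map (\<lambda>i. map (\<lambda>j. adj G i j) [0..<n]) [0..<n])"

definition msor1_instances :: "mso1 \<Rightarrow> nat \<Rightarrow> (nat graph \<Rightarrow> bool) \<Rightarrow> bool list set" where
  "msor1_instances \<phi> X \<C> =
     {encode_instance n G S S' | n G S S'.
        verts G = {..<n} \<and> \<C> G \<and> msor1_instance \<phi> X G S S'}"

definition msor1_yes_instances :: "mso1 \<Rightarrow> nat \<Rightarrow> (nat graph \<Rightarrow> bool) \<Rightarrow> bool list set" where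
  "msor1_yes_instances \<phi> X \<C> =
     {encode_instance n G S S' | n G S S'.
        verts G = {..<n} \<and> \<C> G \<and> msor1_instance \<phi> X G S S' \<and>
        (\<exists>Ss. TJ_sequence G \<phi> X S S' Ss)}"

lemma replicate_True_False_inj:
  "replicate n True @ False # xs = replicate m True @ False # ys \<Longrightarrow> n = m \<and> xs = ys"
proof (induction n arbitrary: m)
  case 0 then show ?case by (cases m) auto
next
  case (Suc n) then show ?case by (cases m) auto
qed

lemma encode_instance_inj:
  assumes eq: "encode_instance n G S T = encode_instance n' G' S' T'"
    and G: "simple_graph G" "verts G = {..<n}" "S \<subseteq> verts G" "T \<subseteq> verts G"
    and G': "simple_graph G'" "verts G' = {..<n'}" "S' \<subseteq> verts G'" "T' \<subseteq> verts G'"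
  shows "n = n' \<and> G = G' \<and> S = S' \<and> T = T'"
proof -
  let ?M = "\<lambda>G::nat graph. map (\<lambda>i. map (\<lambda>j. adj G i j) [0..<n]) [0..<n]"
  have n: "n = n'" and rest:
    "map (\<lambda>i. i \<in> S) [0..<n] @ map (\<lambda>i. i \<in> T) [0..<n] @ concat (?M G) =
     map (\<lambda>i. i \<in> S') [0..<n'] @ map (\<lambda>i. i \<in> T') [0..<n'] @
       concat (map (\<lambda>i. map (\<lambda>j. adj G' i j) [0..<n']) [0..<n'])"
    using replicate_True_False_inj[OF eq[unfolded encode_instance_def append_Cons append_Nil]]
    by blast+
  have S: "map (\<lambda>i. i \<in> S) [0..<n] = map (\<lambda>i. i \<in> S') [0..<n]"
    and T: "map (\<lambda>i. i \<in> T) [0..<n] = map (\<lambda>i. i \<in> T') [0..<n]"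
    and M: "concat (?M G) = concat (?M G')"
    using rest unfolding n[symmetric] by (simp_all add: append_eq_append_conv del: map_eq_conv)
  have M': "?M G = ?M G'"
  proof (rule concat_injective[OF M])
    show "length (?M G) = length (?M G')" by simp
    show "\<forall>(x, y)\<in>set (zip (?M G) (?M G')). length x = length y"
      by (auto simp: set_zip)
  qed
  have SS: "S = S'"
  proof -
    have "i \<in> S \<longleftrightarrow> i \<in> S'" if "i < n" for i
      using arg_cong[OF S, of "\<lambda>xs. xs ! i"] that by simp
    then show ?thesis using G(2,3) G'(2,3) unfolding n by (metis lessThan_iff subsetD subsetI subset_antisym)
  qed
  have TT: "T = T'"
  proof -
    have "i \<in> T \<longleftrightarrow> i \<in> T'" if "i < n" for i
      using arg_cong[OF T, of "\<lambda>xs. xs ! i"] that by simp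
    then show ?thesis using G(2,4) G'(2,4) unfolding n by (metis lessThan_iff subsetD subsetI subset_antisym)
  qed
  have A: "adj G i j = adj G' i j" if "i < n" "j < n" for i j
    using arg_cong[OF M', of "\<lambda>xs. xs ! i ! j"] that by simp
  have "edges G = edges G'"
  proof (intro set_eqI)
    fix e
    have *: "\<exists>i j. i < n \<and> j < n \<and> e = {i, j}" if "e \<in> edges G \<or> e \<in> edges G'"
    proof -
      have "card e = 2" "e \<subseteq> {..<n}"
        using that G(1,2) G'(1,2) unfolding simple_graph_def n by metis+
      then obtain i j where "e = {i, j}" "{i, j} \<subseteq> {..<n}" unfolding card_2_iff by blast
      then show ?thesis by (intro exI[of _ i] exI[of _ j]) simp
    qed
    show "e \<in> edges G \<longleftrightarrow> e \<in> edges G'"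
    proof (cases "e \<in> edges G \<or> e \<in> edges G'")
      case True
      then obtain i j where "i < n" "j < n" "e = {i, j}" using * by blast
      then show ?thesis using A[of i j] unfolding adj_def by simp
    qed simp
  qed
  moreover have "verts G = verts G'" using G(2) G'(2) unfolding n by simp
  ultimately have "G = G'" by simp
  then show ?thesis using n SS TT by blast
qed


section \<open>Turing machines, polynomial space and polynomial time\<close>

text \<open>Deterministic machines with \<open>tm_tapes\<close> many two-way infinite tapes. States and symbols are
  initial segments of the naturals; the symbol 0 is the blank, 1 and 2 encode the bits \<open>False\<close> and
  \<open>True\<close>.\<close>

datatype move = Left | Stay | Right

record tm =
  tm_tapes :: nat
  tm_states :: nat
  tm_symbols :: nat
  tm_start :: nat
  tm_accept :: nat
  tm_reject :: nat
  tm_delta :: "nat \<Rightarrow> nat list \<Rightarrow> nat \<times> (nat \<times> move) list"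

definition wf_tm :: "tm \<Rightarrow> bool" where
  "wf_tm M \<longleftrightarrow>
     tm_tapes M \<ge> 1 \<and> tm_symbols M \<ge> 3 \<and>
     tm_start M < tm_states M \<and> tm_accept M < tm_states M \<and> tm_reject M < tm_states M \<and>
     tm_accept M \<noteq> tm_reject M \<and>
     (\<forall>q < tm_states M. \<forall>ss. length ss = tm_tapes M \<and> (\<forall>s\<in>set ss. s < tm_symbols M) \<longrightarrow>
        (case tm_delta M q ss of (q', acts) \<Rightarrow>
           q' < tm_states M \<and> length acts = tm_tapes M \<and> (\<forall>(s, d)\<in>set acts. s < tm_symbols M)))"

type_synonym tape = "(int \<Rightarrow> nat) \<times> int"
type_synonym config = "nat \<times> tape list"

fun move_head :: "move \<Rightarrow> int \<Rightarrow> int" where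
  "move_head Left h = h - 1"
| "move_head Stay h = h"
| "move_head Right h = h + 1"

fun act :: "tape \<Rightarrow> nat \<times> move \<Rightarrow> tape" where
  "act (c, h) (s, d) = (c(h := s), move_head d h)"

definition halted :: "tm \<Rightarrow> config \<Rightarrow> bool" where
  "halted M C \<longleftrightarrow> fst C = tm_accept M \<or> fst C = tm_reject M"

definition step :: "tm \<Rightarrow> config \<Rightarrow> config" where
  "step M C =
     (if halted M C then C
      else (case tm_delta M (fst C) (map (\<lambda>(c, h). c h) (snd C)) of
              (q', acts) \<Rightarrow> (q', map2 act (snd C) acts)))"

definition word_content :: "bool list \<Rightarrow> int \<Rightarrow> nat" where
  "word_content w i =
     (if 0 \<le> i \<and> i < int (length w) then (if w ! nat i then 2 else 1) else 0)"

text \<open>The input is on tape 0, all other tapes are blank.\<close>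

definition init_config :: "tm \<Rightarrow> bool list \<Rightarrow> config" where
  "init_config M w =
     (tm_start M, (word_content w, 0) # replicate (tm_tapes M - 1) (word_content [], 0))"

definition run :: "tm \<Rightarrow> bool list \<Rightarrow> nat \<Rightarrow> config" where
  "run M w t = (step M ^^ t) (init_config M w)"

definition visited_cells :: "tm \<Rightarrow> bool list \<Rightarrow> nat \<Rightarrow> int set" where
  "visited_cells M w i = {snd (snd (run M w t) ! i) | t. True}"

definition runs_in_space :: "tm \<Rightarrow> bool list \<Rightarrow> nat \<Rightarrow> bool" where
  "runs_in_space M w s \<longleftrightarrow>
     (\<forall>i < tm_tapes M. finite (visited_cells M w i)) \<and>
     (\<Sum>i < tm_tapes M. card (visited_cells M w i)) \<le> s"

definition decides :: "tm \<Rightarrow> bool list set \<Rightarrow> bool" where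
  "decides M L \<longleftrightarrow>
     (\<forall>w. \<exists>t. halted M (run M w t) \<and> (fst (run M w t) = tm_accept M \<longleftrightarrow> w \<in> L))"

definition PSPACE :: "bool list set set" where
  "PSPACE = {L. \<exists>M (p :: nat poly). wf_tm M \<and> decides M L \<and>
                  (\<forall>w. runs_in_space M w (poly p (length w)))}"

text \<open>The output is the content of the last tape.\<close>

definition polytime_computable :: "(bool list \<Rightarrow> bool list) \<Rightarrow> bool" where
  "polytime_computable f \<longleftrightarrow>
     (\<exists>M (p :: nat poly). wf_tm M \<and>
        (\<forall>w. \<exists>t \<le> poly p (length w).
           fst (run M w t) = tm_accept M \<and>
           fst (last (snd (run M w t))) = word_content (f w)))"

text \<open>A decision problem is given by the set \<open>I\<close> of (encodings of) its instances and the set \<open>Y\<close> of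
  its yes-instances. Membership in PSPACE is that of the language \<open>Y\<close>, so that strings outside \<open>I\<close>
  have to be rejected; reductions have to produce elements of \<open>I\<close> on all inputs.\<close>

definition PSPACE_hard :: "bool list set \<Rightarrow> bool list set \<Rightarrow> bool" where
  "PSPACE_hard I Y \<longleftrightarrow>
     (\<forall>L\<in>PSPACE. \<exists>f. polytime_computable f \<and> (\<forall>w. f w \<in> I \<and> (w \<in> L \<longleftrightarrow> f w \<in> Y)))"

definition PSPACE_complete :: "bool list set \<Rightarrow> bool list set \<Rightarrow> bool" where
  "PSPACE_complete I Y \<longleftrightarrow> Y \<in> PSPACE \<and> PSPACE_hard I Y"

end

theory Submission
  imports Defs
begin

text \<open>Membership: configurations are token sets, moves are locally checkable, and Savitch's recursion turns
  reachability into a quantified Boolean formula, evaluated in polynomial space by a small while language that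
  compiles to Turing machines.

  Hardness: a space-bounded machine becomes a deterministic machine that reads and writes one variable per step.
  Its configurations are sets of switched-on cells, and its steps switch a triple (control state, value, link) on or
  off; by determinism, reversibility of this toggling does not create new reachable final states. A cell is a tree of
  depth 3 with two equally large groups of leaves, at distance 1 and 2 from the root, and is on or off according to
  the group that holds the tokens; a possible toggle is a tree with one group of leaves. The number of leaves
  identifies the tree: the sum of the sizes of at most three cells determines these cells, and since only as many
  tokens leave the cells as fit into a toggle tree, a completed excursion of tokens is exactly one toggle. Which excursions
  are allowed is a property of the uncolored forest alone, and so can be fixed in a first-order formula.\<close>


text \<open>A fixed formula over an uncolored graph can neither name a cell nor compare two sizes.
  The one used here counts only up to three disturbed cells and up to two tokens or free places;
  equality of sizes comes from the conservation of tokens. The passage between the two groups of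
  leaves hinges on a single jump, and when it takes the last token out of the old group, the rule
  tree must lack exactly one leaf, so the weights of the disturbed cells add up to its size. With
  four leaves per group, two tokens can leave first and two others last, which keeps both counters
  at two in between.

  Weights have three digits in a base that exceeds three times any digit, and a rule has all digits
  at least 4: no carries occur, and one cell of each kind takes part. The link remembers which
  instruction is half done, since control state and value are both absent then.

  The formula also asserts a rank condition that implies depth 3, so membership needs no separate
  test of the graph class. Arithmetic with bounded quantifiers serves twice: as the matrix of the
  quantified Boolean formula and to define the output bits of the reduction.\<close>

section \<open>A while language on tapes and its compilation to Turing machines\<close>

datatype com =
    Skip
  | Mv nat move
  | Wr nat nat
  | Seq com com (infixr ";;" 60)
  | Ite nat nat com com
  | Loop nat nat com

definition head_sym :: "tape \<Rightarrow> nat" where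
  "head_sym tp = fst tp (snd tp)"

text \<open>The times are the exact step counts of the compiled code: a true branch pays for the
  test and for the jump over the other branch, a loop round for the test and the jump back. Only
  \<open>Mv\<close> changes a head position, so only there is the bound \<open>B\<close>
  checked.\<close>

inductive exec :: "int \<Rightarrow> com \<Rightarrow> (nat \<Rightarrow> tape) \<Rightarrow> nat \<Rightarrow> (nat \<Rightarrow> tape) \<Rightarrow> bool" for B where
  exec_Skip: "exec B Skip T 0 T"
| exec_Mv: "\<bar>move_head d (snd (T i))\<bar> \<le> B \<Longrightarrow>
    exec B (Mv i d) T 1 (T(i := (fst (T i), move_head d (snd (T i)))))"
| exec_Wr: "exec B (Wr i v) T 1 (T(i := ((fst (T i))(snd (T i) := v), snd (T i))))"
| exec_Seq: "exec B c1 T t1 T1 \<Longrightarrow> exec B c2 T1 t2 T2 \<Longrightarrow> exec B (c1 ;; c2) T (t1 + t2) T2"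
| exec_IteT: "head_sym (T i) = v \<Longrightarrow> exec B c1 T t T' \<Longrightarrow> exec B (Ite i v c1 c2) T (t + 2) T'"
| exec_IteF: "head_sym (T i) \<noteq> v \<Longrightarrow> exec B c2 T t T' \<Longrightarrow> exec B (Ite i v c1 c2) T (t + 1) T'"
| exec_LoopE: "head_sym (T i) = v \<Longrightarrow> exec B (Loop i v c) T 1 T"
| exec_LoopS: "head_sym (T i) \<noteq> v \<Longrightarrow> exec B c T t1 T1 \<Longrightarrow> exec B (Loop i v c) T1 t2 T2 \<Longrightarrow>
    exec B (Loop i v c) T (t1 + t2 + 2) T2"

primrec com_len :: "com \<Rightarrow> nat" where
  "com_len Skip = 0"
| "com_len (Mv i d) = 1"
| "com_len (Wr i v) = 1"
| "com_len (c1 ;; c2) = com_len c1 + com_len c2"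
| "com_len (Ite i v c1 c2) = com_len c1 + com_len c2 + 2"
| "com_len (Loop i v c) = com_len c + 2"

primrec com_tapes :: "com \<Rightarrow> nat set" where
  "com_tapes Skip = {}"
| "com_tapes (Mv i d) = {i}"
| "com_tapes (Wr i v) = {i}"
| "com_tapes (c1 ;; c2) = com_tapes c1 \<union> com_tapes c2"
| "com_tapes (Ite i v c1 c2) = insert i (com_tapes c1 \<union> com_tapes c2)"
| "com_tapes (Loop i v c) = insert i (com_tapes c)"

primrec com_wf :: "com \<Rightarrow> bool" where
  "com_wf Skip = True"
| "com_wf (Mv i d) = True"
| "com_wf (Wr i v) = (v < 3)"
| "com_wf (c1 ;; c2) = (com_wf c1 \<and> com_wf c2)"
| "com_wf (Ite i v c1 c2) = (com_wf c1 \<and> com_wf c2)"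
| "com_wf (Loop i v c) = com_wf c"

lemma finite_com_tapes: "finite (com_tapes c)"
  by (induction c) auto

abbreviation stay :: "(nat \<Rightarrow> nat) \<Rightarrow> nat \<Rightarrow> nat \<times> move" where
  "stay \<sigma> \<equiv> (\<lambda>i. (\<sigma> i, Stay))"

text \<open>\<open>com_delta c a q \<sigma>\<close> is the transition in state \<open>q\<close> on reading \<open>\<sigma>\<close> when the code of \<open>c\<close> occupies
  the states from \<open>a\<close> to \<open>a + com_len c - 1\<close> and is left into the state \<open>a + com_len c\<close>.\<close>

primrec com_delta :: "com \<Rightarrow> nat \<Rightarrow> nat \<Rightarrow> (nat \<Rightarrow> nat) \<Rightarrow> nat \<times> (nat \<Rightarrow> nat \<times> move)" where
  "com_delta Skip a q \<sigma> = (a, stay \<sigma>)"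
| "com_delta (Mv i d) a q \<sigma> = (a + 1, (stay \<sigma>)(i := (\<sigma> i, d)))"
| "com_delta (Wr i v) a q \<sigma> = (a + 1, (stay \<sigma>)(i := (v, Stay)))"
| "com_delta (c1 ;; c2) a q \<sigma> =
     (if q < a + com_len c1 then com_delta c1 a q \<sigma> else com_delta c2 (a + com_len c1) q \<sigma>)"
| "com_delta (Ite i v c1 c2) a q \<sigma> =
     (if q = a then (if \<sigma> i = v then a + 1 else a + com_len c1 + 2, stay \<sigma>)
      else if q < a + 1 + com_len c1 then com_delta c1 (a + 1) q \<sigma>
      else if q = a + 1 + com_len c1 then (a + com_len c1 + com_len c2 + 2, stay \<sigma>)
      else com_delta c2 (a + com_len c1 + 2) q \<sigma>)"
| "com_delta (Loop i v c) a q \<sigma> =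
     (if q = a then (if \<sigma> i = v then a + com_len c + 2 else a + 1, stay \<sigma>)
      else if q < a + 1 + com_len c then com_delta c (a + 1) q \<sigma>
      else (a, stay \<sigma>))"

lemma com_delta_wf:
  assumes "com_wf c" "a \<le> q" "q < a + com_len c" "\<And>i. \<sigma> i < 3"
  shows "fst (com_delta c a q \<sigma>) \<le> a + com_len c \<and> (\<forall>i. fst (snd (com_delta c a q \<sigma>) i) < 3)"
  using assms
proof (induction c arbitrary: a)
  case (Seq c1 c2)
  show ?case
  proof (cases "q < a + com_len c1")
    case True
    then show ?thesis using Seq.IH(1)[of a] Seq.prems by simp
  next
    case False
    then show ?thesis using Seq.IH(2)[of "a + com_len c1"] Seq.prems by simp
  qed
next
  case (Ite i v c1 c2)
  consider "q = a" | "a < q" "q < a + 1 + com_len c1" | "q = a + 1 + com_len c1" | "q > a + 1 + com_len c1"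
    using Ite.prems(2) by linarith
  then show ?case
  proof cases
    case 2
    then show ?thesis using Ite.IH(1)[of "a + 1"] Ite.prems by simp
  next
    case 4
    then show ?thesis using Ite.IH(2)[of "a + com_len c1 + 2"] Ite.prems by simp
  qed (use Ite.prems in auto)
next
  case (Loop i v c)
  consider "q = a" | "a < q" "q < a + 1 + com_len c" | "q = a + 1 + com_len c"
    using Loop.prems(2,3) by fastforce
  then show ?case
  proof cases
    case 2
    then show ?thesis using Loop.IH[of "a + 1"] Loop.prems by simp
  qed (use Loop.prems in auto)
qed auto

text \<open>The state \<open>com_len c\<close> behind the code is the verdict: symbol 1 under the
  head of tape \<open>r\<close>, which is the mark of a counter at zero, leads to rejection. Tapes
  are listed by name in \<open>ts\<close>, which makes their physical order a free choice.\<close>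

definition machine :: "com \<Rightarrow> nat \<Rightarrow> nat list \<Rightarrow> tm" where
  "machine c r ts =
     \<lparr>tm_tapes = length ts, tm_states = com_len c + 3, tm_symbols = 3, tm_start = 0,
      tm_accept = com_len c + 1, tm_reject = com_len c + 2,
      tm_delta = (\<lambda>q ss.
        let \<sigma> = (\<lambda>i. case map_of (zip ts ss) i of None \<Rightarrow> 0 | Some s \<Rightarrow> s);
            d = (if q < com_len c then com_delta c 0 q \<sigma>
                 else (if \<sigma> r = 1 then com_len c + 2 else com_len c + 1, stay \<sigma>))
        in (fst d, map (snd d) ts))\<rparr>"

lemma wf_tm_machine:
  assumes "com_wf c" "ts \<noteq> []"
  shows "wf_tm (machine c r ts)"
proof -
  have "case tm_delta (machine c r ts) q ss of (q', acts) \<Rightarrow>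
           q' < com_len c + 3 \<and> length acts = length ts \<and> (\<forall>(s, d)\<in>set acts. s < 3)"
    if "q < com_len c + 3" "length ss = length ts" "\<forall>s\<in>set ss. s < 3" for q ss
  proof -
    define \<sigma> where "\<sigma> = (\<lambda>i. case map_of (zip ts ss) i of None \<Rightarrow> 0 | Some s \<Rightarrow> s)"
    have s: "\<sigma> i < 3" for i
      using that unfolding \<sigma>_def by (auto split: option.split dest!: map_of_SomeD set_zip_rightD)
    define d where "d = (if q < com_len c then com_delta c 0 q \<sigma>
                 else (if \<sigma> r = 1 then com_len c + 2 else com_len c + 1, stay \<sigma>))"
    have d: "tm_delta (machine c r ts) q ss = (fst d, map (snd d) ts)"
      by (simp add: machine_def Let_def d_def \<sigma>_def)
    have "fst d < com_len c + 3 \<and> (\<forall>i. fst (snd d i) < 3)"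
      using com_delta_wf[OF assms(1), of 0 q \<sigma>] s by (auto simp: d_def)
    then show ?thesis unfolding d by (auto simp: case_prod_beta)
  qed
  then show ?thesis
    using assms(2) by (simp add: wf_tm_def machine_def Suc_leI)
qed

text \<open>The default 0 matches what the transition function computes for a name missing from
  \<open>ts\<close>.\<close>

definition tape_syms :: "nat list \<Rightarrow> (nat \<Rightarrow> tape) \<Rightarrow> nat \<Rightarrow> nat" where
  "tape_syms ts T i = (if i \<in> set ts then head_sym (T i) else 0)"

lemma step_machine:
  assumes "q \<le> com_len c"
  shows "step (machine c r ts) (q, map T ts) =
    (let d = (if q < com_len c then com_delta c 0 q (tape_syms ts T)
              else (if tape_syms ts T r = 1 then com_len c + 2 else com_len c + 1, stay (tape_syms ts T)))
     in (fst d, map (\<lambda>i. act (T i) (snd d i)) ts))"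
proof -
  have 1: "map (\<lambda>(c, h). c h) (map T ts) = map (\<lambda>i. head_sym (T i)) ts"
    by (auto simp: head_sym_def split: prod.splits)
  have 2: "(\<lambda>i. case map_of (zip ts (map (\<lambda>i. head_sym (T i)) ts)) i of None \<Rightarrow> 0 | Some s \<Rightarrow> s)
      = tape_syms ts T"
    by (auto simp: map_of_zip_map tape_syms_def)
  have 3: "map2 act (map T ts) (map f ts) = map (\<lambda>i. act (T i) (f i)) ts" for f
    by (induction ts) auto
  show ?thesis
    using assms unfolding step_def halted_def fst_conv snd_conv 1
    by (simp add: machine_def 2 fun_cong[OF 2] 3 Let_def)
qed

lemma map_act_stay: "map (\<lambda>i. act (T i) (tape_syms ts T i, Stay)) ts = map T ts"
proof -
  have "act (T i) (tape_syms ts T i, Stay) = T i" if "i \<in> set ts" for i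
    using that by (cases "T i") (simp add: tape_syms_def head_sym_def)
  then show ?thesis by simp
qed

lemma map_act_upd:
  "map (\<lambda>j. act (T j) (((stay (tape_syms ts T))(i := x)) j)) ts = map (T(i := act (T i) x)) ts"
proof -
  have "act (T i) (tape_syms ts T i, Stay) = T i" if "i \<in> set ts" for i
    using that by (cases "T i") (simp add: tape_syms_def head_sym_def)
  then show ?thesis by simp
qed

definition heads_within :: "int \<Rightarrow> config \<Rightarrow> bool" where
  "heads_within B C \<longleftrightarrow> (\<forall>tp\<in>set (snd C). \<bar>snd tp\<bar> \<le> B)"

text \<open>The bound on the heads is recorded at every configuration passed, both ends included;
  that turns one derivation into a time bound and a space bound at once.\<close>

inductive trace :: "tm \<Rightarrow> int \<Rightarrow> nat \<Rightarrow> config \<Rightarrow> config \<Rightarrow> bool" for M B where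
  trace_refl: "heads_within B C \<Longrightarrow> trace M B 0 C C"
| trace_step: "heads_within B C \<Longrightarrow> trace M B t (step M C) C' \<Longrightarrow> trace M B (Suc t) C C'"

lemma trace_trans: "trace M B t C C' \<Longrightarrow> trace M B t' C' C'' \<Longrightarrow> trace M B (t + t') C C''"
  by (induction rule: trace.induct) (auto intro: trace.intros)

lemma trace_one: "heads_within B C \<Longrightarrow> step M C = C' \<Longrightarrow> heads_within B C' \<Longrightarrow> trace M B 1 C C'"
  using trace_step[of B C M 0 C'] trace_refl[of B C' M] by simp

lemma trace_run:
  assumes "trace M B t C C'"
  shows "(step M ^^ t) C = C'" "\<forall>t'\<le>t. heads_within B ((step M ^^ t') C)"
proof -
  have "(step M ^^ t) C = C' \<and> (\<forall>t'\<le>t. heads_within B ((step M ^^ t') C))"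
    using assms
  proof induction
    case (trace_step C t C')
    have "heads_within B ((step M ^^ t') C)" if "t' \<le> Suc t" for t'
    proof (cases t')
      case (Suc u)
      then show ?thesis using trace_step that by (simp add: funpow_swap1)
    qed (use trace_step in simp)
    then show ?case using trace_step by (simp add: funpow_swap1)
  qed auto
  then show "(step M ^^ t) C = C'" "\<forall>t'\<le>t. heads_within B ((step M ^^ t') C)" by auto
qed


abbreviation heads_ok :: "int \<Rightarrow> nat list \<Rightarrow> (nat \<Rightarrow> tape) \<Rightarrow> bool" where
  "heads_ok B ts T \<equiv> (\<forall>i\<in>set ts. \<bar>snd (T i)\<bar> \<le> B)"

lemma exec_heads_ok: "exec B c T t T' \<Longrightarrow> heads_ok B ts T \<Longrightarrow> heads_ok B ts T'"
  by (induction rule: exec.induct) auto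

lemma heads_within_map: "heads_within B (q, map T ts) \<longleftrightarrow> heads_ok B ts T"
  by (simp add: heads_within_def)

text \<open>Induction on the execution. The second premise says that the code of \<open>c\<close>
  sits inside \<open>p\<close> at address \<open>a\<close>; it is handed down to subprograms with
  shifted addresses, and control always leaves a fragment at the address just behind it.\<close>

lemma exec_trace:
  assumes "exec B c T t T'"
    and "\<And>q \<sigma>. a \<le> q \<Longrightarrow> q < a + com_len c \<Longrightarrow> com_delta p 0 q \<sigma> = com_delta c a q \<sigma>"
    and "a + com_len c \<le> com_len p" "com_tapes c \<subseteq> set ts" "heads_ok B ts T"
  shows "trace (machine p r ts) B t (a, map T ts) (a + com_len c, map T' ts)"
  using assms
proof (induction arbitrary: a)
  case (exec_Skip T)
  then show ?case by (simp add: trace_refl heads_within_map)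
next
  case (exec_Mv d T i)
  have 1: "com_delta p 0 a (tape_syms ts T) = (a + 1, (stay (tape_syms ts T))(i := (tape_syms ts T i, d)))"
    using exec_Mv.prems(1)[of a] by simp
  have 2: "act (T i) (tape_syms ts T i, d) = (fst (T i), move_head d (snd (T i)))"
    using exec_Mv.prems(3) by (cases "T i") (simp add: tape_syms_def head_sym_def)
  have "step (machine p r ts) (a, map T ts) =
      (a + 1, map (T(i := (fst (T i), move_head d (snd (T i))))) ts)"
    using exec_Mv.prems(2) map_act_upd[of T ts i "(tape_syms ts T i, d)"]
    by (simp add: step_machine 1 2 Let_def del: fun_upd_apply)
  then show ?case
    using exec_Mv by (intro trace_one) (simp_all add: heads_within_map)
next
  case (exec_Wr i v T)
  have 1: "com_delta p 0 a (tape_syms ts T) = (a + 1, (stay (tape_syms ts T))(i := (v, Stay)))"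
    using exec_Wr.prems(1)[of a] by simp
  have 2: "act (T i) (v, Stay) = ((fst (T i))(snd (T i) := v), snd (T i))"
    by (cases "T i") simp
  have "step (machine p r ts) (a, map T ts) =
      (a + 1, map (T(i := ((fst (T i))(snd (T i) := v), snd (T i)))) ts)"
    using exec_Wr.prems(2) map_act_upd[of T ts i "(v, Stay)"]
    by (simp add: step_machine 1 2 Let_def del: fun_upd_apply)
  then show ?case
    using exec_Wr by (intro trace_one) (simp_all add: heads_within_map)
next
  case (exec_Seq c1 T t1 T1 c2 t2 T2)
  have 1: "trace (machine p r ts) B t1 (a, map T ts) (a + com_len c1, map T1 ts)"
    using exec_Seq.prems by (intro exec_Seq.IH(1)) auto
  have 2: "trace (machine p r ts) B t2 (a + com_len c1, map T1 ts)
      ((a + com_len c1) + com_len c2, map T2 ts)"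
    using exec_Seq.prems exec_heads_ok[OF exec_Seq.hyps(1)] by (intro exec_Seq.IH(2)) auto
  show ?case using trace_trans[OF 1 2] by (simp add: add.assoc)
next
  case (exec_IteT T i v c1 t T' c2)
  have "com_delta p 0 a (tape_syms ts T) = (a + 1, stay (tape_syms ts T))"
    using exec_IteT.prems(1)[of a] exec_IteT.prems(3) exec_IteT.hyps(1) by (simp add: tape_syms_def)
  then have "step (machine p r ts) (a, map T ts) = (a + 1, map T ts)"
    using exec_IteT.prems(2) by (simp add: step_machine Let_def map_act_stay)
  then have 1: "trace (machine p r ts) B 1 (a, map T ts) (a + 1, map T ts)"
    using exec_IteT.prems(4) by (intro trace_one) (simp_all add: heads_within_map)
  have 2: "trace (machine p r ts) B t (a + 1, map T ts) ((a + 1) + com_len c1, map T' ts)"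
    using exec_IteT.prems by (intro exec_IteT.IH) auto
  \<comment> \<open>The address behind the first branch holds the jump over the second one.\<close>
  have "com_delta p 0 (a + 1 + com_len c1) (tape_syms ts T')
      = (a + com_len c1 + com_len c2 + 2, stay (tape_syms ts T'))"
    using exec_IteT.prems(1)[of "a + 1 + com_len c1"] by simp
  then have "step (machine p r ts) (a + 1 + com_len c1, map T' ts)
      = (a + com_len c1 + com_len c2 + 2, map T' ts)"
    using exec_IteT.prems(2) by (simp add: step_machine Let_def map_act_stay)
  then have 3: "trace (machine p r ts) B 1 (a + 1 + com_len c1, map T' ts)
      (a + com_len c1 + com_len c2 + 2, map T' ts)"
    using exec_heads_ok[OF exec_IteT.hyps(2) exec_IteT.prems(4)]
    by (intro trace_one) (simp_all add: heads_within_map)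
  show ?case
    using trace_trans[OF trace_trans[OF 1 2] 3] by (simp add: add.assoc)
next
  case (exec_IteF T i v c2 t T' c1)
  have "com_delta p 0 a (tape_syms ts T) = (a + com_len c1 + 2, stay (tape_syms ts T))"
    using exec_IteF.prems(1)[of a] exec_IteF.prems(3) exec_IteF.hyps(1) by (simp add: tape_syms_def)
  then have "step (machine p r ts) (a, map T ts) = (a + com_len c1 + 2, map T ts)"
    using exec_IteF.prems(2) by (simp add: step_machine Let_def map_act_stay)
  then have 1: "trace (machine p r ts) B 1 (a, map T ts) (a + com_len c1 + 2, map T ts)"
    using exec_IteF.prems(4) by (intro trace_one) (simp_all add: heads_within_map)
  have 2: "trace (machine p r ts) B t (a + com_len c1 + 2, map T ts)
      ((a + com_len c1 + 2) + com_len c2, map T' ts)"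
    using exec_IteF.prems by (intro exec_IteF.IH) auto
  show ?case
    using trace_trans[OF 1 2] by (simp add: add.assoc add.commute add.left_commute)
next
  case (exec_LoopE T i v c)
  have "com_delta p 0 a (tape_syms ts T) = (a + com_len c + 2, stay (tape_syms ts T))"
    using exec_LoopE.prems(1)[of a] exec_LoopE.prems(3) exec_LoopE.hyps(1) by (simp add: tape_syms_def)
  then have "step (machine p r ts) (a, map T ts) = (a + com_len c + 2, map T ts)"
    using exec_LoopE.prems(2) by (simp add: step_machine Let_def map_act_stay)
  then show ?case
    using exec_LoopE.prems(4) by (intro trace_one) (simp_all add: heads_within_map)
next
  case (exec_LoopS T i v c t1 T1 t2 T2)
  have "com_delta p 0 a (tape_syms ts T) = (a + 1, stay (tape_syms ts T))"
    using exec_LoopS.prems(1)[of a] exec_LoopS.prems(3) exec_LoopS.hyps(1) by (simp add: tape_syms_def)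
  then have "step (machine p r ts) (a, map T ts) = (a + 1, map T ts)"
    using exec_LoopS.prems(2) by (simp add: step_machine Let_def map_act_stay)
  then have 1: "trace (machine p r ts) B 1 (a, map T ts) (a + 1, map T ts)"
    using exec_LoopS.prems(4) by (intro trace_one) (simp_all add: heads_within_map)
  have 2: "trace (machine p r ts) B t1 (a + 1, map T ts) ((a + 1) + com_len c, map T1 ts)"
    using exec_LoopS.prems by (intro exec_LoopS.IH(1)) auto
  have h: "heads_ok B ts T1"
    using exec_heads_ok[OF exec_LoopS.hyps(2) exec_LoopS.prems(4)] .
  have "com_delta p 0 (a + 1 + com_len c) (tape_syms ts T1) = (a, stay (tape_syms ts T1))"
    using exec_LoopS.prems(1)[of "a + 1 + com_len c"] by simp
  then have "step (machine p r ts) (a + 1 + com_len c, map T1 ts) = (a, map T1 ts)"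
    using exec_LoopS.prems(2) by (simp add: step_machine Let_def map_act_stay)
  then have 3: "trace (machine p r ts) B 1 (a + 1 + com_len c, map T1 ts) (a, map T1 ts)"
    using h by (intro trace_one) (simp_all add: heads_within_map)
  have tm: "1 + t1 + 1 + t2 = t1 + t2 + 2" by simp
  have 4: "trace (machine p r ts) B t2 (a, map T1 ts) (a + com_len (Loop i v c), map T2 ts)"
    using exec_LoopS.prems h by (intro exec_LoopS.IH(2)) auto
  show ?case
    using trace_trans[OF trace_trans[OF trace_trans[OF 1 2] 3] 4] unfolding tm .
qed

lemma exec_machine:
  assumes "exec B c T t T'" "com_tapes c \<subseteq> set ts" "heads_ok B ts T" "r \<in> set ts"
  shows "trace (machine c r ts) B (t + 1) (0, map T ts)
     (if head_sym (T' r) = 1 then com_len c + 2 else com_len c + 1, map T' ts)"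
proof -
  have 1: "trace (machine c r ts) B t (0, map T ts) (0 + com_len c, map T' ts)"
    by (rule exec_trace[OF assms(1) _ _ assms(2,3)]) auto
  have "step (machine c r ts) (com_len c, map T' ts) =
     (if head_sym (T' r) = 1 then com_len c + 2 else com_len c + 1, map T' ts)"
    using assms(4) by (simp add: step_machine Let_def map_act_stay) (simp add: tape_syms_def)
  then have 2: "trace (machine c r ts) B 1 (com_len c, map T' ts)
     (if head_sym (T' r) = 1 then com_len c + 2 else com_len c + 1, map T' ts)"
    using exec_heads_ok[OF assms(1,3)] by (intro trace_one) (simp_all add: heads_within_map)
  show ?thesis using trace_trans[OF 1[unfolded add_0] 2] .
qed

lemma step_halted: "halted M C \<Longrightarrow> (step M ^^ t) C = C"
  by (induction t) (auto simp: step_def)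

lemma run_beyond_halt:
  assumes "halted M (run M w t)" "t \<le> t'"
  shows "run M w t' = run M w t"
proof -
  have "run M w t' = (step M ^^ (t' - t)) (run M w t)"
    using assms(2) funpow_add[of "t' - t" t "step M"] unfolding run_def by simp
  then show ?thesis using step_halted[OF assms(1)] by simp
qed

definition start_tapes :: "bool list \<Rightarrow> nat \<Rightarrow> tape" where
  "start_tapes w i = (word_content (if i = 0 then w else []), 0)"

lemma init_config_machine:
  assumes "ts \<noteq> []" "hd ts = 0" "distinct ts" "\<And>i. i \<in> set ts \<Longrightarrow> T i = start_tapes w i"
  shows "init_config (machine c r ts) w = (0, map T ts)"
proof -
  obtain ts' where ts: "ts = 0 # ts'" using assms(1,2) by (cases ts) auto
  have "0 \<notin> set ts'" using assms(3) ts by simp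
  then have "map T ts' = replicate (length ts') (word_content [], 0)"
    using assms(4) unfolding ts by (auto simp: start_tapes_def intro!: replicate_eqI)
  then show ?thesis
    using assms(4)[of 0] by (simp add: init_config_def machine_def ts start_tapes_def)
qed

text \<open>A head confined to the interval from \<open>-B\<close> to \<open>B\<close> visits at
  most \<open>2 * B + 1\<close> cells, on each of the tapes.\<close>

lemma snd_run_bounded_space:
  assumes "\<And>t. heads_within (int B) (run M w t)" "\<And>t. length (snd (run M w t)) = tm_tapes M"
  shows "runs_in_space M w (tm_tapes M * (2 * B + 1))"
proof -
  have sub: "visited_cells M w i \<subseteq> {- int B..int B}" if "i < tm_tapes M" for i
  proof
    fix z assume "z \<in> visited_cells M w i"
    then obtain t where "z = snd (snd (run M w t) ! i)" unfolding visited_cells_def by blast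
    moreover have "snd (run M w t) ! i \<in> set (snd (run M w t))" using that assms(2) by simp
    ultimately show "z \<in> {- int B..int B}"
      using assms(1)[of t] unfolding heads_within_def by force
  qed
  have "card (visited_cells M w i) \<le> 2 * B + 1" if "i < tm_tapes M" for i
    using card_mono[OF _ sub[OF that]] by simp
  then have "(\<Sum>i<tm_tapes M. card (visited_cells M w i)) \<le> (\<Sum>i<tm_tapes M. 2 * B + 1)"
    by (intro sum_mono) auto
  then show ?thesis
    using finite_subset[OF sub] unfolding runs_in_space_def by simp
qed

text \<open>The running time is left open: any terminating execution within the head bound will do,
  because the configuration no longer changes after halting. The tapes \<open>T w\<close> are
  prescribed below \<open>k\<close> only; beyond, they may already look like the counters of an
  abstract store.\<close>

theorem PSPACE_by_com:
  fixes p :: "nat poly"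
  assumes c: "com_wf c" "com_tapes c \<subseteq> {..<k}" "r < k"
    and T: "\<And>w i. i < k \<Longrightarrow> T w i = start_tapes w i"
    and ex: "\<And>w. \<exists>t T'. exec (int (poly p (length w))) c (T w) t T' \<and> (head_sym (T' r) \<noteq> 1 \<longleftrightarrow> w \<in> L)"
  shows "L \<in> PSPACE"
proof -
  let ?M = "machine c r [0..<k]"
  have k: "[0..<k] \<noteq> []" "hd [0..<k] = 0" "tm_tapes ?M = k" using c(3) by (auto simp: machine_def hd_upt)
  have "\<exists>t. halted ?M (run ?M w t) \<and> (fst (run ?M w t) = tm_accept ?M \<longleftrightarrow> w \<in> L)
      \<and> runs_in_space ?M w (k * (2 * poly p (length w) + 1))" for w
  proof -
    let ?B = "poly p (length w)"
    obtain t T' where t: "exec (int ?B) c (T w) t T'" "head_sym (T' r) \<noteq> 1 \<longleftrightarrow> w \<in> L" using ex by blast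
    have i: "init_config ?M w = (0, map (T w) [0..<k])"
      using T k by (intro init_config_machine) auto
    have tr: "trace ?M (int ?B) (t + 1) (init_config ?M w)
       (if head_sym (T' r) = 1 then com_len c + 2 else com_len c + 1, map T' [0..<k])"
      unfolding i using c(2,3) T by (intro exec_machine[OF t(1)]) (auto simp: start_tapes_def)
    have r: "run ?M w (t + 1) = (if head_sym (T' r) = 1 then com_len c + 2 else com_len c + 1, map T' [0..<k])"
      using trace_run(1)[OF tr] unfolding run_def .
    have h: "halted ?M (run ?M w (t + 1))" unfolding r halted_def by (simp add: machine_def)
    have a: "fst (run ?M w (t + 1)) = tm_accept ?M \<longleftrightarrow> w \<in> L"
      unfolding r t(2)[symmetric] by (simp add: machine_def)
    have hw: "heads_within (int ?B) (run ?M w u)" for u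
    proof (cases "u \<le> t + 1")
      case True
      then show ?thesis using trace_run(2)[OF tr] by (simp add: run_def)
    next
      case False
      then have "run ?M w u = run ?M w (t + 1)" by (intro run_beyond_halt[OF h]) simp
      then show ?thesis using trace_run(2)[OF tr, rule_format, OF order_refl] unfolding run_def by (simp only:)
    qed
    have len: "length (snd (run ?M w u)) = k" for u
    proof (induction u)
      case 0 then show ?case by (simp add: run_def i)
    next
      case (Suc u)
      have "length (snd (step ?M C)) = k" if "length (snd C) = k" for C
        using that by (cases "halted ?M C") (simp_all add: step_def machine_def Let_def)
      then show ?case using Suc by (simp add: run_def)
    qed
    show ?thesis
      using h a snd_run_bounded_space[of ?B ?M w, OF hw] len unfolding k(3) by blast
  qed
  note * = this
  have "decides ?M L" unfolding decides_def using * by blast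
  moreover have "runs_in_space ?M w (poly ([:k:] * ([:2:] * p + [:1:])) (length w))" for w
  proof -
    have "poly ([:k:] * ([:2:] * p + [:1:])) (length w) = k * (2 * poly p (length w) + 1)" by simp
    then show ?thesis using *[of w] by (metis (no_types))
  qed
  ultimately show ?thesis
    unfolding PSPACE_def using wf_tm_machine[OF c(1) k(1), of r] by blast
qed

theorem polytime_by_com:
  fixes p :: "nat poly"
  assumes c: "com_wf c" "com_tapes c \<subseteq> {..<k}" "r < k" "1 < k"
    and T: "\<And>w i. i < k \<Longrightarrow> T w i = start_tapes w i"
    and ex: "\<And>w. \<exists>B t T'. exec B c (T w) t T' \<and> 0 \<le> B \<and> t \<le> poly p (length w) \<and> head_sym (T' r) \<noteq> 1 \<and>
      fst (T' 1) = word_content (f w)"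
  shows "polytime_computable f"
proof -
  \<comment> \<open>The input is expected on the first tape and the output is read from the last
    one, so tape 1, the output array, is moved to the end.\<close>
  let ?ts = "0 # [2..<k] @ [1]"
  let ?M = "machine c r ?ts"
  have set: "set ?ts = {..<k}" "distinct ?ts" using c(4) by auto
  have "\<exists>t\<le>poly (p + [:1:]) (length w). fst (run ?M w t) = tm_accept ?M \<and>
      fst (last (snd (run ?M w t))) = word_content (f w)" for w
  proof -
    obtain B t T' where t: "exec B c (T w) t T'" "0 \<le> B" "t \<le> poly p (length w)" "head_sym (T' r) \<noteq> 1"
      "fst (T' 1) = word_content (f w)" using ex by blast
    have i: "init_config ?M w = (0, map (T w) ?ts)"
      using T set by (intro init_config_machine) auto
    have h: "heads_ok B ?ts (T w)" unfolding set using T t(2) by (auto simp: start_tapes_def)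
    have sub: "com_tapes c \<subseteq> set ?ts" and rs: "r \<in> set ?ts" unfolding set using c(2,3) by auto
    have tr: "trace ?M B (t + 1) (init_config ?M w)
       (if head_sym (T' r) = 1 then com_len c + 2 else com_len c + 1, map T' ?ts)"
      unfolding i by (rule exec_machine[OF t(1) sub h rs])
    have r: "run ?M w (t + 1) = (com_len c + 1, map T' ?ts)"
      using trace_run(1)[OF tr] t(4) unfolding run_def by simp
    then show ?thesis
      using t(3,5) by (intro exI[of _ "t + 1"]) (simp add: machine_def)
  qed
  then show ?thesis
    unfolding polytime_computable_def using wf_tm_machine[OF c(1), of ?ts r] by blast
qed

section \<open>Registers and arrays on tapes\<close>

type_synonym store = "(nat \<Rightarrow> nat) \<times> (nat \<Rightarrow> nat \<Rightarrow> nat)"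

definition mark :: "int \<Rightarrow> nat" where
  "mark z = (if z = 0 then 1 else 0)"

definition array_content :: "(nat \<Rightarrow> nat) \<Rightarrow> int \<Rightarrow> nat" where
  "array_content A z = (if z < 0 then 0 else A (nat z))"

text \<open>Tapes 0, 1, 2 hold arrays, with the head parked on cell 0. Every further tape is a counter: its
  only nonblank symbol marks cell 0 and its value is the head position. Tape 3 is a scratch counter
  for array accesses, tape \<open>r + 4\<close> is register \<open>r\<close>.\<close>

definition tapes :: "store \<Rightarrow> nat \<Rightarrow> tape" where
  "tapes s i = (if i < 3 then (array_content (snd s i), 0)
                else (mark, if i = 3 then 0 else int (fst s (i - 4))))"

text \<open>The time is an upper bound here, in contrast to \<open>exec\<close>, so that branches of
  different cost can be given a common one.\<close>

definition runs :: "nat \<Rightarrow> com \<Rightarrow> store \<Rightarrow> nat \<Rightarrow> store \<Rightarrow> bool" where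
  "runs B c s n s' \<longleftrightarrow> (\<exists>t\<le>n. exec (int B) c (tapes s) t (tapes s'))"

lemma tapes_reg: "tapes (R, A) (r + 4) = (mark, int (R r))"
  by (simp add: tapes_def)

lemma tapes_upd_reg: "(tapes (R, A))(r + 4 := (mark, int n)) = tapes (R(r := n), A)"
  by (auto simp: tapes_def fun_eq_iff)

lemma head_sym_reg: "head_sym (tapes s (r + 4)) = 1 \<longleftrightarrow> fst s r = 0"
  by (cases s) (simp add: tapes_reg head_sym_def mark_def)

definition inc :: "nat \<Rightarrow> com" where "inc r = Mv (r + 4) Right"
text \<open>Truncated subtraction: at zero the mark is seen and the head stays where it is.\<close>

definition dec :: "nat \<Rightarrow> com" where "dec r = Ite (r + 4) 1 Skip (Mv (r + 4) Left)"
definition ifz :: "nat \<Rightarrow> com \<Rightarrow> com \<Rightarrow> com" where "ifz r = Ite (r + 4) 1"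
definition while :: "nat \<Rightarrow> com \<Rightarrow> com" where "while r = Loop (r + 4) 1"

lemma runs_mono: "runs B c s n s' \<Longrightarrow> n \<le> m \<Longrightarrow> runs B c s m s'"
  unfolding runs_def using le_trans by blast

lemma runs_Skip: "runs B Skip s n s"
  unfolding runs_def using exec_Skip by blast

lemma runs_Seq: "runs B c1 s n s1 \<Longrightarrow> runs B c2 s1 m s2 \<Longrightarrow> runs B (c1 ;; c2) s (n + m) s2"
  unfolding runs_def by (meson add_mono exec_Seq)

lemma runs_inc: "R r < B \<Longrightarrow> runs B (inc r) (R, A) 1 (R(r := Suc (R r)), A)"
  using exec_Mv[of Right "tapes (R, A)" "r + 4" "int B"] tapes_upd_reg[of R A r "Suc (R r)"]
  by (auto simp: runs_def inc_def tapes_reg add.commute)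

lemma runs_dec: "R r \<le> B \<Longrightarrow> runs B (dec r) (R, A) 3 (R(r := R r - 1), A)"
proof (cases "R r = 0")
  case True
  then show ?thesis
    unfolding runs_def dec_def
    using exec_IteT[OF _ exec_Skip, of "tapes (R, A)" "r + 4" 1 "int B"] head_sym_reg[of "(R, A)" r]
    by (intro exI[of _ 2]) (auto simp: fun_upd_idem numeral_2_eq_2)
next
  case False
  assume "R r \<le> B"
  then have "exec (int B) (Mv (r + 4) Left) (tapes (R, A)) 1 (tapes (R(r := R r - 1), A))"
    using exec_Mv[of Left "tapes (R, A)" "r + 4" "int B"] tapes_upd_reg[of R A r "R r - 1"] False
    by (simp add: tapes_reg of_nat_diff)
  from exec_IteF[OF _ this, of "r + 4" 1 Skip] show ?thesis
    unfolding runs_def dec_def using head_sym_reg[of "(R, A)" r] False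
    by (intro exI[of _ 2]) (auto simp: numeral_2_eq_2)
qed

lemma runs_ifz:
  "(fst s r = 0 \<Longrightarrow> runs B c1 s n s') \<Longrightarrow> (fst s r \<noteq> 0 \<Longrightarrow> runs B c2 s n s') \<Longrightarrow>
    runs B (ifz r c1 c2) s (n + 2) s'"
proof (cases "fst s r = 0")
  case True
  assume "fst s r = 0 \<Longrightarrow> runs B c1 s n s'"
  then obtain t where "t \<le> n" "exec (int B) c1 (tapes s) t (tapes s')" using True unfolding runs_def by blast
  then show ?thesis
    unfolding runs_def ifz_def using True exec_IteT[of "tapes s" "r + 4" 1 "int B" c1 t] head_sym_reg[of s r]
    by (intro exI[of _ "t + 2"]) simp
next
  case False
  assume "fst s r \<noteq> 0 \<Longrightarrow> runs B c2 s n s'"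
  then obtain t where "t \<le> n" "exec (int B) c2 (tapes s) t (tapes s')" using False unfolding runs_def by blast
  then show ?thesis
    unfolding runs_def ifz_def using False exec_IteF[of "tapes s" "r + 4" 1 "int B" c2 t] head_sym_reg[of s r]
    by (intro exI[of _ "t + 1"]) simp
qed

lemma runs_while_end: "fst s r = 0 \<Longrightarrow> runs B (while r c) s 1 s"
  unfolding runs_def while_def using exec_LoopE[of "tapes s" "r + 4" 1] head_sym_reg[of s r] by auto

lemma runs_while_step:
  assumes "fst s r \<noteq> 0" "runs B c s m s1" "runs B (while r c) s1 n s2"
  shows "runs B (while r c) s (m + n + 2) s2"
proof -
  obtain t1 t2 where t: "t1 \<le> m" "exec (int B) c (tapes s) t1 (tapes s1)"
    "t2 \<le> n" "exec (int B) (while r c) (tapes s1) t2 (tapes s2)"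
    using assms(2,3) unfolding runs_def by blast
  have "head_sym (tapes s (r + 4)) \<noteq> 1" using assms(1) by (simp add: head_sym_reg[simplified])
  from exec_LoopS[of "tapes s" "r + 4" 1, OF this t(2)] t(4)
  have "exec (int B) (while r c) (tapes s) (t1 + t2 + 2) (tapes s2)" unfolding while_def by blast
  then show ?thesis unfolding runs_def using t(1,3) by (intro exI[of _ "t1 + t2 + 2"]) simp
qed

text \<open>The invariant is indexed by the number of finished rounds and forces exactly
  \<open>n\<close> of them; the induction is on the rounds that remain.\<close>

lemma runs_while_inv:
  assumes "I 0 s"
    and step: "\<And>i s. i < n \<Longrightarrow> I i s \<Longrightarrow> fst s r \<noteq> 0 \<and> (\<exists>s'. runs B c s m s' \<and> I (Suc i) s')"
    and stop: "\<And>s. I n s \<Longrightarrow> fst s r = 0"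
  shows "\<exists>s'. runs B (while r c) s (n * (m + 2) + 1) s' \<and> I n s'"
proof -
  have "\<exists>s'. runs B (while r c) s (k * (m + 2) + 1) s' \<and> I n s'" if "k \<le> n" "I (n - k) s" for k s
    using that
  proof (induction k arbitrary: s)
    case 0
    then show ?case using runs_while_end[of s r B c] stop[of s] by (intro exI[of _ s]) simp
  next
    case (Suc k)
    have i: "n - Suc k < n" "Suc (n - Suc k) = n - k" using Suc.prems by auto
    obtain s1 where s1: "fst s r \<noteq> 0" "runs B c s m s1" "I (n - k) s1"
      using step[OF i(1) Suc.prems(2)] unfolding i by blast
    obtain s2 where s2: "runs B (while r c) s1 (k * (m + 2) + 1) s2" "I n s2"
      using Suc.IH[of s1] Suc.prems(1) s1(3) by auto
    have "m + (k * (m + 2) + 1) + 2 = Suc k * (m + 2) + 1" by simp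
    then show ?case using runs_while_step[OF s1(1,2) s2(1)] s2(2) by (intro exI[of _ s2]) (simp only:)
  qed
  from this[of n s] show ?thesis using assms(1) by simp
qed

lemma runs_while:
  assumes "\<And>i. i < n \<Longrightarrow> fst (S i) r \<noteq> 0 \<and> runs B c (S i) m (S (Suc i))" "fst (S n) r = 0"
  shows "runs B (while r c) (S 0) (n * (m + 2) + 1) (S n)"
proof -
  have "\<exists>s'. runs B (while r c) (S 0) (n * (m + 2) + 1) s' \<and> s' = S n"
    by (rule runs_while_inv[of "\<lambda>i s. s = S i"]) (use assms in blast)+
  then show ?thesis by blast
qed

definition clr :: "nat \<Rightarrow> com" where "clr r = while r (dec r)"
definition mv :: "nat \<Rightarrow> nat \<Rightarrow> com" where "mv x y = while x (dec x ;; inc y)"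
text \<open>Moving a counter destroys it, so \<open>x\<close> is first moved to the empty register
  \<open>z\<close> and then poured back into \<open>x\<close> and \<open>y\<close>
  simultaneously.\<close>

definition addto :: "nat \<Rightarrow> nat \<Rightarrow> nat \<Rightarrow> com" where
  "addto x y z = mv x z ;; while z (dec z ;; inc x ;; inc y)"

lemma runs_clr: "R r \<le> B \<Longrightarrow> runs B (clr r) (R, A) (5 * B + 1) (R(r := 0), A)"
proof -
  assume B: "R r \<le> B"
  have "runs B (clr r) (R(r := R r - 0), A) (R r * (3 + 2) + 1) (R(r := R r - R r), A)"
    unfolding clr_def
    using B runs_dec[of "R(r := R r - i)" r B A for i]
    by (intro runs_while[where S = "\<lambda>i. (R(r := R r - i), A)"]) (auto simp: diff_Suc split: nat.splits)
  then show ?thesis using B by (auto elim!: runs_mono)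
qed

lemma runs_mv:
  assumes "x \<noteq> y" "R x + R y \<le> B"
  shows "runs B (mv x y) (R, A) (6 * B + 1) (R(x := 0, y := R y + R x), A)"
proof -
  have step: "runs B (dec x ;; inc y) (R(x := R x - i, y := R y + i), A) (3 + 1)
      (R(x := R x - Suc i, y := R y + Suc i), A)" if "i < R x" for i
  proof (rule runs_Seq)
    show "runs B (dec x) (R(x := R x - i, y := R y + i), A) 3 (R(x := R x - Suc i, y := R y + i), A)"
      using runs_dec[of "R(x := R x - i, y := R y + i)" x B A] assms that by (simp add: fun_upd_twist)
    show "runs B (inc y) (R(x := R x - Suc i, y := R y + i), A) 1 (R(x := R x - Suc i, y := R y + Suc i), A)"
      using runs_inc[of "R(x := R x - Suc i, y := R y + i)" y B A] assms that by simp
  qed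
  have "runs B (mv x y) (R(x := R x - 0, y := R y + 0), A) (R x * (4 + 2) + 1)
      (R(x := R x - R x, y := R y + R x), A)"
    unfolding mv_def
    by (rule runs_while[where S = "\<lambda>i. (R(x := R x - i, y := R y + i), A)"])
      (use step assms(1) in \<open>auto\<close>)
  then show ?thesis using assms by (auto elim!: runs_mono)
qed

lemma runs_addto:
  assumes "distinct [x, y, z]" "R x + R y \<le> B" "R z = 0"
  shows "runs B (addto x y z) (R, A) (13 * B + 2) (R(y := R y + R x), A)"
proof -
  define S where "S i = (R(z := R x - i, x := i, y := R y + i), A)" for i
  have step: "runs B (dec z ;; inc x ;; inc y) (S i) (3 + (1 + 1)) (S (Suc i))" if "i < R x" for i
  proof (intro runs_Seq)
    show "runs B (dec z) (S i) 3 (R(z := R x - Suc i, x := i, y := R y + i), A)"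
      using runs_dec[of "R(z := R x - i, x := i, y := R y + i)" z B A] assms that
      unfolding S_def by (simp add: fun_upd_twist)
    show "runs B (inc x) (R(z := R x - Suc i, x := i, y := R y + i), A) 1
       (R(z := R x - Suc i, x := Suc i, y := R y + i), A)"
      using runs_inc[of "R(z := R x - Suc i, x := i, y := R y + i)" x B A] assms that by (simp add: fun_upd_twist)
    show "runs B (inc y) (R(z := R x - Suc i, x := Suc i, y := R y + i), A) 1 (S (Suc i))"
      using runs_inc[of "R(z := R x - Suc i, x := Suc i, y := R y + i)" y B A] assms that
      unfolding S_def by simp
  qed
  have "runs B (while z (dec z ;; inc x ;; inc y)) (S 0) (R x * ((3 + (1 + 1)) + 2) + 1) (S (R x))"
    by (rule runs_while) (use step assms(1) in \<open>auto simp: S_def\<close>)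
  moreover have "S 0 = (R(x := 0, z := R z + R x), A)" "S (R x) = (R(y := R y + R x), A)"
    using assms by (auto simp: S_def fun_eq_iff)
  ultimately have "runs B (addto x y z) (R, A) ((6 * B + 1) + (R x * 7 + 1)) (R(y := R y + R x), A)"
    unfolding addto_def using assms runs_mv[of x z R B A] by (intro runs_Seq) auto
  then show ?thesis using assms by (auto elim!: runs_mono)
qed

text \<open>Tapes have no addresses: the index register is counted down while the array head and the
  scratch counter on tape 3 walk right. The scratch counter then measures the way back and restores
  the index.\<close>

definition at_index :: "nat \<Rightarrow> nat \<Rightarrow> com \<Rightarrow> com" where
  "at_index a r c = Loop (r + 4) 1 (Mv (r + 4) Left ;; Mv 3 Right ;; Mv a Right) ;; c ;;
     Loop 3 1 (Mv 3 Left ;; Mv (r + 4) Right ;; Mv a Left)"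

text \<open>The tapes while array \<open>a\<close> is accessed: its head and the scratch counter are at \<open>j\<close>.\<close>

definition access_tapes :: "nat \<Rightarrow> nat \<Rightarrow> store \<Rightarrow> nat \<Rightarrow> tape" where
  "access_tapes a j s = (tapes s)(a := (array_content (snd s a), int j), 3 := (mark, int j))"

lemma access_tapes_0: "a < 3 \<Longrightarrow> access_tapes a 0 s = tapes s"
  by (auto simp: access_tapes_def tapes_def fun_eq_iff)

lemma exec_go:
  assumes "a < 3" "R r \<le> B" "j \<le> R r"
  shows "exec (int B) (Loop (r + 4) 1 (Mv (r + 4) Left ;; Mv 3 Right ;; Mv a Right))
     (access_tapes a j (R(r := R r - j), A)) (5 * (R r - j) + 1) (access_tapes a (R r) (R(r := 0), A))"
  using assms(3)
proof (induction "R r - j" arbitrary: j)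
  case 0
  then have j: "j = R r" by simp
  have "head_sym (access_tapes a (R r) (R(r := 0), A) (r + 4)) = 1"
    using assms(1) by (simp add: access_tapes_def tapes_def head_sym_def mark_def)
  from exec_LoopE[of "access_tapes a (R r) (R(r := 0), A)" "r + 4" 1, OF this]
  show ?case unfolding j by (simp add: fun_upd_def)
next
  case (Suc k)
  let ?T = "access_tapes a j (R(r := R r - j), A)"
  have j: "j < R r" using Suc by simp
  have a: "a \<noteq> 3" "a \<noteq> r + 4" using assms(1) by auto
  have e: "exec (int B) (Mv (r + 4) Left ;; Mv 3 Right ;; Mv a Right) ?T (1 + (1 + 1))
      (access_tapes a (Suc j) (R(r := R r - Suc j), A))"
  proof -
    have "exec (int B) (Mv (r + 4) Left) ?T 1 (?T(r + 4 := (mark, int (R r - Suc j))))"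
      using exec_Mv[of Left ?T "r + 4" "int B"] j assms a
      by (simp add: access_tapes_def tapes_def of_nat_diff algebra_simps)
    moreover have "exec (int B) (Mv 3 Right) (?T(r + 4 := (mark, int (R r - Suc j)))) 1
       (?T(r + 4 := (mark, int (R r - Suc j)), 3 := (mark, int (Suc j))))"
      using exec_Mv[of Right "?T(r + 4 := (mark, int (R r - Suc j)))" 3 "int B"] j assms a
      by (simp add: access_tapes_def add.commute)
    moreover have "exec (int B) (Mv a Right) (?T(r + 4 := (mark, int (R r - Suc j)), 3 := (mark, int (Suc j)))) 1
       (?T(r + 4 := (mark, int (R r - Suc j)), 3 := (mark, int (Suc j)), a := (array_content (A a), int (Suc j))))"
      using exec_Mv[of Right "?T(r + 4 := (mark, int (R r - Suc j)), 3 := (mark, int (Suc j)))" a "int B"] j assms a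
      by (simp add: access_tapes_def add.commute)
    moreover have "?T(r + 4 := (mark, int (R r - Suc j)), 3 := (mark, int (Suc j)), a := (array_content (A a), int (Suc j)))
        = access_tapes a (Suc j) (R(r := R r - Suc j), A)"
      using a by (auto simp: access_tapes_def tapes_def fun_eq_iff)
    ultimately show ?thesis by (metis exec_Seq)
  qed
  have "exec (int B) (Loop (r + 4) 1 (Mv (r + 4) Left ;; Mv 3 Right ;; Mv a Right)) ?T
    ((1 + (1 + 1)) + (5 * (R r - Suc j) + 1) + 2) (access_tapes a (R r) (R(r := 0), A))"
    using a j Suc.hyps(2) by (intro exec_LoopS[OF _ e] Suc.hyps(1))
      (auto simp: access_tapes_def tapes_def head_sym_def mark_def)
  moreover have "(1 + (1 + 1)) + (5 * (R r - Suc j) + 1) + 2 = 5 * (R r - j) + 1" using j by simp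
  ultimately show ?case by simp
qed

lemma exec_back:
  assumes "a < 3" "n \<le> B" "j \<le> n"
  shows "exec (int B) (Loop 3 1 (Mv 3 Left ;; Mv (r + 4) Right ;; Mv a Left))
     (access_tapes a j (R(r := n - j), A)) (5 * j + 1) (tapes (R(r := n), A))"
  using assms(3)
proof (induction j)
  case 0
  have "head_sym (tapes (R(r := n), A) 3) = 1" by (simp add: tapes_def head_sym_def mark_def)
  from exec_LoopE[of "tapes (R(r := n), A)" 3 1, OF this]
  show ?case using assms(1) by (simp add: access_tapes_0 fun_upd_def)
next
  case (Suc j)
  let ?T = "access_tapes a (Suc j) (R(r := n - Suc j), A)"
  have a: "a \<noteq> 3" "a \<noteq> r + 4" using assms(1) by auto
  have e: "exec (int B) (Mv 3 Left ;; Mv (r + 4) Right ;; Mv a Left) ?T (1 + (1 + 1))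
      (access_tapes a j (R(r := n - j), A))"
  proof -
    have "exec (int B) (Mv 3 Left) ?T 1 (?T(3 := (mark, int j)))"
      using exec_Mv[of Left ?T 3 "int B"] assms Suc.prems a
      by (simp add: access_tapes_def)
    moreover have "exec (int B) (Mv (r + 4) Right) (?T(3 := (mark, int j))) 1
       (?T(3 := (mark, int j), r + 4 := (mark, int (n - j))))"
      using exec_Mv[of Right "?T(3 := (mark, int j))" "r + 4" "int B"] assms Suc.prems a
      by (simp add: access_tapes_def tapes_def of_nat_diff)
    moreover have "exec (int B) (Mv a Left) (?T(3 := (mark, int j), r + 4 := (mark, int (n - j)))) 1
       (?T(3 := (mark, int j), r + 4 := (mark, int (n - j)), a := (array_content (A a), int j)))"
      using exec_Mv[of Left "?T(3 := (mark, int j), r + 4 := (mark, int (n - j)))" a "int B"] assms Suc.prems a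
      by (simp add: access_tapes_def)
    moreover have "?T(3 := (mark, int j), r + 4 := (mark, int (n - j)), a := (array_content (A a), int j))
        = access_tapes a j (R(r := n - j), A)"
      using a by (auto simp: access_tapes_def tapes_def fun_eq_iff)
    ultimately show ?thesis by (metis exec_Seq)
  qed
  have "exec (int B) (Loop 3 1 (Mv 3 Left ;; Mv (r + 4) Right ;; Mv a Left)) ?T
    ((1 + (1 + 1)) + (5 * j + 1) + 2) (tapes (R(r := n), A))"
    using a Suc by (intro exec_LoopS[OF _ e] Suc.IH)
      (auto simp: access_tapes_def head_sym_def mark_def)
  moreover have "(1 + (1 + 1)) + (5 * j + 1) + 2 = 5 * Suc j + 1" by simp
  ultimately show ?case by (simp only: fun_upd_def)
qed

lemma runs_at_index:
  assumes "a < 3" "R r \<le> B" "R' r = 0"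
    and "exec (int B) c (access_tapes a (R r) (R(r := 0), A)) t (access_tapes a (R r) (R', A'))"
  shows "runs B (at_index a r c) (R, A) (10 * B + 2 + t) (R'(r := R r), A')"
proof -
  have 1: "exec (int B) (Loop (r + 4) 1 (Mv (r + 4) Left ;; Mv 3 Right ;; Mv a Right))
     (tapes (R, A)) (5 * (R r - 0) + 1) (access_tapes a (R r) (R(r := 0), A))"
    using exec_go[of a R r B 0 A] assms(1,2) by (simp add: access_tapes_0[OF assms(1)])
  have 2: "exec (int B) (Loop 3 1 (Mv 3 Left ;; Mv (r + 4) Right ;; Mv a Left))
     (access_tapes a (R r) (R', A')) (5 * R r + 1) (tapes (R'(r := R r), A'))"
    using exec_back[of a "R r" B "R r" r R' A'] assms by (simp add: fun_upd_idem)
  have "exec (int B) (at_index a r c) (tapes (R, A)) ((5 * (R r - 0) + 1) + (t + (5 * R r + 1)))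
     (tapes (R'(r := R r), A'))"
    unfolding at_index_def by (rule exec_Seq[OF 1 exec_Seq[OF assms(4) 2]])
  moreover have "(5 * (R r - 0) + 1) + (t + (5 * R r + 1)) \<le> 10 * B + 2 + t" using assms(2) by simp
  ultimately show ?thesis unfolding runs_def by blast
qed

definition get :: "nat \<Rightarrow> nat \<Rightarrow> nat \<Rightarrow> nat \<Rightarrow> com" where
  "get a r v k = clr k ;; at_index a r (Ite a v (Mv (k + 4) Right) Skip)"

definition put :: "nat \<Rightarrow> nat \<Rightarrow> nat \<Rightarrow> com" where
  "put a r v = at_index a r (Wr a v)"

lemma runs_get:
  assumes "a < 3" "r \<noteq> k" "R r \<le> B" "R k \<le> B" "1 \<le> B"
  shows "runs B (get a r v k) (R, A) (20 * (B + 1)) (R(k := (if A a (R r) = v then 1 else 0)), A)"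
proof -
  let ?R = "R(k := 0)"
  let ?T = "access_tapes a (?R r) (?R(r := 0), A)"
  let ?x = "if A a (R r) = v then 1 else 0 :: nat"
  have a: "a \<noteq> 3" "a \<noteq> k + 4" using assms(1) by auto
  have h: "head_sym (?T a) = A a (R r)"
    using assms a by (simp add: access_tapes_def head_sym_def array_content_def)
  have m: "exec (int B) (Mv (k + 4) Right) ?T 1 (access_tapes a (R r) (?R(r := 0, k := 1), A))"
  proof -
    have "?T(k + 4 := (mark, 1)) = access_tapes a (R r) (?R(r := 0, k := 1), A)"
      using a assms(2) by (auto simp: access_tapes_def tapes_def fun_eq_iff)
    moreover have "?T (k + 4) = (mark, 0)" using a assms(2) by (simp add: access_tapes_def tapes_def)
    ultimately show ?thesis
      using exec_Mv[of Right ?T "k + 4" "int B"] assms(5) by simp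
  qed
  have "\<exists>t\<le>3. exec (int B) (Ite a v (Mv (k + 4) Right) Skip) ?T t (access_tapes a (?R r) (?R(r := 0, k := ?x), A))"
  proof (cases "A a (R r) = v")
    case True
    then have "exec (int B) (Ite a v (Mv (k + 4) Right) Skip) ?T (1 + 2) (access_tapes a (R r) (?R(r := 0, k := 1), A))"
      using h by (intro exec_IteT m) simp
    then show ?thesis using True assms(2) by (intro exI[of _ 3]) (simp add: numeral_3_eq_3)
  next
    case False
    then have "exec (int B) (Ite a v (Mv (k + 4) Right) Skip) ?T (0 + 1) ?T"
      using h by (intro exec_IteF exec_Skip) simp
    moreover have "?R(r := 0, k := ?x) = ?R(r := 0)" using False assms(2) by auto
    ultimately show ?thesis using False by (intro exI[of _ 1]) auto
  qed
  then obtain t where t: "t \<le> 3"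
    "exec (int B) (Ite a v (Mv (k + 4) Right) Skip) ?T t (access_tapes a (?R r) (?R(r := 0, k := ?x), A))" by blast
  have "runs B (at_index a r (Ite a v (Mv (k + 4) Right) Skip)) (?R, A) (10 * B + 2 + t)
      ((?R(r := 0, k := ?x))(r := ?R r), A)"
    using assms t(2) by (intro runs_at_index) auto
  moreover have "(?R(r := 0, k := ?x))(r := ?R r) = R(k := ?x)" using assms(2) by auto
  ultimately have "runs B (get a r v k) (R, A) ((5 * B + 1) + (10 * B + 2 + t)) (R(k := ?x), A)"
    unfolding get_def using assms by (intro runs_Seq[OF runs_clr]) auto
  then show ?thesis by (rule runs_mono) (use t(1) in simp)
qed

lemma runs_put:
  assumes "a < 3" "R r \<le> B"
  shows "runs B (put a r v) (R, A) (20 * (B + 1)) (R, A(a := (A a)(R r := v)))"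
proof -
  let ?T = "access_tapes a (R r) (R(r := 0), A)"
  have "?T(a := ((fst (?T a))(snd (?T a) := v), snd (?T a))) =
      access_tapes a (R r) (R(r := 0), A(a := (A a)(R r := v)))"
    using assms(1) by (auto simp: access_tapes_def tapes_def array_content_def fun_eq_iff)
  then have "exec (int B) (Wr a v) ?T 1 (access_tapes a (R r) (R(r := 0), A(a := (A a)(R r := v))))"
    using exec_Wr[of "int B" a v ?T] by simp
  then have "runs B (put a r v) (R, A) (10 * B + 2 + 1) ((R(r := 0))(r := R r), A(a := (A a)(R r := v)))"
    unfolding put_def by (intro runs_at_index assms) simp_all
  moreover have "(R(r := 0))(r := R r) = R" by auto
  ultimately have "runs B (put a r v) (R, A) (10 * B + 2 + 1) (R, A(a := (A a)(R r := v)))" by (simp only:)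
  then show ?thesis by (rule runs_mono) simp
qed

text \<open>A register is the head position of its tape, so the head bound of the execution is a
  bound on registers.\<close>

lemma runs_bounded:
  assumes "runs B c s n s'" "\<And>r. fst s r \<le> B"
  shows "fst s' r \<le> B"
proof -
  obtain t where "exec (int B) c (tapes s) t (tapes s')" using assms(1) unfolding runs_def by blast
  moreover have "heads_ok (int B) [r + 4] (tapes s)" using assms(2)[of r] by (simp add: tapes_def)
  ultimately have "heads_ok (int B) [r + 4] (tapes s')" by (rule exec_heads_ok)
  then show ?thesis by (simp add: tapes_def)
qed

section \<open>Arithmetic formulas with bounded quantifiers and their evaluation\<close>

datatype trm = V nat | N nat | Pl trm trm | Ti trm trm

primrec tval :: "(nat \<Rightarrow> nat) \<Rightarrow> trm \<Rightarrow> nat" where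
  "tval e (V x) = e x"
| "tval e (N n) = n"
| "tval e (Pl s t) = tval e s + tval e t"
| "tval e (Ti s t) = tval e s * tval e t"

text \<open>\<open>Sy a t v\<close> says that array \<open>a\<close> holds symbol \<open>v\<close> at index \<open>t\<close>; \<open>Xs x t f\<close> is \<open>\<exists>x<t. f\<close>.\<close>

datatype fm = Le trm trm | Sy nat trm nat | Ng fm | An fm fm | Xs nat trm fm

primrec fsat :: "(nat \<Rightarrow> nat \<Rightarrow> nat) \<Rightarrow> (nat \<Rightarrow> nat) \<Rightarrow> fm \<Rightarrow> bool" where
  "fsat A e (Le s t) \<longleftrightarrow> tval e s \<le> tval e t"
| "fsat A e (Sy a t v) \<longleftrightarrow> A a (tval e t) = v"
| "fsat A e (Ng f) \<longleftrightarrow> \<not> fsat A e f"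
| "fsat A e (An f g) \<longleftrightarrow> fsat A e f \<and> fsat A e g"
| "fsat A e (Xs x t f) \<longleftrightarrow> (\<exists>i<tval e t. fsat A (e(x := i)) f)"

primrec tbelow :: "nat \<Rightarrow> trm \<Rightarrow> bool" where
  "tbelow m (V x) \<longleftrightarrow> x < m"
| "tbelow m (N n) \<longleftrightarrow> True"
| "tbelow m (Pl s t) \<longleftrightarrow> tbelow m s \<and> tbelow m t"
| "tbelow m (Ti s t) \<longleftrightarrow> tbelow m s \<and> tbelow m t"

primrec fbelow :: "nat \<Rightarrow> fm \<Rightarrow> bool" where
  "fbelow m (Le s t) \<longleftrightarrow> tbelow m s \<and> tbelow m t"
| "fbelow m (Sy a t v) \<longleftrightarrow> a < 3 \<and> tbelow m t"
| "fbelow m (Ng f) \<longleftrightarrow> fbelow m f"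
| "fbelow m (An f g) \<longleftrightarrow> fbelow m f \<and> fbelow m g"
| "fbelow m (Xs x t f) \<longleftrightarrow> x < m \<and> tbelow m t \<and> fbelow m f"

lemma tval_cong: "tbelow m t \<Longrightarrow> (\<And>x. x < m \<Longrightarrow> e x = e' x) \<Longrightarrow> tval e t = tval e' t"
  by (induction t) auto

lemma fsat_cong: "fbelow m f \<Longrightarrow> (\<And>x. x < m \<Longrightarrow> e x = e' x) \<Longrightarrow> fsat A e f = fsat A e' f"
proof (induction f arbitrary: e e')
  case (Xs x t f)
  have "tval e t = tval e' t" using Xs.prems by (intro tval_cong[of m]) auto
  moreover have "fsat A (e(x := i)) f = fsat A (e'(x := i)) f" for i
    using Xs.prems by (intro Xs.IH) auto
  ultimately show ?case by simp
next
  case (Le s t)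
  have "tval e s = tval e' s" "tval e t = tval e' t" using Le.prems by (auto intro: tval_cong[of m])
  then show ?case by simp
next
  case (Sy a t v)
  have "tval e t = tval e' t" using Sy.prems by (auto intro: tval_cong[of m])
  then show ?case by simp
next
  case (Ng f)
  then show ?case by (metis fbelow.simps(3) fsat.simps(3))
next
  case (An f g)
  then show ?case by (metis fbelow.simps(4) fsat.simps(4))
qed

primrec incs :: "nat \<Rightarrow> nat \<Rightarrow> com" where
  "incs k 0 = Skip"
| "incs k (Suc n) = inc k ;; incs k n"

text \<open>Registers form a stack: variables lie below \<open>k\<close>, the result appears in
  \<open>k\<close>, and everything from \<open>k + 1\<close> upward is scratch space whose previous
  content is arbitrary.\<close>

primrec ev :: "nat \<Rightarrow> trm \<Rightarrow> com" where
  "ev k (V x) = clr k ;; clr (k + 1) ;; addto x k (k + 1)"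
| "ev k (N n) = clr k ;; incs k n"
| "ev k (Pl s t) = ev k s ;; ev (k + 1) t ;; mv (k + 1) k"
| "ev k (Ti s t) = ev (k + 1) s ;; ev (k + 2) t ;; clr k ;; clr (k + 3) ;;
     while (k + 1) (dec (k + 1) ;; addto (k + 2) k (k + 3))"

text \<open>A comparison subtracts the right side from the left one with truncation and tests for
  zero. In \<open>Xs x t f\<close> the register \<open>x\<close> is itself the loop variable: its
  old value waits in \<open>k\<close> and is moved back afterwards, \<open>k + 1\<close> counts the
  candidates still to come, \<open>k + 2\<close> collects the disjunction, and \<open>f\<close> is
  evaluated from \<open>k + 3\<close> on.\<close>

primrec cf :: "nat \<Rightarrow> fm \<Rightarrow> com" where
  "cf k (Le s t) = ev k s ;; ev (k + 1) t ;; while (k + 1) (dec (k + 1) ;; dec k) ;; ifz k (inc k) (clr k)"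
| "cf k (Sy a t v) = ev (k + 1) t ;; get a (k + 1) v k"
| "cf k (Ng f) = cf k f ;; ifz k (inc k) (clr k)"
| "cf k (An f g) = cf k f ;; ifz k Skip (cf k g)"
| "cf k (Xs x t f) = clr k ;; clr (k + 1) ;; addto x k (k + 1) ;; ev (k + 1) t ;; clr (k + 2) ;; clr x ;;
     while (k + 1) (dec (k + 1) ;; cf (k + 3) f ;; ifz (k + 3) Skip (clr (k + 2) ;; inc (k + 2)) ;; inc x) ;;
     clr x ;; mv k x ;; mv (k + 2) k"

lemma runs_incs: "R k + n \<le> B \<Longrightarrow> runs B (incs k n) (R, A) n (R(k := R k + n), A)"
proof (induction n arbitrary: R)
  case 0
  then show ?case by (simp add: runs_Skip fun_upd_idem)
next
  case (Suc n)
  have "runs B (inc k ;; incs k n) (R, A) (1 + n) ((R(k := Suc (R k)))(k := (R(k := Suc (R k))) k + n), A)"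
    using Suc.prems by (intro runs_Seq[OF runs_inc] Suc.IH) auto
  moreover have "(R(k := Suc (R k)))(k := (R(k := Suc (R k))) k + n) = R(k := R k + Suc n)" by auto
  ultimately show ?case by (simp only: incs.simps plus_1_eq_Suc)
qed

text \<open>The contract of compiled terms and formulas. Arrays and lower registers are unchanged,
  and the common bound on all registers is passed on because the next piece of code starts from
  them.\<close>

definition evals :: "nat \<Rightarrow> nat \<Rightarrow> com \<Rightarrow> (nat \<Rightarrow> nat) \<Rightarrow> (nat \<Rightarrow> nat \<Rightarrow> nat) \<Rightarrow> nat \<Rightarrow> nat \<Rightarrow> bool" where
  "evals B k c R A n v \<longleftrightarrow>
     (\<exists>R'. runs B c (R, A) n (R', A) \<and> R' k = v \<and> (\<forall>r<k. R' r = R r) \<and> (\<forall>r. R' r \<le> B))"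

lemma evalsI:
  assumes "runs B c (R, A) n (R', A)" "R' k = v" "\<And>r. r < k \<Longrightarrow> R' r = R r" "\<And>r. R r \<le> B"
  shows "evals B k c R A n v"
  unfolding evals_def using assms runs_bounded[OF assms(1)] by auto

lemma evals_mono: "evals B k c R A n v \<Longrightarrow> n \<le> m \<Longrightarrow> evals B k c R A m v"
  unfolding evals_def using runs_mono by blast

text \<open>One polynomial in the bound \<open>b\<close> on the variables controls the value, the
  room that is needed and, up to the factor \<open>B + 1\<close>, the time. This factor is the price
  of clearing or moving a register with arbitrary content up to \<open>B\<close>; the polynomial
  itself does not depend on \<open>B\<close>.\<close>

lemma ev_evals:
  assumes "tbelow m t"
  shows "\<exists>p :: nat poly. \<forall>k b B R A. m \<le> k \<longrightarrow> (\<forall>x<m. R x \<le> b) \<longrightarrow> (\<forall>r. R r \<le> B) \<longrightarrow> poly p b \<le> B \<longrightarrow>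
     tval R t \<le> poly p b \<and> evals B k (ev k t) R A (poly p b * (B + 1)) (tval R t)"
  using assms
proof (induction t)
  case (V x)
  show ?case
  proof (intro exI[of _ "[:23, 1:]"] allI impI conjI)
    fix k b B :: nat and R :: "nat \<Rightarrow> nat" and A assume *: "m \<le> k" "\<forall>x<m. R x \<le> b" "\<forall>r. R r \<le> B" "poly [:23, 1:] b \<le> B"
    show "tval R (V x) \<le> poly [:23, 1:] b" using * V by simp (meson le_add2 order_trans)
    have "runs B (ev k (V x)) (R, A) ((5 * B + 1) + ((5 * B + 1) + (13 * B + 2)))
        ((R(k := 0, k + 1 := 0))(k := (R(k := 0, k + 1 := 0)) k + (R(k := 0, k + 1 := 0)) x), A)"
      unfolding ev.simps using * V
      by (intro runs_Seq[OF runs_clr] runs_Seq[OF runs_clr] runs_addto) auto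
    then have "evals B k (ev k (V x)) R A ((5 * B + 1) + ((5 * B + 1) + (13 * B + 2))) (tval R (V x))"
      by (rule evalsI) (use * V in auto)
    then show "evals B k (ev k (V x)) R A (poly [:23, 1:] b * (B + 1)) (tval R (V x))"
      by (rule evals_mono) (simp add: algebra_simps)
  qed
next
  case (N n)
  show ?case
  proof (intro exI[of _ "[:n + 5:]"] allI impI conjI)
    fix k b B :: nat and R :: "nat \<Rightarrow> nat" and A assume *: "m \<le> k" "\<forall>x<m. R x \<le> b" "\<forall>r. R r \<le> B" "poly [:n + 5:] b \<le> B"
    show "tval R (N n) \<le> poly [:n + 5:] b" by simp
    have "runs B (ev k (N n)) (R, A) ((5 * B + 1) + n) ((R(k := 0))(k := (R(k := 0)) k + n), A)"
      unfolding ev.simps using * by (intro runs_Seq[OF runs_clr] runs_incs) auto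
    then have "evals B k (ev k (N n)) R A ((5 * B + 1) + n) (tval R (N n))"
      by (rule evalsI) (use * in auto)
    then show "evals B k (ev k (N n)) R A (poly [:n + 5:] b * (B + 1)) (tval R (N n))"
      by (rule evals_mono) (simp add: algebra_simps)
  qed
next
  case (Pl s t)
  then obtain p q :: "nat poly" where
    p: "\<And>k b B R A. m \<le> k \<Longrightarrow> \<forall>x<m. R x \<le> b \<Longrightarrow> \<forall>r. R r \<le> B \<Longrightarrow> poly p b \<le> B \<Longrightarrow>
      tval R s \<le> poly p b \<and> evals B k (ev k s) R A (poly p b * (B + 1)) (tval R s)" and
    q: "\<And>k b B R A. m \<le> k \<Longrightarrow> \<forall>x<m. R x \<le> b \<Longrightarrow> \<forall>r. R r \<le> B \<Longrightarrow> poly q b \<le> B \<Longrightarrow>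
      tval R t \<le> poly q b \<and> evals B k (ev k t) R A (poly q b * (B + 1)) (tval R t)"
    by (metis tbelow.simps(3))
  show ?case
  proof (intro exI[of _ "p + q + [:7:]"] allI impI conjI)
    fix k b B :: nat and R :: "nat \<Rightarrow> nat" and A assume *: "m \<le> k" "\<forall>x<m. R x \<le> b" "\<forall>r. R r \<le> B" "poly (p + q + [:7:]) b \<le> B"
    have B: "poly p b \<le> B" "poly q b \<le> B" using * by auto
    note ps = p[OF *(1-3) B(1), of A] and qs = q[OF *(1-3) B(2), of A]
    show "tval R (Pl s t) \<le> poly (p + q + [:7:]) b" using ps qs by simp
    obtain R1 where R1: "runs B (ev k s) (R, A) (poly p b * (B + 1)) (R1, A)" "R1 k = tval R s"
      "\<forall>r<k. R1 r = R r" "\<forall>r. R1 r \<le> B" using ps unfolding evals_def by blast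
    have "\<forall>x<m. R1 x \<le> b" "m \<le> k + 1" using * R1(3) by auto
    moreover have "tval R1 t = tval R t" using Pl.prems * R1(3) by (intro tval_cong[of m]) auto
    ultimately obtain R2 where R2: "runs B (ev (k + 1) t) (R1, A) (poly q b * (B + 1)) (R2, A)"
      "R2 (k + 1) = tval R t" "\<forall>r<k + 1. R2 r = R1 r" "\<forall>r. R2 r \<le> B"
      using q[of "k + 1" R1 b B A] R1(4) B(2) unfolding evals_def by auto
    have "runs B (ev k (Pl s t)) (R, A) (poly p b * (B + 1) + (poly q b * (B + 1) + (6 * B + 1)))
        (R2(k + 1 := 0, k := R2 k + R2 (k + 1)), A)"
      unfolding ev.simps
    proof (intro runs_Seq[OF R1(1)] runs_Seq[OF R2(1)] runs_mv)
      show "R2 (k + 1) + R2 k \<le> B" using R2(2,3) R1(2) ps qs *(4) by simp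
    qed simp
    then have "evals B k (ev k (Pl s t)) R A (poly p b * (B + 1) + (poly q b * (B + 1) + (6 * B + 1))) (tval R (Pl s t))"
      by (rule evalsI) (use R1 R2 * in auto)
    then show "evals B k (ev k (Pl s t)) R A (poly (p + q + [:7:]) b * (B + 1)) (tval R (Pl s t))"
      by (rule evals_mono) (simp add: algebra_simps)
  qed
next
  case (Ti s t)
  then obtain p q :: "nat poly" where
    p: "\<And>k b B R A. m \<le> k \<Longrightarrow> \<forall>x<m. R x \<le> b \<Longrightarrow> \<forall>r. R r \<le> B \<Longrightarrow> poly p b \<le> B \<Longrightarrow>
      tval R s \<le> poly p b \<and> evals B k (ev k s) R A (poly p b * (B + 1)) (tval R s)" and
    q: "\<And>k b B R A. m \<le> k \<Longrightarrow> \<forall>x<m. R x \<le> b \<Longrightarrow> \<forall>r. R r \<le> B \<Longrightarrow> poly q b \<le> B \<Longrightarrow>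
      tval R t \<le> poly q b \<and> evals B k (ev k t) R A (poly q b * (B + 1)) (tval R t)"
    by (metis tbelow.simps(4))
  let ?p = "p + q + p * q + [:13:] * p + [:13:]"
  show ?case
  proof (intro exI[of _ ?p] allI impI conjI)
    fix k b B :: nat and R :: "nat \<Rightarrow> nat" and A assume *: "m \<le> k" "\<forall>x<m. R x \<le> b" "\<forall>r. R r \<le> B" "poly ?p b \<le> B"
    have B: "poly p b \<le> B" "poly q b \<le> B" "poly p b * poly q b \<le> B" using * by auto
    have k1: "m \<le> k + 1" "m \<le> k + 2" using * by auto
    note ps = p[OF k1(1) *(2,3) B(1), of A] and qs = q[OF k1(2) *(2,3) B(2), of A]
    have vv: "tval R s * tval R t \<le> poly p b * poly q b" using ps qs by (intro mult_mono) auto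
    then show "tval R (Ti s t) \<le> poly ?p b" by simp
    obtain R1 where R1: "runs B (ev (k + 1) s) (R, A) (poly p b * (B + 1)) (R1, A)" "R1 (k + 1) = tval R s"
      "\<forall>r<k + 1. R1 r = R r" "\<forall>r. R1 r \<le> B" using ps unfolding evals_def by blast
    have "\<forall>x<m. R1 x \<le> b" using * R1(3) by auto
    moreover have "tval R1 t = tval R t" using Ti.prems * R1(3) by (intro tval_cong[of m]) auto
    ultimately obtain R2 where R2: "runs B (ev (k + 2) t) (R1, A) (poly q b * (B + 1)) (R2, A)"
      "R2 (k + 2) = tval R t" "\<forall>r<k + 2. R2 r = R1 r" "\<forall>r. R2 r \<le> B"
      using q[OF k1(2), of R1 b B A] R1(4) B(2) unfolding evals_def by auto
    define R3 where "R3 = R2(k := 0, k + 3 := 0)"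
    define S where "S i = (R3(k := i * tval R t, k + 1 := tval R s - i), A)" for i
    have step: "runs B (dec (k + 1) ;; addto (k + 2) k (k + 3)) (S i) (3 + (13 * B + 2)) (S (Suc i))"
      if "i < tval R s" for i
    proof (rule runs_Seq)
      have "tval R s - i \<le> B" using ps B(1) by linarith
      then show "runs B (dec (k + 1)) (S i) 3 (R3(k := i * tval R t, k + 1 := tval R s - Suc i), A)"
        using runs_dec[of "R3(k := i * tval R t, k + 1 := tval R s - i)" "k + 1" B A] that
        unfolding S_def by (simp add: fun_upd_twist)
      let ?R = "R3(k := i * tval R t, k + 1 := tval R s - Suc i)"
      have 1: "?R (k + 2) = tval R t" "?R k = i * tval R t" "?R (k + 3) = 0"
        using R2(2) by (simp_all add: R3_def)
      have "Suc i * tval R t \<le> tval R s * tval R t" using that by (intro mult_right_mono) auto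
      then have "?R (k + 2) + ?R k \<le> B" unfolding 1 using vv B(3) by simp
      from runs_addto[of "k + 2" k "k + 3" ?R, OF _ this 1(3), of A]
      show "runs B (addto (k + 2) k (k + 3)) (?R, A) (13 * B + 2) (S (Suc i))"
        unfolding 1 S_def by (simp add: fun_upd_twist add.commute)
    qed
    have "runs B (while (k + 1) (dec (k + 1) ;; addto (k + 2) k (k + 3))) (S 0)
      (tval R s * ((3 + (13 * B + 2)) + 2) + 1) (S (tval R s))"
      by (rule runs_while) (use step in \<open>auto simp: S_def\<close>)
    moreover have "S 0 = (R3, A)" using R1(2) R2(3) by (auto simp: S_def R3_def)
    ultimately have w: "runs B (while (k + 1) (dec (k + 1) ;; addto (k + 2) k (k + 3))) (R3, A)
      (tval R s * ((3 + (13 * B + 2)) + 2) + 1) (S (tval R s))" by simp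
    have "runs B (ev k (Ti s t)) (R, A) (poly p b * (B + 1) + (poly q b * (B + 1) + ((5 * B + 1) + ((5 * B + 1) +
        (tval R s * ((3 + (13 * B + 2)) + 2) + 1))))) (R3(k := tval R s * tval R t, k + 1 := 0), A)"
      unfolding ev.simps using w R2(4) unfolding R3_def S_def
      by (intro runs_Seq[OF R1(1)] runs_Seq[OF R2(1)] runs_Seq[OF runs_clr] runs_Seq[OF runs_clr]) auto
    then have "evals B k (ev k (Ti s t)) R A (poly p b * (B + 1) + (poly q b * (B + 1) + ((5 * B + 1) + ((5 * B + 1) +
        (tval R s * ((3 + (13 * B + 2)) + 2) + 1))))) (tval R (Ti s t))"
      by (rule evalsI) (use R1 R2 * in \<open>auto simp: R3_def\<close>)
    then show "evals B k (ev k (Ti s t)) R A (poly ?p b * (B + 1)) (tval R (Ti s t))"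
    proof (rule evals_mono)
      have "tval R s * ((3 + (13 * B + 2)) + 2) \<le> poly p b * (13 * (B + 1))"
        using ps by (intro mult_mono) auto
      then show "poly p b * (B + 1) + (poly q b * (B + 1) + ((5 * B + 1) + ((5 * B + 1) +
        (tval R s * ((3 + (13 * B + 2)) + 2) + 1)))) \<le> poly ?p b * (B + 1)"
        by (simp add: algebra_simps)
    qed
  qed
qed


lemma runs_flip:
  assumes "R k \<le> B" "1 \<le> B"
  shows "runs B (ifz k (inc k) (clr k)) (R, A) (5 * B + 1 + 2) (R(k := (if R k = 0 then 1 else 0)), A)"
proof (rule runs_ifz)
  assume "fst (R, A) k = 0"
  then show "runs B (inc k) (R, A) (5 * B + 1) (R(k := (if R k = 0 then 1 else 0)), A)"
    using runs_mono[OF runs_inc[of R k B A], of "5 * B + 1"] assms by simp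
next
  assume "fst (R, A) k \<noteq> 0"
  then show "runs B (clr k) (R, A) (5 * B + 1) (R(k := (if R k = 0 then 1 else 0)), A)"
    using runs_clr[of R k B A] assms by simp
qed

lemma cf_evals:
  assumes "fbelow m f"
  shows "\<exists>p :: nat poly. \<forall>k b B R A. m \<le> k \<longrightarrow> (\<forall>x<m. R x \<le> b) \<longrightarrow> (\<forall>r. R r \<le> B) \<longrightarrow> poly p b \<le> B \<longrightarrow>
     evals B k (cf k f) R A (poly p b * (B + 1)) (of_bool (fsat A R f))"
  using assms
proof (induction f)
  case (Le s t)
  obtain p :: "nat poly" where
    p: "\<And>k b B R A. m \<le> k \<Longrightarrow> \<forall>x<m. R x \<le> b \<Longrightarrow> \<forall>r. R r \<le> B \<Longrightarrow> poly p b \<le> B \<Longrightarrow>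
      tval R s \<le> poly p b \<and> evals B k (ev k s) R A (poly p b * (B + 1)) (tval R s)"
    using ev_evals[of m s] Le.prems unfolding fbelow.simps by blast
  obtain q :: "nat poly" where
    q: "\<And>k b B R A. m \<le> k \<Longrightarrow> \<forall>x<m. R x \<le> b \<Longrightarrow> \<forall>r. R r \<le> B \<Longrightarrow> poly q b \<le> B \<Longrightarrow>
      tval R t \<le> poly q b \<and> evals B k (ev k t) R A (poly q b * (B + 1)) (tval R t)"
    using ev_evals[of m t] Le.prems unfolding fbelow.simps by blast
  let ?p = "p + q + [:8:] * q + [:20:]"
  show ?case
  proof (intro exI[of _ ?p] allI impI)
    fix k b B :: nat and R :: "nat \<Rightarrow> nat" and A
    assume *: "m \<le> k" "\<forall>x<m. R x \<le> b" "\<forall>r. R r \<le> B" "poly ?p b \<le> B"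
    have B: "poly p b \<le> B" "poly q b \<le> B" "1 \<le> B" using * by auto
    note ps = p[OF *(1-3) B(1), of A] and qs = q[OF *(1-3) B(2), of A]
    obtain R1 where R1: "runs B (ev k s) (R, A) (poly p b * (B + 1)) (R1, A)" "R1 k = tval R s"
      "\<forall>r<k. R1 r = R r" "\<forall>r. R1 r \<le> B" using ps unfolding evals_def by blast
    have "\<forall>x<m. R1 x \<le> b" "m \<le> k + 1" using * R1(3) by auto
    moreover have "tval R1 t = tval R t" using Le.prems * R1(3) by (intro tval_cong[of m]) auto
    ultimately obtain R2 where R2: "runs B (ev (k + 1) t) (R1, A) (poly q b * (B + 1)) (R2, A)"
      "R2 (k + 1) = tval R t" "\<forall>r<k + 1. R2 r = R1 r" "\<forall>r. R2 r \<le> B"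
      using q[of "k + 1" R1 b B A] R1(4) B(2) unfolding evals_def by auto
    define S where "S i = (R2(k := tval R s - i, k + 1 := tval R t - i), A)" for i
    have step: "runs B (dec (k + 1) ;; dec k) (S i) (3 + 3) (S (Suc i))" if "i < tval R t" for i
    proof (rule runs_Seq)
      have "tval R t - i \<le> B" "tval R s - i \<le> B" using ps qs B by linarith+
      then show "runs B (dec (k + 1)) (S i) 3 (R2(k := tval R s - i, k + 1 := tval R t - Suc i), A)"
        "runs B (dec k) (R2(k := tval R s - i, k + 1 := tval R t - Suc i), A) 3 (S (Suc i))"
        using runs_dec[of "R2(k := tval R s - i, k + 1 := tval R t - i)" "k + 1" B A]
          runs_dec[of "R2(k := tval R s - i, k + 1 := tval R t - Suc i)" k B A]
        unfolding S_def by (simp_all add: fun_upd_twist)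
    qed
    have "runs B (while (k + 1) (dec (k + 1) ;; dec k)) (S 0) (tval R t * ((3 + 3) + 2) + 1) (S (tval R t))"
      by (rule runs_while) (use step in \<open>auto simp: S_def\<close>)
    moreover have "S 0 = (R2, A)" using R1(2) R2(2,3) by (auto simp: S_def)
    ultimately have w: "runs B (while (k + 1) (dec (k + 1) ;; dec k)) (R2, A) (tval R t * ((3 + 3) + 2) + 1)
      (R2(k := tval R s - tval R t, k + 1 := 0), A)" by (simp add: S_def)
    let ?R = "R2(k := tval R s - tval R t, k + 1 := 0)"
    have k: "?R k = tval R s - tval R t" by simp
    have "?R k \<le> B" unfolding k using ps B by linarith
    then have "runs B (cf k (Le s t)) (R, A) (poly p b * (B + 1) + (poly q b * (B + 1) +
        ((tval R t * ((3 + 3) + 2) + 1) + (5 * B + 1 + 2)))) (?R(k := (if ?R k = 0 then 1 else 0)), A)"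
      unfolding cf.simps by (intro runs_Seq[OF R1(1)] runs_Seq[OF R2(1)] runs_Seq[OF w] runs_flip B)
    then have "evals B k (cf k (Le s t)) R A (poly p b * (B + 1) + (poly q b * (B + 1) +
        ((tval R t * ((3 + 3) + 2) + 1) + (5 * B + 1 + 2)))) (of_bool (fsat A R (Le s t)))"
      by (rule evalsI) (use R1 R2 * in auto)
    then show "evals B k (cf k (Le s t)) R A (poly ?p b * (B + 1)) (of_bool (fsat A R (Le s t)))"
    proof (rule evals_mono)
      have "tval R t * ((3 + 3) + 2) \<le> poly q b * (8 * (B + 1))"
        using qs by (intro mult_mono) auto
      then show "poly p b * (B + 1) + (poly q b * (B + 1) +
        ((tval R t * ((3 + 3) + 2) + 1) + (5 * B + 1 + 2))) \<le> poly ?p b * (B + 1)"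
        by (simp add: algebra_simps)
    qed
  qed
next
  case (Sy a t v)
  obtain p :: "nat poly" where
    p: "\<And>k b B R A. m \<le> k \<Longrightarrow> \<forall>x<m. R x \<le> b \<Longrightarrow> \<forall>r. R r \<le> B \<Longrightarrow> poly p b \<le> B \<Longrightarrow>
      tval R t \<le> poly p b \<and> evals B k (ev k t) R A (poly p b * (B + 1)) (tval R t)"
    using ev_evals[of m t] Sy.prems unfolding fbelow.simps by blast
  let ?p = "p + [:20:]"
  show ?case
  proof (intro exI[of _ ?p] allI impI)
    fix k b B :: nat and R :: "nat \<Rightarrow> nat" and A
    assume *: "m \<le> k" "\<forall>x<m. R x \<le> b" "\<forall>r. R r \<le> B" "poly ?p b \<le> B"
    have B: "poly p b \<le> B" "1 \<le> B" "m \<le> k + 1" using * by auto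
    obtain R1 where R1: "runs B (ev (k + 1) t) (R, A) (poly p b * (B + 1)) (R1, A)" "R1 (k + 1) = tval R t"
      "\<forall>r<k + 1. R1 r = R r" "\<forall>r. R1 r \<le> B" using p[OF B(3) *(2,3) B(1), of A] unfolding evals_def by blast
    have "runs B (cf k (Sy a t v)) (R, A) (poly p b * (B + 1) + 20 * (B + 1))
        (R1(k := (if A a (R1 (k + 1)) = v then 1 else 0)), A)"
      unfolding cf.simps using Sy.prems R1(4) B by (intro runs_Seq[OF R1(1)] runs_get) auto
    then have "evals B k (cf k (Sy a t v)) R A (poly p b * (B + 1) + 20 * (B + 1)) (of_bool (fsat A R (Sy a t v)))"
      by (rule evalsI) (use R1 * in auto)
    then show "evals B k (cf k (Sy a t v)) R A (poly ?p b * (B + 1)) (of_bool (fsat A R (Sy a t v)))"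
      by (rule evals_mono) (simp add: algebra_simps)
  qed
next
  case (Ng f)
  then obtain p :: "nat poly" where
    p: "\<And>k b B R A. m \<le> k \<Longrightarrow> \<forall>x<m. R x \<le> b \<Longrightarrow> \<forall>r. R r \<le> B \<Longrightarrow> poly p b \<le> B \<Longrightarrow>
      evals B k (cf k f) R A (poly p b * (B + 1)) (of_bool (fsat A R f))"
    unfolding fbelow.simps by blast
  let ?p = "p + [:20:]"
  show ?case
  proof (intro exI[of _ ?p] allI impI)
    fix k b B :: nat and R :: "nat \<Rightarrow> nat" and A
    assume *: "m \<le> k" "\<forall>x<m. R x \<le> b" "\<forall>r. R r \<le> B" "poly ?p b \<le> B"
    have B: "poly p b \<le> B" "1 \<le> B" using * by auto
    obtain R1 where R1: "runs B (cf k f) (R, A) (poly p b * (B + 1)) (R1, A)" "R1 k = of_bool (fsat A R f)"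
      "\<forall>r<k. R1 r = R r" "\<forall>r. R1 r \<le> B" using p[OF *(1-3) B(1), of A] unfolding evals_def by blast
    have "runs B (cf k (Ng f)) (R, A) (poly p b * (B + 1) + (5 * B + 1 + 2))
        (R1(k := (if R1 k = 0 then 1 else 0)), A)"
      unfolding cf.simps using R1(4) B by (intro runs_Seq[OF R1(1)] runs_flip) auto
    then have "evals B k (cf k (Ng f)) R A (poly p b * (B + 1) + (5 * B + 1 + 2)) (of_bool (fsat A R (Ng f)))"
      by (rule evalsI) (use R1 * in auto)
    then show "evals B k (cf k (Ng f)) R A (poly ?p b * (B + 1)) (of_bool (fsat A R (Ng f)))"
      by (rule evals_mono) (simp add: algebra_simps)
  qed
next
  case (An f g)
  then obtain p q :: "nat poly" where
    p: "\<And>k b B R A. m \<le> k \<Longrightarrow> \<forall>x<m. R x \<le> b \<Longrightarrow> \<forall>r. R r \<le> B \<Longrightarrow> poly p b \<le> B \<Longrightarrow>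
      evals B k (cf k f) R A (poly p b * (B + 1)) (of_bool (fsat A R f))" and
    q: "\<And>k b B R A. m \<le> k \<Longrightarrow> \<forall>x<m. R x \<le> b \<Longrightarrow> \<forall>r. R r \<le> B \<Longrightarrow> poly q b \<le> B \<Longrightarrow>
      evals B k (cf k g) R A (poly q b * (B + 1)) (of_bool (fsat A R g))"
    by (metis fbelow.simps(4))
  let ?p = "p + q + [:20:]"
  show ?case
  proof (intro exI[of _ ?p] allI impI)
    fix k b B :: nat and R :: "nat \<Rightarrow> nat" and A
    assume *: "m \<le> k" "\<forall>x<m. R x \<le> b" "\<forall>r. R r \<le> B" "poly ?p b \<le> B"
    have B: "poly p b \<le> B" "poly q b \<le> B" using * by auto
    obtain R1 where R1: "runs B (cf k f) (R, A) (poly p b * (B + 1)) (R1, A)" "R1 k = of_bool (fsat A R f)"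
      "\<forall>r<k. R1 r = R r" "\<forall>r. R1 r \<le> B" using p[OF *(1-3) B(1), of A] unfolding evals_def by blast
    have "\<forall>x<m. R1 x \<le> b" using * R1(3) by auto
    moreover have "fsat A R1 g = fsat A R g" using An.prems * R1(3) by (intro fsat_cong[of m]) auto
    ultimately obtain R2 where R2: "runs B (cf k g) (R1, A) (poly q b * (B + 1)) (R2, A)"
      "R2 k = of_bool (fsat A R g)" "\<forall>r<k. R2 r = R1 r"
      using q[OF *(1), of R1 b B A] R1(4) B(2) unfolding evals_def by auto
    let ?R = "if R1 k = 0 then R1 else R2"
    have "runs B (ifz k Skip (cf k g)) (R1, A) (poly q b * (B + 1) + 2) (?R, A)"
      using R2(1) runs_Skip[of B "(R1, A)" "poly q b * (B + 1)"] by (intro runs_ifz) auto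
    then have "runs B (cf k (An f g)) (R, A) (poly p b * (B + 1) + (poly q b * (B + 1) + 2)) (?R, A)"
      unfolding cf.simps by (intro runs_Seq[OF R1(1)])
    then have "evals B k (cf k (An f g)) R A (poly p b * (B + 1) + (poly q b * (B + 1) + 2))
        (of_bool (fsat A R (An f g)))"
      by (rule evalsI) (use R1 R2 * in \<open>auto split: if_splits\<close>)
    then show "evals B k (cf k (An f g)) R A (poly ?p b * (B + 1)) (of_bool (fsat A R (An f g)))"
      by (rule evals_mono) (simp add: algebra_simps)
  qed
next
  case (Xs x t f)
  obtain p :: "nat poly" where
    p: "\<And>k b B R A. m \<le> k \<Longrightarrow> \<forall>x<m. R x \<le> b \<Longrightarrow> \<forall>r. R r \<le> B \<Longrightarrow> poly p b \<le> B \<Longrightarrow>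
      tval R t \<le> poly p b \<and> evals B k (ev k t) R A (poly p b * (B + 1)) (tval R t)"
    using ev_evals[of m t] Xs.prems unfolding fbelow.simps by blast
  obtain q0 :: "nat poly" where
    q0: "\<And>k b B R A. m \<le> k \<Longrightarrow> \<forall>x<m. R x \<le> b \<Longrightarrow> \<forall>r. R r \<le> B \<Longrightarrow> poly q0 b \<le> B \<Longrightarrow>
      evals B k (cf k f) R A (poly q0 b * (B + 1)) (of_bool (fsat A R f))"
    using Xs unfolding fbelow.simps by blast
  \<comment> \<open>Inside the quantifier the bound variable can be as large as the value of
    \<open>t\<close>, so the polynomial of the body is taken at \<open>b + poly p b\<close>.\<close>
  define q where "q = pcompose q0 ([:0, 1:] + p)"
  have q_eq: "poly q b = poly q0 (b + poly p b)" for b by (simp add: q_def poly_pcompose)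
  let ?p = "p + p * (q + [:10:]) + q + [:70:]"
  show ?case
  proof (intro exI[of _ ?p] allI impI)
    fix k b B :: nat and R :: "nat \<Rightarrow> nat" and A
    assume *: "m \<le> k" "\<forall>x<m. R x \<le> b" "\<forall>r. R r \<le> B" "poly ?p b \<le> B"
    have B: "poly p b \<le> B" "poly q b \<le> B" "1 \<le> B" "m \<le> k + 1" "m \<le> k + 3" using * by auto
    have x: "x < m" "x < k" using Xs.prems * by auto
    define n where "n = tval R t"
    have nB: "n \<le> poly p b" "n \<le> B" unfolding n_def using p[OF B(4) *(2,3) B(1), of A] B by auto
    let ?R0 = "R(k := 0, k + 1 := 0)"
    let ?R1 = "?R0(k := ?R0 k + ?R0 x)"
    have r1: "runs B (clr k ;; clr (k + 1) ;; addto x k (k + 1)) (R, A) ((5 * B + 1) + ((5 * B + 1) + (13 * B + 2))) (?R1, A)"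
      using * x by (intro runs_Seq[OF runs_clr] runs_Seq[OF runs_clr] runs_addto) auto
    have R1: "\<forall>y<m. ?R1 y \<le> b" "\<forall>r. ?R1 r \<le> B" "?R1 k = R x" "\<forall>y<k. ?R1 y = R y"
      using * x by auto
    have "tval ?R1 t = n" unfolding n_def using Xs.prems * by (intro tval_cong[of m]) auto
    then obtain R2 where R2: "runs B (ev (k + 1) t) (?R1, A) (poly p b * (B + 1)) (R2, A)" "R2 (k + 1) = n"
      "\<forall>r<k + 1. R2 r = ?R1 r" "\<forall>r. R2 r \<le> B"
      using p[OF B(4) R1(1,2) B(1), of A] unfolding evals_def by auto
    let ?R3 = "R2(k + 2 := 0, x := 0)"
    have r3: "runs B (clr (k + 2) ;; clr x) (R2, A) ((5 * B + 1) + (5 * B + 1)) (?R3, A)"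
      using R2(4) by (intro runs_Seq[OF runs_clr] runs_clr) auto
    \<comment> \<open>After \<open>i\<close> rounds \<open>x\<close> holds \<open>i\<close>,
      \<open>k + 1\<close> the rounds left, \<open>k + 2\<close> the disjunction so far, and
      \<open>k\<close> still guards the outer value of \<open>x\<close>.\<close>
    define I where "I i s \<longleftrightarrow> (\<exists>R'. s = (R', A) \<and> R' x = i \<and> R' (k + 1) = n - i \<and>
      R' (k + 2) = of_bool (\<exists>j<i. fsat A (R(x := j)) f) \<and> R' k = R x \<and>
      (\<forall>r<k. r \<noteq> x \<longrightarrow> R' r = R r) \<and> (\<forall>r. R' r \<le> B))" for i :: nat and s :: store
    let ?body = "dec (k + 1) ;; cf (k + 3) f ;; ifz (k + 3) Skip (clr (k + 2) ;; inc (k + 2)) ;; inc x"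
    let ?m = "3 + (poly q b * (B + 1) + ((5 * B + 1 + 1 + 2) + 1))"
    have "\<exists>s'. runs B (while (k + 1) ?body) (?R3, A) (n * (?m + 2) + 1) s' \<and> I n s'"
    proof (rule runs_while_inv[of I])
      show "I 0 (?R3, A)" using R2 R1(3,4) x unfolding I_def by auto
    next
      fix i s assume i: "i < n" "I i s"
      then obtain R' where R': "s = (R', A)" "R' x = i" "R' (k + 1) = n - i"
        "R' (k + 2) = of_bool (\<exists>j<i. fsat A (R(x := j)) f)" "R' k = R x"
        "\<forall>r<k. r \<noteq> x \<longrightarrow> R' r = R r" "\<forall>r. R' r \<le> B" unfolding I_def by blast
      let ?Ra = "R'(k + 1 := n - Suc i)"
      have ra: "runs B (dec (k + 1)) (R', A) 3 (?Ra, A)"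
        using runs_dec[of R' "k + 1" B A] R'(3,7) by (metis diff_Suc_eq_diff_pred diff_commute diff_diff_left plus_1_eq_Suc)
      have bd: "\<forall>y<m. ?Ra y \<le> b + poly p b" "\<forall>r. ?Ra r \<le> B"
        using R' * i nB x by (auto simp: trans_le_add1) (metis less_imp_le_nat nat_le_linear order_trans trans_le_add1 trans_le_add2 le_trans less_le_trans)+
      have fe: "fsat A ?Ra f = fsat A (R(x := i)) f"
        using Xs.prems * R' x by (intro fsat_cong[of m]) auto
      obtain Rb where Rb: "runs B (cf (k + 3) f) (?Ra, A) (poly q b * (B + 1)) (Rb, A)"
        "Rb (k + 3) = of_bool (fsat A (R(x := i)) f)" "\<forall>r<k + 3. Rb r = ?Ra r" "\<forall>r. Rb r \<le> B"
        using q0[OF B(5) bd B(2)[unfolded q_eq], of A] unfolding evals_def fe q_eq by blast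
      let ?Rc = "Rb(k + 2 := of_bool (\<exists>j<Suc i. fsat A (R(x := j)) f))"
      have rc: "runs B (ifz (k + 3) Skip (clr (k + 2) ;; inc (k + 2))) (Rb, A) (5 * B + 1 + 1 + 2) (?Rc, A)"
      proof (rule runs_ifz)
        assume "fst (Rb, A) (k + 3) = 0"
        then have "\<not> fsat A (R(x := i)) f" using Rb(2) by simp
        then have "Rb (k + 2) = of_bool (\<exists>j<Suc i. fsat A (R(x := j)) f)"
          using Rb(3) R'(4) by (auto simp: less_Suc_eq)
        then have "?Rc = Rb" by (rule fun_upd_idem)
        then show "runs B Skip (Rb, A) (5 * B + 1 + 1) (?Rc, A)" using runs_Skip by simp
      next
        assume "fst (Rb, A) (k + 3) \<noteq> 0"
        then have "fsat A (R(x := i)) f" using Rb(2) by (cases "fsat A (R(x := i)) f") auto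
        then have e: "(Rb(k + 2 := 0))(k + 2 := Suc ((Rb(k + 2 := 0)) (k + 2))) = ?Rc" by (auto simp: fun_eq_iff)
        have "runs B (clr (k + 2) ;; inc (k + 2)) (Rb, A) ((5 * B + 1) + 1)
            ((Rb(k + 2 := 0))(k + 2 := Suc ((Rb(k + 2 := 0)) (k + 2))), A)"
          using Rb(4) B(3) by (intro runs_Seq[OF runs_clr] runs_inc) auto
        then show "runs B (clr (k + 2) ;; inc (k + 2)) (Rb, A) (5 * B + 1 + 1) (?Rc, A)" unfolding e .
      qed
      have xx: "?Rc x = i" using Rb(3) R'(2) x by simp
      have rd: "runs B (inc x) (?Rc, A) 1 (?Rc(x := Suc i), A)"
        using runs_inc[of ?Rc x B A] i(1) nB(2) unfolding xx by simp
      have "runs B ?body (R', A) ?m (?Rc(x := Suc i), A)"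
        by (intro runs_Seq[OF ra] runs_Seq[OF Rb(1)] runs_Seq[OF rc] rd)
      moreover have "I (Suc i) (?Rc(x := Suc i), A)"
        unfolding I_def using R' Rb(3,4) x i nB B(3) by auto
      ultimately show "fst s (k + 1) \<noteq> 0 \<and> (\<exists>s'. runs B ?body s ?m s' \<and> I (Suc i) s')"
        using R'(1,3) i by auto
    next
      show "fst s (k + 1) = 0" if "I n s" for s using that unfolding I_def by auto
    qed
    then obtain R4 where R4: "runs B (while (k + 1) ?body) (?R3, A) (n * (?m + 2) + 1) (R4, A)"
      "R4 (k + 2) = of_bool (\<exists>j<n. fsat A (R(x := j)) f)" "R4 k = R x" "\<forall>r<k. r \<noteq> x \<longrightarrow> R4 r = R r"
      "\<forall>r. R4 r \<le> B" unfolding I_def by blast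
    let ?R5 = "(R4(x := 0))(k := 0, x := (R4(x := 0)) x + (R4(x := 0)) k)"
    let ?R6 = "?R5(k + 2 := 0, k := ?R5 k + ?R5 (k + 2))"
    have "runs B (clr x ;; mv k x ;; mv (k + 2) k) (R4, A) ((5 * B + 1) + ((6 * B + 1) + (6 * B + 1))) (?R6, A)"
      using R4(5) x by (intro runs_Seq[OF runs_clr] runs_Seq[OF runs_mv] runs_mv) auto
    have "runs B (cf k (Xs x t f)) (R, A) ((5 * B + 1) + ((5 * B + 1) + ((13 * B + 2) + (poly p b * (B + 1) +
        ((5 * B + 1) + ((5 * B + 1) + ((n * (?m + 2) + 1) + ((5 * B + 1) + ((6 * B + 1) + (6 * B + 1)))))))))) (?R6, A)"
      unfolding cf.simps using * x R2(4) R4(5)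
      by (intro runs_Seq[OF runs_clr] runs_Seq[OF runs_addto] runs_Seq[OF R2(1)] runs_Seq[OF R4(1)]
        runs_Seq[OF runs_mv] runs_mv) auto
    then have "evals B k (cf k (Xs x t f)) R A ((5 * B + 1) + ((5 * B + 1) + ((13 * B + 2) + (poly p b * (B + 1) +
        ((5 * B + 1) + ((5 * B + 1) + ((n * (?m + 2) + 1) + ((5 * B + 1) + ((6 * B + 1) + (6 * B + 1))))))))))
        (of_bool (fsat A R (Xs x t f)))"
      by (rule evalsI) (use R4 * x in \<open>auto simp: n_def\<close>)
    then show "evals B k (cf k (Xs x t f)) R A (poly ?p b * (B + 1)) (of_bool (fsat A R (Xs x t f)))"
    proof (rule evals_mono)
      have "n * (?m + 2) \<le> poly p b * ((poly q b + 10) * (B + 1))"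
        using nB by (intro mult_mono) (auto simp: algebra_simps)
      then show "(5 * B + 1) + ((5 * B + 1) + ((13 * B + 2) + (poly p b * (B + 1) +
        ((5 * B + 1) + ((5 * B + 1) + ((n * (?m + 2) + 1) + ((5 * B + 1) + ((6 * B + 1) + (6 * B + 1))))))))) \<le> poly ?p b * (B + 1)"
        by (simp add: algebra_simps)
    qed
  qed
qed

primrec farrs :: "fm \<Rightarrow> nat set" where
  "farrs (Le s t) = {}"
| "farrs (Sy a t v) = {a}"
| "farrs (Ng f) = farrs f"
| "farrs (An f g) = farrs f \<union> farrs g"
| "farrs (Xs x t f) = farrs f"

lemma fsat_cong_arrs: "(\<And>a. a \<in> farrs f \<Longrightarrow> A a = A' a) \<Longrightarrow> fsat A e f = fsat A' e f"
  by (induction f arbitrary: e) auto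

section \<open>Loading the input; polynomial-time functions given by formulas for their bits\<close>

definition word_arrays :: "bool list \<Rightarrow> nat \<Rightarrow> nat \<Rightarrow> nat" where
  "word_arrays w a j = (if a = 0 then word_content w (int j) else 0)"

definition prelude :: "nat \<Rightarrow> com" where
  "prelude k = foldr (\<lambda>i c. Wr i 1 ;; c) [3..<k] Skip"

text \<open>A store has a counter for every natural number, but a machine has only \<open>k\<close>
  tapes, blank apart from the input. The tapes below \<open>k\<close> are therefore as in an initial
  configuration and get their marks from \<open>prelude\<close>; the remaining ones are taken to be
  marked already.\<close>

definition prelude_tapes :: "nat \<Rightarrow> bool list \<Rightarrow> nat \<Rightarrow> tape" where
  "prelude_tapes k w i = (if i < k then start_tapes w i else tapes (\<lambda>_. 0, word_arrays w) i)"

lemma exec_prelude: "exec B (prelude k) (prelude_tapes k w) (k - 3) (tapes (\<lambda>_. 0, word_arrays w))"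
proof -
  have "exec B (foldr (\<lambda>i c. Wr i 1 ;; c) [k - j..<k] Skip)
     (\<lambda>i. if k - j \<le> i \<and> i < k then start_tapes w i else tapes (\<lambda>_. 0, word_arrays w) i)
     j (tapes (\<lambda>_. 0, word_arrays w))" if "j \<le> k - 3" for j
    using that
  proof (induction j)
    case 0
    have "(\<lambda>i. if k - 0 \<le> i \<and> i < k then start_tapes w i else tapes (\<lambda>_. 0, word_arrays w) i) =
        tapes (\<lambda>_. 0, word_arrays w)" by (rule ext) auto
    then show ?case using exec_Skip by (simp only: diff_zero upt_rec[of k k] foldr.simps) simp
  next
    case (Suc j)
    let ?T = "\<lambda>j i. if k - j \<le> i \<and> i < k then start_tapes w i else tapes (\<lambda>_. 0, word_arrays w) i"
    have l: "[k - Suc j..<k] = (k - Suc j) # [k - j..<k]"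
      using Suc.prems by (subst upt_conv_Cons) (auto simp: Suc_diff_Suc)
    have "(?T (Suc j))(k - Suc j := ((fst (?T (Suc j) (k - Suc j)))(snd (?T (Suc j) (k - Suc j)) := 1),
        snd (?T (Suc j) (k - Suc j)))) = ?T j"
      using Suc.prems by (auto simp: fun_eq_iff tapes_def start_tapes_def word_content_def mark_def)
    then have "exec B (Wr (k - Suc j) 1) (?T (Suc j)) 1 (?T j)"
      using exec_Wr[of B "k - Suc j" 1 "?T (Suc j)"] by simp
    from exec_Seq[OF this Suc.IH] Suc.prems show ?case unfolding l by simp
  qed
  from this[of "k - 3"]
  have "exec B (prelude k)
     (\<lambda>i. if k - (k - 3) \<le> i \<and> i < k then start_tapes w i else tapes (\<lambda>_. 0, word_arrays w) i)
     (k - 3) (tapes (\<lambda>_. 0, word_arrays w))"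
    unfolding prelude_def by (cases "3 \<le> k") auto
  moreover have "(\<lambda>i. if k - (k - 3) \<le> i \<and> i < k then start_tapes w i else tapes (\<lambda>_. 0, word_arrays w) i)
      = prelude_tapes k w"
    by (auto simp: fun_eq_iff prelude_tapes_def tapes_def start_tapes_def array_content_def word_arrays_def
        word_content_def)
  ultimately show ?thesis by simp
qed

lemma com_wf_prelude: "com_wf (prelude k)" "com_tapes (prelude k) \<subseteq> {..<k}"
proof -
  have "com_wf (foldr (\<lambda>i c. Wr i 1 ;; c) is Skip) \<and> com_tapes (foldr (\<lambda>i c. Wr i 1 ;; c) is Skip) = set is" for "is"
    by (induction "is") auto
  then show "com_wf (prelude k)" "com_tapes (prelude k) \<subseteq> {..<k}" unfolding prelude_def by auto
qed

lemma com_wf_simps [simp]: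
  "com_wf (inc r)" "com_wf (dec r)" "com_wf (ifz r c1 c2) = (com_wf c1 \<and> com_wf c2)"
  "com_wf (while r c) = com_wf c" "com_wf (clr r)" "com_wf (mv x y)" "com_wf (addto x y z)"
  "com_wf (get a r v k)" "v < 3 \<Longrightarrow> com_wf (put a r v)" "com_wf (incs k n)"
proof -
  show "com_wf (incs k n)" by (induction n) (auto simp: inc_def)
qed (auto simp: inc_def dec_def ifz_def while_def clr_def mv_def addto_def get_def put_def at_index_def)

lemma com_wf_ev [simp]: "com_wf (ev k t)"
  by (induction t arbitrary: k) auto

lemma com_wf_cf [simp]: "com_wf (cf k f)"
  by (induction f arbitrary: k) auto

definition scan :: com where
  "scan = inc 2 ;; while 2 (get 0 0 0 3 ;; ifz 3 (inc 0) (dec 2)) ;; clr 3"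

lemma com_wf_scan [simp]: "com_wf scan" by (simp add: scan_def)

lemma runs_scan:
  assumes "length w + 1 \<le> B"
  shows "runs B scan (\<lambda>_. 0, word_arrays w) (30 * (length w + 2) * (B + 1)) ((\<lambda>_. 0)(0 := length w), word_arrays w)"
proof -
  define n where "n = length w"
  \<comment> \<open>Register 2 is the loop flag and register 3 the last test for a blank. The round
    with \<open>i = n\<close> meets the blank, drops the flag and leaves the length alone; hence
    \<open>min i n\<close> and the flag \<open>i \<le> n\<close>.\<close>
  define S :: "nat \<Rightarrow> store" where "S i = ((\<lambda>_. 0)(0 := min i n, 2 := of_bool (i \<le> n), 3 := of_bool (i = n + 1)), word_arrays w)" for i
  have step: "runs B (get 0 0 0 3 ;; ifz 3 (inc 0) (dec 2)) (S i) (20 * (B + 1) + (3 + 2)) (S (Suc i))" if "i \<le> n" for i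
  proof (rule runs_Seq)
    let ?R = "(\<lambda>_. 0)(0 := min i n, 2 := of_bool (i \<le> n), 3 := of_bool (i = n + 1)) :: nat \<Rightarrow> nat"
    let ?R1 = "?R(3 := (if word_arrays w 0 (?R 0) = 0 then 1 else 0))"
    show "runs B (get 0 0 0 3) (S i) (20 * (B + 1)) (?R1, word_arrays w)"
      unfolding S_def using assms that n_def by (intro runs_get) auto
    have z: "word_arrays w 0 (?R 0) = 0 \<longleftrightarrow> i = n"
      using that by (auto simp: word_arrays_def word_content_def n_def)
    show "runs B (ifz 3 (inc 0) (dec 2)) (?R1, word_arrays w) (3 + 2) (S (Suc i))"
    proof (rule runs_ifz)
      assume "fst (?R1, word_arrays w) 3 = 0"
      then have i: "i < n" using z that by (auto split: if_splits)
      have "runs B (inc 0) (?R1, word_arrays w) 1 (?R1(0 := Suc (?R1 0)), word_arrays w)"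
        using i assms n_def by (intro runs_inc) auto
      moreover have "?R1(0 := Suc (?R1 0)) = fst (S (Suc i))" using i z by (auto simp: S_def fun_eq_iff)
      ultimately show "runs B (inc 0) (?R1, word_arrays w) 3 (S (Suc i))"
        by (auto simp: S_def intro: runs_mono)
    next
      assume "fst (?R1, word_arrays w) 3 \<noteq> 0"
      then have i: "i = n" using z by (auto split: if_splits)
      have "runs B (dec 2) (?R1, word_arrays w) 3 (?R1(2 := ?R1 2 - 1), word_arrays w)"
        using i assms n_def by (intro runs_dec) auto
      moreover have "?R1(2 := ?R1 2 - 1) = fst (S (Suc i))" using i z by (auto simp: S_def fun_eq_iff)
      ultimately show "runs B (dec 2) (?R1, word_arrays w) 3 (S (Suc i))"
        by (auto simp: S_def)
    qed
  qed
  have w: "runs B (while 2 (get 0 0 0 3 ;; ifz 3 (inc 0) (dec 2))) (S 0)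
      ((n + 1) * (20 * (B + 1) + (3 + 2) + 2) + 1) (S (n + 1))"
    by (rule runs_while) (use step in \<open>auto simp: S_def\<close>)
  have "runs B (inc 2) (\<lambda>_. 0, word_arrays w) 1 ((\<lambda>_. 0)(2 := Suc ((\<lambda>_. 0) 2)), word_arrays w)"
    using assms by (intro runs_inc) auto
  moreover have "(\<lambda>_. 0)(2 := Suc ((\<lambda>_. 0) 2)) = fst (S 0)" by (auto simp: S_def fun_eq_iff)
  ultimately have i: "runs B (inc 2) (\<lambda>_. 0, word_arrays w) 1 (S 0)" by (auto simp: S_def)
  have "runs B (clr 3) (S (n + 1)) (5 * B + 1) ((fst (S (n + 1)))(3 := 0), word_arrays w)"
    using assms runs_clr[of "fst (S (n + 1))" 3 B "word_arrays w"] by (simp add: S_def)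
  moreover have "(fst (S (n + 1)))(3 := 0) = (\<lambda>_. 0)(0 := length w)" by (auto simp: S_def n_def fun_eq_iff)
  ultimately have c: "runs B (clr 3) (S (n + 1)) (5 * B + 1) ((\<lambda>_. 0)(0 := length w), word_arrays w)" by simp
  have "runs B scan (\<lambda>_. 0, word_arrays w) (1 + ((n + 1) * (20 * (B + 1) + (3 + 2) + 2) + 1 + (5 * B + 1)))
      ((\<lambda>_. 0)(0 := length w), word_arrays w)"
    unfolding scan_def by (intro runs_Seq[OF i] runs_Seq[OF w] c)
  then show ?thesis by (rule runs_mono) (simp add: n_def algebra_simps)
qed

text \<open>Free variables of formulas about an input \<open>w\<close>: 0 stands for the length of \<open>w\<close>, 1 for an index.\<close>

definition env :: "nat \<Rightarrow> nat \<Rightarrow> nat \<Rightarrow> nat" where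
  "env n i = (\<lambda>_. 0)(0 := n, 1 := i)"

lemma runs_prelude:
  assumes "runs B c (\<lambda>_. 0, word_arrays w) n s'"
  shows "\<exists>t\<le>k + n. exec (int B) (prelude k ;; c) (prelude_tapes k w) t (tapes s')"
proof -
  obtain t where "t \<le> n" "exec (int B) c (tapes (\<lambda>_. 0, word_arrays w)) t (tapes s')"
    using assms unfolding runs_def by blast
  then show ?thesis
    using exec_Seq[OF exec_prelude[of "int B" k w]] by (intro exI[of _ "k - 3 + t"]) auto
qed

lemma com_tapes_bound: "\<exists>k>n. com_tapes c \<subseteq> {..<k}"
proof -
  obtain k where "\<forall>i\<in>com_tapes c. i < k"
    using finite_com_tapes[of c] finite_nat_set_iff_bounded by blast
  then show ?thesis by (intro exI[of _ "max k (Suc n)"]) (auto simp: less_max_iff_disj)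
qed

lemma tapes_accept: "head_sym (tapes s (r + 4)) \<noteq> 1 \<longleftrightarrow> fst s r \<noteq> 0"
  using head_sym_reg[of s r] by simp

text \<open>The number of output bits is the value of a fixed term, hence polynomial, and each bit
  costs one evaluation of a fixed formula. The formula reads array 0 only, since array 1 changes
  while the output is written into it.\<close>

theorem polytime_by_formula:
  assumes \<beta>: "fbelow m \<beta>" "farrs \<beta> \<subseteq> {0}" and len: "tbelow m len" and m: "2 \<le> m"
  shows "polytime_computable (\<lambda>w. map (\<lambda>i. fsat (word_arrays w) (env (length w) i) \<beta>)
            [0..<tval (env (length w) 0) len])"
proof -
  obtain p :: "nat poly" where
    p: "\<And>k b B R A. m \<le> k \<Longrightarrow> \<forall>x<m. R x \<le> b \<Longrightarrow> \<forall>r. R r \<le> B \<Longrightarrow> poly p b \<le> B \<Longrightarrow>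
      tval R len \<le> poly p b \<and> evals B k (ev k len) R A (poly p b * (B + 1)) (tval R len)"
    using ev_evals[OF len] by blast
  obtain q0 :: "nat poly" where
    q0: "\<And>k b B R A. m \<le> k \<Longrightarrow> \<forall>x<m. R x \<le> b \<Longrightarrow> \<forall>r. R r \<le> B \<Longrightarrow> poly q0 b \<le> B \<Longrightarrow>
      evals B k (cf k \<beta>) R A (poly q0 b * (B + 1)) (of_bool (fsat A R \<beta>))"
    using cf_evals[OF \<beta>(1)] by blast
  define q where "q = pcompose q0 ([:0, 1:] + p)"
  have q_eq: "poly q b = poly q0 (b + poly p b)" for b by (simp add: q_def poly_pcompose)
  define PB where "PB = p + q + [:2, 1:]"
  let ?body = "dec m ;; cf (m + 1) \<beta> ;; ifz (m + 1) (put 1 1 1) (put 1 1 2) ;; inc 1"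
  define c where "c = scan ;; ev m len ;; while m ?body ;; inc m"
  define PT where "PT = ([:30:] * [:2, 1:] + p + p * (q + [:40:]) + [:2:]) * (PB + [:1:])"
  let ?f = "\<lambda>w. map (\<lambda>i. fsat (word_arrays w) (env (length w) i) \<beta>) [0..<tval (env (length w) 0) len]"
  have main: "\<exists>s'. runs (poly PB (length w)) c (\<lambda>_. 0, word_arrays w) (poly PT (length w)) s' \<and>
     fst s' m \<noteq> 0 \<and> array_content (snd s' 1) = word_content (?f w)" for w
  proof -
    define L where "L = length w"
    define B where "B = poly PB L"
    define n where "n = tval (env L 0) len"
    define bit where "bit i = fsat (word_arrays w) (env L i) \<beta>" for i
    have B: "poly p L \<le> B" "poly q L \<le> B" "L + 1 \<le> B" "1 \<le> B" by (simp_all add: B_def PB_def)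
    have e0: "(\<lambda>_. 0)(0 := L) = env L 0" by (auto simp: env_def)
    have r1: "runs B scan (\<lambda>_. 0, word_arrays w) (30 * (L + 2) * (B + 1)) (env L 0, word_arrays w)"
      using runs_scan[of w B] B(3) by (simp add: L_def e0[unfolded L_def])
    have eb: "\<forall>x<m. env L 0 x \<le> L" "\<forall>r. env L 0 r \<le> B" using B by (auto simp: env_def)
    note pp = p[OF order_refl eb B(1), of "word_arrays w", folded n_def]
    then have nB: "n \<le> poly p L" "n \<le> B" using B(1) by auto
    obtain R1 where R1: "runs B (ev m len) (env L 0, word_arrays w) (poly p L * (B + 1)) (R1, word_arrays w)"
      "R1 m = n" "\<forall>r<m. R1 r = env L 0 r" "\<forall>r. R1 r \<le> B" using pp unfolding evals_def by blast
    \<comment> \<open>The first \<open>i\<close> bits are written, as symbols 1 and 2; the cells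
      beyond are blank, as the output convention demands.\<close>
    define AA where "AA i = (word_arrays w)(1 := (\<lambda>j. if j < i then (if bit j then 2 else 1) else 0))" for i
    define I where "I i s \<longleftrightarrow> (\<exists>R. s = (R, AA i) \<and> (\<forall>r<m. R r = env L i r) \<and> R m = n - i \<and> (\<forall>r. R r \<le> B))" for i s
    let ?m = "3 + (poly q L * (B + 1) + ((20 * (B + 1) + 2) + 1))"
    have "\<exists>s'. runs B (while m ?body) (R1, word_arrays w) (n * (?m + 2) + 1) s' \<and> I n s'"
    proof (rule runs_while_inv[of I])
      have "AA 0 = word_arrays w" by (auto simp: AA_def word_arrays_def fun_eq_iff)
      then show "I 0 (R1, word_arrays w)" unfolding I_def using R1 by auto
    next
      fix i s assume i: "i < n" "I i s"
      then obtain R where R: "s = (R, AA i)" "\<forall>r<m. R r = env L i r" "R m = n - i" "\<forall>r. R r \<le> B"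
        unfolding I_def by blast
      let ?R = "R(m := R m - 1)"
      have ra: "runs B (dec m) (R, AA i) 3 (?R, AA i)" using R(4) by (intro runs_dec) auto
      have bd: "\<forall>x<m. ?R x \<le> L + poly p L" "\<forall>r. ?R r \<le> B"
        using R i nB by (auto simp: env_def intro: le_trans[OF diff_le_self])
      have fe: "fsat (AA i) ?R \<beta> = bit i"
      proof -
        have "fsat (AA i) ?R \<beta> = fsat (AA i) (env L i) \<beta>" using R(2) by (intro fsat_cong[OF \<beta>(1)]) auto
        also have "\<dots> = bit i" unfolding bit_def using \<beta>(2) by (intro fsat_cong_arrs) (auto simp: AA_def)
        finally show ?thesis .
      qed
      obtain Rb where Rb: "runs B (cf (m + 1) \<beta>) (?R, AA i) (poly q L * (B + 1)) (Rb, AA i)"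
        "Rb (m + 1) = of_bool (bit i)" "\<forall>r<m + 1. Rb r = ?R r" "\<forall>r. Rb r \<le> B"
        using q0[OF _ bd B(2)[unfolded q_eq], of "m + 1" "AA i"] unfolding evals_def fe q_eq by auto
      have R1i: "Rb 1 = i" using Rb(3) R(2) m by (simp add: env_def)
      have A1: "AA (Suc i) = (AA i)(1 := (AA i 1)(Rb 1 := (if bit i then 2 else 1)))"
        unfolding AA_def R1i by (auto simp: fun_eq_iff less_Suc_eq)
      have rc: "runs B (ifz (m + 1) (put 1 1 1) (put 1 1 2)) (Rb, AA i) (20 * (B + 1) + 2) (Rb, AA (Suc i))"
      proof (rule runs_ifz)
        assume "fst (Rb, AA i) (m + 1) = 0"
        then have "\<not> bit i" using Rb(2) by simp
        then show "runs B (put 1 1 1) (Rb, AA i) (20 * (B + 1)) (Rb, AA (Suc i))"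
          unfolding A1 using runs_put[of 1 Rb 1 B 1 "AA i"] Rb(4) by simp
      next
        assume "fst (Rb, AA i) (m + 1) \<noteq> 0"
        then have "bit i" using Rb(2) by (cases "bit i") auto
        then show "runs B (put 1 1 2) (Rb, AA i) (20 * (B + 1)) (Rb, AA (Suc i))"
          unfolding A1 using runs_put[of 1 Rb 1 B 2 "AA i"] Rb(4) by simp
      qed
      have rd: "runs B (inc 1) (Rb, AA (Suc i)) 1 (Rb(1 := Suc i), AA (Suc i))"
        using runs_inc[of Rb 1 B "AA (Suc i)"] R1i i(1) nB(2) by simp
      have "runs B ?body (R, AA i) ?m (Rb(1 := Suc i), AA (Suc i))"
        by (intro runs_Seq[OF ra] runs_Seq[OF Rb(1)] runs_Seq[OF rc] rd)
      moreover have "I (Suc i) (Rb(1 := Suc i), AA (Suc i))"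
        unfolding I_def using R(2,3) Rb(3,4) i nB m by (auto simp: env_def)
      ultimately show "fst s m \<noteq> 0 \<and> (\<exists>s'. runs B ?body s ?m s' \<and> I (Suc i) s')"
        using R(1,3) i by auto
    next
      show "fst s m = 0" if "I n s" for s using that unfolding I_def by auto
    qed
    then obtain R2 where R2: "runs B (while m ?body) (R1, word_arrays w) (n * (?m + 2) + 1) (R2, AA n)" "R2 m = 0"
      unfolding I_def by auto
    have "runs B c (\<lambda>_. 0, word_arrays w) (30 * (L + 2) * (B + 1) + (poly p L * (B + 1) + (n * (?m + 2) + 1 + 1)))
      (R2(m := Suc (R2 m)), AA n)"
      unfolding c_def using R2(2) B(4)
      by (intro runs_Seq[OF r1] runs_Seq[OF R1(1)] runs_Seq[OF R2(1)] runs_inc) auto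
    then have "runs B c (\<lambda>_. 0, word_arrays w) (poly PT L) (R2(m := Suc (R2 m)), AA n)"
    proof (rule runs_mono)
      have "n * (?m + 2) \<le> poly p L * ((poly q L + 40) * (B + 1))"
        using nB by (intro mult_mono) (auto simp: algebra_simps)
      then show "30 * (L + 2) * (B + 1) + (poly p L * (B + 1) + (n * (?m + 2) + 1 + 1)) \<le> poly PT L"
        unfolding PT_def B_def[symmetric] poly_mult[of _ "PB + [:1:]"] by (simp add: B_def[symmetric] algebra_simps)
    qed
    moreover have "array_content (AA n 1) = word_content (?f w)"
      by (auto simp: fun_eq_iff array_content_def word_content_def AA_def n_def bit_def L_def)
    ultimately show ?thesis unfolding B_def L_def by (intro exI[of _ "(R2(m := Suc (R2 m)), AA n)"]) simp
  qed
  obtain k where k: "m + 5 < k" "com_tapes c \<subseteq> {..<k}" using com_tapes_bound by blast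
  have "com_wf c" by (simp add: c_def)
  show ?thesis
  proof (rule polytime_by_com[of "prelude k ;; c" k "m + 4" "prelude_tapes k" "[:k:] + PT"])
    show "com_wf (prelude k ;; c)" "com_tapes (prelude k ;; c) \<subseteq> {..<k}" "m + 4 < k" "1 < k"
      using \<open>com_wf c\<close> com_wf_prelude k by auto
    show "prelude_tapes k w i = start_tapes w i" if "i < k" for w i using that by (simp add: prelude_tapes_def)
    fix w
    obtain s' where s': "runs (poly PB (length w)) c (\<lambda>_. 0, word_arrays w) (poly PT (length w)) s'"
     "fst s' m \<noteq> 0" "array_content (snd s' 1) = word_content (?f w)" using main by blast
    obtain t where t: "t \<le> k + poly PT (length w)"
      "exec (int (poly PB (length w))) (prelude k ;; c) (prelude_tapes k w) t (tapes s')"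
      using runs_prelude[OF s'(1)] by blast
    have "fst (tapes s' 1) = word_content (?f w)" using s'(3) by (simp add: tapes_def)
    then show "\<exists>B t T'. exec B (prelude k ;; c) (prelude_tapes k w) t T' \<and> 0 \<le> B \<and>
       t \<le> poly ([:k:] + PT) (length w) \<and> head_sym (T' (m + 4)) \<noteq> 1 \<and> fst (T' 1) = word_content (?f w)"
      using t s'(2) tapes_accept[of s' m]
      by (intro exI[of _ "int (poly PB (length w))"] exI[of _ t] exI[of _ "tapes s'"]) simp
  qed
qed


section \<open>Evaluating quantified Boolean formulas in polynomial space\<close>

text \<open>\<open>qev U M d k x\<close> is the truth value of \<open>Q\<^sub>k x\<^sub>k \<dots> Q\<^bsub>k+d-1\<^esub> x\<^bsub>k+d-1\<^esub>. M x\<close>, where \<open>Q\<^sub>i\<close> is universal iff \<open>U i\<close>.\<close>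

primrec qev :: "(nat \<Rightarrow> bool) \<Rightarrow> ((nat \<Rightarrow> nat) \<Rightarrow> bool) \<Rightarrow> nat \<Rightarrow> nat \<Rightarrow> (nat \<Rightarrow> nat) \<Rightarrow> bool" where
  "qev U M 0 k x = M x"
| "qev U M (Suc d) k x =
    (if U k then qev U M d (Suc k) (x(k := 0)) \<and> qev U M d (Suc k) (x(k := 1))
     else qev U M d (Suc k) (x(k := 0)) \<or> qev U M d (Suc k) (x(k := 1)))"

text \<open>The assignments are enumerated in lexicographic order in array 1. When the value of a subtree is
  known in register \<open>m + 3\<close>, register 1 walks back up: where a left branch was taken, the value is saved
  in array 2 and the right branch is entered, otherwise it is combined with the saved one.\<close>

definition qbf_body :: "nat \<Rightarrow> fm \<Rightarrow> fm \<Rightarrow> com" where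
  "qbf_body m \<mu> \<upsilon> =
     ifz (m + 2)
       (clr 1 ;; cf (m + 4) \<mu> ;; clr (m + 3) ;; mv (m + 4) (m + 3) ;; addto m 1 (m + 4) ;; inc (m + 2))
       (ifz 1
          (dec (m + 1))
          (dec 1 ;; get 1 1 1 (m + 4) ;;
           ifz (m + 4)
             (ifz (m + 3) (put 2 1 0) (put 2 1 1) ;; put 1 1 1 ;; dec (m + 2))
             (put 1 1 0 ;; cf (m + 4) \<upsilon> ;; get 2 1 1 (m + 5) ;;
              ifz (m + 4)
                (ifz (m + 5) Skip (clr (m + 3) ;; inc (m + 3)))
                (ifz (m + 5) (clr (m + 3)) Skip))))"

text \<open>Only registers and array indices have to stay polynomial; the number of rounds of the
  main loop is exponential and therefore only asserted to exist. The matrix sees the input and the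
  assignment in array 1, the quantifier pattern sees the input alone; array 2 with the saved values
  is hidden from both.\<close>

theorem PSPACE_by_qbf:
  assumes \<mu>: "fbelow m \<mu>" "farrs \<mu> \<subseteq> {0, 1}" and \<upsilon>: "fbelow m \<upsilon>" "farrs \<upsilon> \<subseteq> {0}"
    and cnt: "tbelow m cnt" and m: "2 \<le> m"
  shows "{w. qev (\<lambda>k. fsat (word_arrays w) (env (length w) k) \<upsilon>)
             (\<lambda>x. fsat ((word_arrays w)(1 := x)) (env (length w) 0) \<mu>)
             (tval (env (length w) 0) cnt) 0 (\<lambda>_. 0)} \<in> PSPACE" (is "?L \<in> PSPACE")
proof -
  obtain p :: "nat poly" where
    p: "\<And>k b B R A. m \<le> k \<Longrightarrow> \<forall>x<m. R x \<le> b \<Longrightarrow> \<forall>r. R r \<le> B \<Longrightarrow> poly p b \<le> B \<Longrightarrow>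
      tval R cnt \<le> poly p b \<and> evals B k (ev k cnt) R A (poly p b * (B + 1)) (tval R cnt)"
    using ev_evals[OF cnt] by blast
  obtain q0 :: "nat poly" where
    q0: "\<And>k b B R A. m \<le> k \<Longrightarrow> \<forall>x<m. R x \<le> b \<Longrightarrow> \<forall>r. R r \<le> B \<Longrightarrow> poly q0 b \<le> B \<Longrightarrow>
      evals B k (cf k \<mu>) R A (poly q0 b * (B + 1)) (of_bool (fsat A R \<mu>))"
    using cf_evals[OF \<mu>(1)] by blast
  obtain q1 :: "nat poly" where
    q1: "\<And>k b B R A. m \<le> k \<Longrightarrow> \<forall>x<m. R x \<le> b \<Longrightarrow> \<forall>r. R r \<le> B \<Longrightarrow> poly q1 b \<le> B \<Longrightarrow>
      evals B k (cf k \<upsilon>) R A (poly q1 b * (B + 1)) (of_bool (fsat A R \<upsilon>))"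
    using cf_evals[OF \<upsilon>(1)] by blast
  define q where "q = pcompose q1 ([:0, 1:] + p)"
  have q_eq: "poly q b = poly q1 (b + poly p b)" for b by (simp add: q_def poly_pcompose)
  define PB where "PB = p + q + q0 + [:2, 1:]"
  let ?body = "qbf_body m \<mu> \<upsilon>"
  define c where "c = scan ;; ev m cnt ;; clr (m + 1) ;; clr (m + 2) ;; inc (m + 1) ;; while (m + 1) ?body"
  have main: "\<exists>n s'. runs (poly PB (length w)) c (\<lambda>_. 0, word_arrays w) n s' \<and> (fst s' (m + 3) \<noteq> 0 \<longleftrightarrow> w \<in> ?L)" for w
  proof -
    define L where "L = length w"
    define B where "B = poly PB L"
    define n where "n = tval (env L 0) cnt"
    define U where "U i = fsat (word_arrays w) (env L i) \<upsilon>" for i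
    define M where "M x = fsat ((word_arrays w)(1 := x)) (env L 0) \<mu>" for x
    have B: "poly p L \<le> B" "poly q L \<le> B" "poly q0 L \<le> B" "L + 1 \<le> B" "1 \<le> B" by (simp_all add: B_def PB_def)
    have e0: "(\<lambda>_. 0)(0 := L) = env L 0" by (auto simp: env_def)
    have r1: "runs B scan (\<lambda>_. 0, word_arrays w) (30 * (L + 2) * (B + 1)) (env L 0, word_arrays w)"
      using runs_scan[of w B] B(4) by (simp add: L_def e0[unfolded L_def])
    have eb: "\<forall>x<m. env L 0 x \<le> L" "\<forall>r. env L 0 r \<le> B" using B by (auto simp: env_def)
    note pp = p[OF order_refl eb B(1), of "word_arrays w", folded n_def]
    then have nB: "n \<le> poly p L" "n \<le> B" using B(1) by auto
    obtain R1 where R1: "runs B (ev m cnt) (env L 0, word_arrays w) (poly p L * (B + 1)) (R1, word_arrays w)"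
      "R1 m = n" "\<forall>r<m. R1 r = env L 0 r" "\<forall>r. R1 r \<le> B" using pp unfolding evals_def by blast
    define AA where "AA x v = (word_arrays w)(1 := x, 2 := v)" for x v
    \<comment> \<open>With \<open>g = 0\<close> the matrix is about to be evaluated at the
      assignment \<open>x\<close>; with \<open>g = 1\<close> the value \<open>b\<close> of the
      subtree below level \<open>i\<close> is known. The register \<open>m + 1\<close> keeps the
      loop alive.\<close>
    define St where "St g i b x v s \<longleftrightarrow> (\<exists>R. s = (R, AA x v) \<and> (\<forall>r<m. R r = env L i r) \<and> R m = n \<and> R (m + 1) = 1 \<and>
       R (m + 2) = g \<and> R (m + 3) = b \<and> (\<forall>r. R r \<le> B))" for g i b x v s
    have StI: "St g i b x v (R, AA x v)" if "\<forall>r<m. R r = env L i r" "R m = n" "R (m + 1) = 1"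
       "R (m + 2) = g" "R (m + 3) = b" "\<forall>r. R r \<le> B" for g i b x v R
      unfolding St_def using that by blast
    \<comment> \<open>\<open>a\<close> is the saved value of the left branch and \<open>b\<close>
      that of the right one: conjunction at universal levels, disjunction at the others.\<close>
    define Q where "Q i a b = (if U i then (if a = 0 then 0 else b) else (if a = 0 then b else 1))" for i and a b :: nat
    have Mf: "fsat (AA x v) R \<mu> = M x" if "\<forall>r<m. R r = env L 0 r" for x v R
    proof -
      have "fsat (AA x v) R \<mu> = fsat (AA x v) (env L 0) \<mu>" using that by (intro fsat_cong[OF \<mu>(1)]) auto
      also have "\<dots> = M x" unfolding M_def using \<mu>(2) by (intro fsat_cong_arrs) (auto simp: AA_def)
      finally show ?thesis .
    qed
    have Uf: "fsat (AA x v) R \<upsilon> = U i" if "\<forall>r<m. R r = env L i r" for x v R i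
    proof -
      have "fsat (AA x v) R \<upsilon> = fsat (AA x v) (env L i) \<upsilon>" using that by (intro fsat_cong[OF \<upsilon>(1)]) auto
      also have "\<dots> = U i" unfolding U_def using \<upsilon>(2) by (intro fsat_cong_arrs) (auto simp: AA_def)
      finally show ?thesis .
    qed
    \<comment> \<open>At a leaf: the matrix is evaluated and the climb begins at level
      \<open>n\<close>.\<close>
    have b1: "\<exists>t s'. runs B ?body s t s' \<and> St 1 n (of_bool (M x)) x v s'" if st: "St 0 i b x v s" for i b x v s
    proof -
      obtain R where R: "s = (R, AA x v)" "\<forall>r<m. R r = env L i r" "R m = n" "R (m + 1) = 1"
       "R (m + 2) = 0" "R (m + 3) = b" "\<forall>r. R r \<le> B" using st unfolding St_def by blast
      let ?R = "R(1 := 0)"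
      have e: "\<forall>r<m. ?R r = env L 0 r" using R(2) by (auto simp: env_def)
      have bd: "\<forall>x<m. ?R x \<le> L" "\<forall>r. ?R r \<le> B" using e eb(1) R(7) by auto
      obtain Rb where Rb: "runs B (cf (m + 4) \<mu>) (?R, AA x v) (poly q0 L * (B + 1)) (Rb, AA x v)"
        "Rb (m + 4) = of_bool (M x)" "\<forall>r<m + 4. Rb r = ?R r" "\<forall>r. Rb r \<le> B"
        using q0[OF _ bd B(3), of "m + 4" "AA x v"] unfolding evals_def Mf[OF e] by auto
      let ?Rc = "Rb(m + 3 := 0)"
      let ?Rd = "?Rc(m + 4 := 0, m + 3 := ?Rc (m + 3) + ?Rc (m + 4))"
      let ?Re = "?Rd(1 := ?Rd 1 + ?Rd m)"
      let ?Rf = "?Re(m + 2 := Suc (?Re (m + 2)))"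
      have v: "Rb 1 = 0" "Rb m = n" "Rb (m + 2) = 0" using Rb(3) R m by auto
      have "runs B (clr 1 ;; cf (m + 4) \<mu> ;; clr (m + 3) ;; mv (m + 4) (m + 3) ;; addto m 1 (m + 4) ;; inc (m + 2))
          (R, AA x v) ((5 * B + 1) + (poly q0 L * (B + 1) + ((5 * B + 1) + ((6 * B + 1) + ((13 * B + 2) + 1))))) (?Rf, AA x v)"
        using R(7) Rb(2,4) m v nB(2) B(5)
        by (intro runs_Seq[OF runs_clr] runs_Seq[OF Rb(1)] runs_Seq[OF runs_mv] runs_Seq[OF runs_addto] runs_inc) auto
      then obtain t where t: "runs B (clr 1 ;; cf (m + 4) \<mu> ;; clr (m + 3) ;; mv (m + 4) (m + 3) ;; addto m 1 (m + 4) ;; inc (m + 2))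
          (R, AA x v) t (?Rf, AA x v)" by blast
      have "runs B ?body s (t + 2) (?Rf, AA x v)"
        unfolding qbf_body_def R(1) using t R(5) by (intro runs_ifz) auto
      moreover have "St 1 n (of_bool (M x)) x v (?Rf, AA x v)"
      proof (rule StI)
        show "\<forall>r. ?Rf r \<le> B" using runs_bounded[OF t] R(7) by simp
        show "\<forall>r<m. ?Rf r = env L n r" using Rb(3) R(2) m v by (auto simp: env_def)
        show "?Rf m = n" "?Rf (m + 1) = 1" "?Rf (m + 2) = 1" "?Rf (m + 3) = of_bool (M x)"
          using Rb(2,3) R(4) m v by auto
      qed
      ultimately show ?thesis by blast
    qed
    have dec1: "\<exists>Rb. (\<exists>t. runs B (dec 1 ;; get 1 1 1 (m + 4)) (R, AA x v) t (Rb, AA x v)) \<and> Rb (m + 4) = of_bool (x i = 1) \<and>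
         (\<forall>r<m. Rb r = env L i r) \<and> (\<forall>r<m + 4. r \<ge> m \<longrightarrow> Rb r = R r) \<and> (\<forall>r. Rb r \<le> B)"
      if R: "\<forall>r<m. R r = env L (Suc i) r" "\<forall>r. R r \<le> B" for R i x v
    proof -
      have "R 1 = Suc i" using R m by (auto simp: env_def)
      let ?R = "R(1 := R 1 - 1)"
      let ?Rb = "?R(m + 4 := (if AA x v 1 (?R 1) = 1 then 1 else 0))"
      define Rb where "Rb = ?Rb"
      have r: "runs B (dec 1 ;; get 1 1 1 (m + 4)) (R, AA x v) (3 + 20 * (B + 1)) (Rb, AA x v)"
        unfolding Rb_def using R(2) m B(5) le_trans[OF diff_le_self]
        by (intro runs_Seq[OF runs_dec] runs_get) auto
      have "\<forall>r. Rb r \<le> B" using runs_bounded[OF r] R(2) by simp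
      moreover have "\<forall>r<m. Rb r = env L i r" unfolding Rb_def using R(1) m \<open>R 1 = Suc i\<close> by (auto simp: env_def)
      moreover have "Rb (m + 4) = of_bool (x i = 1)" unfolding Rb_def using \<open>R 1 = Suc i\<close> m by (simp add: AA_def)
      moreover have "\<forall>r<m + 4. r \<ge> m \<longrightarrow> Rb r = R r" unfolding Rb_def using m by auto
      ultimately show ?thesis using r by blast
    qed
    \<comment> \<open>A left branch is finished: its value is saved and the right branch entered.
      The deeper entries of the assignment are 0 by then, so the next round can evaluate the matrix
      at once.\<close>
    have b2: "\<exists>t s' b'. runs B ?body s t s' \<and> St 0 i b' (x(i := 1)) (v(i := b)) s'"
      if st: "St 1 (Suc i) b x v s" and hyps: "x i = 0" "b \<le> 1" for i b x v s
    proof -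
      obtain R where R: "s = (R, AA x v)" "\<forall>r<m. R r = env L (Suc i) r" "R m = n" "R (m + 1) = 1"
       "R (m + 2) = 1" "R (m + 3) = b" "\<forall>r. R r \<le> B" using st unfolding St_def by blast
      obtain Rb t1 where Rb: "runs B (dec 1 ;; get 1 1 1 (m + 4)) (R, AA x v) t1 (Rb, AA x v)" "Rb (m + 4) = 0"
         "\<forall>r<m. Rb r = env L i r" "\<forall>r<m + 4. r \<ge> m \<longrightarrow> Rb r = R r" "\<forall>r. Rb r \<le> B"
        using dec1[OF R(2,7), of x v] hyps(1) by auto
      have v: "Rb 1 = i" "R 1 = Suc i" "Rb (m + 3) = b" using Rb(3,4) R(2,6) m by (auto simp: env_def)
      have A1: "(AA x v)(2 := (AA x v 2)(Rb 1 := b)) = AA x (v(i := b))" unfolding v AA_def by auto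
      have A2: "(AA x (v(i := b)))(1 := (AA x (v(i := b)) 1)(Rb 1 := 1)) = AA (x(i := 1)) (v(i := b))"
        unfolding v AA_def by (auto simp: fun_upd_twist)
      have r2: "runs B (ifz (m + 3) (put 2 1 0) (put 2 1 1)) (Rb, AA x v) (20 * (B + 1) + 2) (Rb, AA x (v(i := b)))"
        unfolding A1[symmetric] using hyps(2) v(3) Rb(5) runs_put[of 2 Rb 1 B b "AA x v"]
        by (intro runs_ifz) (auto simp: le_Suc_eq)
      have r3: "runs B (put 1 1 1) (Rb, AA x (v(i := b))) (20 * (B + 1)) (Rb, AA (x(i := 1)) (v(i := b)))"
        unfolding A2[symmetric] using Rb(5) by (intro runs_put) auto
      let ?Rc = "Rb(m + 2 := Rb (m + 2) - 1)"
      have r4: "runs B (dec (m + 2)) (Rb, AA (x(i := 1)) (v(i := b))) 3 (?Rc, AA (x(i := 1)) (v(i := b)))"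
        using Rb(5) by (intro runs_dec) auto
      let ?then = "ifz (m + 3) (put 2 1 0) (put 2 1 1) ;; put 1 1 1 ;; dec (m + 2)"
      have "runs B ?then (Rb, AA x v) ((20 * (B + 1) + 2) + ((20 * (B + 1)) + 3)) (?Rc, AA (x(i := 1)) (v(i := b)))"
        by (intro runs_Seq[OF r2] runs_Seq[OF r3] r4)
      then have "runs B (ifz (m + 4) ?then c2) (Rb, AA x v) (((20 * (B + 1) + 2) + ((20 * (B + 1)) + 3)) + 2)
         (?Rc, AA (x(i := 1)) (v(i := b)))" for c2
        using Rb(2) by (intro runs_ifz) auto
      from runs_Seq[OF Rb(1) this] obtain t2 where t2: "\<And>c2. runs B ((dec 1 ;; get 1 1 1 (m + 4)) ;; ifz (m + 4) ?then c2)
         (R, AA x v) t2 (?Rc, AA (x(i := 1)) (v(i := b)))" by blast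
      have assoc: "runs B ((c1 ;; c2) ;; c3) s1 t s2 \<Longrightarrow> runs B (c1 ;; c2 ;; c3) s1 t s2" for c1 c2 c3 s1 s2 t
        unfolding runs_def by (auto elim!: exec.cases[of _ "_ ;; _"]) (metis add.assoc exec_Seq)
      have "runs B ?body s (t2 + 2 + 2) (?Rc, AA (x(i := 1)) (v(i := b)))"
        unfolding qbf_body_def R(1) using assoc[OF t2] R(5) v(2)
        by (intro runs_ifz) auto
      moreover have "St 0 i b (x(i := 1)) (v(i := b)) (?Rc, AA (x(i := 1)) (v(i := b)))"
      proof (rule StI)
        show "\<forall>r. ?Rc r \<le> B" using runs_bounded[OF r4] Rb(5) by simp
        show "\<forall>r<m. ?Rc r = env L i r" using Rb(3) by auto
        show "?Rc m = n" "?Rc (m + 1) = 1" "?Rc (m + 2) = 0" "?Rc (m + 3) = b"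
          using Rb(4) R(3-6) by auto
      qed
      ultimately show ?thesis by blast
    qed
    \<comment> \<open>A right branch is finished: the values are combined, and resetting the entry
      to 0 restores the assignment that the level was entered with.\<close>
    have b3: "\<exists>t s'. runs B ?body s t s' \<and> St 1 i (Q i (v i) b) (x(i := 0)) v s'"
      if st: "St 1 (Suc i) b x v s" and hyps: "x i = 1" "Suc i \<le> n" "v i \<le> 1" for i b x v s
    proof -
      obtain R where R: "s = (R, AA x v)" "\<forall>r<m. R r = env L (Suc i) r" "R m = n" "R (m + 1) = 1"
       "R (m + 2) = 1" "R (m + 3) = b" "\<forall>r. R r \<le> B" using st unfolding St_def by blast
      obtain Rb t1 where Rb: "runs B (dec 1 ;; get 1 1 1 (m + 4)) (R, AA x v) t1 (Rb, AA x v)" "Rb (m + 4) = 1"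
         "\<forall>r<m. Rb r = env L i r" "\<forall>r<m + 4. r \<ge> m \<longrightarrow> Rb r = R r" "\<forall>r. Rb r \<le> B"
        using dec1[OF R(2,7), of x v] hyps(1) by auto
      have v: "Rb 1 = i" "R 1 = Suc i" "Rb (m + 3) = b" using Rb(3,4) R(2,6) m by (auto simp: env_def)
      let ?A = "AA (x(i := 0)) v"
      have A1: "(AA x v)(1 := (AA x v 1)(Rb 1 := 0)) = ?A" unfolding v AA_def by auto
      have r2: "runs B (put 1 1 0) (Rb, AA x v) (20 * (B + 1)) (Rb, ?A)"
        unfolding A1[symmetric] using Rb(5) by (intro runs_put) auto
      have bd: "\<forall>x<m. Rb x \<le> L + poly p L" using Rb(3) hyps(2) nB(1) by (auto simp: env_def)
      obtain Rc where Rc: "runs B (cf (m + 4) \<upsilon>) (Rb, ?A) (poly q L * (B + 1)) (Rc, ?A)"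
        "Rc (m + 4) = of_bool (U i)" "\<forall>r<m + 4. Rc r = Rb r" "\<forall>r. Rc r \<le> B"
        using q1[OF _ bd Rb(5) B(2)[unfolded q_eq], of "m + 4" ?A] unfolding evals_def Uf[OF Rb(3)] q_eq by auto
      have v2: "Rc 1 = i" "Rc (m + 3) = b" using Rc(3) v m by auto
      let ?Rd = "Rc(m + 5 := (if ?A 2 (Rc 1) = 1 then 1 else 0))"
      have r4: "runs B (get 2 1 1 (m + 5)) (Rc, ?A) (20 * (B + 1)) (?Rd, ?A)"
        using Rc(4) B(5) m by (intro runs_get) auto
      have Rd: "\<forall>r. ?Rd r \<le> B" using runs_bounded[OF r4] Rc(4) by simp
      have d5: "?Rd (m + 5) = v i" "?Rd (m + 4) = of_bool (U i)" "?Rd (m + 3) = b" using hyps(3) v2 Rc(2) by (auto simp: AA_def)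
      let ?Re = "?Rd(m + 3 := Q i (v i) b)"
      have e1: "(?Rd(m + 3 := 0))(m + 3 := Suc ((?Rd(m + 3 := 0)) (m + 3))) = ?Rd(m + 3 := 1)" by auto
      have s1: "runs B (clr (m + 3) ;; inc (m + 3)) (?Rd, ?A) (5 * B + 1 + 1) (?Rd(m + 3 := 1), ?A)"
        unfolding e1[symmetric] using Rc(4) B(5) by (intro runs_Seq[OF runs_clr] runs_inc) auto
      have s0: "runs B (clr (m + 3)) (?Rd, ?A) (5 * B + 1 + 1) (?Rd(m + 3 := 0), ?A)"
        using Rc(4) by (intro runs_mono[OF runs_clr]) auto
      have s2: "runs B Skip (?Rd, ?A) (5 * B + 1 + 1) (?Rd(m + 3 := b), ?A)"
        using runs_Skip d5(3) by (simp add: fun_upd_idem)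
      have r5: "runs B (ifz (m + 4) (ifz (m + 5) Skip (clr (m + 3) ;; inc (m + 3)))
                (ifz (m + 5) (clr (m + 3)) Skip)) (?Rd, ?A) (5 * B + 1 + 1 + 2 + 2) (?Re, ?A)"
      proof (rule runs_ifz; rule runs_ifz)
        show "runs B Skip (?Rd, ?A) (5 * B + 1 + 1) (?Re, ?A)"
          if "fst (?Rd, ?A) (m + 4) = 0" "fst (?Rd, ?A) (m + 5) = 0"
          using that s2 unfolding fst_conv d5 by (simp add: Q_def)
        show "runs B (clr (m + 3) ;; inc (m + 3)) (?Rd, ?A) (5 * B + 1 + 1) (?Re, ?A)"
          if "fst (?Rd, ?A) (m + 4) = 0" "fst (?Rd, ?A) (m + 5) \<noteq> 0"
          using that s1 unfolding fst_conv d5 by (simp add: Q_def)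
        show "runs B (clr (m + 3)) (?Rd, ?A) (5 * B + 1 + 1) (?Re, ?A)"
          if "fst (?Rd, ?A) (m + 4) \<noteq> 0" "fst (?Rd, ?A) (m + 5) = 0"
          using that s0 unfolding fst_conv d5 by (simp add: Q_def)
        show "runs B Skip (?Rd, ?A) (5 * B + 1 + 1) (?Re, ?A)"
          if "fst (?Rd, ?A) (m + 4) \<noteq> 0" "fst (?Rd, ?A) (m + 5) \<noteq> 0"
          using that s2 unfolding fst_conv d5 by (simp add: Q_def)
      qed
      let ?else = "put 1 1 0 ;; cf (m + 4) \<upsilon> ;; get 2 1 1 (m + 5) ;;
              ifz (m + 4) (ifz (m + 5) Skip (clr (m + 3) ;; inc (m + 3))) (ifz (m + 5) (clr (m + 3)) Skip)"
      obtain t2 where "runs B ?else (Rb, AA x v) t2 (?Re, ?A)"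
        using runs_Seq[OF r2 runs_Seq[OF Rc(1) runs_Seq[OF r4 r5]]] by blast
      then have "runs B (ifz (m + 4) c1 ?else) (Rb, AA x v) (t2 + 2) (?Re, ?A)" for c1
        using Rb(2) by (intro runs_ifz) auto
      from runs_Seq[OF Rb(1) this] obtain t3 where t3: "\<And>c1. runs B ((dec 1 ;; get 1 1 1 (m + 4)) ;; ifz (m + 4) c1 ?else)
         (R, AA x v) t3 (?Re, ?A)" by blast
      have assoc: "runs B ((c1 ;; c2) ;; c3) s1 t s2 \<Longrightarrow> runs B (c1 ;; c2 ;; c3) s1 t s2" for c1 c2 c3 s1 s2 t
        unfolding runs_def by (auto elim!: exec.cases[of _ "_ ;; _"]) (metis add.assoc exec_Seq)
      have "runs B ?body s (t3 + 2 + 2) (?Re, ?A)"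
        unfolding qbf_body_def R(1) using assoc[OF t3] R(5) v(2) by (intro runs_ifz) auto
      moreover have "St 1 i (Q i (v i) b) (x(i := 0)) v (?Re, ?A)"
      proof (rule StI)
        show "\<forall>r. ?Re r \<le> B" using runs_bounded[OF r5] Rd by simp
        show "\<forall>r<m. ?Re r = env L i r" using Rb(3) Rc(3) by auto
        show "?Re m = n" "?Re (m + 1) = 1" "?Re (m + 2) = 1" "?Re (m + 3) = Q i (v i) b"
          using Rb(4) Rc(3) R(3-6) by auto
      qed
      ultimately show ?thesis by blast
    qed
    define res where "res = (of_bool (qev U M n 0 (\<lambda>_. 0)) :: nat)"
    define good where "good s \<longleftrightarrow> (\<exists>t s'. runs B (while (m + 1) ?body) s t s' \<and> fst s' (m + 3) = res)" for s
    have good_step: "good s" if "St g i b x v s" "runs B ?body s t s'" "good s'" for g i b x v s t s'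
    proof -
      have "fst s (m + 1) \<noteq> 0" using that(1) unfolding St_def by auto
      then show ?thesis using runs_while_step[OF _ that(2)] that(3) unfolding good_def by blast
    qed
    have fin: "good s" if st: "St 1 0 res x v s" for x v s
    proof -
      obtain R where R: "s = (R, AA x v)" "\<forall>r<m. R r = env L 0 r" "R (m + 1) = 1" "R (m + 2) = 1" "R (m + 3) = res" "\<forall>r. R r \<le> B"
        using st unfolding St_def by blast
      have "R 1 = 0" using R(2) m by (auto simp: env_def)
      let ?R = "R(m + 1 := R (m + 1) - 1)"
      have "runs B (dec (m + 1)) (R, AA x v) 3 (?R, AA x v)" using R(6) by (intro runs_dec) auto
      then have "runs B ?body s (3 + 2 + 2) (?R, AA x v)"
        unfolding qbf_body_def R(1) using R(4) \<open>R 1 = 0\<close> by (intro runs_ifz) auto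
      moreover have "good (?R, AA x v)"
        unfolding good_def using R(3,5) runs_while_end[of "(?R, AA x v)" "m + 1" B ?body] by (intro exI[of _ 1] exI[of _ "(?R, AA x v)"]) simp
      ultimately show ?thesis using good_step[OF st] by blast
    qed
    \<comment> \<open>Continuation style: if every state in which the subtree at level
      \<open>k\<close> has just been evaluated leads to the right result, so does every state in
      which its evaluation begins. Saved values below level \<open>k\<close> survive, which is what
      the enclosing levels rely on.\<close>
    have loop: "good s"
      if "k + d = n" "\<forall>j. k \<le> j \<longrightarrow> x j = 0" "St 0 i b x v s"
        "\<And>s v'. (\<forall>j<k. v' j = v j) \<Longrightarrow> St 1 k (of_bool (qev U M d k x)) x v' s \<Longrightarrow> good s" for d k x i b v s
      using that
    proof (induction d arbitrary: k x i b v s)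
      case 0
      then have "k = n" by simp
      obtain t s' where "runs B ?body s t s'" "St 1 n (of_bool (M x)) x v s'" using b1[OF 0(3)] by blast
      moreover then have "good s'" using 0(4)[of v s'] \<open>k = n\<close> by simp
      ultimately show ?case using good_step[OF 0(3)] by blast
    next
      case (Suc d)
      let ?q0 = "of_bool (qev U M d (Suc k) x) :: nat"
      let ?x1 = "x(k := 1)"
      let ?q1 = "of_bool (qev U M d (Suc k) ?x1) :: nat"
      have xk: "x k = 0" "x(k := 0) = x" using Suc.prems(2) by auto
      have qq: "Q k ?q0 ?q1 = of_bool (qev U M (Suc d) k x)"
        using xk(2) by (auto simp: Q_def)
      show ?case
      proof (rule Suc.IH[of "Suc k" x i b v s])
        show "Suc k + d = n" "\<forall>j. Suc k \<le> j \<longrightarrow> x j = 0" "St 0 i b x v s" using Suc.prems by auto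
        fix s v' assume v': "\<forall>j<Suc k. v' j = v j" "St 1 (Suc k) ?q0 x v' s"
        have "?q0 \<le> 1" by (cases "qev U M d (Suc k) x") auto
        then obtain t s' b' where s': "runs B ?body s t s'" "St 0 k b' ?x1 (v'(k := ?q0)) s'"
          using b2[OF v'(2) xk(1)] by blast
        have "good s'"
        proof (rule Suc.IH[of "Suc k" ?x1 k b' "v'(k := ?q0)" s'])
          show "Suc k + d = n" "\<forall>j. Suc k \<le> j \<longrightarrow> ?x1 j = 0" "St 0 k b' ?x1 (v'(k := ?q0)) s'"
            using Suc.prems s' by auto
          fix s2 v2 assume v2: "\<forall>j<Suc k. v2 j = (v'(k := ?q0)) j" "St 1 (Suc k) ?q1 ?x1 v2 s2"
          have vk: "v2 k = ?q0" using v2(1) by simp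
          have "v2 k \<le> 1" unfolding vk by (cases "qev U M d (Suc k) x") auto
          moreover have "Suc k \<le> n" "?x1 k = 1" using Suc.prems(1) by auto
          ultimately obtain t s3 where s3: "runs B ?body s2 t s3" "St 1 k (Q k (v2 k) ?q1) (?x1(k := 0)) v2 s3"
            using b3[OF v2(2)] by blast
          have "?x1(k := 0) = x" using xk(2) by simp
          then have "St 1 k (of_bool (qev U M (Suc d) k x)) x v2 s3" using s3(2) unfolding vk qq by simp
          moreover have "\<forall>j<k. v2 j = v j" using v2(1) v'(1) by auto
          ultimately have "good s3" using Suc.prems(4) by blast
          then show "good s2" using good_step[OF v2(2) s3(1)] by blast
        qed
        then show "good s" using good_step[OF v'(2) s'(1)] by blast
      qed
    qed
    let ?R = "R1(m + 1 := 0, m + 2 := 0)"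
    let ?R2 = "?R(m + 1 := Suc (?R (m + 1)))"
    have A0: "AA (\<lambda>_. 0) (\<lambda>_. 0) = word_arrays w" by (auto simp: AA_def word_arrays_def fun_eq_iff)
    have "St 0 0 (R1 (m + 3)) (\<lambda>_. 0) (\<lambda>_. 0) (?R2, AA (\<lambda>_. 0) (\<lambda>_. 0))"
      by (rule StI) (use R1(2-4) B(5) in auto)
    then have "St 0 0 (R1 (m + 3)) (\<lambda>_. 0) (\<lambda>_. 0) (?R2, word_arrays w)" unfolding A0 .
    then have "good (?R2, word_arrays w)"
      by (rule loop[of 0 n, rotated 2]) (use fin in \<open>auto simp: res_def\<close>)
    then obtain t s' where t: "runs B (while (m + 1) ?body) (?R2, word_arrays w) t s'" "fst s' (m + 3) = res"
      unfolding good_def by blast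
    have "runs B c (\<lambda>_. 0, word_arrays w) (30 * (L + 2) * (B + 1) + (poly p L * (B + 1) + ((5 * B + 1) + ((5 * B + 1) + (1 + t))))) s'"
      unfolding c_def using R1(4) B(5) t(1)
      by (intro runs_Seq[OF r1] runs_Seq[OF R1(1)] runs_Seq[OF runs_clr] runs_Seq[OF runs_inc]) auto
    moreover have "fst s' (m + 3) \<noteq> 0 \<longleftrightarrow> w \<in> ?L"
      unfolding t(2) res_def n_def L_def U_def M_def by simp
    ultimately show ?thesis unfolding B_def L_def by blast
  qed
  obtain k where k: "m + 8 < k" "com_tapes c \<subseteq> {..<k}" using com_tapes_bound by blast
  have "com_wf c" by (simp add: c_def qbf_body_def)
  show ?thesis
  proof (rule PSPACE_by_com[of "prelude k ;; c" k "m + 3 + 4" "prelude_tapes k" PB])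
    show "com_wf (prelude k ;; c)" "com_tapes (prelude k ;; c) \<subseteq> {..<k}" "m + 3 + 4 < k"
      using \<open>com_wf c\<close> com_wf_prelude k by auto
    show "prelude_tapes k w i = start_tapes w i" if "i < k" for w i using that by (simp add: prelude_tapes_def)
    fix w
    obtain n s' where s': "runs (poly PB (length w)) c (\<lambda>_. 0, word_arrays w) n s'"
     "fst s' (m + 3) \<noteq> 0 \<longleftrightarrow> w \<in> ?L" using main by blast
    obtain t where t: "exec (int (poly PB (length w))) (prelude k ;; c) (prelude_tapes k w) t (tapes s')"
      using runs_prelude[OF s'(1)] by blast
    show "\<exists>t T'. exec (int (poly PB (length w))) (prelude k ;; c) (prelude_tapes k w) t T' \<and>
        (head_sym (T' (m + 3 + 4)) \<noteq> 1 \<longleftrightarrow> w \<in> ?L)"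
      using t s'(2) unfolding tapes_accept[symmetric] by blast
  qed
qed

section \<open>Token sets on cells and rules, abstractly\<close>

definition normal :: "('c \<Rightarrow> 'v set) \<Rightarrow> ('c \<Rightarrow> 'v set) \<Rightarrow> 'v set \<Rightarrow> 'c \<Rightarrow> bool" where
  "normal a b X j \<longleftrightarrow> (a j \<subseteq> X \<and> b j \<inter> X = {}) \<or> (a j \<inter> X = {} \<and> b j \<subseteq> X)"

definition resting :: "'c set \<Rightarrow> 'r set \<Rightarrow> ('c \<Rightarrow> 'v set) \<Rightarrow> ('c \<Rightarrow> 'v set) \<Rightarrow> ('r \<Rightarrow> 'v set) \<Rightarrow> 'v set \<Rightarrow> bool" where
  "resting C R a b d X \<longleftrightarrow> (\<forall>j\<in>C. normal a b X j) \<and> (\<forall>r\<in>R. d r \<inter> X = {})"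

text \<open>Tokens are on the way from the \<open>a\<close>-groups of at most three cells to
  \<open>d r\<close>. The last two clauses replace counting: unless two tokens remain in groups that
  are not full, \<open>d r\<close> lacks at most one vertex; unless two places are free in groups
  that are not empty, \<open>d r\<close> holds at most one token. The first governs the end of the
  excursion, the second its abandonment.\<close>

definition draining_into :: "'c set \<Rightarrow> 'r set \<Rightarrow> ('c \<Rightarrow> 'v set) \<Rightarrow> ('c \<Rightarrow> 'v set) \<Rightarrow> ('r \<Rightarrow> 'v set) \<Rightarrow> 'v set \<Rightarrow> 'r \<Rightarrow> bool" where
  "draining_into C R a b d X r \<longleftrightarrow> d r \<inter> X \<noteq> {} \<and> \<not> d r \<subseteq> X \<and> (\<forall>r'\<in>R. r' \<noteq> r \<longrightarrow> d r' \<inter> X = {}) \<and>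
     (\<forall>j\<in>C. b j \<inter> X = {} \<or> (b j \<subseteq> X \<and> a j \<inter> X = {})) \<and>
     (\<exists>j\<in>C. b j \<inter> X = {} \<and> a j \<inter> X \<noteq> {} \<and> \<not> a j \<subseteq> X) \<and>
     (\<exists>j1 j2 j3. \<forall>j\<in>C. \<not> normal a b X j \<longrightarrow> j \<in> {j1, j2, j3}) \<and>
     ((\<exists>j\<in>C. \<exists>j'\<in>C. \<exists>x\<in>a j \<inter> X. \<exists>x'\<in>a j' \<inter> X. x \<noteq> x' \<and> \<not> a j \<subseteq> X \<and> \<not> a j' \<subseteq> X) \<or>
      (\<forall>y\<in>d r - X. \<forall>y'\<in>d r - X. y = y')) \<and>
     ((\<exists>j\<in>C. \<exists>j'\<in>C. \<exists>x\<in>a j - X. \<exists>x'\<in>a j' - X. x \<noteq> x' \<and> a j \<inter> X \<noteq> {} \<and> a j' \<inter> X \<noteq> {}) \<or>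
      (\<forall>y\<in>d r \<inter> X. \<forall>y'\<in>d r \<inter> X. y = y'))"

definition draining :: "'c set \<Rightarrow> 'r set \<Rightarrow> ('c \<Rightarrow> 'v set) \<Rightarrow> ('c \<Rightarrow> 'v set) \<Rightarrow> ('r \<Rightarrow> 'v set) \<Rightarrow> 'v set \<Rightarrow> bool" where
  "draining C R a b d X \<longleftrightarrow> (\<exists>r\<in>R. draining_into C R a b d X r)"

lemma drainingD:
  assumes "draining C R a b d X"
  shows "\<forall>j\<in>C. b j \<inter> X = {} \<or> (b j \<subseteq> X \<and> a j \<inter> X = {})"
    "\<exists>j\<in>C. b j \<inter> X = {} \<and> a j \<inter> X \<noteq> {} \<and> \<not> a j \<subseteq> X" "\<exists>r\<in>R. d r \<inter> X \<noteq> {}"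
proof -
  obtain r where r: "r \<in> R" "draining_into C R a b d X r" using assms unfolding draining_def by blast
  note 1 = r(2)[unfolded draining_into_def]
  show "\<forall>j\<in>C. b j \<inter> X = {} \<or> (b j \<subseteq> X \<and> a j \<inter> X = {})" using 1 by (elim conjE)
  show "\<exists>j\<in>C. b j \<inter> X = {} \<and> a j \<inter> X \<noteq> {} \<and> \<not> a j \<subseteq> X" using 1 by (elim conjE)
  have "d r \<inter> X \<noteq> {}" using 1 by (elim conjE)
  then show "\<exists>r\<in>R. d r \<inter> X \<noteq> {}" using r(1) by blast
qed

definition token_set :: "'c set \<Rightarrow> 'r set \<Rightarrow> ('c \<Rightarrow> 'v set) \<Rightarrow> ('c \<Rightarrow> 'v set) \<Rightarrow> ('r \<Rightarrow> 'v set) \<Rightarrow> 'v set \<Rightarrow> bool" where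
  "token_set C R a b d X \<longleftrightarrow> X \<subseteq> (\<Union>j\<in>C. a j) \<union> (\<Union>j\<in>C. b j) \<union> (\<Union>r\<in>R. d r) \<and>
     (resting C R a b d X \<or> draining C R a b d X \<or> draining C R b a d X)"

definition jump :: "'v set \<Rightarrow> 'v set \<Rightarrow> bool" where
  "jump X Y \<longleftrightarrow> card (X - Y) = 1 \<and> card (Y - X) = 1"

lemma jump_sym: "jump X Y \<Longrightarrow> jump Y X"
  by (simp add: jump_def)

lemma jumpD:
  assumes "jump X Y"
  shows "\<exists>u v. u \<in> X \<and> u \<notin> Y \<and> v \<in> Y \<and> v \<notin> X \<and> Y = insert v (X - {u})"
proof -
  obtain u v where uv: "X - Y = {u}" "Y - X = {v}"
    using assms unfolding jump_def One_nat_def card_1_singleton_iff by blast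
  have "z \<in> X - Y \<longleftrightarrow> z = u" "z \<in> Y - X \<longleftrightarrow> z = v" for z unfolding uv by auto
  then have "Y = insert v (X - {u})" "u \<in> X" "u \<notin> Y" "v \<in> Y" "v \<notin> X" by auto
  then show ?thesis by metis
qed

lemma jumpI: "u \<in> X \<Longrightarrow> u \<notin> Y \<Longrightarrow> v \<in> Y \<Longrightarrow> v \<notin> X \<Longrightarrow> X - {u} = Y - {v} \<Longrightarrow> jump X Y"
proof -
  assume *: "u \<in> X" "u \<notin> Y" "v \<in> Y" "v \<notin> X" "X - {u} = Y - {v}"
  then have "X - Y = {u}" "Y - X = {v}" by auto
  then show ?thesis by (simp add: jump_def)
qed

lemma card_le_3_subset:
  assumes "finite J" "card J \<le> 3"
  obtains j1 j2 j3 where "J \<subseteq> {j1, j2, j3}"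
proof -
  obtain xs where xs: "set xs = J" "length xs = card J"
    using finite_distinct_list[OF assms(1)] distinct_card by metis
  have "set xs \<subseteq> {xs ! 0, xs ! 1, xs ! 2}"
  proof
    fix z assume "z \<in> set xs"
    then obtain i where "i < length xs" "z = xs ! i" by (auto simp: in_set_conv_nth)
    moreover then have "i = 0 \<or> i = 1 \<or> i = 2" using xs(2) assms(2) by linarith
    ultimately show "z \<in> {xs ! 0, xs ! 1, xs ! 2}" by blast
  qed
  then show ?thesis using that xs(1) by blast
qed

text \<open>Four vertices per group leave room for two early and two late tokens, which keep the two
  last clauses of \<open>draining_into\<close> satisfied along an excursion. Equal sizes of
  \<open>a j\<close> and \<open>b j\<close> make the token count of a resting position independent
  of which cells are on.\<close>

locale toggle_system =
  fixes C :: "'c set" and R :: "'r set" and a b :: "'c \<Rightarrow> 'v set" and d :: "'r \<Rightarrow> 'v set"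
  assumes finite_C: "finite C" and finite_R: "finite R"
    and fin: "\<And>j. j \<in> C \<Longrightarrow> finite (a j)" "\<And>j. j \<in> C \<Longrightarrow> finite (b j)" "\<And>r. r \<in> R \<Longrightarrow> finite (d r)"
    and card_ab: "\<And>j. j \<in> C \<Longrightarrow> card (a j) = card (b j)" "\<And>j. j \<in> C \<Longrightarrow> 4 \<le> card (a j)"
    and disj: "\<And>i j. i \<in> C \<Longrightarrow> j \<in> C \<Longrightarrow> i \<noteq> j \<Longrightarrow> a i \<inter> a j = {}"
      "\<And>i j. i \<in> C \<Longrightarrow> j \<in> C \<Longrightarrow> i \<noteq> j \<Longrightarrow> b i \<inter> b j = {}"
      "\<And>i j. i \<in> C \<Longrightarrow> j \<in> C \<Longrightarrow> a i \<inter> b j = {}"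
      "\<And>i j. i \<in> R \<Longrightarrow> j \<in> R \<Longrightarrow> i \<noteq> j \<Longrightarrow> d i \<inter> d j = {}"
      "\<And>i j. i \<in> C \<Longrightarrow> j \<in> R \<Longrightarrow> a i \<inter> d j = {}"
      "\<And>i j. i \<in> C \<Longrightarrow> j \<in> R \<Longrightarrow> b i \<inter> d j = {}"
begin

text \<open>Filling the \<open>b\<close>-groups from \<open>d r\<close> is draining them read
  backwards, so every fact about one half of an excursion yields the other half.\<close>

lemma swapped: "toggle_system C R b a d"
proof
  show "b i \<inter> a j = {}" if "i \<in> C" "j \<in> C" for i j using disj(3)[OF that(2,1)] by blast
  show "4 \<le> card (b j)" if "j \<in> C" for j using card_ab that by simp
qed (use finite_C finite_R fin card_ab disj in \<open>auto\<close>)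

abbreviation "ok \<equiv> token_set C R a b d"

lemma ok_swap: "token_set C R b a d X = ok X"
  unfolding token_set_def resting_def normal_def by blast

definition wt :: "'c \<Rightarrow> nat" where "wt j = card (a j)"

lemma card_tokens:
  assumes "ok X"
  shows "card X = (\<Sum>j\<in>C. card (a j \<inter> X) + card (b j \<inter> X)) + (\<Sum>r\<in>R. card (d r \<inter> X))"
proof -
  let ?A = "\<Union>j\<in>C. a j \<inter> X" and ?B = "\<Union>j\<in>C. b j \<inter> X" and ?D = "\<Union>r\<in>R. d r \<inter> X"
  have X: "X = (?A \<union> ?B) \<union> ?D" using assms unfolding token_set_def by blast
  have fs: "finite ?A" "finite ?B" "finite ?D" using fin finite_C finite_R by auto
  have "card X = card (?A \<union> ?B) + card ?D"
    by (subst X, rule card_Un_disjoint) (use fs disj(5,6) in blast)+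
  also have "card (?A \<union> ?B) = card ?A + card ?B"
    by (rule card_Un_disjoint) (use fs disj(3) in blast)+
  also have "card ?A = (\<Sum>j\<in>C. card (a j \<inter> X))"
    by (rule card_UN_disjoint) (use fin(1) finite_C disj(1) in blast)+
  also have "card ?B = (\<Sum>j\<in>C. card (b j \<inter> X))"
    by (rule card_UN_disjoint) (use fin(2) finite_C disj(2) in blast)+
  also have "card ?D = (\<Sum>r\<in>R. card (d r \<inter> X))"
    by (rule card_UN_disjoint) (use fin(3) finite_R disj(4) in blast)+
  finally show ?thesis by (simp add: sum.distrib)
qed

text \<open>A jump adds one vertex and removes one, too little to turn an empty group of at least
  four vertices into a full one or conversely.\<close>

lemma unchanged_by_jump:
  assumes "jump X Y" "\<forall>j\<in>C. b j \<inter> X = {} \<or> b j \<subseteq> X" "\<forall>j\<in>C. b j \<inter> Y = {} \<or> b j \<subseteq> Y"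
  shows "{j \<in> C. b j \<inter> X = {}} = {j \<in> C. b j \<inter> Y = {}}"
proof -
  have *: "b j \<inter> Y = {}" if "jump X Y" "j \<in> C" "b j \<inter> X = {}" "b j \<inter> Y = {} \<or> b j \<subseteq> Y" for j X Y
  proof (rule ccontr)
    assume "b j \<inter> Y \<noteq> {}"
    have jm: "jump X Y" by (rule that(1))
    obtain u v where "Y = insert v (X - {u})" using jumpD[OF jm] by blast
    then have "b j \<subseteq> {v}" using that(3,4) \<open>b j \<inter> Y \<noteq> {}\<close> by blast
    then have "card (b j) \<le> 1" using card_mono[of "{v}" "b j"] by simp
    then show False using card_ab[OF that(2)] by simp
  qed
  show ?thesis using *[OF assms(1)] *[OF jump_sym[OF assms(1)]] assms(2,3) by blast
qed

text \<open>This jump crosses from draining the \<open>a\<close>-groups to draining the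
  \<open>b\<close>-groups. It must repair a partial \<open>a\<close>-group and disturb a
  \<open>b\<close>-group, which fixes the kinds of both its ends. Either the last token leaves the
  \<open>a\<close>-group, and counting tokens shows that the disturbed cells weigh exactly as much
  as \<open>r\<close>, or the last missing token comes back and nothing is toggled.\<close>

lemma toggle_core:
  assumes X: "ok X" "draining C R a b d X" and Y: "draining C R b a d Y" and j: "jump X Y"
    and K: "card X = (\<Sum>j\<in>C. wt j)"
  defines "F \<equiv> {j \<in> C. b j \<inter> X = {}}" and "G \<equiv> {j \<in> C. a j \<inter> Y \<noteq> {}}"
  shows "F = G \<or> (\<exists>r\<in>R. \<exists>J\<subseteq>C. card J \<le> 3 \<and> (\<Sum>j\<in>J. wt j) = card (d r) \<and> J \<subseteq> F \<and> G = F - J)"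
proof -
  obtain u v where uv: "u \<in> X" "u \<notin> Y" "v \<in> Y" "v \<notin> X" "Y = insert v (X - {u})"
    using jumpD[OF j] by (elim exE conjE) (rule that)
  have uvz: "z \<in> Y \<longleftrightarrow> (z \<in> X \<and> z \<noteq> u) \<or> z = v" for z unfolding uv(5) by auto
  obtain r where r1: "r \<in> R" "draining_into C R a b d X r" using X(2) unfolding draining_def by blast
  note c = r1(2)[unfolded draining_into_def]
  note r = r1(1) c[THEN conjunct1]
    c[THEN conjunct2, THEN conjunct1]
    c[THEN conjunct2, THEN conjunct2, THEN conjunct1]
    c[THEN conjunct2, THEN conjunct2, THEN conjunct2, THEN conjunct1]
    c[THEN conjunct2, THEN conjunct2, THEN conjunct2, THEN conjunct2, THEN conjunct1]
    c[THEN conjunct2, THEN conjunct2, THEN conjunct2, THEN conjunct2, THEN conjunct2, THEN conjunct1]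
    c[THEN conjunct2, THEN conjunct2, THEN conjunct2, THEN conjunct2, THEN conjunct2, THEN conjunct2, THEN conjunct1]
    c[THEN conjunct2, THEN conjunct2, THEN conjunct2, THEN conjunct2, THEN conjunct2, THEN conjunct2, THEN conjunct2]
  note Ya = drainingD(1)[OF Y] and Yb = drainingD(2)[OF Y]
  obtain j where j: "j \<in> C" "b j \<inter> X = {}" "a j \<inter> X \<noteq> {}" "\<not> a j \<subseteq> X" using r(6) by blast
  obtain l where l: "l \<in> C" "a l \<inter> Y = {}" "b l \<inter> Y \<noteq> {}" "\<not> b l \<subseteq> Y" using Yb by blast
  \<comment> \<open>In \<open>Y\<close> every \<open>a\<close>-group is empty or full, so the jump
    touches each one that is partial in \<open>X\<close>. The same holds for \<open>b l\<close>,
    which is partial in \<open>Y\<close> but empty or full in \<open>X\<close>.\<close>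
  have partial: "u \<in> a i \<or> v \<in> a i" if "i \<in> C" "a i \<inter> X \<noteq> {}" "\<not> a i \<subseteq> X" for i
    using that Ya uvz by blast
  have "u \<in> b l \<or> v \<in> b l" using l r(5) uvz by blast
  moreover have "u \<in> a j \<or> v \<in> a j" using partial j by blast
  moreover have "a j \<inter> b l = {}" using disj(3) j l by blast
  ultimately have uvc: "(u \<in> a j \<and> v \<in> b l) \<or> (v \<in> a j \<and> u \<in> b l)" by blast
  have only_j: "i = j" if "i \<in> C" "a i \<inter> X \<noteq> {}" "\<not> a i \<subseteq> X" for i
  proof (rule ccontr)
    assume "i \<noteq> j"
    have "u \<in> a i \<or> v \<in> a i" using partial that by blast
    moreover have "a i \<inter> a j = {}" "a i \<inter> b l = {}" using disj \<open>i \<noteq> j\<close> that(1) j(1) l(1) by blast+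
    ultimately show False using uvc by blast
  qed
  define J where "J = {j \<in> C. \<not> normal a b X j}"
  have fJ: "finite J" "J \<subseteq> C" using finite_C unfolding J_def by auto
  obtain j1 j2 j3 where "J \<subseteq> {j1, j2, j3}" using r(7) unfolding J_def by blast
  then have "card J \<le> card {j1, j2, j3}" by (intro card_mono) auto
  also have "\<dots> \<le> 3" by (simp add: card_insert_if)
  finally have cJ: "card J \<le> 3" .
  have jJ: "j \<in> J" using j unfolding J_def normal_def by blast
  have nJ: "b i \<inter> X = {}" "\<not> a i \<subseteq> X" if "i \<in> J" for i
    using that r(5) unfolding J_def normal_def by blast+
  have zJ: "a i \<inter> X = {}" if "i \<in> J" "i \<noteq> j" for i
    using only_j nJ(2)[OF that(1)] that fJ(2) by blast
  have cn: "card (a i \<inter> X) + card (b i \<inter> X) = wt i" if "i \<in> C - J" for i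
    using that card_ab unfolding J_def normal_def wt_def
    by (auto simp: Int_absorb2)
  have "(\<Sum>i\<in>C. card (a i \<inter> X) + card (b i \<inter> X)) =
      (\<Sum>i\<in>C - J. card (a i \<inter> X) + card (b i \<inter> X)) + (\<Sum>i\<in>J. card (a i \<inter> X) + card (b i \<inter> X))"
    using sum.subset_diff[OF fJ(2) finite_C] by simp
  also have "(\<Sum>i\<in>C - J. card (a i \<inter> X) + card (b i \<inter> X)) = (\<Sum>i\<in>C - J. wt i)" using cn by simp
  also have "(\<Sum>i\<in>J. card (a i \<inter> X) + card (b i \<inter> X)) = card (a j \<inter> X)"
  proof -
    have "(\<Sum>i\<in>J. card (a i \<inter> X) + card (b i \<inter> X)) = (\<Sum>i\<in>J. if i = j then card (a j \<inter> X) else 0)"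
      using nJ zJ by (intro sum.cong) auto
    then show ?thesis using fJ(1) jJ by simp
  qed
  also have "(\<Sum>r\<in>R. card (d r \<inter> X)) = card (d r \<inter> X)"
  proof -
    have "(\<Sum>r'\<in>R. card (d r' \<inter> X)) = (\<Sum>r'\<in>R. if r' = r then card (d r \<inter> X) else 0)"
      using r(4) by (intro sum.cong) auto
    then show ?thesis using finite_R r(1) by simp
  qed
  moreover have "(\<Sum>i\<in>C. wt i) = (\<Sum>i\<in>C - J. wt i) + (\<Sum>i\<in>J. wt i)"
    using sum.subset_diff[OF fJ(2) finite_C] by simp
  \<comment> \<open>A normal cell carries exactly its weight, so the tokens of the abnormal cells
    are those left in \<open>a j\<close> and those in \<open>d r\<close>.\<close>
  ultimately have sum: "(\<Sum>i\<in>J. wt i) = card (a j \<inter> X) + card (d r \<inter> X)"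
    using K card_tokens[OF X(1)] by simp
  have normalF: "i \<in> F \<longleftrightarrow> i \<in> G" if "i \<in> C - J" for i
  proof -
    have i: "i \<in> C" "i \<noteq> j" "normal a b X i" using that jJ unfolding J_def by auto
    have "u \<notin> a i" "v \<notin> a i"
      using uvc disj(1)[OF i(1) j(1) i(2)] disj(3)[OF i(1) l(1)] by blast+
    then have ai: "a i \<inter> Y = a i \<inter> X" unfolding uv(5) by blast
    have "a i \<noteq> {}" "b i \<noteq> {}" using card_ab[OF i(1)] by auto
    then show ?thesis using i(1,3) unfolding F_def G_def normal_def mem_Collect_eq ai by blast
  qed
  show ?thesis
    using uvc
  proof (elim disjE conjE)
    \<comment> \<open>With \<open>u\<close> as the only token in groups that are not full, the
      counting clause leaves one gap in \<open>d r\<close>; this gap and \<open>u\<close> balance in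
      the sum.\<close>
    assume loses: "u \<in> a j" "v \<in> b l"
    have "a j \<inter> Y = {}" using Ya j(1) loses(1) uv(2) by blast
    then have aj: "a j \<inter> X = {u}" using loses(1) uv(1) uvz by blast
    have "\<not> (\<exists>j\<in>C. \<exists>j'\<in>C. \<exists>x\<in>a j \<inter> X. \<exists>x'\<in>a j' \<inter> X. x \<noteq> x' \<and> \<not> a j \<subseteq> X \<and> \<not> a j' \<subseteq> X)"
    proof (intro notI, elim bexE conjE)
      fix i i' z z' assume z: "i \<in> C" "i' \<in> C" "z \<in> a i \<inter> X" "z' \<in> a i' \<inter> X" "z \<noteq> z'" "\<not> a i \<subseteq> X" "\<not> a i' \<subseteq> X"
      have "i = j" "i' = j" using only_j[of i] only_j[of i'] z by blast+
      then show False using z(3-5) aj by auto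
    qed
    then have one: "\<forall>y\<in>d r - X. \<forall>y'\<in>d r - X. y = y'" using r(8) by blast
    obtain y where y: "y \<in> d r - X" using r(3) by blast
    then have "d r - X = {y}" using one by blast
    then have "card (d r - X) = 1" by simp
    then have "card (d r \<inter> X) + 1 = card (d r)"
      using card_Int_Diff[of "d r" X] fin(3)[OF r(1)] by simp
    then have s: "(\<Sum>i\<in>J. wt i) = card (d r)" using sum aj by simp
    have "J \<subseteq> F" using nJ(1) fJ(2) unfolding F_def by blast
    moreover have "i \<notin> G" if "i \<in> J" for i
    proof (cases "i = j")
      case True
      then show ?thesis using \<open>a j \<inter> Y = {}\<close> unfolding G_def by simp
    next
      case False
      have "i \<in> C" using that fJ(2) by blast
      then have "a i \<inter> X = {}" "v \<notin> a i" using zJ[OF that False] disj(3)[of i l] l(1) loses(2) by blast+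
      then show ?thesis unfolding G_def uv(5) by blast
    qed
    moreover have "F \<subseteq> C" "G \<subseteq> C" unfolding F_def G_def by auto
    ultimately have "J \<subseteq> F \<and> G = F - J" using normalF by blast
    then show ?thesis using s cJ r(1) fJ(2) by blast
  next
    \<comment> \<open>With \<open>v\<close> as the only gap, \<open>d r\<close> holds a single
      token, the abnormal cells weigh \<open>wt j\<close> altogether, and so \<open>j\<close> is the
      only one.\<close>
    assume gains: "v \<in> a j" "u \<in> b l"
    have aj: "a j - X = {v}"
    proof -
      have "a j \<subseteq> Y" using Ya j(1) gains(1) uv(3) by blast
      then show ?thesis using uv(4) uvz gains(1) by blast
    qed
    have "\<not> (\<exists>j\<in>C. \<exists>j'\<in>C. \<exists>x\<in>a j - X. \<exists>x'\<in>a j' - X. x \<noteq> x' \<and> a j \<inter> X \<noteq> {} \<and> a j' \<inter> X \<noteq> {})"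
    proof (intro notI, elim bexE conjE)
      fix i i' z z' assume z: "i \<in> C" "i' \<in> C" "z \<in> a i - X" "z' \<in> a i' - X" "z \<noteq> z'" "a i \<inter> X \<noteq> {}" "a i' \<inter> X \<noteq> {}"
      have "i = j" "i' = j" using only_j[of i] only_j[of i'] z by blast+
      then show False using z(3-5) aj by auto
    qed
    then have one: "\<forall>y\<in>d r \<inter> X. \<forall>y'\<in>d r \<inter> X. y = y'" using r(9) by blast
    obtain y where y: "y \<in> d r \<inter> X" using r(2) by blast
    then have "d r \<inter> X = {y}" using one by blast
    then have "card (d r \<inter> X) = 1" by simp
    moreover have "card (a j \<inter> X) + 1 = wt j"
      using card_Int_Diff[of "a j" X] fin(1)[OF j(1)] aj unfolding wt_def by simp
    ultimately have "(\<Sum>i\<in>J. wt i) = wt j" using sum by simp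
    moreover have "(\<Sum>i\<in>J. wt i) = wt j + (\<Sum>i\<in>J - {j}. wt i)" using fJ(1) jJ by (simp add: sum.remove)
    ultimately have "(\<Sum>i\<in>J - {j}. wt i) = 0" by simp
    then have "\<forall>i\<in>J - {j}. wt i = 0" using fJ(1) by simp
    then have "i = j" if "i \<in> J" for i
      using card_ab(2)[of i] subsetD[OF fJ(2) that] that unfolding wt_def by (cases "i = j") auto
    then have Jj: "J = {j}" using jJ by blast
    have "j \<in> F" "j \<in> G" using j gains(1) uv(3) unfolding F_def G_def by auto
    moreover have "F \<subseteq> C" "G \<subseteq> C" unfolding F_def G_def by auto
    ultimately have "F = G" using normalF Jj by blast
    then show ?thesis by blast
  qed
qed

text \<open>While \<open>a\<close>-groups drain, a disturbed cell still counts as on because its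
  \<open>b\<close>-group is empty; while \<open>b\<close>-groups drain, it counts as off because its
  \<open>a\<close>-group is empty. The toggle is thus booked at the one jump between the two
  phases.\<close>

definition on_cells :: "'v set \<Rightarrow> 'c set" where
  "on_cells X = (if draining C R b a d X then {j \<in> C. a j \<inter> X \<noteq> {}} else {j \<in> C. b j \<inter> X = {}})"

lemma token_set_modes:
  assumes "ok X" "\<not> draining C R b a d X"
  shows "\<forall>j\<in>C. b j \<inter> X = {} \<or> b j \<subseteq> X" "resting C R a b d X \<or> draining C R a b d X"
  using assms drainingD(1)[of C R a b d X] unfolding token_set_def resting_def normal_def by blast+

text \<open>Within a phase, or between a phase and rest, one family of groups is empty or full on
  both sides of the jump, and \<open>unchanged_by_jump\<close> applies. What remains is a jump
  between the two phases, in either direction.\<close>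

lemma toggle_sound:
  assumes "ok X" "ok Y" "jump X Y" "card X = (\<Sum>j\<in>C. wt j)" "card Y = (\<Sum>j\<in>C. wt j)"
  shows "on_cells X = on_cells Y \<or> (\<exists>r\<in>R. \<exists>J\<subseteq>C. card J \<le> 3 \<and> (\<Sum>j\<in>J. wt j) = card (d r) \<and>
     (J \<subseteq> on_cells X \<and> on_cells Y = on_cells X - J \<or> J \<subseteq> on_cells Y \<and> on_cells X = on_cells Y - J))"
proof -
  have ne: "a j \<noteq> {}" "b j \<noteq> {}" if "j \<in> C" for j using card_ab[OF that] by auto
  have hi: "\<forall>j\<in>C. a j \<inter> Z = {} \<or> a j \<subseteq> Z" if "draining C R b a d Z \<or> resting C R a b d Z" for Z
    using that drainingD(1)[of C R b a d Z] unfolding resting_def normal_def by blast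
  have rest: "on_cells Z = {j \<in> C. a j \<inter> Z \<noteq> {}}" if "resting C R a b d Z" for Z
  proof -
    have "b j \<inter> Z = {} \<longleftrightarrow> a j \<inter> Z \<noteq> {}" if "j \<in> C" for j
      using \<open>resting C R a b d Z\<close> ne[OF that] that unfolding resting_def normal_def by blast
    then show ?thesis unfolding on_cells_def by auto
  qed
  have aa: "{j \<in> C. a j \<inter> X \<noteq> {}} = {j \<in> C. a j \<inter> Y \<noteq> {}}"
    if "\<forall>j\<in>C. a j \<inter> X = {} \<or> a j \<subseteq> X" "\<forall>j\<in>C. a j \<inter> Y = {} \<or> a j \<subseteq> Y"
    using toggle_system.unchanged_by_jump[OF swapped assms(3) that] by blast
  consider (ll) "\<not> draining C R b a d X" "\<not> draining C R b a d Y"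
    | (hh) "draining C R b a d X" "draining C R b a d Y"
    | (hr) "draining C R b a d X" "\<not> draining C R b a d Y" "resting C R a b d Y"
    | (rh) "draining C R b a d Y" "\<not> draining C R b a d X" "resting C R a b d X"
    | (lh) "\<not> draining C R b a d X" "draining C R b a d Y" "draining C R a b d X"
    | (hl) "draining C R b a d X" "\<not> draining C R b a d Y" "draining C R a b d Y"
    using token_set_modes(2)[OF assms(1)] token_set_modes(2)[OF assms(2)] by blast
  then show ?thesis
  proof cases
    case ll
    then show ?thesis
      using unchanged_by_jump[OF assms(3)] token_set_modes(1)[OF assms(1)] token_set_modes(1)[OF assms(2)]
      by (simp add: on_cells_def)
  next
    case hh
    then show ?thesis using aa hi by (simp add: on_cells_def)
  next
    case hr
    then have "on_cells X = on_cells Y" using aa hi rest[of Y] by (simp add: on_cells_def)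
    then show ?thesis by blast
  next
    case rh
    then have "on_cells X = on_cells Y" using aa hi rest[of X] by (simp add: on_cells_def)
    then show ?thesis by blast
  next
    case lh
    then show ?thesis
      using toggle_core[OF assms(1) lh(3,2) assms(3,4)] unfolding on_cells_def by auto
  next
    case hl
    then show ?thesis
      using toggle_core[OF assms(2) hl(3,1) jump_sym[OF assms(3)] assms(5)] unfolding on_cells_def by auto
  qed
qed

end

context toggle_system begin

definition rest_set :: "'c set \<Rightarrow> 'v set" where
  "rest_set F = (\<Union>j\<in>F. a j) \<union> (\<Union>j\<in>C - F. b j)"

lemma rest_set_int:
  assumes "F \<subseteq> C"
  shows "j \<in> C \<Longrightarrow> a j \<inter> rest_set F = (if j \<in> F then a j else {})"
    "j \<in> C \<Longrightarrow> b j \<inter> rest_set F = (if j \<in> F then {} else b j)"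
    "r \<in> R \<Longrightarrow> d r \<inter> rest_set F = {}"
  using assms disj unfolding rest_set_def by (auto; blast)+

lemma resting_rest_set: "F \<subseteq> C \<Longrightarrow> resting C R a b d (rest_set F)"
  unfolding resting_def normal_def by (simp add: inf.absorb_iff1 rest_set_int)

lemma ok_rest_set: "F \<subseteq> C \<Longrightarrow> ok (rest_set F)"
  using resting_rest_set[of F] unfolding token_set_def rest_set_def by blast

lemma on_cells_rest_set:
  assumes "F \<subseteq> C"
  shows "on_cells (rest_set F) = F"
proof -
  have ne: "a j \<noteq> {}" "b j \<noteq> {}" if "j \<in> C" for j using card_ab[OF that] by auto
  have "\<not> draining C R b a d (rest_set F)" using drainingD(3)[of C R b a d] rest_set_int(3)[OF assms] by blast
  moreover have "b j \<inter> rest_set F = {} \<longleftrightarrow> j \<in> F" if "j \<in> C" for j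
    using rest_set_int(2)[OF assms that] ne[OF that] by simp
  ultimately have "on_cells (rest_set F) = {j \<in> C. j \<in> F}" unfolding on_cells_def by auto
  then show ?thesis using assms by blast
qed

lemma card_rest_set: "F \<subseteq> C \<Longrightarrow> card (rest_set F) = (\<Sum>j\<in>C. wt j)"
proof -
  assume F: "F \<subseteq> C"
  have "card (rest_set F) = (\<Sum>j\<in>C. card (a j \<inter> rest_set F) + card (b j \<inter> rest_set F)) +
      (\<Sum>r\<in>R. card (d r \<inter> rest_set F))" using card_tokens ok_rest_set[OF F] by blast
  also have "(\<Sum>r\<in>R. card (d r \<inter> rest_set F)) = 0" using rest_set_int(3)[OF F] by simp
  also have "(\<Sum>j\<in>C. card (a j \<inter> rest_set F) + card (b j \<inter> rest_set F)) = (\<Sum>j\<in>C. wt j)"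
    using rest_set_int[OF F] card_ab unfolding wt_def by (intro sum.cong) auto
  finally show ?thesis by simp
qed

definition move :: "'v set \<Rightarrow> 'v set \<Rightarrow> bool" where
  "move X Y \<longleftrightarrow> ok X \<and> ok Y \<and> jump X Y"

lemma move_sym: "move X Y \<Longrightarrow> move Y X"
  by (auto simp: move_def jump_sym)

lemma two_elements: "p \<in> A \<Longrightarrow> q \<in> A \<Longrightarrow> p \<noteq> q \<Longrightarrow> (\<exists>z\<in>A. \<exists>z'\<in>A. z \<noteq> z') \<or> E"
  by blast

text \<open>The first half of an excursion, up to one token \<open>x3\<close> left and one gap
  \<open>d0\<close> in \<open>d r\<close>. The tokens \<open>x1\<close>, \<open>x2\<close> leave
  first and provide two gaps, \<open>x3\<close>, \<open>x4\<close> stay longest and provide two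
  tokens, so both counting clauses hold throughout; the other tokens may travel in any
  order.\<close>

lemma drain:
  assumes F: "F \<subseteq> C" and J: "J \<subseteq> F" "card J \<le> 3" and r: "r \<in> R" "(\<Sum>j\<in>J. wt j) = card (d r)"
    and j: "j \<in> J" and x: "x3 \<in> a j" and y: "d0 \<in> d r"
  shows "move\<^sup>*\<^sup>* (rest_set F) ((rest_set F - (\<Union>j\<in>J. a j)) \<union> {x3} \<union> (d r - {d0}))"
proof -
  define AJ where "AJ = (\<Union>j\<in>J. a j)"
  define S where "S P Q = (rest_set F - AJ) \<union> P \<union> Q" for P Q
  have fJ: "finite J" "J \<subseteq> C" "j \<in> C" using F J j finite_subset[OF subset_trans[OF J(1) F] finite_C] by auto
  have fAJ: "finite AJ" unfolding AJ_def using fJ fin by auto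
  have fd: "finite (d r)" using fin r by auto
  have cAJ: "card AJ = card (d r)"
    unfolding AJ_def r(2)[symmetric] wt_def by (rule card_UN_disjoint) (use fJ fin(1) disj(1) in blast)+
  have AJF: "AJ \<subseteq> rest_set F" unfolding AJ_def rest_set_def using J by blast
  have aJ: "a i \<inter> AJ = (if i \<in> J then a i else {})" if "i \<in> C" for i
    unfolding AJ_def using that disj(1) fJ(2) by (auto; blast)
  have bJ: "b i \<inter> AJ = {}" if "i \<in> C" for i unfolding AJ_def using that disj(3) fJ(2) by blast
  have dJ: "d i \<inter> AJ = {}" if "i \<in> R" for i unfolding AJ_def using that disj(5) fJ(2) by blast
  have Sa: "a i \<inter> S P Q = (if i \<in> J then a i \<inter> P else if i \<in> F then a i else {})"
    and Sb: "b i \<inter> S P Q = (if i \<in> F then {} else b i)"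
    if "P \<subseteq> AJ" "Q \<subseteq> d r" "i \<in> C" for P Q i
  proof -
    have q: "a i \<inter> Q = {}" "b i \<inter> Q = {}" using disj(5,6) that r(1) by blast+
    have "a i \<inter> S P Q = (a i \<inter> rest_set F - a i \<inter> AJ) \<union> (a i \<inter> P)" unfolding S_def using q by blast
    moreover have "a i \<inter> P = {}" if "i \<notin> J" using aJ[OF \<open>i \<in> C\<close>] that \<open>P \<subseteq> AJ\<close> by auto
    ultimately show "a i \<inter> S P Q = (if i \<in> J then a i \<inter> P else if i \<in> F then a i else {})"
      using rest_set_int(1)[OF F that(3)] aJ[OF that(3)] J by auto
    show "b i \<inter> S P Q = (if i \<in> F then {} else b i)"
      unfolding S_def using q rest_set_int(2)[OF F that(3)] bJ[OF that(3)] that(1) by (auto split: if_splits)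
  qed
  have Sd: "d i \<inter> S P Q = (if i = r then Q else {})" if "P \<subseteq> AJ" "Q \<subseteq> d r" "i \<in> R" for P Q i
  proof (cases "i = r")
    case True
    then show ?thesis unfolding S_def using rest_set_int(3)[OF F that(3)] dJ[OF that(3)] that(1,2) by auto
  next
    case False
    then show ?thesis
      unfolding S_def using rest_set_int(3)[OF F that(3)] dJ[OF that(3)] that(1,2) disj(4)[OF that(3) r(1) False] by (simp add: False) blast
  qed
  have okS: "ok (S P Q)" if P: "P \<subseteq> AJ" and Q: "Q \<subseteq> d r" "Q \<noteq> {}" "Q \<noteq> d r"
    and pj: "a j \<inter> P \<noteq> {}" "\<not> a j \<subseteq> P"
    and T: "(\<exists>z\<in>a j \<inter> P. \<exists>z'\<in>a j \<inter> P. z \<noteq> z') \<or> (\<forall>y\<in>d r - Q. \<forall>y'\<in>d r - Q. y = y')"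
    and M: "(\<exists>z\<in>a j - P. \<exists>z'\<in>a j - P. z \<noteq> z') \<or> (\<forall>y\<in>Q. \<forall>y'\<in>Q. y = y')" for P Q
  proof -
    let ?X = "S P Q"
    note Sa = Sa[OF P Q(1)] and Sb = Sb[OF P Q(1)] and Sd = Sd[OF P Q(1)]
    have 1: "d r \<inter> ?X = Q" using Sd[OF r(1)] by simp
    have 2: "a j \<inter> ?X = a j \<inter> P" using Sa[OF fJ(3)] j by simp
    have 3: "b j \<inter> ?X = {}" using Sb[OF fJ(3)] j J by auto
    have nr: "normal a b ?X i" if "i \<in> C" "i \<notin> J" for i
      unfolding normal_def using that by (simp add: inf.absorb_iff1 Sa Sb)
    obtain j1 j2 j3 where j123: "J \<subseteq> {j1, j2, j3}" using card_le_3_subset[OF fJ(1) J(2)] by metis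
    have "draining C R a b d ?X"
      unfolding draining_def draining_into_def
    proof (intro bexI[of _ r] conjI)
      show "d r \<inter> ?X \<noteq> {}" "\<not> d r \<subseteq> ?X" using 1 Q by auto
      show "\<forall>r'\<in>R. r' \<noteq> r \<longrightarrow> d r' \<inter> ?X = {}" using Sd by simp
      show "\<forall>i\<in>C. b i \<inter> ?X = {} \<or> (b i \<subseteq> ?X \<and> a i \<inter> ?X = {})"
        using J by (auto simp: inf.absorb_iff1 Sa Sb)
      show "\<exists>i\<in>C. b i \<inter> ?X = {} \<and> a i \<inter> ?X \<noteq> {} \<and> \<not> a i \<subseteq> ?X"
        using 2 3 pj fJ(3) by (intro bexI[of _ j]) auto
      show "\<exists>j1 j2 j3. \<forall>i\<in>C. \<not> normal a b ?X i \<longrightarrow> i \<in> {j1, j2, j3}" using nr j123 by blast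
      have nj: "\<not> a j \<subseteq> ?X" "a j \<inter> ?X \<noteq> {}" "d r - ?X = d r - Q" using 1 2 pj by blast+
      show "(\<exists>j\<in>C. \<exists>j'\<in>C. \<exists>x\<in>a j \<inter> ?X. \<exists>x'\<in>a j' \<inter> ?X. x \<noteq> x' \<and> \<not> a j \<subseteq> ?X \<and> \<not> a j' \<subseteq> ?X) \<or>
         (\<forall>y\<in>d r - ?X. \<forall>y'\<in>d r - ?X. y = y')"
        using T unfolding nj(3) 2[symmetric] using nj(1) fJ(3) by blast
      have "a j - ?X = a j - P" using 2 by blast
      then show "(\<exists>j\<in>C. \<exists>j'\<in>C. \<exists>x\<in>a j - ?X. \<exists>x'\<in>a j' - ?X. x \<noteq> x' \<and> a j \<inter> ?X \<noteq> {} \<and> a j' \<inter> ?X \<noteq> {}) \<or>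
         (\<forall>y\<in>d r \<inter> ?X. \<forall>y'\<in>d r \<inter> ?X. y = y')"
        using M nj(2) fJ(3) unfolding 1 by metis
    qed (use r in auto)
    moreover have "?X \<subseteq> (\<Union>j\<in>C. a j) \<union> (\<Union>j\<in>C. b j) \<union> (\<Union>r\<in>R. d r)"
    proof -
      have "rest_set F \<subseteq> (\<Union>j\<in>C. a j) \<union> (\<Union>j\<in>C. b j) \<union> (\<Union>r\<in>R. d r)"
        using ok_rest_set[OF F] unfolding token_set_def by (rule conjunct1)
      moreover have "Q \<subseteq> (\<Union>r\<in>R. d r)" using Q(1) r(1) by blast
      ultimately show ?thesis unfolding S_def using P AJF by (meson Diff_subset Un_least le_supI2 subset_trans)
    qed
    ultimately show ?thesis unfolding token_set_def by blast
  qed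
  have jumpS: "jump (S P Q) (S (P - {z}) (insert q Q))" if "P \<subseteq> AJ" "Q \<subseteq> d r" "z \<in> P" "q \<in> d r - Q" for P Q z q
  proof (rule jumpI[of z _ _ q])
    have zd: "z \<notin> d r" "q \<notin> AJ" using that dJ[OF r(1)] by blast+
    have qf: "q \<notin> rest_set F" using that(4) rest_set_int(3)[OF F r(1)] by blast
    show "z \<in> S P Q" "z \<notin> S (P - {z}) (insert q Q)" "q \<in> S (P - {z}) (insert q Q)" "q \<notin> S P Q"
      unfolding S_def using that zd qf by blast+
    show "S P Q - {z} = S (P - {z}) (insert q Q) - {q}"
      unfolding S_def using that zd qf by blast
  qed
  \<comment> \<open>Any order of travel works provided all positions with the right number of tokens
    between the two ends are legal.\<close>
  have chain: "move\<^sup>*\<^sup>* (S P Q) (S P2 Q2)"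
    if "P2 \<subseteq> P" "P \<subseteq> AJ" "Q \<subseteq> Q2" "Q2 \<subseteq> d r" "card P + card Q = card P2 + card Q2"
      "\<And>P' Q'. P2 \<subseteq> P' \<Longrightarrow> P' \<subseteq> P \<Longrightarrow> Q \<subseteq> Q' \<Longrightarrow> Q' \<subseteq> Q2 \<Longrightarrow> card P' + card Q' = card P2 + card Q2 \<Longrightarrow> ok (S P' Q')" for P Q P2 Q2
    using that
  proof (induction "card (P - P2)" arbitrary: P Q)
    case 0
    have "finite P" "finite Q2" using 0(3,5) fAJ fd finite_subset by blast+
    then have "P = P2" using 0(1,2) by (auto simp: card_eq_0_iff)
    moreover from this have "Q = Q2" using 0(4,6) \<open>finite Q2\<close> by (simp add: card_subset_eq)
    ultimately show ?case by simp
  next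
    case (Suc n)
    have fP: "finite P" by (rule finite_subset[OF Suc.prems(2) fAJ])
    have fQ: "finite Q2" by (rule finite_subset[OF Suc.prems(4) fd])
    note f = fP fQ finite_subset[OF Suc.prems(1) fP] finite_subset[OF Suc.prems(3) fQ]
    have "P - P2 \<noteq> {}" using Suc.hyps(2) by (metis card.empty nat.distinct(1))
    then obtain z where z: "z \<in> P - P2" by blast
    have "card P2 < card P" using z Suc.prems(1) f by (intro psubset_card_mono) auto
    then have "card Q < card Q2" using Suc.prems(5) by simp
    then have "\<not> Q2 \<subseteq> Q" using card_mono[OF f(4), of Q2] by auto
    then obtain q where q: "q \<in> Q2 - Q" by blast
    let ?P = "P - {z}" and ?Q = "insert q Q"
    have c: "card ?P + card ?Q = card P + card Q" using z q f card_gt_0_iff[of P] by (auto simp: card_Diff_singleton)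
    have "move\<^sup>*\<^sup>* (S ?P ?Q) (S P2 Q2)"
    proof (rule Suc.hyps(1))
      have "P - {z} - P2 = (P - P2) - {z}" by blast
      then show "n = card (?P - P2)" using Suc.hyps(2) z f by simp
      fix P' Q' assume "P2 \<subseteq> P'" "P' \<subseteq> ?P" "?Q \<subseteq> Q'" "Q' \<subseteq> Q2" "card P' + card Q' = card P2 + card Q2"
      then show "ok (S P' Q')" by (intro Suc.prems(6)) auto
    qed (use Suc.prems(1-5) z q c in auto)
    moreover have "ok (S P Q)" by (rule Suc.prems(6)) (use Suc.prems(1-5) in auto)
    moreover have "ok (S ?P ?Q)" by (rule Suc.prems(6)) (use Suc.prems(1-5) z q c in auto)
    moreover have "jump (S P Q) (S ?P ?Q)" by (rule jumpS) (use Suc.prems(1-5) z q in auto)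
    ultimately have "move (S P Q) (S ?P ?Q)" "move\<^sup>*\<^sup>* (S ?P ?Q) (S P2 Q2)" by (simp_all add: move_def[of "S P Q"])
    then show ?case by (rule converse_rtranclp_into_rtranclp)
  qed
  have pick: "\<exists>s1 s2 s3. s1 \<in> Z \<and> s2 \<in> Z \<and> s3 \<in> Z \<and> s \<notin> {s1, s2, s3} \<and> s1 \<noteq> s2 \<and> s1 \<noteq> s3 \<and> s2 \<noteq> s3"
    if Z: "finite Z" "4 \<le> card Z" "s \<in> Z" for Z :: "'v set" and s
  proof -
    have "3 \<le> card (Z - {s})" using Z by simp
    then obtain T where T: "T \<subseteq> Z - {s}" "card T = 3" by (rule obtain_subset_with_card_n) (rule that)
    then obtain s1 s2 s3 where "T = {s1, s2, s3}" "s1 \<noteq> s2" "s1 \<noteq> s3" "s2 \<noteq> s3"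
      unfolding card_3_iff by (elim exE conjE) (rule that)
    then show ?thesis using T(1) by (intro exI[of _ s1] exI[of _ s2] exI[of _ s3]) auto
  qed
  \<comment> \<open>The four vertices of one single group \<open>a j\<close> serve as witnesses in
    the counting clauses, whichever other cells take part.\<close>
  obtain x1 x2 x4 where xs: "x1 \<in> a j" "x2 \<in> a j" "x4 \<in> a j" "x3 \<notin> {x1, x2, x4}" "x1 \<noteq> x2" "x1 \<noteq> x4" "x2 \<noteq> x4"
    using pick[OF fin(1)[OF fJ(3)] card_ab(2)[OF fJ(3)] x] by (elim exE conjE) (rule that)
  have ajAJ: "a j \<subseteq> AJ" unfolding AJ_def using j by blast
  have "4 \<le> card (d r)" unfolding cAJ[symmetric] using card_mono[OF fAJ ajAJ] card_ab(2)[OF fJ(3)] by simp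
  note pick_y = pick[OF fd this y]
  obtain y1 y2 y3 where ys: "y1 \<in> d r" "y2 \<in> d r" "y3 \<in> d r" "d0 \<notin> {y1, y2, y3}" "y1 \<noteq> y2" "y1 \<noteq> y3" "y2 \<noteq> y3"
    using pick_y by (elim exE conjE) (rule that)
  have S0: "S AJ {} = rest_set F" unfolding S_def using AJF by blast
  have xA: "x1 \<in> AJ" "x2 \<in> AJ" "x3 \<in> AJ" "x4 \<in> AJ" using xs(1-3) x ajAJ by auto
  have x31: "x3 \<noteq> x1" "x3 \<noteq> x2" "x3 \<noteq> x4" "d0 \<noteq> y1" "d0 \<noteq> y2" "d0 \<noteq> y3" using xs(4) ys(4) by auto
  have ok1: "ok (S (AJ - {x1}) {y1})"
  proof (rule okS)
    show "{y1} \<noteq> d r" using ys(2,5) by auto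
    have m: "x3 \<in> a j \<inter> (AJ - {x1})" "x4 \<in> a j \<inter> (AJ - {x1})" using x xs(3,6) xA x31 by auto
    show "a j \<inter> (AJ - {x1}) \<noteq> {}" using m(1) by blast
    show "(\<exists>z\<in>a j \<inter> (AJ - {x1}). \<exists>z'\<in>a j \<inter> (AJ - {x1}). z \<noteq> z') \<or> (\<forall>y\<in>d r - {y1}. \<forall>y'\<in>d r - {y1}. y = y')"
      by (rule two_elements[OF m x31(3)])
  qed (use xs(1) ys(1) in auto)
  have ok2: "ok (S (AJ - {x1} - {x2}) {y2, y1})"
  proof (rule okS)
    show "{y2, y1} \<noteq> d r" using ys(3,6,7) by auto
    have m: "x3 \<in> a j \<inter> (AJ - {x1} - {x2})" "x4 \<in> a j \<inter> (AJ - {x1} - {x2})" using x xs(3,6,7) xA x31 by auto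
    show "a j \<inter> (AJ - {x1} - {x2}) \<noteq> {}" using m(1) by blast
    show "(\<exists>z\<in>a j \<inter> (AJ - {x1} - {x2}). \<exists>z'\<in>a j \<inter> (AJ - {x1} - {x2}). z \<noteq> z') \<or> (\<forall>y\<in>d r - {y2, y1}. \<forall>y'\<in>d r - {y2, y1}. y = y')"
      by (rule two_elements[OF m x31(3)])
    have n: "x1 \<in> a j - (AJ - {x1} - {x2})" "x2 \<in> a j - (AJ - {x1} - {x2})" using xs(1,2) by auto
    show "(\<exists>z\<in>a j - (AJ - {x1} - {x2}). \<exists>z'\<in>a j - (AJ - {x1} - {x2}). z \<noteq> z') \<or> (\<forall>y\<in>{y2, y1}. \<forall>y'\<in>{y2, y1}. y = y')"
      by (rule two_elements[OF n xs(5)])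
  qed (use xs(1) ys(1,2) in auto)
  have m1: "move (rest_set F) (S (AJ - {x1}) {y1})"
    unfolding move_def using ok1 ok_rest_set[OF F] jumpS[of AJ "{}" x1 y1] xs(1) ys(1) ajAJ S0 by auto
  have m2: "move (S (AJ - {x1}) {y1}) (S (AJ - {x1} - {x2}) {y2, y1})"
    unfolding move_def using ok1 ok2 jumpS[of "AJ - {x1}" "{y1}" x2 y2] xs ys ajAJ by auto
  have cA: "card (AJ - {x1} - {x2}) = card AJ - 2" "2 \<le> card AJ"
    using xs(5) xA(1,2) fAJ card_mono[of AJ "{x1, x2}"] by (simp_all add: card_Diff_singleton)
  have cd: "card (d r - {d0, y3}) = card (d r) - 2" "2 \<le> card (d r)"
    using ys(3) x31(6) y fd cA(2) cAJ by (simp_all add: card_Diff_subset)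
  have m3: "move\<^sup>*\<^sup>* (S (AJ - {x1} - {x2}) {y2, y1}) (S {x3, x4} (d r - {d0, y3}))"
  proof (rule chain)
    show "{x3, x4} \<subseteq> AJ - {x1} - {x2}" using x xs ajAJ by auto
    show "{y2, y1} \<subseteq> d r - {d0, y3}" using ys by auto
    show "card (AJ - {x1} - {x2}) + card {y2, y1} = card {x3, x4} + card (d r - {d0, y3})"
      using cA cd cAJ xs ys by simp
    fix P' Q' assume *: "{x3, x4} \<subseteq> P'" "P' \<subseteq> AJ - {x1} - {x2}" "{y2, y1} \<subseteq> Q'" "Q' \<subseteq> d r - {d0, y3}"
    have m: "x3 \<in> a j \<inter> P'" "x4 \<in> a j \<inter> P'" "x1 \<in> a j - P'" "x2 \<in> a j - P'"
      using *(1,2) x xs(1-3) by auto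
    show "ok (S P' Q')"
    proof (rule okS)
      show "P' \<subseteq> AJ" "Q' \<subseteq> d r" "Q' \<noteq> {}" "Q' \<noteq> d r" using *(2-4) y by auto
      show "a j \<inter> P' \<noteq> {}" "\<not> a j \<subseteq> P'" using m(1,3) by blast+
    qed (rule two_elements[OF m(1,2) x31(3)] two_elements[OF m(3,4) xs(5)])+
  qed auto
  have ok4: "ok (S {x3} (d r - {d0}))"
  proof (rule okS)
    show "{x3} \<subseteq> AJ" using xA by simp
    show "d r - {d0} \<noteq> {}" using ys(1) x31(4) by blast
    show "a j \<inter> {x3} \<noteq> {}" using x by blast
    show "\<not> a j \<subseteq> {x3}" using xs(1) x31(1) by blast
    have n: "x1 \<in> a j - {x3}" "x2 \<in> a j - {x3}" using xs(1,2) x31 by auto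
    show "(\<exists>z\<in>a j - {x3}. \<exists>z'\<in>a j - {x3}. z \<noteq> z') \<or> (\<forall>y\<in>d r - {d0}. \<forall>y'\<in>d r - {d0}. y = y')"
      by (rule two_elements[OF n xs(5)])
  qed (use y in auto)
  have ok3: "ok (S {x3, x4} (d r - {d0, y3}))"
  proof -
    have m: "x3 \<in> a j \<inter> {x3, x4}" "x4 \<in> a j \<inter> {x3, x4}" "x1 \<in> a j - {x3, x4}" "x2 \<in> a j - {x3, x4}"
      using x xs(1-3,6,7) x31 by auto
    show ?thesis
    proof (rule okS)
      show "{x3, x4} \<subseteq> AJ" using xA by simp
      show "d r - {d0, y3} \<noteq> {}" using ys(1,6) x31(4) by blast
      show "d r - {d0, y3} \<subseteq> d r" "d r - {d0, y3} \<noteq> d r" using y by auto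
      show "a j \<inter> {x3, x4} \<noteq> {}" "\<not> a j \<subseteq> {x3, x4}" using m(1,3) by blast+
    qed (rule two_elements[OF m(1,2) x31(3)] two_elements[OF m(3,4) xs(5)])+
  qed
  have "{x3, x4} - {x4} = {x3}" "insert y3 (d r - {d0, y3}) = d r - {d0}" using xs(4) ys(3,4) by auto
  then have m4: "move (S {x3, x4} (d r - {d0, y3})) (S {x3} (d r - {d0}))"
    unfolding move_def using ok3 ok4 jumpS[of "{x3, x4}" "d r - {d0, y3}" x4 y3] x xs ys ajAJ by auto
  have "move\<^sup>*\<^sup>* (rest_set F) (S {x3} (d r - {d0}))"
    using m1 m2 m3 m4 by (meson converse_rtranclp_into_rtranclp rtranclp.rtrancl_into_rtrancl)
  then show ?thesis unfolding S_def AJ_def .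
qed

lemma move_reach_sym: "move\<^sup>*\<^sup>* X Y \<Longrightarrow> move\<^sup>*\<^sup>* Y X"
  by (induction rule: rtranclp_induct) (auto intro: converse_rtranclp_into_rtranclp move_sym)

lemma move_reach_ok: "move\<^sup>*\<^sup>* X Y \<Longrightarrow> ok X \<Longrightarrow> ok Y"
  by (induction rule: rtranclp_induct) (auto simp: move_def)

text \<open>Both halves are instances of \<open>drain\<close>: one from \<open>F\<close> with the
  groups \<open>a\<close>, one from the complement of \<open>F - J\<close> with the groups swapped.
  Both end with \<open>d r\<close> filled up to the same \<open>y\<close>, one with a token on
  \<open>x\<close> and the other on \<open>x'\<close>; the jump from \<open>x\<close> to
  \<open>x'\<close> joins them, and the second half is run backwards.\<close>

lemma toggle_complete:
  assumes F: "F \<subseteq> C" and J: "J \<subseteq> F" "J \<noteq> {}" "card J \<le> 3" and r: "r \<in> R" "(\<Sum>j\<in>J. wt j) = card (d r)"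
  shows "move\<^sup>*\<^sup>* (rest_set F) (rest_set (F - J))"
proof -
  interpret sw: toggle_system C R b a d by (rule swapped)
  have mv: "sw.move = move" by (intro ext) (simp add: sw.move_def move_def ok_swap)
  obtain j where j: "j \<in> J" using J by blast
  have jC: "j \<in> C" using j J F by blast
  obtain x where x: "x \<in> a j" using card_ab(2)[OF jC] by (metis card.empty ex_in_conv not_numeral_le_zero)
  obtain x' where x': "x' \<in> b j" using card_ab[OF jC] by (metis card.empty ex_in_conv not_numeral_le_zero)
  have "wt j \<le> (\<Sum>j\<in>J. wt j)" using j finite_subset[OF subset_trans[OF J(1) F] finite_C] by (intro member_le_sum) auto
  then have "card (d r) \<noteq> 0" using r card_ab(2)[OF jC] unfolding wt_def by simp
  then obtain y where y: "y \<in> d r" by fastforce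
  let ?U = "(rest_set F - (\<Union>j\<in>J. a j)) \<union> {x} \<union> (d r - {y})"
  let ?G = "C - (F - J)"
  let ?V = "(sw.rest_set ?G - (\<Union>j\<in>J. b j)) \<union> {x'} \<union> (d r - {y})"
  have 1: "move\<^sup>*\<^sup>* (rest_set F) ?U" by (rule drain[OF F J(1,3) r j x y])
  have s: "(\<Sum>j\<in>J. sw.wt j) = card (d r)"
    using r(2) card_ab(1) J(1) F unfolding wt_def sw.wt_def by (metis (no_types, lifting) subset_trans sum.cong subsetD)
  have 2: "move\<^sup>*\<^sup>* (sw.rest_set ?G) ?V"
    unfolding mv[symmetric] by (rule sw.drain[OF _ _ J(3) r(1) s j x' y]) (use J F in auto)
  have G: "sw.rest_set ?G = rest_set (F - J)"
    unfolding sw.rest_set_def rest_set_def using F by auto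
  have dJ: "a i \<inter> (\<Union>j\<in>J. b j) = {}" "b i \<inter> (\<Union>j\<in>J. a j) = {}" if "i \<in> C" for i
    using disj(3) that J(1) F by blast+
  have aa: "(\<Union>i\<in>F. a i) - (\<Union>j\<in>J. a j) = (\<Union>i\<in>F - J. a i)" using disj(1) J(1) F by blast
  have bb: "(\<Union>i\<in>C - (F - J). b i) - (\<Union>j\<in>J. b j) = (\<Union>i\<in>C - F. b i)" using disj(2) J(1) F by blast
  have "rest_set F - (\<Union>j\<in>J. a j) = (\<Union>i\<in>F - J. a i) \<union> (\<Union>i\<in>C - F. b i)"
    unfolding rest_set_def Un_Diff aa using dJ(2) by blast
  moreover have "rest_set (F - J) - (\<Union>j\<in>J. b j) = (\<Union>i\<in>F - J. a i) \<union> (\<Union>i\<in>C - F. b i)"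
    unfolding rest_set_def Un_Diff bb using dJ(1) F by blast
  ultimately have UV: "?U = ((\<Union>i\<in>F - J. a i) \<union> (\<Union>i\<in>C - F. b i) \<union> (d r - {y})) \<union> {x}"
    "?V = ((\<Union>i\<in>F - J. a i) \<union> (\<Union>i\<in>C - F. b i) \<union> (d r - {y})) \<union> {x'}" unfolding G by auto
  let ?W = "(\<Union>i\<in>F - J. a i) \<union> (\<Union>i\<in>C - F. b i) \<union> (d r - {y})"
  have xW: "x \<notin> ?W" using x disj(1,3,5) jC j F r(1) by blast
  have x'W: "x' \<notin> ?W" using x' disj(2,3,6) jC j J F r(1) by blast
  have "x \<noteq> x'" using x x' disj(3)[OF jC jC] by blast
  then have "jump ?U ?V" unfolding UV using xW x'W by (intro jumpI[of x _ _ x']) auto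
  moreover have "ok ?U" by (rule move_reach_ok[OF 1 ok_rest_set[OF F]])
  moreover have "ok ?V" using move_reach_ok[OF 2] ok_rest_set[of "F - J"] F unfolding G by blast
  ultimately have "move ?U ?V" unfolding move_def by blast
  then show ?thesis
    using 1 move_reach_sym[OF 2] unfolding G by (meson rtranclp.rtrancl_into_rtrancl rtranclp_trans)
qed

end

section \<open>Ranks that certify forests of depth 3\<close>

lemma adj_sym: "adj G x y = adj G y x"
  by (simp add: adj_def insert_commute)

lemma adj_verts: "simple_graph G \<Longrightarrow> adj G x y \<Longrightarrow> x \<in> verts G \<and> y \<in> verts G \<and> x \<noteq> y"
  unfolding simple_graph_def adj_def by fastforce

text \<open>A vertex of highest rank on a cycle would have two lower neighbours there. Descending
  from a vertex at most twice reaches one without lower neighbour, and this vertex is a suitable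
  root: ranks increase strictly along every path that starts in it.\<close>

lemma forest_of_depth_3_by_rank:
  fixes rk :: "'a \<Rightarrow> nat"
  assumes G: "simple_graph G" and le2: "\<And>x. rk x \<le> 2"
    and ne: "\<And>x y. adj G x y \<Longrightarrow> rk x \<noteq> rk y"
    and parent: "\<And>x y z. adj G x y \<Longrightarrow> adj G x z \<Longrightarrow> rk y < rk x \<Longrightarrow> rk z < rk x \<Longrightarrow> y = z"
  shows "forest_of_depth 3 G"
proof -
  have nocyc: "\<not> is_cycle G p" for p
  proof
    assume p: "is_cycle G p"
    define n where "n = length p"
    have n: "3 \<le> n" "distinct p" "adj G (last p) (hd p)" "successively (adj G) p" "p \<noteq> []"
      using p unfolding is_cycle_def is_path_def n_def by auto
    have cyc: "adj G (p ! i) (p ! (Suc i mod n))" if "i < n" for i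
    proof (cases "Suc i = n")
      case True
      then have "i = length p - 1" by (simp add: n_def)
      then have "p ! i = last p" "p ! (Suc i mod n) = hd p"
        using n(5) True by (auto simp: last_conv_nth hd_conv_nth n_def)
      then show ?thesis using n(3) by simp
    next
      case False
      then show ?thesis using that n(4) by (simp add: successively_conv_nth n_def)
    qed
    obtain i where i: "i < n" "\<And>k. k < n \<Longrightarrow> rk (p ! k) \<le> rk (p ! i)"
    proof -
      let ?S = "(\<lambda>k. rk (p ! k)) ` {..<n}"
      have "Max ?S \<in> ?S" using n(1) by (intro Max_in) (auto simp: lessThan_empty_iff)
      then obtain i where "i < n" "Max ?S = rk (p ! i)" by auto
      moreover have "rk (p ! k) \<le> Max ?S" if "k < n" for k using that by (intro Max_ge) auto
      ultimately show ?thesis using that by metis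
    qed
    define j where "j = (if i = 0 then n - 1 else i - 1)"
    have j: "j < n" "Suc j mod n = i" using i(1) n(1) unfolding j_def by auto
    have k: "Suc i mod n < n" using n(1) by simp
    have "j \<noteq> Suc i mod n" using i(1) n(1) unfolding j_def by (auto simp: mod_Suc)
    then have "p ! j \<noteq> p ! (Suc i mod n)" using n(2) j(1) k by (simp add: nth_eq_iff_index_eq n_def)
    moreover have "adj G (p ! i) (p ! j)" using cyc[OF j(1)] j(2) adj_sym[of G] by simp
    moreover have "rk (p ! j) < rk (p ! i)" "rk (p ! (Suc i mod n)) < rk (p ! i)"
      using i(2)[OF j(1)] i(2)[OF k] ne[OF calculation(2)] ne[OF cyc[OF i(1)]] by auto
    ultimately show False using parent cyc[OF i(1)] by blast
  qed
  have root: "\<exists>r\<in>component G v. \<forall>y. adj G r y \<longrightarrow> \<not> rk y < rk r" if "v \<in> verts G" for v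
  proof -
    have "is_path G [v]" using that by (simp add: is_path_def)
    then have v: "v \<in> component G v" unfolding component_def by force
    show ?thesis
    proof (cases "\<exists>y. adj G v y \<and> rk y < rk v")
      case True
      then obtain y where y: "adj G v y" "rk y < rk v" by blast
      have yv: "y \<in> verts G" "y \<noteq> v" using adj_verts[OF G y(1)] by auto
      have "is_path G [v, y]" using that y yv by (auto simp: is_path_def)
      then have y': "y \<in> component G v" unfolding component_def by force
      show ?thesis
      proof (cases "\<exists>z. adj G y z \<and> rk z < rk y")
        case True
        then obtain z where z: "adj G y z" "rk z < rk y" by blast
        have zv: "z \<in> verts G" "z \<noteq> y" "z \<noteq> v" using adj_verts[OF G z(1)] y(2) z(2) by auto
        have "is_path G [v, y, z]" using that y yv z zv by (auto simp: is_path_def)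
        then have "z \<in> component G v" unfolding component_def by force
        moreover have "rk z = 0" using z(2) y(2) le2[of v] by simp
        ultimately show ?thesis by (intro bexI[of _ z]) auto
      qed (use y' in blast)
    qed (use v in blast)
  qed
  have len: "length p \<le> 3"
    if r: "\<forall>y. adj G r y \<longrightarrow> \<not> rk y < rk r" and path: "is_path G p" "hd p = r" for r p
  proof -
    have n: "distinct p" "successively (adj G) p" "p \<noteq> []" using path unfolding is_path_def by auto
    have ad: "adj G (p ! i) (p ! Suc i)" if "Suc i < length p" for i
      using n(2) that by (simp add: successively_conv_nth)
    \<comment> \<open>A step down after a step up would return to the unique lower neighbour, which
      is the previous vertex of the path.\<close>
    have up: "rk (p ! i) < rk (p ! Suc i)" if "Suc i < length p" for i
      using that
    proof (induction i)
      case 0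
      then show ?case using ad[of 0] r path(2) ne[OF ad[of 0]] n(3) by (auto simp: hd_conv_nth)
    next
      case (Suc i)
      show ?case
      proof (rule ccontr)
        assume "\<not> ?thesis"
        then have "rk (p ! Suc (Suc i)) < rk (p ! Suc i)" using ne[OF ad[of "Suc i"]] Suc.prems by auto
        moreover have "rk (p ! i) < rk (p ! Suc i)" using Suc by simp
        moreover have "adj G (p ! Suc i) (p ! i)" using ad[of i] Suc.prems adj_sym[of G] by simp
        ultimately have "p ! i = p ! Suc (Suc i)" using parent ad[of "Suc i"] Suc.prems by blast
        then show False using n(1) Suc.prems by (simp add: nth_eq_iff_index_eq)
      qed
    qed
    have "i \<le> rk (p ! i)" if "i < length p" for i
      using that by (induction i) (use up in \<open>auto simp: Suc_le_eq intro: le_less_trans\<close>)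
    from this[of "length p - 1"] show ?thesis using le2[of "p ! (length p - 1)"] n(3) by (cases p) auto
  qed
  show ?thesis
    unfolding forest_of_depth_def forest_def root_leaf_path_def using G nocyc root len by blast
qed

text \<open>In a forest this says that \<open>x\<close> is the middle of a path on five vertices. In
  trees of depth 3 that branch at the root into two or more such arms, only the root qualifies if
  its children have at most one child each; this is how roots are found without colors.\<close>

definition rootv :: "'a graph \<Rightarrow> 'a \<Rightarrow> bool" where
  "rootv G x \<longleftrightarrow> (\<exists>y\<in>verts G. \<exists>z\<in>verts G. \<exists>y'\<in>verts G. \<exists>z'\<in>verts G.
     y \<noteq> y' \<and> adj G x y \<and> adj G x y' \<and> adj G y z \<and> z \<noteq> x \<and> adj G y' z' \<and> z' \<noteq> x)"

definition midv :: "'a graph \<Rightarrow> 'a \<Rightarrow> bool" where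
  "midv G x \<longleftrightarrow> \<not> rootv G x \<and> (\<exists>r\<in>verts G. adj G x r \<and> rootv G r)"

definition rank :: "'a graph \<Rightarrow> 'a \<Rightarrow> nat" where
  "rank G x = (if rootv G x then 0 else if midv G x then 1 else 2)"

text \<open>A first-order condition that is sufficient, though not necessary, for a forest of depth
  3: a single isolated edge has two vertices of rank 2 and fails it. Being part of
  \<open>phi\<close>, it confines satisfying instances to the required class.\<close>

definition ranked :: "'a graph \<Rightarrow> bool" where
  "ranked G \<longleftrightarrow> (\<forall>x\<in>verts G. \<forall>y\<in>verts G. adj G x y \<longrightarrow> rank G x \<noteq> rank G y) \<and>
     (\<forall>x\<in>verts G. \<forall>y\<in>verts G. \<forall>z\<in>verts G.
        adj G x y \<and> adj G x z \<and> rank G y < rank G x \<and> rank G z < rank G x \<longrightarrow> y = z)"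

lemma ranked_forest: "simple_graph G \<Longrightarrow> ranked G \<Longrightarrow> forest_of_depth 3 G"
proof (rule forest_of_depth_3_by_rank[of G "rank G"])
  assume G: "simple_graph G" "ranked G"
  show "rank G x \<le> 2" for x by (simp add: rank_def)
  show "rank G x \<noteq> rank G y" if "adj G x y" for x y
    using G(2) adj_verts[OF G(1) that] that unfolding ranked_def by blast
  show "y = z" if "adj G x y" "adj G x z" "rank G y < rank G x" "rank G z < rank G x" for x y z
    using G(2) adj_verts[OF G(1) that(1)] adj_verts[OF G(1) that(2)] that unfolding ranked_def by blast
qed

section \<open>The first-order formula\<close>

definition aset :: "'a graph \<Rightarrow> 'a \<Rightarrow> 'a set" where
  "aset G r = {x \<in> verts G. rootv G r \<and> adj G x r \<and> (\<forall>y\<in>verts G. adj G x y \<longrightarrow> y = r)}"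

definition pset :: "'a graph \<Rightarrow> 'a \<Rightarrow> 'a set" where
  "pset G r = {x \<in> verts G. rootv G r \<and> x \<noteq> r \<and> (\<exists>b\<in>verts G. adj G x b \<and> adj G b r)}"

text \<open>Cells and rules differ only in whether the root has leaf neighbours. The group at
  distance two plays the part of \<open>b\<close> in a cell and of \<open>d\<close> in a
  rule.\<close>

definition cells :: "'a graph \<Rightarrow> 'a set" where
  "cells G = {r \<in> verts G. aset G r \<noteq> {}}"

definition rules :: "'a graph \<Rightarrow> 'a set" where
  "rules G = {r \<in> verts G. rootv G r \<and> aset G r = {}}"

definition mOr :: "mso1 \<Rightarrow> mso1 \<Rightarrow> mso1" where "mOr \<phi> \<psi> = Neg (Conj (Neg \<phi>) (Neg \<psi>))"
definition mImp :: "mso1 \<Rightarrow> mso1 \<Rightarrow> mso1" where "mImp \<phi> \<psi> = Neg (Conj \<phi> (Neg \<psi>))"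
definition mAll :: "nat \<Rightarrow> mso1 \<Rightarrow> mso1" where "mAll x \<phi> = Neg (ExV x (Neg \<phi>))"

lemma sat_mOr [simp]: "sat G \<nu> \<sigma> (mOr \<phi> \<psi>) \<longleftrightarrow> sat G \<nu> \<sigma> \<phi> \<or> sat G \<nu> \<sigma> \<psi>" by (simp add: mOr_def)
lemma sat_mImp [simp]: "sat G \<nu> \<sigma> (mImp \<phi> \<psi>) \<longleftrightarrow> (sat G \<nu> \<sigma> \<phi> \<longrightarrow> sat G \<nu> \<sigma> \<psi>)" by (simp add: mImp_def)
lemma sat_mAll [simp]: "sat G \<nu> \<sigma> (mAll x \<phi>) \<longleftrightarrow> (\<forall>v\<in>verts G. sat G (\<nu>(x := v)) \<sigma> \<phi>)" by (simp add: mAll_def)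

text \<open>In the following formulas \<open>b\<close> is the first variable that may be bound; set variable 0 is \<open>X\<close>.\<close>

definition fRoot :: "nat \<Rightarrow> nat \<Rightarrow> mso1" where
  "fRoot x b = ExV b (ExV (b + 1) (ExV (b + 2) (ExV (b + 3)
     (Conj (Neg (Eq b (b + 2))) (Conj (Edge x b) (Conj (Edge x (b + 2)) (Conj (Edge b (b + 1))
       (Conj (Neg (Eq (b + 1) x)) (Conj (Edge (b + 2) (b + 3)) (Neg (Eq (b + 3) x)))))))))))"

lemma sat_fRoot: "x < b \<Longrightarrow> sat G \<nu> \<sigma> (fRoot x b) \<longleftrightarrow> rootv G (\<nu> x)"
  by (simp add: fRoot_def rootv_def)

definition fMid :: "nat \<Rightarrow> nat \<Rightarrow> mso1" where
  "fMid x b = Conj (Neg (fRoot x b)) (ExV b (Conj (Edge x b) (fRoot b (b + 1))))"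

lemma sat_fMid: "x < b \<Longrightarrow> sat G \<nu> \<sigma> (fMid x b) \<longleftrightarrow> midv G (\<nu> x)"
  by (simp add: fMid_def midv_def sat_fRoot)

definition fA :: "nat \<Rightarrow> nat \<Rightarrow> nat \<Rightarrow> mso1" where
  "fA r x b = Conj (fRoot r b) (Conj (Edge x r) (mAll b (mImp (Edge x b) (Eq b r))))"

definition fP :: "nat \<Rightarrow> nat \<Rightarrow> nat \<Rightarrow> mso1" where
  "fP r x b = Conj (fRoot r b) (Conj (Neg (Eq x r)) (ExV b (Conj (Edge x b) (Edge b r))))"

text \<open>Abstracting over the formula for a group of leaves allows the draining condition to be
  written once and instantiated in both directions.\<close>

definition leaf_formula :: "'a graph \<Rightarrow> (nat \<Rightarrow> nat \<Rightarrow> nat \<Rightarrow> mso1) \<Rightarrow> ('a \<Rightarrow> 'a set) \<Rightarrow> bool" where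
  "leaf_formula G Q q \<longleftrightarrow> (\<forall>\<nu> \<sigma> r x b. r < b \<longrightarrow> x < b \<longrightarrow> \<nu> x \<in> verts G \<longrightarrow> sat G \<nu> \<sigma> (Q r x b) = (\<nu> x \<in> q (\<nu> r))) \<and>
     (\<forall>r. q r \<subseteq> verts G)"

lemma leaf_formulas: "leaf_formula G fA (aset G)" "leaf_formula G fP (pset G)"
  by (auto simp: leaf_formula_def fA_def fP_def aset_def pset_def sat_fRoot)

lemma leaf_formulaD:
  "leaf_formula G Q q \<Longrightarrow> r < b \<Longrightarrow> x < b \<Longrightarrow> \<nu> x \<in> verts G \<Longrightarrow> sat G \<nu> \<sigma> (Q r x b) = (\<nu> x \<in> q (\<nu> r))"
  unfolding leaf_formula_def by blast

lemma leaf_formula_verts: "leaf_formula G Q q \<Longrightarrow> q r \<subseteq> verts G"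
  unfolding leaf_formula_def by blast

definition fCell :: "nat \<Rightarrow> nat \<Rightarrow> mso1" where
  "fCell r b = ExV b (fA r b (b + 1))"

definition fRule :: "nat \<Rightarrow> nat \<Rightarrow> mso1" where
  "fRule r b = Conj (fRoot r b) (Neg (fCell r b))"

lemma sat_fCell: "r < b \<Longrightarrow> \<nu> r \<in> verts G \<Longrightarrow> sat G \<nu> \<sigma> (fCell r b) \<longleftrightarrow> \<nu> r \<in> cells G"
  using leaf_formula_verts[OF leaf_formulas(1)[of G], of "\<nu> r"]
  by (simp add: fCell_def cells_def leaf_formulaD[OF leaf_formulas(1)]) blast

lemma sat_fRule: "r < b \<Longrightarrow> \<nu> r \<in> verts G \<Longrightarrow> sat G \<nu> \<sigma> (fRule r b) \<longleftrightarrow> \<nu> r \<in> rules G"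
  by (auto simp: fRule_def rules_def cells_def sat_fCell sat_fRoot)

definition fEmp :: "(nat \<Rightarrow> nat \<Rightarrow> nat \<Rightarrow> mso1) \<Rightarrow> nat \<Rightarrow> nat \<Rightarrow> mso1" where
  "fEmp Q r b = Neg (ExV b (Conj (Mem 0 b) (Q r b (b + 1))))"

definition fFul :: "(nat \<Rightarrow> nat \<Rightarrow> nat \<Rightarrow> mso1) \<Rightarrow> nat \<Rightarrow> nat \<Rightarrow> mso1" where
  "fFul Q r b = mAll b (mImp (Q r b (b + 1)) (Mem 0 b))"

lemma sat_fEmp: "leaf_formula G Q q \<Longrightarrow> r < b \<Longrightarrow> sat G \<nu> \<sigma> (fEmp Q r b) \<longleftrightarrow> q (\<nu> r) \<inter> \<sigma> 0 = {}"
  using leaf_formula_verts[of G Q q "\<nu> r"] by (simp add: fEmp_def leaf_formulaD) blast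

lemma sat_fFul: "leaf_formula G Q q \<Longrightarrow> r < b \<Longrightarrow> sat G \<nu> \<sigma> (fFul Q r b) \<longleftrightarrow> q (\<nu> r) \<subseteq> \<sigma> 0"
  using leaf_formula_verts[of G Q q "\<nu> r"] by (simp add: fFul_def leaf_formulaD) blast

definition fNorm :: "(nat \<Rightarrow> nat \<Rightarrow> nat \<Rightarrow> mso1) \<Rightarrow> (nat \<Rightarrow> nat \<Rightarrow> nat \<Rightarrow> mso1) \<Rightarrow> nat \<Rightarrow> nat \<Rightarrow> mso1" where
  "fNorm Q Q' r b = mOr (Conj (fFul Q r b) (fEmp Q' r b)) (Conj (fEmp Q r b) (fFul Q' r b))"

lemma sat_fNorm:
  "leaf_formula G Q q \<Longrightarrow> leaf_formula G Q' q' \<Longrightarrow> r < b \<Longrightarrow>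
    sat G \<nu> \<sigma> (fNorm Q Q' r b) \<longleftrightarrow> normal q q' (\<sigma> 0) (\<nu> r)"
  by (simp add: fNorm_def normal_def sat_fEmp sat_fFul)

definition fResting :: mso1 where
  "fResting = Conj (mAll 0 (mImp (fCell 0 1) (fNorm fA fP 0 1))) (mAll 0 (mImp (fRule 0 1) (fEmp fP 0 1)))"

lemma cells_rules_verts: "cells G \<subseteq> verts G" "rules G \<subseteq> verts G"
  by (auto simp: cells_def rules_def)

lemma sat_fResting:
  "sat G \<nu> \<sigma> fResting \<longleftrightarrow> resting (cells G) (rules G) (aset G) (pset G) (pset G) (\<sigma> 0)"
proof -
  note lf = leaf_formulas[of G]
  show ?thesis
    unfolding resting_def using cells_rules_verts[of G]
    by (auto simp: fResting_def sat_fCell sat_fRule sat_fNorm[OF lf] sat_fEmp[OF lf(2)])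
qed

definition fDraining :: "(nat \<Rightarrow> nat \<Rightarrow> nat \<Rightarrow> mso1) \<Rightarrow> (nat \<Rightarrow> nat \<Rightarrow> nat \<Rightarrow> mso1) \<Rightarrow> mso1" where
  "fDraining Q Q' = ExV 0 (Conj (fRule 0 1) (
     Conj (Neg (fEmp fP 0 1)) (
     Conj (Neg (fFul fP 0 1)) (
     Conj (mAll 1 (mImp (Conj (fRule 1 2) (Neg (Eq 1 0))) (fEmp fP 1 2))) (
     Conj (mAll 1 (mImp (fCell 1 2) (mOr (fEmp Q' 1 2) (Conj (fFul Q' 1 2) (fEmp Q 1 2))))) (
     Conj (ExV 1 (Conj (fCell 1 2) (Conj (fEmp Q' 1 2) (Conj (Neg (fEmp Q 1 2)) (Neg (fFul Q 1 2)))))) (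
     Conj (ExV 1 (ExV 2 (ExV 3 (mAll 4 (mImp (Conj (fCell 4 5) (Neg (fNorm Q Q' 4 5)))
             (mOr (Eq 4 1) (mOr (Eq 4 2) (Eq 4 3)))))))) (
     Conj (mOr
       (ExV 1 (ExV 2 (ExV 3 (ExV 4 (Conj (fCell 1 5) (Conj (fCell 2 5) (Conj (Q 1 3 5) (Conj (Mem 0 3)
          (Conj (Q 2 4 5) (Conj (Mem 0 4) (Conj (Neg (Eq 3 4)) (Conj (Neg (fFul Q 1 5)) (Neg (fFul Q 2 5))))))))))))))
       (mAll 1 (mAll 2 (mImp (Conj (fP 0 1 3) (Conj (Neg (Mem 0 1)) (Conj (fP 0 2 3) (Neg (Mem 0 2))))) (Eq 1 2))))) (
     mOr
       (ExV 1 (ExV 2 (ExV 3 (ExV 4 (Conj (fCell 1 5) (Conj (fCell 2 5) (Conj (Q 1 3 5) (Conj (Neg (Mem 0 3))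
          (Conj (Q 2 4 5) (Conj (Neg (Mem 0 4)) (Conj (Neg (Eq 3 4)) (Conj (Neg (fEmp Q 1 5)) (Neg (fEmp Q 2 5))))))))))))))
       (mAll 1 (mAll 2 (mImp (Conj (fP 0 1 3) (Conj (Mem 0 1) (Conj (fP 0 2 3) (Mem 0 2)))) (Eq 1 2)))))))))))))"

lemma sat_fDraining:
  assumes Q: "leaf_formula G Q q" "leaf_formula G Q' q'"
  shows "sat G \<nu> \<sigma> (fDraining Q Q') \<longleftrightarrow> draining (cells G) (rules G) q q' (pset G) (\<sigma> 0)"
proof -
  let ?V = "verts G" and ?C = "cells G" and ?R = "rules G" and ?X = "\<sigma> 0" and ?d = "pset G"
  note P = leaf_formulas(2)[of G]
  have V: "?C \<subseteq> ?V" "?R \<subseteq> ?V" "\<And>r. q r \<subseteq> ?V" "\<And>r. ?d r \<subseteq> ?V"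
    by (fact cells_rules_verts leaf_formula_verts[OF Q(1)] leaf_formula_verts[OF P])+
  \<comment> \<open>The formula can choose its three exceptional cells only among the vertices,
    whereas \<open>draining_into\<close> allows arbitrary values; values outside the graph are
    replaced by some vertex \<open>v0\<close>.\<close>
  have three: "(\<exists>j1\<in>?V. \<exists>j2\<in>?V. \<exists>j3\<in>?V. \<forall>j\<in>?V. j \<in> ?C \<and> \<not> normal q q' ?X j \<longrightarrow> j = j1 \<or> j = j2 \<or> j = j3) \<longleftrightarrow>
      (\<exists>j1 j2 j3. \<forall>j\<in>?C. \<not> normal q q' ?X j \<longrightarrow> j \<in> {j1, j2, j3})" (is "?l = ?r") if "?V \<noteq> {}"
  proof
    assume ?r
    then obtain j1 j2 j3 where j: "\<forall>j\<in>?C. \<not> normal q q' ?X j \<longrightarrow> j \<in> {j1, j2, j3}" by blast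
    obtain v0 where v0: "v0 \<in> ?V" using \<open>?V \<noteq> {}\<close> by blast
    define f where "f j = (if j \<in> ?V then j else v0)" for j
    have "f j1 \<in> ?V" "f j2 \<in> ?V" "f j3 \<in> ?V" using v0 by (auto simp: f_def)
    moreover have "\<forall>j\<in>?V. j \<in> ?C \<and> \<not> normal q q' ?X j \<longrightarrow> j = f j1 \<or> j = f j2 \<or> j = f j3"
      using j by (auto simp: f_def)
    ultimately show ?l by blast
  next
    assume ?l
    then obtain j1 j2 j3 where "\<forall>j\<in>?V. j \<in> ?C \<and> \<not> normal q q' ?X j \<longrightarrow> j = j1 \<or> j = j2 \<or> j = j3" by blast
    then have "\<forall>j\<in>?C. \<not> normal q q' ?X j \<longrightarrow> j \<in> {j1, j2, j3}" using V(1) by blast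
    then show ?r by blast
  qed
  have "sat G \<nu> \<sigma> (fDraining Q Q') \<longleftrightarrow> (\<exists>r\<in>?V. r \<in> ?R \<and> ?d r \<inter> ?X \<noteq> {} \<and> \<not> ?d r \<subseteq> ?X \<and>
     (\<forall>r'\<in>?V. r' \<in> ?R \<and> r' \<noteq> r \<longrightarrow> ?d r' \<inter> ?X = {}) \<and>
     (\<forall>j\<in>?V. j \<in> ?C \<longrightarrow> q' j \<inter> ?X = {} \<or> (q' j \<subseteq> ?X \<and> q j \<inter> ?X = {})) \<and>
     (\<exists>j\<in>?V. j \<in> ?C \<and> q' j \<inter> ?X = {} \<and> q j \<inter> ?X \<noteq> {} \<and> \<not> q j \<subseteq> ?X) \<and>
     (\<exists>j1\<in>?V. \<exists>j2\<in>?V. \<exists>j3\<in>?V. \<forall>j\<in>?V. j \<in> ?C \<and> \<not> normal q q' ?X j \<longrightarrow> j = j1 \<or> j = j2 \<or> j = j3) \<and>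
     ((\<exists>j\<in>?V. \<exists>j'\<in>?V. \<exists>x\<in>?V. \<exists>x'\<in>?V. j \<in> ?C \<and> j' \<in> ?C \<and> x \<in> q j \<and> x \<in> ?X \<and> x' \<in> q j' \<and> x' \<in> ?X \<and> x \<noteq> x' \<and> \<not> q j \<subseteq> ?X \<and> \<not> q j' \<subseteq> ?X) \<or>
      (\<forall>y\<in>?V. \<forall>y'\<in>?V. y \<in> ?d r \<and> y \<notin> ?X \<and> y' \<in> ?d r \<and> y' \<notin> ?X \<longrightarrow> y = y')) \<and>
     ((\<exists>j\<in>?V. \<exists>j'\<in>?V. \<exists>x\<in>?V. \<exists>x'\<in>?V. j \<in> ?C \<and> j' \<in> ?C \<and> x \<in> q j \<and> x \<notin> ?X \<and> x' \<in> q j' \<and> x' \<notin> ?X \<and> x \<noteq> x' \<and> q j \<inter> ?X \<noteq> {} \<and> q j' \<inter> ?X \<noteq> {}) \<or>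
      (\<forall>y\<in>?V. \<forall>y'\<in>?V. y \<in> ?d r \<and> y \<in> ?X \<and> y' \<in> ?d r \<and> y' \<in> ?X \<longrightarrow> y = y')))"
    unfolding fDraining_def
    by (simp add: sat_fRule sat_fCell sat_fEmp[OF P] sat_fFul[OF P] sat_fEmp[OF Q(1)] sat_fFul[OF Q(1)]
        sat_fEmp[OF Q(2)] sat_fFul[OF Q(2)] sat_fNorm[OF Q] leaf_formulaD[OF P] leaf_formulaD[OF Q(1)] cong: conj_cong)
  also have "\<dots> \<longleftrightarrow> draining ?C ?R q q' ?d ?X"
  proof (cases "?V = {}")
    case True
    then show ?thesis using V(2) unfolding draining_def by blast
  next
    case False
    have gex: "(\<exists>j\<in>?V. j \<in> S \<and> \<Phi> j) = (\<exists>j\<in>S. \<Phi> j)" and gall: "(\<forall>j\<in>?V. j \<in> S \<longrightarrow> \<Phi> j) = (\<forall>j\<in>S. \<Phi> j)"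
      if "S \<subseteq> ?V" for S \<Phi> using that by blast+
    have gall2: "(\<forall>j\<in>?V. j \<in> S \<and> \<Psi> j \<longrightarrow> \<Phi> j) = (\<forall>j\<in>S. \<Psi> j \<longrightarrow> \<Phi> j)" if "S \<subseteq> ?V" for S \<Phi> \<Psi>
      using that by blast
    have T: "(\<exists>j\<in>?V. \<exists>j'\<in>?V. \<exists>x\<in>?V. \<exists>x'\<in>?V. j \<in> ?C \<and> j' \<in> ?C \<and> x \<in> q j \<and> x \<in> ?X \<and> x' \<in> q j' \<and> x' \<in> ?X \<and> x \<noteq> x' \<and> \<not> q j \<subseteq> ?X \<and> \<not> q j' \<subseteq> ?X)
       = (\<exists>j\<in>?C. \<exists>j'\<in>?C. \<exists>x\<in>q j \<inter> ?X. \<exists>x'\<in>q j' \<inter> ?X. x \<noteq> x' \<and> \<not> q j \<subseteq> ?X \<and> \<not> q j' \<subseteq> ?X)" (is "?l = ?r")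
    proof
      show "?l \<Longrightarrow> ?r" by (elim bexE conjE) (intro bexI conjI IntI; assumption)
      show "?r \<Longrightarrow> ?l" by (elim bexE conjE IntE) (intro bexI conjI; (assumption | erule subsetD[OF V(1)] subsetD[OF V(3)]))
    qed
    have M: "(\<exists>j\<in>?V. \<exists>j'\<in>?V. \<exists>x\<in>?V. \<exists>x'\<in>?V. j \<in> ?C \<and> j' \<in> ?C \<and> x \<in> q j \<and> x \<notin> ?X \<and> x' \<in> q j' \<and> x' \<notin> ?X \<and> x \<noteq> x' \<and> q j \<inter> ?X \<noteq> {} \<and> q j' \<inter> ?X \<noteq> {})
       = (\<exists>j\<in>?C. \<exists>j'\<in>?C. \<exists>x\<in>q j - ?X. \<exists>x'\<in>q j' - ?X. x \<noteq> x' \<and> q j \<inter> ?X \<noteq> {} \<and> q j' \<inter> ?X \<noteq> {})" (is "?l = ?r")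
    proof
      show "?l \<Longrightarrow> ?r" by (elim bexE conjE) (intro bexI conjI DiffI; assumption)
      show "?r \<Longrightarrow> ?l" by (elim bexE conjE DiffE) (intro bexI conjI; (assumption | erule subsetD[OF V(1)] subsetD[OF V(3)]))
    qed
    have D1: "(\<forall>y\<in>?V. \<forall>y'\<in>?V. y \<in> ?d r \<and> y \<notin> ?X \<and> y' \<in> ?d r \<and> y' \<notin> ?X \<longrightarrow> y = y') = (\<forall>y\<in>?d r - ?X. \<forall>y'\<in>?d r - ?X. y = y')"
      and D2: "(\<forall>y\<in>?V. \<forall>y'\<in>?V. y \<in> ?d r \<and> y \<in> ?X \<and> y' \<in> ?d r \<and> y' \<in> ?X \<longrightarrow> y = y') = (\<forall>y\<in>?d r \<inter> ?X. \<forall>y'\<in>?d r \<inter> ?X. y = y')" for r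
      using V(4)[of r] by blast+
    show ?thesis
      unfolding draining_def draining_into_def T M D1 D2 three[OF False] gall2[OF V(2)] gall[OF V(1)] gex[OF V(1)] gex[OF V(2)] ..
  qed
  finally show ?thesis .
qed


definition fSame :: "nat \<Rightarrow> nat \<Rightarrow> nat \<Rightarrow> mso1" where
  "fSame x y b = mOr (Conj (fRoot x b) (fRoot y b)) (mOr (Conj (fMid x b) (fMid y b))
     (Conj (Conj (Neg (fRoot x b)) (Neg (fMid x b))) (Conj (Neg (fRoot y b)) (Neg (fMid y b)))))"

definition fLower :: "nat \<Rightarrow> nat \<Rightarrow> nat \<Rightarrow> mso1" where
  "fLower y x b = mOr (Conj (fRoot y b) (Neg (fRoot x b)))
     (Conj (fMid y b) (Conj (Neg (fRoot x b)) (Neg (fMid x b))))"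

lemma sat_fSame: "x < b \<Longrightarrow> y < b \<Longrightarrow> sat G \<nu> \<sigma> (fSame x y b) \<longleftrightarrow> rank G (\<nu> x) = rank G (\<nu> y)"
  by (auto simp: fSame_def sat_fRoot sat_fMid rank_def midv_def)

lemma sat_fLower: "x < b \<Longrightarrow> y < b \<Longrightarrow> sat G \<nu> \<sigma> (fLower y x b) \<longleftrightarrow> rank G (\<nu> y) < rank G (\<nu> x)"
  by (auto simp: fLower_def sat_fRoot sat_fMid rank_def midv_def)

definition fRanked :: mso1 where
  "fRanked = Conj (mAll 0 (mAll 1 (mImp (Edge 0 1) (Neg (fSame 0 1 2)))))
     (mAll 0 (mAll 1 (mAll 2 (mImp (Conj (Edge 0 1) (Conj (Edge 0 2) (Conj (fLower 1 0 3) (fLower 2 0 3)))) (Eq 1 2)))))"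

lemma sat_fRanked: "sat G \<nu> \<sigma> fRanked \<longleftrightarrow> ranked G"
  by (simp add: fRanked_def ranked_def sat_fSame sat_fLower)

definition fTok :: mso1 where
  "fTok = mAll 0 (mImp (Mem 0 0) (ExV 1 (mOr (Conj (fCell 1 2) (mOr (fA 1 0 2) (fP 1 0 2))) (Conj (fRule 1 2) (fP 1 0 2)))))"

lemma sat_fTok:
  assumes "\<sigma> 0 \<subseteq> verts G"
  shows "sat G \<nu> \<sigma> fTok \<longleftrightarrow>
    \<sigma> 0 \<subseteq> (\<Union>j\<in>cells G. aset G j) \<union> (\<Union>j\<in>cells G. pset G j) \<union> (\<Union>r\<in>rules G. pset G r)"
proof -
  note lf = leaf_formulas[of G]
  have "sat G \<nu> \<sigma> fTok \<longleftrightarrow> (\<forall>x\<in>verts G. x \<in> \<sigma> 0 \<longrightarrow> (\<exists>r\<in>verts G. (r \<in> cells G \<and> (x \<in> aset G r \<or> x \<in> pset G r)) \<or>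
     (r \<in> rules G \<and> x \<in> pset G r)))"
    by (simp add: fTok_def sat_fCell sat_fRule leaf_formulaD[OF lf(1)] leaf_formulaD[OF lf(2)])
  moreover define U where "U = (\<Union>j\<in>cells G. aset G j) \<union> (\<Union>j\<in>cells G. pset G j) \<union> (\<Union>r\<in>rules G. pset G r)"
  have "(\<exists>r\<in>verts G. (r \<in> cells G \<and> (x \<in> aset G r \<or> x \<in> pset G r)) \<or> (r \<in> rules G \<and> x \<in> pset G r)) \<longleftrightarrow>
      x \<in> U" for x
    unfolding U_def using cells_rules_verts[of G] by blast
  ultimately have "sat G \<nu> \<sigma> fTok \<longleftrightarrow> (\<forall>x\<in>verts G. x \<in> \<sigma> 0 \<longrightarrow> x \<in> U)" by (simp only:)
  then show ?thesis unfolding U_def[symmetric] using assms by blast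
qed

definition phi :: mso1 where
  "phi = Conj fRanked (Conj fTok (mOr fResting (mOr (fDraining fA fP) (fDraining fP fA))))"

lemma sat_phi:
  "\<sigma> 0 \<subseteq> verts G \<Longrightarrow> sat G \<nu> \<sigma> phi \<longleftrightarrow>
    ranked G \<and> token_set (cells G) (rules G) (aset G) (pset G) (pset G) (\<sigma> 0)"
  using sat_fDraining[OF leaf_formulas, of G \<nu> \<sigma>] sat_fDraining[OF leaf_formulas(2,1), of G \<nu> \<sigma>]
  by (simp add: phi_def token_set_def sat_fRanked sat_fTok sat_fResting)

lemma models_phi:
  "S \<subseteq> verts G \<Longrightarrow> models G phi 0 S \<longleftrightarrow>
    ranked G \<and> token_set (cells G) (rules G) (aset G) (pset G) (pset G) S"
  unfolding models_def by (subst sat_phi) auto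

text \<open>The fragment that translates into bounded arithmetic: no set quantifier, and set
  variable 0 as the only set.\<close>

primrec first_order :: "mso1 \<Rightarrow> bool" where
  "first_order (Eq x y) = True"
| "first_order (Edge x y) = True"
| "first_order (Mem X x) = (X = 0)"
| "first_order (Neg \<phi>) = first_order \<phi>"
| "first_order (Conj \<phi> \<psi>) = (first_order \<phi> \<and> first_order \<psi>)"
| "first_order (ExV x \<phi>) = first_order \<phi>"
| "first_order (ExS X \<phi>) = False"

lemmas formula_defs = mOr_def mImp_def mAll_def fRoot_def fMid_def fA_def fP_def fCell_def fRule_def fEmp_def
  fFul_def fNorm_def

lemma first_order_phi: "first_order phi"
  by (simp add: phi_def fResting_def fDraining_def fTok_def fRanked_def fSame_def fLower_def formula_defs)

lemma free_mso_ops: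
  "free_vertex_vars (mOr \<phi> \<psi>) = free_vertex_vars \<phi> \<union> free_vertex_vars \<psi>"
  "free_vertex_vars (mImp \<phi> \<psi>) = free_vertex_vars \<phi> \<union> free_vertex_vars \<psi>"
  "free_vertex_vars (mAll x \<phi>) = free_vertex_vars \<phi> - {x}"
  "free_set_vars (mOr \<phi> \<psi>) = free_set_vars \<phi> \<union> free_set_vars \<psi>"
  "free_set_vars (mImp \<phi> \<psi>) = free_set_vars \<phi> \<union> free_set_vars \<psi>"
  "free_set_vars (mAll x \<phi>) = free_set_vars \<phi>"
  by (simp_all add: mOr_def mImp_def mAll_def)

lemma free_vertex_atoms:
  "x < b \<Longrightarrow> free_vertex_vars (fRoot x b) = {x}"
  "x < b \<Longrightarrow> free_vertex_vars (fMid x b) = {x}"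
  "r < b \<Longrightarrow> x < b \<Longrightarrow> free_vertex_vars (fA r x b) = {r, x}"
  "r < b \<Longrightarrow> x < b \<Longrightarrow> free_vertex_vars (fP r x b) = {r, x}"
  "r < b \<Longrightarrow> free_vertex_vars (fCell r b) = {r}"
  "r < b \<Longrightarrow> free_vertex_vars (fRule r b) = {r}"
  "r < b \<Longrightarrow> free_vertex_vars (fEmp fA r b) = {r}"
  "r < b \<Longrightarrow> free_vertex_vars (fEmp fP r b) = {r}"
  "r < b \<Longrightarrow> free_vertex_vars (fFul fA r b) = {r}"
  "r < b \<Longrightarrow> free_vertex_vars (fFul fP r b) = {r}"
  "r < b \<Longrightarrow> free_vertex_vars (fNorm fA fP r b) = {r}"
  "r < b \<Longrightarrow> free_vertex_vars (fNorm fP fA r b) = {r}"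
  by (auto simp: fRoot_def fMid_def fA_def fP_def fCell_def fRule_def fEmp_def fFul_def fNorm_def free_mso_ops)

lemma free_vertex_phi: "free_vertex_vars phi = {}"
  by (simp add: phi_def fResting_def fDraining_def fTok_def fRanked_def fSame_def fLower_def free_mso_ops
      free_vertex_atoms insert_Diff_if)

lemma free_set_phi: "free_set_vars phi = {0}"
proof -
  have "free_set_vars \<psi> \<subseteq> {0}" if "first_order \<psi>" for \<psi>
    using that by (induction \<psi>) auto
  moreover have "0 \<in> free_set_vars phi" by (simp add: phi_def fTok_def free_mso_ops)
  ultimately show ?thesis using first_order_phi by blast
qed

section \<open>Instances as bit strings\<close>

lemma concat_grid:
  "concat (map (\<lambda>i. map (f i) [0..<n]) [0..<m]) = map (\<lambda>k. f (k div n) (k mod n)) [0..<m * n]"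
proof (induction m)
  case (Suc m)
  have "map (\<lambda>k. f (k div n) (k mod n)) [m * n..<m * n + n] = map (\<lambda>k. f ((k + m * n) div n) ((k + m * n) mod n)) [0..<n]"
    by (simp add: map_add_upt[symmetric, of "m * n"] add.commute)
  also have "\<dots> = map (f m) [0..<n]" by simp
  finally have "map (\<lambda>k. f (k div n) (k mod n)) [m * n..<m * n + n] = map (f m) [0..<n]" .
  then show ?case using Suc upt_add_eq_append[of 0 "m * n" n] by (simp add: add.commute)
qed simp

text \<open>The encoding position by position, the shape in which arithmetic formulas can both read
  and produce it.\<close>

definition instance_bit :: "nat \<Rightarrow> (nat \<Rightarrow> nat \<Rightarrow> bool) \<Rightarrow> nat set \<Rightarrow> nat set \<Rightarrow> nat \<Rightarrow> bool" where
  "instance_bit n E S S' i \<longleftrightarrow> i < n \<or> (n < i \<and> i < 2 * n + 1 \<and> i - (n + 1) \<in> S) \<or>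
     (2 * n + 1 \<le> i \<and> i < 3 * n + 1 \<and> i - (2 * n + 1) \<in> S') \<or>
     (3 * n + 1 \<le> i \<and> E ((i - (3 * n + 1)) div n) ((i - (3 * n + 1)) mod n))"

lemma encode_instance_bits:
  "encode_instance n G S S' = map (instance_bit n (adj G) S S') [0..<3 * n + 1 + n * n]"
proof (rule nth_equalityI)
  show len: "length (encode_instance n G S S') = length (map (instance_bit n (adj G) S S') [0..<3 * n + 1 + n * n])"
    by (simp add: encode_instance_def concat_grid)
  fix i assume "i < length (encode_instance n G S S')"
  then have i: "i < 3 * n + 1 + n * n" using len by simp
  have "encode_instance n G S S' ! i = instance_bit n (adj G) S S' i"
  proof -
    consider "i < n" | "i = n" | "n < i" "i < 2 * n + 1" | "2 * n + 1 \<le> i" "i < 3 * n + 1" | "3 * n + 1 \<le> i"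
      by linarith
    then show ?thesis
    proof cases
      case 5
      then have "encode_instance n G S S' ! i =
          map (\<lambda>k. adj G (k div n) (k mod n)) [0..<n * n] ! (i - n - 1 - n - n)"
        unfolding encode_instance_def concat_grid by (simp add: nth_append)
      also have "\<dots> = adj G ((i - (3 * n + 1)) div n) ((i - (3 * n + 1)) mod n)"
      proof -
        have "i - n - 1 - n - n = i - (3 * n + 1)" "i - (3 * n + 1) < n * n" using 5 i by auto
        then show ?thesis by simp
      qed
      finally show ?thesis using 5 by (simp add: instance_bit_def)
    next
      case 3
      define k where "k = i - (n + 1)"
      have "i = n + 1 + k" "k < n" using 3 by (auto simp: k_def)
      then show ?thesis by (simp add: encode_instance_def nth_append instance_bit_def)
    next
      case 4
      define k where "k = i - (2 * n + 1)"
      have "i = 2 * n + 1 + k" "k < n" using 4 by (auto simp: k_def)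
      then show ?thesis by (simp add: encode_instance_def nth_append instance_bit_def)
    qed (simp_all add: encode_instance_def nth_append instance_bit_def)
  qed
  then show "encode_instance n G S S' ! i = map (instance_bit n (adj G) S S') [0..<3 * n + 1 + n * n] ! i"
    using i by (simp del: upt_Suc)
qed

definition well_shaped :: "bool list \<Rightarrow> nat \<Rightarrow> bool" where
  "well_shaped w n \<longleftrightarrow> length w = 3 * n + 1 + n * n \<and> (\<forall>i<n. w ! i) \<and> \<not> w ! n \<and>
     (\<forall>i<n. \<forall>j<n. w ! (3 * n + 1 + i * n + j) \<longrightarrow> w ! (3 * n + 1 + j * n + i)) \<and>
     (\<forall>i<n. \<not> w ! (3 * n + 1 + i * n + i))"

definition dec_graph :: "bool list \<Rightarrow> nat \<Rightarrow> nat graph" where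
  "dec_graph w n = \<lparr>verts = {..<n}, edges = {{i, j} |i j. i < n \<and> j < n \<and> w ! (3 * n + 1 + i * n + j)}\<rparr>"

definition dec_set :: "bool list \<Rightarrow> nat \<Rightarrow> nat \<Rightarrow> nat set" where
  "dec_set w n k = {i. i < n \<and> w ! (k + i)}"

lemma adj_dec_graph:
  assumes "well_shaped w n"
  shows "adj (dec_graph w n) i j \<longleftrightarrow> i < n \<and> j < n \<and> w ! (3 * n + 1 + i * n + j)"
proof
  assume "adj (dec_graph w n) i j"
  then obtain i' j' where "{i, j} = {i', j'}" "i' < n" "j' < n" "w ! (3 * n + 1 + i' * n + j')"
    unfolding adj_def dec_graph_def by auto
  then show "i < n \<and> j < n \<and> w ! (3 * n + 1 + i * n + j)"
    using assms unfolding well_shaped_def by (auto simp: doubleton_eq_iff)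
qed (auto simp: adj_def dec_graph_def)

lemma grid_less: "i < n \<Longrightarrow> j < n \<Longrightarrow> i * n + j < n * n" for n :: nat
proof -
  assume "i < n" "j < n"
  then have "i * n + j < Suc i * n" by simp
  also have "\<dots> \<le> n * n" using \<open>i < n\<close> by (intro mult_right_mono) auto
  finally show ?thesis .
qed

lemma decode:
  assumes w: "well_shaped w n"
  shows "simple_graph (dec_graph w n)" "verts (dec_graph w n) = {..<n}" "dec_set w n k \<subseteq> {..<n}"
    "w = encode_instance n (dec_graph w n) (dec_set w n (n + 1)) (dec_set w n (2 * n + 1))"
proof -
  show v: "verts (dec_graph w n) = {..<n}" "dec_set w n k \<subseteq> {..<n}" by (auto simp: dec_graph_def dec_set_def)
  have irr: "\<not> w ! (3 * n + 1 + i * n + i)" if "i < n" for i using w that unfolding well_shaped_def by blast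
  show "simple_graph (dec_graph w n)"
    unfolding simple_graph_def v(1)
  proof (intro conjI ballI)
    fix e assume "e \<in> edges (dec_graph w n)"
    then obtain i j where e: "e = {i, j}" "i < n" "j < n" "w ! (3 * n + 1 + i * n + j)"
      unfolding dec_graph_def by auto
    then have "i \<noteq> j" using irr by auto
    then show "e \<subseteq> {..<n}" "card e = 2" using e by auto
  qed simp
  show "w = encode_instance n (dec_graph w n) (dec_set w n (n + 1)) (dec_set w n (2 * n + 1))"
    unfolding encode_instance_bits
  proof (rule nth_equalityI)
    show "length w = length (map (instance_bit n (adj (dec_graph w n)) (dec_set w n (n + 1)) (dec_set w n (2 * n + 1))) [0..<3 * n + 1 + n * n])"
      using w by (simp add: well_shaped_def)
    fix i assume "i < length w"
    then have i: "i < 3 * n + 1 + n * n" using w by (simp add: well_shaped_def)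
    have "w ! i = instance_bit n (adj (dec_graph w n)) (dec_set w n (n + 1)) (dec_set w n (2 * n + 1)) i"
    proof (cases "3 * n + 1 \<le> i")
      case True
      define k where "k = i - (3 * n + 1)"
      have k: "k < n * n" "i = 3 * n + 1 + k" using True i by (auto simp: k_def)
      have n0: "0 < n" using k(1) by (cases n) auto
      have "k div n < n" using k(1) by (simp add: less_mult_imp_div_less)
      then show ?thesis
        unfolding instance_bit_def adj_dec_graph[OF w] using k n0 by (simp add: add.assoc)
    next
        case False
      have d: "v \<in> dec_set w n k \<longleftrightarrow> v < n \<and> w ! (k + v)" for v k by (simp add: dec_set_def)
      consider "i < n" | "i = n" | "n < i" "i < 2 * n + 1" | "2 * n + 1 \<le> i" "i < 3 * n + 1" using False by linarith
      then show ?thesis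
      proof cases
        case 1
        then show ?thesis using w by (simp add: instance_bit_def well_shaped_def)
      next
        case 2
        then show ?thesis using w by (simp add: instance_bit_def well_shaped_def)
      next
        case 3
        then have "i - (n + 1) < n" "n + 1 + (i - (n + 1)) = i" by auto
        then show ?thesis using 3 by (simp add: instance_bit_def d)
      next
        case 4
        then have "i - (2 * n + 1) < n" "2 * n + 1 + (i - (2 * n + 1)) = i" by auto
        then show ?thesis using 4 by (simp add: instance_bit_def d)
      qed
    qed
    then show "w ! i = map (instance_bit n (adj (dec_graph w n)) (dec_set w n (n + 1)) (dec_set w n (2 * n + 1))) [0..<3 * n + 1 + n * n] ! i"
      using i by (simp del: upt_Suc)
  qed
qed

lemma well_shaped_encode:
  assumes "simple_graph G" "verts G = {..<n}"
  shows "well_shaped (encode_instance n G S S') n"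
proof -
  have b: "encode_instance n G S S' ! i = instance_bit n (adj G) S S' i" if "i < 3 * n + 1 + n * n" for i
    unfolding encode_instance_bits using that by (simp del: upt_Suc)
  have a: "encode_instance n G S S' ! (3 * n + 1 + i * n + j) = adj G i j" if "i < n" "j < n" for i j
    using b[of "3 * n + 1 + i * n + j"] grid_less[OF that] that by (simp add: instance_bit_def)
  have "length (encode_instance n G S S') = 3 * n + 1 + n * n" unfolding encode_instance_bits by simp
  moreover have "encode_instance n G S S' ! i" if "i < n" for i using b[of i] that by (simp add: instance_bit_def)
  moreover have "\<not> encode_instance n G S S' ! n" using b[of n] by (simp add: instance_bit_def)
  moreover have "\<not> adj G i i" for i using adj_verts[OF assms(1), of i i] by blast
  moreover have "adj G j i" if "adj G i j" for i j using adj_sym[of G i j] that by blast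
  ultimately show ?thesis unfolding well_shaped_def using a by simp
qed

section \<open>Reachability by Savitch's recursion as a quantified Boolean formula\<close>

definition tj_ok :: "'a graph \<Rightarrow> 'a set \<Rightarrow> bool" where
  "tj_ok G A \<longleftrightarrow> A \<subseteq> verts G \<and> models G phi 0 A"

definition tj_step :: "'a graph \<Rightarrow> 'a set \<Rightarrow> 'a set \<Rightarrow> bool" where
  "tj_step G A B \<longleftrightarrow> tj_ok G A \<and> tj_ok G B \<and> jump A B"

lemma TJ_sequence_iff_reach:
  "(\<exists>Ss. TJ_sequence G phi 0 S S' Ss) \<longleftrightarrow> tj_ok G S \<and> (tj_step G)\<^sup>*\<^sup>* S S'"
proof
  assume "\<exists>Ss. TJ_sequence G phi 0 S S' Ss"
  then obtain Ss where "TJ_sequence G phi 0 S S' Ss" by blast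
  then show "tj_ok G S \<and> (tj_step G)\<^sup>*\<^sup>* S S'"
  proof (induction Ss arbitrary: S)
    case (Cons A Ss)
    show ?case
    proof (cases Ss)
      case Nil
      then show ?thesis using Cons.prems by (auto simp: TJ_sequence_def tj_ok_def)
    next
      case (Cons B Bs)
      have "TJ_sequence G phi 0 B S' Ss" and ok: "tj_ok G A" "S = A" and j: "jump A B"
        using Cons.prems unfolding Cons TJ_sequence_def tj_ok_def jump_def by auto
      then have "tj_ok G B" "(tj_step G)\<^sup>*\<^sup>* B S'" using Cons.IH by blast+
      then have "tj_step G A B" "(tj_step G)\<^sup>*\<^sup>* B S'" using ok j by (simp_all add: tj_step_def[of G A B])
      then have "(tj_step G)\<^sup>*\<^sup>* A S'" by (rule converse_rtranclp_into_rtranclp)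
      then show ?thesis using ok by simp
    qed
  qed (simp add: TJ_sequence_def)
next
  assume "tj_ok G S \<and> (tj_step G)\<^sup>*\<^sup>* S S'"
  then have "(tj_step G)\<^sup>*\<^sup>* S S'" "tj_ok G S" by auto
  then show "\<exists>Ss. TJ_sequence G phi 0 S S' Ss"
  proof (induction rule: converse_rtranclp_induct)
    case base
    then show ?case by (intro exI[of _ "[S']"]) (simp add: TJ_sequence_def tj_ok_def)
  next
    case (step A B)
    then obtain Ss where Ss: "TJ_sequence G phi 0 B S' Ss" by (auto simp: tj_step_def)
    then obtain Bs where "Ss = B # Bs" by (cases Ss) (auto simp: TJ_sequence_def)
    then have "TJ_sequence G phi 0 A S' (A # Ss)"
      using Ss step by (auto simp: TJ_sequence_def tj_step_def tj_ok_def jump_def)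
    then show ?case by blast
  qed
qed

lemma jump_card: "finite A \<Longrightarrow> finite B \<Longrightarrow> jump A B \<Longrightarrow> card A = card B"
proof -
  assume "finite A" "finite B" "jump A B"
  then have "card A = card (A \<inter> B) + 1" "card B = card (B \<inter> A) + 1"
    using card_Int_Diff[of A B] card_Int_Diff[of B A] by (simp_all add: jump_def)
  then show ?thesis by (simp add: Int_commute)
qed

lemma tj_reach_props:
  assumes "(tj_step G)\<^sup>*\<^sup>* A B" "tj_ok G A" "finite (verts G)"
  shows "tj_ok G B" "card B = card A"
proof -
  have "tj_ok G B \<and> card B = card A"
    using assms(1,2)
  proof (induction rule: rtranclp_induct)
    case (step B C)
    then have "finite B" "finite C" using assms(3) finite_subset unfolding tj_step_def tj_ok_def by auto
    then show ?case using step jump_card[of B C] by (auto simp: tj_step_def)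
  qed simp
  then show "tj_ok G B" "card B = card A" by auto
qed

text \<open>The remaining conditions on an instance come for free: \<open>phi\<close> contains
  \<open>ranked\<close>, which implies the graph class, and reachability from a legal
  \<open>S\<close> makes \<open>S'\<close> legal and of equal size.\<close>

lemma yes_instances_iff:
  "w \<in> msor1_yes_instances phi 0 (forest_of_depth 3) \<longleftrightarrow>
    (\<exists>n. well_shaped w n \<and> tj_ok (dec_graph w n) (dec_set w n (n + 1)) \<and>
      (tj_step (dec_graph w n))\<^sup>*\<^sup>* (dec_set w n (n + 1)) (dec_set w n (2 * n + 1)))"
proof
  assume "w \<in> msor1_yes_instances phi 0 (forest_of_depth 3)"
  then obtain n G S S' where *: "w = encode_instance n G S S'" "verts G = {..<n}" "msor1_instance phi 0 G S S'"
    "\<exists>Ss. TJ_sequence G phi 0 S S' Ss" unfolding msor1_yes_instances_def by blast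
  then have G: "simple_graph G" "S \<subseteq> verts G" "S' \<subseteq> verts G" by (auto simp: msor1_instance_def)
  have sh: "well_shaped w n" unfolding *(1) by (rule well_shaped_encode[OF G(1) *(2)])
  have "G = dec_graph w n \<and> S = dec_set w n (n + 1) \<and> S' = dec_set w n (2 * n + 1)"
    using encode_instance_inj[of n G S S' n "dec_graph w n" "dec_set w n (n + 1)" "dec_set w n (2 * n + 1)"]
      decode[OF sh] G *(1,2) by auto
  then show "\<exists>n. well_shaped w n \<and> tj_ok (dec_graph w n) (dec_set w n (n + 1)) \<and>
      (tj_step (dec_graph w n))\<^sup>*\<^sup>* (dec_set w n (n + 1)) (dec_set w n (2 * n + 1))"
    using sh *(4) unfolding TJ_sequence_iff_reach by blast
next
  assume "\<exists>n. well_shaped w n \<and> tj_ok (dec_graph w n) (dec_set w n (n + 1)) \<and>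
      (tj_step (dec_graph w n))\<^sup>*\<^sup>* (dec_set w n (n + 1)) (dec_set w n (2 * n + 1))"
  then obtain n where n: "well_shaped w n" "tj_ok (dec_graph w n) (dec_set w n (n + 1))"
      "(tj_step (dec_graph w n))\<^sup>*\<^sup>* (dec_set w n (n + 1)) (dec_set w n (2 * n + 1))" by blast
  note d = decode[OF n(1)]
  have fin: "finite (verts (dec_graph w n))" unfolding d(2) by simp
  note p = tj_reach_props[OF n(3,2) fin]
  have "ranked (dec_graph w n)"
    using n(2) models_phi[of "dec_set w n (n + 1)" "dec_graph w n"] unfolding tj_ok_def by blast
  then have "forest_of_depth 3 (dec_graph w n)" by (rule ranked_forest[OF d(1)])
  moreover have "msor1_instance phi 0 (dec_graph w n) (dec_set w n (n + 1)) (dec_set w n (2 * n + 1))"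
    unfolding msor1_instance_def using d(1) p n(2) unfolding tj_ok_def by simp
  moreover have "\<exists>Ss. TJ_sequence (dec_graph w n) phi 0 (dec_set w n (n + 1)) (dec_set w n (2 * n + 1)) Ss"
    unfolding TJ_sequence_iff_reach using n by blast
  ultimately show "w \<in> msor1_yes_instances phi 0 (forest_of_depth 3)"
    unfolding msor1_yes_instances_def using d(2,4) by blast
qed

text \<open>Standing still is a step, so exactly \<open>2 ^ d\<close> steps cover all shorter
  sequences; only legal sets may stand still.\<close>

definition lazy :: "nat graph \<Rightarrow> nat set \<Rightarrow> nat set \<Rightarrow> bool" where
  "lazy G A B \<longleftrightarrow> tj_ok G A \<and> tj_ok G B \<and> (A = B \<or> jump A B)"

primrec savitch :: "nat graph \<Rightarrow> nat \<Rightarrow> nat set \<times> nat set \<Rightarrow> bool" where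
  "savitch G 0 p = lazy G (fst p) (snd p)"
| "savitch G (Suc d) p = (\<exists>M\<subseteq>verts G. savitch G d (fst p, M) \<and> savitch G d (M, snd p))"

lemma savitch_relpowp: "savitch G d p \<longleftrightarrow> ((lazy G) ^^ (2 ^ d)) (fst p) (snd p)"
proof (induction d arbitrary: p)
  case (Suc d)
  have "tj_ok G M" if "((lazy G) ^^ (2 ^ d)) A M" for A M
  proof -
    obtain k where "(2::nat) ^ d = Suc k" by (metis not0_implies_Suc power_not_zero zero_neq_numeral)
    then show ?thesis using that by (auto simp: lazy_def relcompp_apply)
  qed
  then have "savitch G (Suc d) p \<longleftrightarrow> (\<exists>M. ((lazy G) ^^ (2 ^ d)) (fst p) M \<and> ((lazy G) ^^ (2 ^ d)) M (snd p))"
    using Suc.IH by (auto simp: tj_ok_def)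
  also have "\<dots> \<longleftrightarrow> ((lazy G) ^^ (2 ^ d + 2 ^ d)) (fst p) (snd p)"
    unfolding relpowp_add by auto
  finally show ?case by (simp add: mult_2)
next
  case 0
  then show ?case by (simp only: savitch.simps power_0 relpowp_1)
qed

text \<open>There are at most \<open>2 ^ (2 * n)\<close> pairs of vertex sets, so a shortest
  sequence has at most that many steps, and it is padded by standing still at
  \<open>B\<close>.\<close>

lemma savitch_reach:
  assumes G: "verts G = {..<n}" and d: "2 * n \<le> d" and A: "tj_ok G A"
  shows "savitch G d (A, B) \<longleftrightarrow> (tj_step G)\<^sup>*\<^sup>* A B"
proof
  assume "savitch G d (A, B)"
  then have "((lazy G) ^^ (2 ^ d)) A B" unfolding savitch_relpowp by simp
  moreover have "(lazy G) ^^ k \<le> (tj_step G)\<^sup>*\<^sup>*" for k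
  proof (induction k)
    case (Suc k)
    have l: "(tj_step G)\<^sup>*\<^sup>* X Y" if "lazy G X Y" for X Y
      using that unfolding lazy_def using tj_step_def[of G X Y] by (metis r_into_rtranclp rtranclp.rtrancl_refl)
    show ?case
    proof (rule predicate2I)
      fix X Z assume "((lazy G) ^^ Suc k) X Z"
      then obtain Y where "((lazy G) ^^ k) X Y" "lazy G Y Z" by auto
      then show "(tj_step G)\<^sup>*\<^sup>* X Z" using Suc.IH l by (meson predicate2D rtranclp_trans)
    qed
  qed auto
  ultimately show "(tj_step G)\<^sup>*\<^sup>* A B" by blast
next
  assume r: "(tj_step G)\<^sup>*\<^sup>* A B"
  define T where "T = {(X, Y). tj_step G X Y}"
  have sub: "T \<subseteq> Pow {..<n} \<times> Pow {..<n}" unfolding T_def tj_step_def tj_ok_def G by auto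
  then have fT: "finite T" by (rule finite_subset) simp
  have "card T \<le> card (Pow {..<n} \<times> Pow {..<n})" by (rule card_mono[OF _ sub]) simp
  also have "\<dots> = 2 ^ (2 * n)" by (simp add: card_cartesian_product card_Pow power_mult power2_eq_square mult_2 power_add)
  also have "\<dots> \<le> (2::nat) ^ d" using d by (intro power_increasing) auto
  finally have cT: "card T \<le> 2 ^ d" .
  have "(A, B) \<in> T\<^sup>*" using r unfolding T_def rtranclp_rtrancl_eq by (simp add: case_prod_unfold)
  then obtain k where k: "k \<le> card T" "(A, B) \<in> T ^^ k" using rtrancl_finite_eq_relpow[OF fT] by auto
  have "((lazy G) ^^ k) A B" if "(A, B) \<in> T ^^ k" for k B
    using that
  proof (induction k arbitrary: B)
    case (Suc k)
    then obtain C where "(A, C) \<in> T ^^ k" "(C, B) \<in> T" by auto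
    then show ?case using Suc.IH by (auto simp: T_def tj_step_def lazy_def relcompp_apply)
  qed simp
  then have kk: "((lazy G) ^^ k) A B" using k(2) by blast
  have "tj_ok G B" using tj_reach_props(1)[OF r A] G by simp
  then have pad: "((lazy G) ^^ j) B B" for j by (induction j) (auto simp: lazy_def relcompp_apply)
  have "((lazy G) ^^ (k + (2 ^ d - k))) A B" unfolding relpowp_add using kk pad by blast
  then show "savitch G d (A, B)" unfolding savitch_relpowp using k(1) cT by simp
qed

text \<open>A block of existential quantifiers guesses a bit vector; outside the block the
  assignment is unchanged.\<close>

lemma qev_ex_block:
  assumes "\<And>i. i < c \<Longrightarrow> \<not> U (k + i)"
  shows "qev U M (c + r) k x \<longleftrightarrow>
    (\<exists>y. (\<forall>i. i < k \<or> k + c \<le> i \<longrightarrow> y i = x i) \<and> (\<forall>i<c. y (k + i) \<le> 1) \<and> qev U M r (k + c) y)"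
  using assms
proof (induction c arbitrary: k x)
  case 0
  have "qev U M r k x \<longleftrightarrow> (\<exists>y. y = x \<and> qev U M r k y)" by simp
  moreover have "(\<forall>i. i < k \<or> k + 0 \<le> i \<longrightarrow> y i = x i) \<longleftrightarrow> y = x" for y :: "nat \<Rightarrow> nat" by (auto simp: fun_eq_iff)
  ultimately show ?case by simp
next
  case (Suc c)
  have U: "\<not> U (Suc k + i)" if "i < c" for i using Suc.prems[of "Suc i"] that by simp
  have "qev U M (Suc c + r) k x \<longleftrightarrow> (\<exists>v\<le>1. qev U M (c + r) (Suc k) (x(k := v)))"
    using Suc.prems[of 0] by (auto simp: le_Suc_eq)
  also have "\<dots> \<longleftrightarrow> (\<exists>v\<le>1. \<exists>y. (\<forall>i. i < Suc k \<or> Suc k + c \<le> i \<longrightarrow> y i = (x(k := v)) i) \<and>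
      (\<forall>i<c. y (Suc k + i) \<le> 1) \<and> qev U M r (Suc k + c) y)"
    using Suc.IH[OF U] by simp
  also have "\<dots> \<longleftrightarrow> (\<exists>y. (\<forall>i. i < k \<or> k + Suc c \<le> i \<longrightarrow> y i = x i) \<and> (\<forall>i<Suc c. y (k + i) \<le> 1) \<and> qev U M r (k + Suc c) y)"
    (is "?l \<longleftrightarrow> ?r")
  proof
    assume ?l
    then obtain v y where y: "v \<le> 1" "\<forall>i. i < Suc k \<or> Suc k + c \<le> i \<longrightarrow> y i = (x(k := v)) i"
      "\<forall>i<c. y (Suc k + i) \<le> 1" "qev U M r (Suc k + c) y" by blast
    have "y (k + i) \<le> 1" if "i < Suc c" for i
      using that y(1) y(2)[rule_format, of k] y(3) by (cases i) auto
    moreover have "y i = x i" if "i < k \<or> k + Suc c \<le> i" for i using y(2)[rule_format, of i] that by auto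
    ultimately show ?r using y(4) by (intro exI[of _ y]) auto
  next
    assume ?r
    then obtain y where y: "\<forall>i. i < k \<or> k + Suc c \<le> i \<longrightarrow> y i = x i" "\<forall>i<Suc c. y (k + i) \<le> 1" "qev U M r (k + Suc c) y"
      by blast
    show ?l
    proof (intro exI[of _ "y k"] exI[of _ y] conjI allI impI)
      show "y k \<le> 1" using y(2) by force
      show "y (Suc k + i) \<le> 1" if "i < c" for i using y(2)[rule_format, of "Suc i"] that by simp
      show "y i = (x(k := y k)) i" if "i < Suc k \<or> Suc k + c \<le> i" for i using y(1)[rule_format, of i] that by (cases "i = k") auto
      show "qev U M r (Suc k + c) y" using y(3) by simp
    qed
  qed
  finally show ?case .
qed

text \<open>The variable \<open>j * (L + 1) + v\<close> with \<open>v < L\<close> tells whether \<open>v\<close> belongs to the midpoint guessed on level \<open>j\<close>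
  of Savitch's recursion, and \<open>j * (L + 1) + L\<close> is the universal choice between its two halves.\<close>

definition midpoint :: "nat \<Rightarrow> nat \<Rightarrow> (nat \<Rightarrow> nat) \<Rightarrow> nat \<Rightarrow> nat set" where
  "midpoint L n x j = {v. v < n \<and> x (j * (L + 1) + v) = 1}"

primrec segment :: "nat \<Rightarrow> nat \<Rightarrow> nat set \<times> nat set \<Rightarrow> (nat \<Rightarrow> nat) \<Rightarrow> nat \<Rightarrow> nat set \<times> nat set" where
  "segment L n p x 0 = p"
| "segment L n p x (Suc j) =
    (if x (j * (L + 1) + L) = 1 then (midpoint L n x j, snd (segment L n p x j))
     else (fst (segment L n p x j), midpoint L n x j))"

lemma segment_cong:
  assumes "n \<le> L" "\<And>i. i < j * (L + 1) \<Longrightarrow> x i = y i"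
  shows "segment L n p x j = segment L n p y j"
  using assms(2)
proof (induction j)
  case (Suc j)
  have "x (j * (L + 1) + v) = y (j * (L + 1) + v)" if "v \<le> L" for v
    by (rule Suc.prems) (use that in simp)
  then have "midpoint L n x j = midpoint L n y j" "x (j * (L + 1) + L) = y (j * (L + 1) + L)"
    using assms(1) by (auto simp: midpoint_def)
  moreover have "segment L n p x j = segment L n p y j" by (rule Suc.IH) (use Suc.prems in simp)
  ultimately show ?case by simp
qed simp

text \<open>Each level guesses a midpoint existentially and then picks one of the two halves
  universally, so a single copy of the base case suffices. The block length is the length
  \<open>L\<close> of the input instead of the number \<open>n\<close> of vertices, because the
  quantifier pattern is to be read off the position and \<open>L\<close> alone.\<close>

lemma qev_savitch:
  assumes n: "n \<le> L" and G: "verts G = {..<n}" and U: "\<And>k. U k \<longleftrightarrow> k mod (L + 1) = L"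
    and M: "\<And>x. M x \<longleftrightarrow> lazy G (fst (segment L n p x L)) (snd (segment L n p x L))"
  shows "j + d = L \<Longrightarrow> qev U M (d * (L + 1)) (j * (L + 1)) x \<longleftrightarrow> savitch G d (segment L n p x j)"
proof (induction d arbitrary: j x)
  case 0
  then show ?case using M by simp
next
  case (Suc d)
  let ?k = "j * (L + 1)"
  have mm: "(?k + i) mod (L + 1) = i" if "i \<le> L" for i
    using that by (simp only: mod_mult_self3) simp
  have U1: "\<not> U (?k + i)" if "i < L" for i using that mm[of i] unfolding U by simp
  have U2: "U (?k + L)" using mm[of L] unfolding U by simp
  have e: "Suc d * (L + 1) = L + Suc (d * (L + 1))" by simp
  have IH: "qev U M (d * (L + 1)) (Suc (?k + L)) y \<longleftrightarrow> savitch G d (segment L n p y (Suc j))" for y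
  proof -
    have e2: "Suc j * (L + 1) = Suc (?k + L)" by simp
    show ?thesis by (rule Suc.IH[of "Suc j" y, unfolded e2]) (use Suc.prems in simp)
  qed
  have "qev U M (Suc d * (L + 1)) ?k x \<longleftrightarrow> (\<exists>y. (\<forall>i. i < ?k \<or> ?k + L \<le> i \<longrightarrow> y i = x i) \<and> (\<forall>i<L. y (?k + i) \<le> 1) \<and>
      savitch G d (segment L n p (y(?k + L := 0)) (Suc j)) \<and> savitch G d (segment L n p (y(?k + L := 1)) (Suc j)))"
  proof -
    have "qev U M (L + Suc (d * (L + 1))) ?k x \<longleftrightarrow> (\<exists>y. (\<forall>i. i < ?k \<or> ?k + L \<le> i \<longrightarrow> y i = x i) \<and>
        (\<forall>i<L. y (?k + i) \<le> 1) \<and> qev U M (Suc (d * (L + 1))) (?k + L) y)"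
      by (rule qev_ex_block) (rule U1)
    then show ?thesis by (simp only: e qev.simps(2) U2 if_True IH)
  qed
  also have "\<dots> \<longleftrightarrow> (\<exists>y. (\<forall>i. i < ?k \<or> ?k + L \<le> i \<longrightarrow> y i = x i) \<and> (\<forall>i<L. y (?k + i) \<le> 1) \<and>
      savitch G d (fst (segment L n p x j), midpoint L n y j) \<and> savitch G d (midpoint L n y j, snd (segment L n p x j)))"
  proof (intro ex_cong1 conj_cong refl)
    fix y :: "nat \<Rightarrow> nat" assume y: "\<forall>i. i < ?k \<or> ?k + L \<le> i \<longrightarrow> y i = x i"
    have s: "segment L n p (y(?k + L := v)) j = segment L n p x j" for v
      using y by (intro segment_cong[OF n]) auto
    have m: "midpoint L n (y(?k + L := v)) j = midpoint L n y j" for v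
      using n by (auto simp: midpoint_def)
    show "savitch G d (segment L n p (y(?k + L := 0)) (Suc j)) = savitch G d (fst (segment L n p x j), midpoint L n y j)"
      "savitch G d (segment L n p (y(?k + L := 1)) (Suc j)) = savitch G d (midpoint L n y j, snd (segment L n p x j))"
      by (simp_all only: segment.simps s m fun_upd_same simp_thms if_True if_False zero_neq_one)
  qed
  also have "\<dots> \<longleftrightarrow> savitch G (Suc d) (segment L n p x j)" (is "?l \<longleftrightarrow> ?r")
  proof
    assume ?l
    moreover have "midpoint L n y j \<subseteq> verts G" for y unfolding G by (auto simp: midpoint_def)
    ultimately show ?r by auto
  next
    assume ?r
    then obtain A where A: "A \<subseteq> {..<n}" "savitch G d (fst (segment L n p x j), A)" "savitch G d (A, snd (segment L n p x j))"
      unfolding G[symmetric] by auto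
    define y where "y i = (if ?k \<le> i \<and> i < ?k + L then of_bool (i - ?k \<in> A) else x i)" for i
    have "midpoint L n y j = A" using A(1) n by (auto simp: midpoint_def y_def)
    then show ?l using A(2,3) by (intro exI[of _ y]) (auto simp: y_def)
  qed
  finally show ?case .
qed

text \<open>The recursion of \<open>segment\<close> overwrites an end at each level where the choice
  says so; in closed form, the end is the midpoint of the last such level, or the original end.
  Formulas cannot recurse but can express this.\<close>

lemma last_choice:
  fixes b m :: "nat \<Rightarrow> bool" and s :: bool
  defines "P J \<equiv> (\<exists>j<J. b j \<and> (\<forall>j'<J. j < j' \<longrightarrow> \<not> b j') \<and> m j) \<or> ((\<forall>j<J. \<not> b j) \<and> s)"
  shows "P (Suc J) \<longleftrightarrow> (if b J then m J else P J)"
  unfolding P_def by (auto simp: less_Suc_eq)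

lemma fst_segment:
  "v \<in> fst (segment L n (S, T) x J) \<longleftrightarrow>
    (\<exists>j<J. x (j * (L + 1) + L) = 1 \<and> (\<forall>j'<J. j < j' \<longrightarrow> x (j' * (L + 1) + L) \<noteq> 1) \<and> v \<in> midpoint L n x j) \<or>
    ((\<forall>j<J. x (j * (L + 1) + L) \<noteq> 1) \<and> v \<in> S)"
proof (induction J)
  case (Suc J)
  show ?case
    unfolding last_choice[where b = "\<lambda>j. x (j * (L + 1) + L) = 1" and m = "\<lambda>j. v \<in> midpoint L n x j" and s = "v \<in> S" and J = J] Suc[symmetric]
    by (simp only: segment.simps) (simp split: if_split)
qed simp

lemma snd_segment:
  "v \<in> snd (segment L n (S, T) x J) \<longleftrightarrow>
    (\<exists>j<J. x (j * (L + 1) + L) \<noteq> 1 \<and> (\<forall>j'<J. j < j' \<longrightarrow> \<not> x (j' * (L + 1) + L) \<noteq> 1) \<and> v \<in> midpoint L n x j) \<or>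
    ((\<forall>j<J. \<not> x (j * (L + 1) + L) \<noteq> 1) \<and> v \<in> T)"
proof (induction J)
  case (Suc J)
  show ?case
    unfolding last_choice[where b = "\<lambda>j. x (j * (L + 1) + L) \<noteq> 1" and m = "\<lambda>j. v \<in> midpoint L n x j" and s = "v \<in> T" and J = J] Suc[symmetric]
    by (simp only: segment.simps) (simp split: if_split)
qed simp

section \<open>Translating the formula and the base case into bounded arithmetic\<close>

definition fOr :: "fm \<Rightarrow> fm \<Rightarrow> fm" where "fOr f g = Ng (An (Ng f) (Ng g))"
definition fImp :: "fm \<Rightarrow> fm \<Rightarrow> fm" where "fImp f g = Ng (An f (Ng g))"
definition fAll :: "nat \<Rightarrow> trm \<Rightarrow> fm \<Rightarrow> fm" where "fAll x t f = Ng (Xs x t (Ng f))"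
definition fEq :: "trm \<Rightarrow> trm \<Rightarrow> fm" where "fEq s t = An (Le s t) (Le t s)"
definition fLt :: "trm \<Rightarrow> trm \<Rightarrow> fm" where "fLt s t = Le (Pl s (N 1)) t"

lemma fsat_ops [simp]:
  "fsat A e (fOr f g) \<longleftrightarrow> fsat A e f \<or> fsat A e g"
  "fsat A e (fImp f g) \<longleftrightarrow> (fsat A e f \<longrightarrow> fsat A e g)"
  "fsat A e (fAll x t f) \<longleftrightarrow> (\<forall>i<tval e t. fsat A (e(x := i)) f)"
  "fsat A e (fEq s t) \<longleftrightarrow> tval e s = tval e t"
  "fsat A e (fLt s t) \<longleftrightarrow> tval e s < tval e t"
  by (auto simp: fOr_def fImp_def fAll_def fEq_def fLt_def)

lemma farrs_ops [simp]:
  "farrs (fOr f g) = farrs f \<union> farrs g" "farrs (fImp f g) = farrs f \<union> farrs g"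
  "farrs (fAll x t f) = farrs f" "farrs (fEq s t) = {}" "farrs (fLt s t) = {}"
  by (auto simp: fOr_def fImp_def fAll_def fEq_def fLt_def)

lemma tbelow_mono: "tbelow m t \<Longrightarrow> m \<le> m' \<Longrightarrow> tbelow m' t"
  by (induction t) auto

lemma fbelow_mono: "fbelow m f \<Longrightarrow> m \<le> m' \<Longrightarrow> fbelow m' f"
  by (induction f) (auto intro: tbelow_mono)

lemma ex_tbelow: "\<exists>m. tbelow m t"
proof (induction t)
  case (V x)
  show ?case by (intro exI[of _ "Suc x"]) simp
next
  case (Pl s t)
  then obtain m1 m2 where "tbelow m1 s" "tbelow m2 t" by blast
  then show ?case using tbelow_mono[of m1 s "m1 + m2"] tbelow_mono[of m2 t "m1 + m2"]
    by (intro exI[of _ "m1 + m2"]) simp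
next
  case (Ti s t)
  then obtain m1 m2 where "tbelow m1 s" "tbelow m2 t" by blast
  then show ?case using tbelow_mono[of m1 s "m1 + m2"] tbelow_mono[of m2 t "m1 + m2"]
    by (intro exI[of _ "m1 + m2"]) simp
qed simp

lemma ex_fbelow: "farrs f \<subseteq> {..<3} \<Longrightarrow> \<exists>m. fbelow m f"
proof (induction f)
  case (Le s t)
  obtain m1 m2 where "tbelow m1 s" "tbelow m2 t" using ex_tbelow by blast
  then show ?case using tbelow_mono[of m1 s "m1 + m2"] tbelow_mono[of m2 t "m1 + m2"]
    by (intro exI[of _ "m1 + m2"]) simp
next
  case (Sy a t v)
  then show ?case using ex_tbelow[of t] by auto
next
  case (An f g)
  then obtain m1 m2 where "fbelow m1 f" "fbelow m2 g" by auto
  then show ?case using fbelow_mono[of m1 f "m1 + m2"] fbelow_mono[of m2 g "m1 + m2"]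
    by (intro exI[of _ "m1 + m2"]) simp
next
  case (Xs x t f)
  then obtain m1 m2 where "fbelow m1 f" "tbelow m2 t" using ex_tbelow[of t] by auto
  then show ?case using fbelow_mono[of m1 f "m1 + m2 + Suc x"] tbelow_mono[of m2 t "m1 + m2 + Suc x"]
    by (intro exI[of _ "m1 + m2 + Suc x"]) simp
qed auto

lemma word_arrays_0: "word_arrays w 0 i = 2 \<longleftrightarrow> i < length w \<and> w ! i"
  by (simp add: word_arrays_def word_content_def)

text \<open>Variable 0 is the length of the input and variable 2 the number of vertices; vertex variable \<open>x\<close> of a
  formula over graphs becomes variable \<open>x + 10\<close>.\<close>

definition tGrid :: "trm \<Rightarrow> trm \<Rightarrow> trm" where
  "tGrid i j = Pl (Pl (Pl (Ti (N 3) (V 2)) (N 1)) (Ti i (V 2))) j"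

definition fShape :: fm where
  "fShape = An (fEq (V 0) (Pl (Pl (Ti (N 3) (V 2)) (N 1)) (Ti (V 2) (V 2))))
    (An (fAll 3 (V 2) (Sy 0 (V 3) 2)) (An (Ng (Sy 0 (V 2) 2))
    (An (fAll 3 (V 2) (fAll 4 (V 2) (fImp (Sy 0 (tGrid (V 3) (V 4)) 2) (Sy 0 (tGrid (V 4) (V 3)) 2))))
        (fAll 3 (V 2) (Ng (Sy 0 (tGrid (V 3) (V 3)) 2))))))"

lemma tval_tGrid [simp]: "tval e (tGrid i j) = 3 * e 2 + 1 + tval e i * e 2 + tval e j"
  by (simp add: tGrid_def)

lemma fsat_fShape:
  assumes "e 0 = length w" "A 0 = word_arrays w 0"
  shows "fsat A e fShape \<longleftrightarrow> well_shaped w (e 2)"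
proof (cases "length w = 3 * e 2 + 1 + e 2 * e 2")
  case True
  have 1: "3 * e 2 + 1 + i * e 2 + j < length w" if "i < e 2" "j < e 2" for i j
    using grid_less[OF that] unfolding True by simp
  have 2: "i < length w" if "i \<le> e 2" for i using that unfolding True by simp
  have "fsat A e fShape \<longleftrightarrow> (\<forall>i<e 2. w ! i) \<and> \<not> w ! e 2 \<and>
     (\<forall>i<e 2. \<forall>j<e 2. w ! (3 * e 2 + 1 + i * e 2 + j) \<longrightarrow> w ! (3 * e 2 + 1 + j * e 2 + i)) \<and>
     (\<forall>i<e 2. \<not> w ! (3 * e 2 + 1 + i * e 2 + i))"
    using True assms(1) 1 2 by (simp add: fShape_def assms(2) word_arrays_0 del: add_Suc_right add_Suc)
  then show ?thesis using True unfolding well_shaped_def by blast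
next
  case False
  then show ?thesis using assms(1) by (auto simp: fShape_def well_shaped_def)
qed

text \<open>The renaming keeps the graph variables clear of the small variables bound inside
  \<open>mem\<close> and in the matrix. The clause for set quantifiers is a dummy; the translation
  is correct for \<open>first_order\<close> formulas.\<close>

primrec to_fm :: "(trm \<Rightarrow> fm) \<Rightarrow> mso1 \<Rightarrow> fm" where
  "to_fm mem (Eq x y) = fEq (V (x + 10)) (V (y + 10))"
| "to_fm mem (Edge x y) = Sy 0 (tGrid (V (x + 10)) (V (y + 10))) 2"
| "to_fm mem (Mem X x) = mem (V (x + 10))"
| "to_fm mem (Neg \<phi>) = Ng (to_fm mem \<phi>)"
| "to_fm mem (Conj \<phi> \<psi>) = An (to_fm mem \<phi>) (to_fm mem \<psi>)"
| "to_fm mem (ExV x \<phi>) = Xs (x + 10) (V 2) (to_fm mem \<phi>)"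
| "to_fm mem (ExS X \<phi>) = Le (N 0) (N 0)"

lemma fsat_to_fm:
  assumes w: "well_shaped w n" and A: "A 0 = word_arrays w 0"
    and mem: "\<And>e t. e 0 = length w \<Longrightarrow> e 2 = n \<Longrightarrow> tval e t < n \<Longrightarrow> (\<exists>x. t = V x \<and> 5 \<le> x) \<Longrightarrow> fsat A e (mem t) \<longleftrightarrow> tval e t \<in> \<sigma> 0"
  shows "first_order \<phi> \<Longrightarrow> e 0 = length w \<Longrightarrow> e 2 = n \<Longrightarrow> (\<And>x. x \<in> free_vertex_vars \<phi> \<Longrightarrow> e (x + 10) < n) \<Longrightarrow>
    fsat A e (to_fm mem \<phi>) \<longleftrightarrow> sat (dec_graph w n) (\<lambda>x. e (x + 10)) \<sigma> \<phi>"
proof (induction \<phi> arbitrary: e)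
  case (Edge x y)
  have l: "e (x + 10) < n" "e (y + 10) < n" using Edge.prems(4) by auto
  have "3 * n + 1 + e (x + 10) * n + e (y + 10) < length w"
    using grid_less[OF l] w by (simp add: well_shaped_def)
  then show ?case using l Edge.prems(3) by (simp add: A word_arrays_0 adj_dec_graph[OF w])
next
  case (Mem X x)
  then show ?case by (simp add: mem)
next
  case (ExV x \<phi>)
  have "fsat A (e(x + 10 := i)) (to_fm mem \<phi>) \<longleftrightarrow> sat (dec_graph w n) ((\<lambda>y. e (y + 10))(x := i)) \<sigma> \<phi>" if "i < n" for i
  proof -
    have eq: "(\<lambda>y. (e(x + 10 := i)) (y + 10)) = (\<lambda>y. e (y + 10))(x := i)" by auto
    have "fsat A (e(x + 10 := i)) (to_fm mem \<phi>) \<longleftrightarrow> sat (dec_graph w n) (\<lambda>y. (e(x + 10 := i)) (y + 10)) \<sigma> \<phi>"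
      by (rule ExV.IH) (use ExV.prems that in auto)
    then show ?thesis unfolding eq .
  qed
  then show ?case using ExV.prems(3) by (auto simp: decode(2)[OF w])
qed auto

lemma farrs_to_fm: "(\<And>t. farrs (mem t) \<subseteq> {0, 1}) \<Longrightarrow> farrs (to_fm mem \<phi>) \<subseteq> {0, 1}"
  by (induction \<phi>) auto

definition tVar :: "trm \<Rightarrow> trm \<Rightarrow> trm" where
  "tVar j v = Pl (Ti j (Pl (V 0) (N 1))) v"

text \<open>Membership in the two ends of the segment that Savitch's recursion reaches on the last level.\<close>

definition fFst :: "trm \<Rightarrow> fm" where
  "fFst v = fOr (Xs 3 (V 0) (An (Sy 1 (tVar (V 3) (V 0)) 1)
      (An (fAll 4 (V 0) (fImp (fLt (V 3) (V 4)) (Ng (Sy 1 (tVar (V 4) (V 0)) 1)))) (Sy 1 (tVar (V 3) v) 1))))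
    (An (fAll 3 (V 0) (Ng (Sy 1 (tVar (V 3) (V 0)) 1))) (Sy 0 (Pl (Pl (V 2) (N 1)) v) 2))"

definition fSnd :: "trm \<Rightarrow> fm" where
  "fSnd v = fOr (Xs 3 (V 0) (An (Ng (Sy 1 (tVar (V 3) (V 0)) 1))
      (An (fAll 4 (V 0) (fImp (fLt (V 3) (V 4)) (Sy 1 (tVar (V 4) (V 0)) 1))) (Sy 1 (tVar (V 3) v) 1))))
    (An (fAll 3 (V 0) (Sy 1 (tVar (V 3) (V 0)) 1)) (Sy 0 (Pl (Pl (Ti (N 2) (V 2)) (N 1)) v) 2))"

text \<open>The argument has to be a variable from 5 on: the formulas bind 3 and 4 and refer to 0
  and 2.\<close>

lemma fsat_ends:
  assumes w: "well_shaped w n" and A: "A 0 = word_arrays w 0"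
    and e: "e 0 = length w" "e 2 = n" "tval e (V y) < n" "5 \<le> y"
  defines "seg \<equiv> segment (length w) n (dec_set w n (n + 1), dec_set w n (2 * n + 1)) (A 1) (length w)"
  shows "fsat A e (fFst (V y)) \<longleftrightarrow> e y \<in> fst seg" "fsat A e (fSnd (V y)) \<longleftrightarrow> e y \<in> snd seg"
proof -
  have L: "length w = 3 * n + 1 + n * n" using w by (simp add: well_shaped_def)
  have l: "e y < n" "n + 1 + e y < length w" "2 * n + 1 + e y < length w" using e(3) L by auto
  have y: "y \<noteq> 3" "y \<noteq> 4" using e(4) by auto
  have m: "v \<in> midpoint (length w) n (A 1) j \<longleftrightarrow> v < n \<and> A 1 (j * (length w + 1) + v) = 1" for v j
    by (simp add: midpoint_def)
  have d: "v \<in> dec_set w n k \<longleftrightarrow> v < n \<and> w ! (k + v)" for v k by (simp add: dec_set_def)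
  show "fsat A e (fFst (V y)) \<longleftrightarrow> e y \<in> fst seg"
    unfolding seg_def fst_segment m d using e(1,2) l y
    by (simp add: fFst_def tVar_def A word_arrays_0)
  show "fsat A e (fSnd (V y)) \<longleftrightarrow> e y \<in> snd seg"
    unfolding seg_def snd_segment m d using e(1,2) l y
    by (simp add: fSnd_def tVar_def A word_arrays_0 mult_2)
qed

definition fJump :: "(trm \<Rightarrow> fm) \<Rightarrow> (trm \<Rightarrow> fm) \<Rightarrow> fm" where
  "fJump f g = Xs 5 (V 2) (An (An (f (V 5)) (Ng (g (V 5))))
     (fAll 6 (V 2) (fImp (An (f (V 6)) (Ng (g (V 6)))) (fEq (V 6) (V 5)))))"

text \<open>The number of vertices is quantified inside the matrix, in variable 2; the shape of the
  word admits at most one value. The rest is the relation \<open>lazy\<close> between the two ends,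
  with size one expressed by existence and uniqueness.\<close>

definition fMatrix :: fm where
  "fMatrix = Xs 2 (Pl (V 0) (N 1)) (An fShape (An (to_fm fFst phi) (An (to_fm fSnd phi)
     (fOr (fAll 5 (V 2) (An (fImp (fFst (V 5)) (fSnd (V 5))) (fImp (fSnd (V 5)) (fFst (V 5)))))
          (An (fJump fFst fSnd) (fJump fSnd fFst))))))"

lemma card_1_iff_ex: "B \<subseteq> {..<n} \<Longrightarrow> card B = 1 \<longleftrightarrow> (\<exists>x<n. x \<in> B \<and> (\<forall>y<n. y \<in> B \<longrightarrow> y = x))" for n :: nat
proof
  assume B: "B \<subseteq> {..<n}"
  show "\<exists>x<n. x \<in> B \<and> (\<forall>y<n. y \<in> B \<longrightarrow> y = x)" if c: "card B = 1"
  proof -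
    obtain x where "B = {x}" using c by (rule card_1_singletonE)
    then show ?thesis using B by auto
  qed
  show "card B = 1" if c: "\<exists>x<n. x \<in> B \<and> (\<forall>y<n. y \<in> B \<longrightarrow> y = x)"
  proof -
    obtain x where "x \<in> B" "\<forall>y<n. y \<in> B \<longrightarrow> y = x" using c by blast
    then have "B = {x}" using B by auto
    then show ?thesis by simp
  qed
qed

lemma well_shaped_unique: "well_shaped w n \<Longrightarrow> well_shaped w n' \<Longrightarrow> n = n'"
  unfolding well_shaped_def by (metis nat_neq_iff)

lemma segment_subset:
  assumes "fst p \<subseteq> {..<n}" "snd p \<subseteq> {..<n}"
  shows "fst (segment L n p x j) \<subseteq> {..<n} \<and> snd (segment L n p x j) \<subseteq> {..<n}"
  by (induction j) (use assms in \<open>auto simp: midpoint_def\<close>)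

lemma fsat_fMatrix:
  assumes w: "well_shaped w n" and A: "A 0 = word_arrays w 0" and e: "e 0 = length w"
  defines "seg \<equiv> segment (length w) n (dec_set w n (n + 1), dec_set w n (2 * n + 1)) (A 1) (length w)"
  shows "fsat A e fMatrix \<longleftrightarrow> lazy (dec_graph w n) (fst seg) (snd seg)"
proof -
  let ?G = "dec_graph w n" and ?e = "e(2 := n)"
  have nL: "n < length w + 1" using w by (simp add: well_shaped_def)
  have sub: "fst seg \<subseteq> {..<n}" "snd seg \<subseteq> {..<n}"
    unfolding seg_def using segment_subset[of "(dec_set w n (n + 1), dec_set w n (2 * n + 1))" n]
      decode(3)[OF w] by auto
  have mem: "fsat A e' (fFst t) \<longleftrightarrow> tval e' t \<in> fst seg" "fsat A e' (fSnd t) \<longleftrightarrow> tval e' t \<in> snd seg"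
    if "e' 0 = length w" "e' 2 = n" "tval e' t < n" "\<exists>x. t = V x \<and> 5 \<le> x" for e' t
    using that fsat_ends[where w = w and n = n and A = A, OF w A] unfolding seg_def by auto
  have ph: "fsat A ?e (to_fm fFst phi) \<longleftrightarrow> models ?G phi 0 (fst seg)" "fsat A ?e (to_fm fSnd phi) \<longleftrightarrow> models ?G phi 0 (snd seg)"
  proof -
    have *: "fsat A ?e (to_fm m phi) \<longleftrightarrow> models ?G phi 0 S"
      if "\<And>e' t. e' 0 = length w \<Longrightarrow> e' 2 = n \<Longrightarrow> tval e' t < n \<Longrightarrow> (\<exists>x. t = V x \<and> 5 \<le> x) \<Longrightarrow> fsat A e' (m t) \<longleftrightarrow> tval e' t \<in> S" for m S
    proof -
      have "fsat A ?e (to_fm m phi) \<longleftrightarrow> sat ?G (\<lambda>x. ?e (x + 10)) ((\<lambda>_. {})(0 := S)) phi"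
        by (rule fsat_to_fm[where w = w and n = n and A = A, OF w A]) (use that first_order_phi e in \<open>auto simp: free_vertex_phi\<close>)
      also have "\<dots> \<longleftrightarrow> models ?G phi 0 S"
        unfolding models_def by (rule sat_cong_free) (auto simp: free_vertex_phi)
      finally show ?thesis .
    qed
    show "fsat A ?e (to_fm fFst phi) \<longleftrightarrow> models ?G phi 0 (fst seg)" by (rule *) (rule mem)
    show "fsat A ?e (to_fm fSnd phi) \<longleftrightarrow> models ?G phi 0 (snd seg)" by (rule *) (rule mem)
  qed
  have F: "fsat A e' (fFst (V x)) \<longleftrightarrow> e' x \<in> fst seg" "fsat A e' (fSnd (V x)) \<longleftrightarrow> e' x \<in> snd seg"
    if "e' 0 = length w" "e' 2 = n" "e' x < n" "5 \<le> x" for e' x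
    using mem[of e' "V x"] that by auto
  have eq: "(\<forall>i<n. (i \<in> fst seg \<longrightarrow> i \<in> snd seg) \<and> (i \<in> snd seg \<longrightarrow> i \<in> fst seg)) \<longleftrightarrow> fst seg = snd seg"
    using sub by auto
  have j1: "fsat A ?e (fJump fFst fSnd) \<longleftrightarrow> card (fst seg - snd seg) = 1"
  proof -
    have "fst seg - snd seg \<subseteq> {..<n}" using sub by blast
    from card_1_iff_ex[OF this] show ?thesis
      by (simp add: fJump_def F e cong: conj_cong)
  qed
  have j2: "fsat A ?e (fJump fSnd fFst) \<longleftrightarrow> card (snd seg - fst seg) = 1"
  proof -
    have "snd seg - fst seg \<subseteq> {..<n}" using sub by blast
    from card_1_iff_ex[OF this] show ?thesis
      by (simp add: fJump_def F e cong: conj_cong)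
  qed
  have only: "i = n" if "fsat A (e(2 := i)) fShape" for i
    using that fsat_fShape[of "e(2 := i)" w A] e A well_shaped_unique[OF _ w] by simp
  have "fsat A e fMatrix \<longleftrightarrow> fsat A ?e (An fShape (An (to_fm fFst phi) (An (to_fm fSnd phi)
     (fOr (fAll 5 (V 2) (An (fImp (fFst (V 5)) (fSnd (V 5))) (fImp (fSnd (V 5)) (fFst (V 5)))))
          (An (fJump fFst fSnd) (fJump fSnd fFst))))))" (is "_ \<longleftrightarrow> fsat A ?e ?f")
  proof -
    have "fsat A e fMatrix \<longleftrightarrow> (\<exists>i<length w + 1. fsat A (e(2 := i)) ?f)" using e by (simp add: fMatrix_def)
    moreover have "i = n" if "fsat A (e(2 := i)) ?f" for i using only that by simp
    ultimately show ?thesis using nL by metis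
  qed
  also have "\<dots> \<longleftrightarrow> models ?G phi 0 (fst seg) \<and> models ?G phi 0 (snd seg) \<and>
     ((\<forall>i<n. (i \<in> fst seg \<longrightarrow> i \<in> snd seg) \<and> (i \<in> snd seg \<longrightarrow> i \<in> fst seg)) \<or>
      card (fst seg - snd seg) = 1 \<and> card (snd seg - fst seg) = 1)"
    using fsat_fShape[of ?e w A] e A w by (simp add: ph j1 j2 F)
  also have "\<dots> \<longleftrightarrow> lazy ?G (fst seg) (snd seg)"
    unfolding lazy_def tj_ok_def jump_def eq decode(2)[OF w] using sub by auto
  finally show ?thesis .
qed

text \<open>Recursion depth \<open>L\<close>, the input length, is sufficient because a well-shaped
  word has length \<open>3 * n + 1 + n * n\<close>, which is at least \<open>2 * n\<close>.\<close>

theorem yes_instances_PSPACE: "msor1_yes_instances phi 0 (forest_of_depth 3) \<in> PSPACE"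
proof -
  \<comment> \<open>Universal are exactly the positions congruent to \<open>L\<close> modulo
    \<open>L + 1\<close>, the choices between halves; there are \<open>L\<close> levels of
    \<open>L + 1\<close> variables each.\<close>
  let ?\<upsilon> = "Xs 3 (Pl (V 1) (N 1)) (fEq (V 1) (Pl (Ti (V 3) (Pl (V 0) (N 1))) (V 0)))"
  let ?cnt = "Ti (V 0) (Pl (V 0) (N 1))"
  have arr: "farrs (fFst t) \<subseteq> {0, 1}" "farrs (fSnd t) \<subseteq> {0, 1}" for t by (auto simp: fFst_def fSnd_def)
  have am: "farrs fMatrix \<subseteq> {0, 1}"
    using arr farrs_to_fm[of fFst phi, OF arr(1)] farrs_to_fm[of fSnd phi, OF arr(2)]
    by (simp add: fMatrix_def fShape_def fJump_def)
  moreover have "{0, 1} \<subseteq> {..<3::nat}" by auto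
  ultimately obtain m0 where "fbelow m0 fMatrix" using ex_fbelow[of fMatrix] by (meson subset_trans)
  then have m: "fbelow (m0 + 4) fMatrix" by (rule fbelow_mono) simp
  have U: "fsat (word_arrays w) (env L k) ?\<upsilon> \<longleftrightarrow> k mod (L + 1) = L" for w L k
  proof -
    have "fsat (word_arrays w) (env L k) ?\<upsilon> \<longleftrightarrow> (\<exists>q<k + 1. k = q * (L + 1) + L)" by (simp add: env_def)
    also have "\<dots> \<longleftrightarrow> k mod (L + 1) = L"
    proof
      assume "\<exists>q<k + 1. k = q * (L + 1) + L"
      then obtain q where "k = q * (L + 1) + L" by blast
      then show "k mod (L + 1) = L" by (simp only: mod_mult_self3) simp
    next
      assume "k mod (L + 1) = L"
      then have "k = (k div (L + 1)) * (L + 1) + L" using div_mult_mod_eq[of k "L + 1"] by simp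
      moreover have "k div (L + 1) < k + 1" using div_le_dividend[of k "L + 1"] by (simp add: le_imp_less_Suc)
      ultimately show "\<exists>q<k + 1. k = q * (L + 1) + L" by blast
    qed
    finally show ?thesis .
  qed
  have "w \<in> msor1_yes_instances phi 0 (forest_of_depth 3) \<longleftrightarrow>
     qev (\<lambda>k. fsat (word_arrays w) (env (length w) k) ?\<upsilon>)
             (\<lambda>x. fsat ((word_arrays w)(1 := x)) (env (length w) 0) fMatrix)
             (tval (env (length w) 0) ?cnt) 0 (\<lambda>_. 0)" for w
  proof (cases "\<exists>n. well_shaped w n")
    case True
    then obtain n where n: "well_shaped w n" by blast
    let ?L = "length w" and ?G = "dec_graph w n" and ?S = "dec_set w n (n + 1)" and ?T = "dec_set w n (2 * n + 1)"
    have L: "n \<le> ?L" "2 * n \<le> ?L" using n by (simp_all add: well_shaped_def)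
    have M: "fsat ((word_arrays w)(1 := x)) (env ?L 0) fMatrix \<longleftrightarrow>
       lazy ?G (fst (segment ?L n (?S, ?T) x ?L)) (snd (segment ?L n (?S, ?T) x ?L))" for x
      using fsat_fMatrix[OF n, of "(word_arrays w)(1 := x)" "env ?L 0"] by (simp add: env_def)
    have c: "tval (env ?L 0) ?cnt = ?L * (?L + 1)" by (simp add: env_def)
    have q: "qev (\<lambda>k. fsat (word_arrays w) (env ?L k) ?\<upsilon>) (\<lambda>x. fsat ((word_arrays w)(1 := x)) (env ?L 0) fMatrix)
             (tval (env ?L 0) ?cnt) 0 (\<lambda>_. 0) \<longleftrightarrow> savitch ?G ?L (?S, ?T)"
    proof -
      have "qev (\<lambda>k. fsat (word_arrays w) (env ?L k) ?\<upsilon>) (\<lambda>x. fsat ((word_arrays w)(1 := x)) (env ?L 0) fMatrix)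
             (?L * (?L + 1)) (0 * (?L + 1)) (\<lambda>_. 0) \<longleftrightarrow> savitch ?G ?L (segment ?L n (?S, ?T) (\<lambda>_. 0) 0)"
        by (rule qev_savitch[OF L(1) decode(2)[OF n]]) (rule U, rule M, simp)
      then show ?thesis unfolding c by simp
    qed
    have "savitch ?G ?L (?S, ?T) \<longleftrightarrow> tj_ok ?G ?S \<and> (tj_step ?G)\<^sup>*\<^sup>* ?S ?T"
    proof (cases "tj_ok ?G ?S")
      case True
      then show ?thesis using savitch_reach[OF decode(2)[OF n] L(2)] by blast
    next
      case False
      obtain k where "(2::nat) ^ ?L = Suc k" by (metis not0_implies_Suc power_not_zero zero_neq_numeral)
      then have "\<not> savitch ?G ?L (?S, ?T)" unfolding savitch_relpowp using False
        by (auto simp: lazy_def simp del: relpowp.simps(2) dest!: relpowp_Suc_D2)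
      then show ?thesis using False by blast
    qed
    then show ?thesis
      unfolding yes_instances_iff q using n well_shaped_unique[OF n] by blast
  next
    case False
    \<comment> \<open>A word of the wrong shape satisfies the matrix for no assignment, hence no
      quantifier prefix makes it true.\<close>
    have nm: "\<not> fsat ((word_arrays w)(1 := x)) (env (length w) 0) fMatrix" for x
    proof
      assume "fsat ((word_arrays w)(1 := x)) (env (length w) 0) fMatrix"
      then obtain i where "fsat ((word_arrays w)(1 := x)) ((env (length w) 0)(2 := i)) fShape"
        by (auto simp: fMatrix_def)
      then show False
        using fsat_fShape[of "(env (length w) 0)(2 := i)" w "(word_arrays w)(1 := x)"] False by (auto simp: env_def)
    qed
    have nq: "\<not> qev U M d k x" if "\<And>x. \<not> M x" for U M d k x
      using that by (induction d arbitrary: k x) auto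
    have "\<not> qev (\<lambda>k. fsat (word_arrays w) (env (length w) k) ?\<upsilon>)
             (\<lambda>x. fsat ((word_arrays w)(1 := x)) (env (length w) 0) fMatrix)
             (tval (env (length w) 0) ?cnt) 0 (\<lambda>_. 0)"
      by (rule nq) (rule nm)
    moreover have "w \<notin> msor1_yes_instances phi 0 (forest_of_depth 3)"
      unfolding yes_instances_iff using False by blast
    ultimately show ?thesis by (simp only:)
  qed
  then have "msor1_yes_instances phi 0 (forest_of_depth 3) = {w.
     qev (\<lambda>k. fsat (word_arrays w) (env (length w) k) ?\<upsilon>)
             (\<lambda>x. fsat ((word_arrays w)(1 := x)) (env (length w) 0) fMatrix)
             (tval (env (length w) 0) ?cnt) 0 (\<lambda>_. 0)}" by blast
  moreover have "\<dots> \<in> PSPACE"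
    by (rule PSPACE_by_qbf[OF m am]) (auto simp: fEq_def)
  ultimately show ?thesis by simp
qed

section \<open>Deterministic variable machines and reversible toggling\<close>

text \<open>A deterministic machine with finitely many variables: in control state \<open>c\<close> it looks at variable \<open>i\<close>, and
  if that has value \<open>v\<close>, replaces it by \<open>v'\<close> and goes to control state \<open>c'\<close>.\<close>

locale var_machine =
  fixes I :: "nat \<Rightarrow> nat \<Rightarrow> nat \<Rightarrow> nat \<Rightarrow> nat \<Rightarrow> bool" and m g H :: nat
  assumes det_var: "I c i v c' v' \<Longrightarrow> I c j u d' u' \<Longrightarrow> i = j"
    and det: "I c i v c' v' \<Longrightarrow> I c i v d' u' \<Longrightarrow> c' = d' \<and> v' = u'"
    and range: "I c i v c' v' \<Longrightarrow> c < H \<and> c' < H \<and> i < m \<and> v < g \<and> v' < g \<and> v + g * c < H"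
begin

definition bstep :: "nat \<times> (nat \<Rightarrow> nat) \<Rightarrow> nat \<times> (nat \<Rightarrow> nat) \<Rightarrow> bool" where
  "bstep p p' \<longleftrightarrow> (\<exists>i v'. I (fst p) i (snd p i) (fst p') v' \<and> snd p' = (snd p)(i := v'))"

text \<open>Control state \<open>c\<close> is the cell \<open>(0, c)\<close>, the value \<open>v\<close> of variable \<open>i\<close> the cell \<open>(1, v + g * i)\<close>, and the link
  \<open>(2, v + g * c)\<close> records that the instruction for value \<open>v\<close> in state \<open>c\<close> is not being executed.\<close>

definition facts :: "(nat \<Rightarrow> nat) \<Rightarrow> nat set \<Rightarrow> (nat \<times> nat) set" where
  "facts x A = (\<lambda>i. (1, x i + g * i)) ` A"

definition conf :: "nat \<times> (nat \<Rightarrow> nat) \<Rightarrow> (nat \<times> nat) set" where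
  "conf p = insert (0, fst p) (facts (snd p) {..<m} \<union> Pair 2 ` {..<H})"

text \<open>The position halfway through an instruction: control state and value of variable
  \<open>i\<close> are both absent, and the missing link \<open>l\<close> alone tells which
  instruction is being executed.\<close>

definition mid :: "(nat \<Rightarrow> nat) \<Rightarrow> nat \<Rightarrow> nat \<Rightarrow> (nat \<times> nat) set" where
  "mid x i l = facts x ({..<m} - {i}) \<union> Pair 2 ` ({..<H} - {l})"

definition triple :: "nat \<Rightarrow> nat \<Rightarrow> nat \<Rightarrow> (nat \<times> nat) set" where
  "triple c f l = {(0, c), (1, f), (2, l)}"

text \<open>Every instruction gives two triples with the same link: the old state and value, whose
  removal begins it, and the new state and value, whose addition completes it. Either can also be
  applied in the opposite sense.\<close>

definition reaction :: "nat \<Rightarrow> nat \<Rightarrow> nat \<Rightarrow> bool" where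
  "reaction c f l \<longleftrightarrow> (\<exists>c0 i v c' v'. I c0 i v c' v' \<and> l = v + g * c0 \<and>
     (c = c0 \<and> f = v + g * i \<or> c = c' \<and> f = v' + g * i))"

definition toggle :: "(nat \<times> nat) set \<Rightarrow> (nat \<times> nat) set \<Rightarrow> bool" where
  "toggle F F' \<longleftrightarrow> (\<exists>c f l. reaction c f l \<and>
     (triple c f l \<subseteq> F \<and> F' = F - triple c f l \<or> triple c f l \<subseteq> F' \<and> F = F' - triple c f l))"

definition valid :: "nat \<times> (nat \<Rightarrow> nat) \<Rightarrow> bool" where
  "valid p \<longleftrightarrow> (\<forall>i. snd p i < g) \<and> (\<forall>i\<ge>m. snd p i = 0)"

lemma bstep_valid: "bstep p p' \<Longrightarrow> valid p \<Longrightarrow> valid p'"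
  unfolding bstep_def valid_def using range by fastforce

lemma code_inj: "v < g \<Longrightarrow> u < g \<Longrightarrow> v + g * i = u + g * j \<Longrightarrow> v = u \<and> i = j"
proof -
  assume *: "v < g" "u < g" "v + g * i = u + g * j"
  have "(v + g * i) mod g = v" "(u + g * j) mod g = u" "(v + g * i) div g = i" "(u + g * j) div g = j" using *(1,2) by auto
  then show ?thesis using *(3) by metis
qed

lemma conf_minus_triple:
  assumes "valid (c, x)" "i < m" "l < H"
  shows "conf (c, x) - triple c (x i + g * i) l = mid x i l" "triple c (x i + g * i) l \<subseteq> conf (c, x)"
    "conf (c, x) = mid x i l \<union> triple c (x i + g * i) l"
proof -
  have inj: "x j + g * j = x i + g * i \<longleftrightarrow> j = i" for j
    using code_inj[of "x j" "x i" j i] assms(1) by (auto simp: valid_def)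
  have inj': "x i + g * i = x j + g * j \<longleftrightarrow> j = i" for j using inj[of j] by metis
  show "conf (c, x) - triple c (x i + g * i) l = mid x i l"
    unfolding conf_def mid_def triple_def facts_def by (auto simp: inj inj')
  show "triple c (x i + g * i) l \<subseteq> conf (c, x)"
    unfolding conf_def triple_def facts_def using assms by auto
  show "conf (c, x) = mid x i l \<union> triple c (x i + g * i) l"
    unfolding conf_def mid_def triple_def facts_def using assms by (auto simp: inj inj')
qed

lemma mid_upd: "mid (x(i := v)) i l = mid x i l"
  unfolding mid_def facts_def by auto

lemma conf_inj: "valid p \<Longrightarrow> valid p' \<Longrightarrow> conf p = conf p' \<Longrightarrow> p = p'"
proof -
  assume v: "valid p" "valid p'" and e: "conf p = conf p'"
  have 0: "(0, c) \<in> conf p \<longleftrightarrow> c = fst p" "(0, c) \<in> conf p' \<longleftrightarrow> c = fst p'" for c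
    by (auto simp: conf_def facts_def)
  have "fst p = fst p'" using 0 e by blast
  moreover have "snd p i = snd p' i" for i
  proof (cases "i < m")
    case True
    then have "(1, snd p i + g * i) \<in> conf p'" using e[symmetric] by (auto simp: conf_def facts_def)
    then obtain j where "snd p i + g * i = snd p' j + g * j" by (auto simp: conf_def facts_def)
    then show ?thesis using code_inj[of "snd p i" "snd p' j" i j] v by (auto simp: valid_def)
  qed (use v in \<open>simp add: valid_def\<close>)
  ultimately show ?thesis by (simp add: prod_eq_iff fun_eq_iff)
qed

lemma bstep_toggles: "bstep p p' \<Longrightarrow> valid p \<Longrightarrow> toggle\<^sup>*\<^sup>* (conf p) (conf p')"
proof -
  assume b: "bstep p p'" and v: "valid p"
  obtain c x c' x' where p: "p = (c, x)" "p' = (c', x')" by (cases p, cases p')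
  obtain i v' where I: "I c i (x i) c' v'" "x' = x(i := v')" using b unfolding p bstep_def by auto
  let ?l = "x i + g * c"
  note r = range[OF I(1)]
  have v0: "valid (c, x)" using v p(1) by simp
  have v': "valid (c', x')" using bstep_valid[OF b v] p by simp
  have i: "i < m" "?l < H" using r by auto
  have xi: "x' i = v'" using I(2) by simp
  have 0: "reaction c (x i + g * i) ?l" "reaction c' (x' i + g * i) ?l"
    unfolding reaction_def xi using I(1) by blast+
  have 1: "toggle (conf (c, x)) (mid x i ?l)"
    unfolding toggle_def using 0(1) conf_minus_triple(1,2)[OF v0 i] by metis
  have mm: "mid x' i ?l = mid x i ?l" unfolding I(2) by (rule mid_upd)
  have 2: "toggle (mid x i ?l) (conf (c', x'))"
    unfolding toggle_def using 0(2) conf_minus_triple(1,2)[OF v' i] unfolding mm by metis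
  show ?thesis unfolding p using 1 2 by (rule converse_rtranclp_into_rtranclp[OF _ r_into_rtranclp])
qed

definition sym_step :: "nat \<times> (nat \<Rightarrow> nat) \<Rightarrow> nat \<times> (nat \<Rightarrow> nat) \<Rightarrow> bool" where
  "sym_step p p' \<longleftrightarrow> valid p \<and> valid p' \<and> (bstep p p' \<or> bstep p' p)"

text \<open>The invariant of toggling: only configurations joined to \<open>p0\<close> by steps in
  both directions, and the midpoints of their own instructions, ever arise.\<close>

definition covered :: "nat \<times> (nat \<Rightarrow> nat) \<Rightarrow> (nat \<times> nat) set \<Rightarrow> bool" where
  "covered p0 F \<longleftrightarrow> (\<exists>c x. sym_step\<^sup>*\<^sup>* p0 (c, x) \<and> valid (c, x) \<and> (F = conf (c, x) \<or>
     (\<exists>i c' v'. I c i (x i) c' v' \<and> F = mid x i (x i + g * c))))"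

lemma covered_toggle:
  assumes "covered p0 F" "toggle F F'"
  shows "covered p0 F'"
proof -
  obtain c x where cx: "sym_step\<^sup>*\<^sup>* p0 (c, x)" "valid (c, x)" "F = conf (c, x) \<or>
     (\<exists>i c' v'. I c i (x i) c' v' \<and> F = mid x i (x i + g * c))" using assms(1) unfolding covered_def by blast
  obtain c1 f l where t: "reaction c1 f l" "triple c1 f l \<subseteq> F \<and> F' = F - triple c1 f l \<or> triple c1 f l \<subseteq> F' \<and> F = F' - triple c1 f l"
    using assms(2) unfolding toggle_def by blast
  obtain c0 i v c' v' where I: "I c0 i v c' v'" "l = v + g * c0" "c1 = c0 \<and> f = v + g * i \<or> c1 = c' \<and> f = v' + g * i"
    using t(1) unfolding reaction_def by blast
  note r = range[OF I(1)]
  have lH: "l < H" using r I(2) by simp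
  have xg: "x j < g" for j using cx(2) by (simp add: valid_def)
  show ?thesis
    using cx(3)
  proof
    assume F: "F = conf (c, x)"
    \<comment> \<open>All links are present in a configuration, so the toggle must remove its
      triple.\<close>
    have "(2, l) \<in> F" unfolding F conf_def using lH by auto
    then have rem: "triple c1 f l \<subseteq> F" "F' = F - triple c1 f l" using t(2) unfolding triple_def by blast+
    have "(0, c1) \<in> F" "(1, f) \<in> F" using rem(1) unfolding triple_def by auto
    then have c1: "c1 = c" and "\<exists>j<m. f = x j + g * j" unfolding F conf_def facts_def by auto
    then obtain j where j: "j < m" "f = x j + g * j" by blast
    show ?thesis
      using I(3)
    proof
      assume *: "c1 = c0 \<and> f = v + g * i"
      then have "x j = v \<and> j = i" using code_inj[of "x j" v j i] xg r j(2) by simp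
      then have "F' = mid x i l" "I c i (x i) c' v'" "l = x i + g * c"
        using conf_minus_triple(1)[OF cx(2), of i l] rem(2) j * c1 lH I unfolding F by auto
      then show ?thesis unfolding covered_def using cx(1,2) by blast
    next
      assume *: "c1 = c' \<and> f = v' + g * i"
      then have ji: "x j = v' \<and> j = i" using code_inj[of "x j" v' j i] xg r j(2) by simp
      let ?y = "x(i := v)"
      have y: "valid (c0, ?y)" using cx(2) r unfolding valid_def by auto
      have "bstep (c0, ?y) (c, x)"
        unfolding bstep_def using I(1) * c1 ji by (intro exI[of _ i] exI[of _ v']) auto
      then have "sym_step (c, x) (c0, ?y)" using y cx(2) unfolding sym_step_def by blast
      then have s: "sym_step\<^sup>*\<^sup>* p0 (c0, ?y)" using cx(1) by (rule rtranclp.rtrancl_into_rtrancl[rotated])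
      have "F' = mid x i l"
        using conf_minus_triple(1)[OF cx(2), of i l] rem(2) j ji c1 lH unfolding F by auto
      then have "F' = mid ?y i (?y i + g * c0)" unfolding mid_upd using I(2) by simp
      moreover have "I c0 i (?y i) c' v'" using I(1) by simp
      ultimately show ?thesis unfolding covered_def using s y by blast
    qed
  next
    assume "\<exists>i c' v'. I c i (x i) c' v' \<and> F = mid x i (x i + g * c)"
    then obtain i2 c2 v2 where I2: "I c i2 (x i2) c2 v2" and F: "F = mid x i2 (x i2 + g * c)" by blast
    note r2 = range[OF I2]
    \<comment> \<open>No control cell is present at a midpoint, so the toggle must add its triple;
      the one missing link determines the instruction, which is then either undone or
      completed.\<close>
    have "(0, c1) \<notin> F" unfolding F mid_def facts_def by auto
    then have add: "triple c1 f l \<subseteq> F'" "F = F' - triple c1 f l" using t(2) unfolding triple_def by blast+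
    then have F': "F' = F \<union> triple c1 f l" by blast
    have "(2, l) \<notin> F" using add(2) unfolding triple_def by blast
    then have "v + g * c0 = x i2 + g * c" unfolding F mid_def using lH I(2) by auto
    then have e: "v = x i2" "c0 = c" using code_inj[of v "x i2" c0 c] r xg by auto
    then have i: "i2 = i" using det_var[OF I(1)] I2 by blast
    have e2: "c2 = c'" "v2 = v'" using det[of c i v c2 v2 c' v'] I2 I(1) e i by auto
    have l: "l = x i + g * c" using I(2) e i by simp
    show ?thesis
      using I(3)
    proof
      assume *: "c1 = c0 \<and> f = v + g * i"
      have "F' = conf (c, x)"
        using conf_minus_triple(3)[OF cx(2), of i l] r lH * e i l unfolding F' F by auto
      then show ?thesis unfolding covered_def using cx(1,2) by blast
    next
      assume *: "c1 = c' \<and> f = v' + g * i"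
      let ?y = "x(i := v')"
      have b: "bstep (c, x) (c', ?y)" unfolding bstep_def using I(1) e i by auto
      have y: "valid (c', ?y)" by (rule bstep_valid[OF b cx(2)])
      have "sym_step (c, x) (c', ?y)" using b y cx(2) unfolding sym_step_def by blast
      then have s: "sym_step\<^sup>*\<^sup>* p0 (c', ?y)" using cx(1) by (rule rtranclp.rtrancl_into_rtrancl[rotated])
      have "F' = conf (c', ?y)"
        using conf_minus_triple(3)[OF y, of i l] r lH * i l unfolding F' F by (simp add: mid_upd)
      then show ?thesis unfolding covered_def using s y by blast
    qed
  qed
qed

lemma bstep_det:
  assumes "bstep p q" "bstep p q'"
  shows "q = q'"
proof -
  obtain i v' where I: "I (fst p) i (snd p i) (fst q) v'" "snd q = (snd p)(i := v')"
    using assms(1) unfolding bstep_def by blast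
  obtain j u' where J: "I (fst p) j (snd p j) (fst q') u'" "snd q' = (snd p)(j := u')"
    using assms(2) unfolding bstep_def by blast
  have j: "j = i" by (rule det_var[OF J(1) I(1)])
  have "fst q = fst q' \<and> v' = u'" by (rule det[OF I(1) J(1)[unfolded j]])
  then show ?thesis using I(2) J(2) j by (simp add: prod_eq_iff)
qed

text \<open>Steps backwards bring no new final states: if \<open>z\<close> steps to \<open>y\<close>
  and from \<open>z\<close> the stuck configuration \<open>pf\<close> can be reached, then by
  determinism the way from \<open>z\<close> to \<open>pf\<close> leads through
  \<open>y\<close>.\<close>

lemma toggle_reach_iff:
  assumes p0: "valid p0" and pf: "valid pf" and stop: "\<And>i v c' v'. \<not> I (fst pf) i v c' v'"
  shows "toggle\<^sup>*\<^sup>* (conf p0) (conf pf) \<longleftrightarrow> bstep\<^sup>*\<^sup>* p0 pf"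
proof
  assume "bstep\<^sup>*\<^sup>* p0 pf"
  then have "toggle\<^sup>*\<^sup>* (conf p0) (conf pf) \<and> valid pf"
    using p0
  proof (induction rule: rtranclp_induct)
    case (step y z)
    then show ?case using bstep_toggles bstep_valid by (meson rtranclp_trans)
  qed simp
  then show "toggle\<^sup>*\<^sup>* (conf p0) (conf pf)" ..
next
  assume t: "toggle\<^sup>*\<^sup>* (conf p0) (conf pf)"
  have "covered p0 (conf p0)" unfolding covered_def using p0 by (metis rtranclp.rtrancl_refl surj_pair)
  with t have "covered p0 (conf pf)"
    by (induction rule: rtranclp_induct) (auto intro: covered_toggle)
  then obtain c x where cx: "sym_step\<^sup>*\<^sup>* p0 (c, x)" "valid (c, x)" "conf pf = conf (c, x) \<or>
     (\<exists>i c' v'. I c i (x i) c' v' \<and> conf pf = mid x i (x i + g * c))" unfolding covered_def by blast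
  have "(0, fst pf) \<in> conf pf" by (simp add: conf_def)
  then have "conf pf \<noteq> mid x i l" for i l by (auto simp: mid_def facts_def)
  then have "pf = (c, x)" using cx(3) conf_inj[OF pf cx(2)] by blast
  then have "sym_step\<^sup>*\<^sup>* p0 pf" using cx(1) by simp
  then show "bstep\<^sup>*\<^sup>* p0 pf"
  proof (induction rule: converse_rtranclp_induct)
    case (step y z)
    show ?case
    proof (cases "bstep y z")
      case True
      then show ?thesis using step by (meson converse_rtranclp_into_rtranclp)
    next
      case False
      then have zy: "bstep z y" using step(1) unfolding sym_step_def by blast
      obtain i v' where "I (fst z) i (snd z i) (fst y) v'" using zy unfolding bstep_def by blast
      then have "z \<noteq> pf" using stop[of i "snd z i" "fst y" v'] by auto
      then obtain y' where y': "bstep z y'" "bstep\<^sup>*\<^sup>* y' pf" using step(3) by (auto elim: converse_rtranclpE)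
      then show ?thesis using bstep_det[OF y'(1) zy] by simp
    qed
  qed simp
qed

lemma bstep_terminal_unique:
  assumes "bstep\<^sup>*\<^sup>* p q" "bstep\<^sup>*\<^sup>* p q'" "\<And>r. \<not> bstep q r" "\<And>r. \<not> bstep q' r"
  shows "q = q'"
  using assms(1,2)
proof (induction rule: converse_rtranclp_induct)
  case base
  then show ?case using assms(3) by (meson converse_rtranclpE)
next
  case (step y z)
  then show ?case using assms(4) bstep_det by (metis converse_rtranclpE)
qed

end

section \<open>Simulating a Turing machine by a variable machine\<close>

datatype ctl = Rd nat "nat list" | Wt nat "(nat \<times> move) list"

text \<open>The tape in turn is found by counting: as many tapes have been read as \<open>ss\<close>
  is long, and as many remain to be written as \<open>acts\<close> is long.\<close>

fun ctl_tape :: "nat \<Rightarrow> ctl \<Rightarrow> nat" where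
  "ctl_tape k (Rd q ss) = length ss"
| "ctl_tape k (Wt q acts) = k - length acts"

text \<open>One step of a machine is split into \<open>k\<close> steps that read one tape each and \<open>k\<close> steps that write one tape each.\<close>

fun ctl_trans :: "tm \<Rightarrow> ctl \<Rightarrow> nat \<Rightarrow> ctl \<times> nat \<times> move" where
  "ctl_trans M (Rd q ss) v = (let ss' = ss @ [v] in
     (if length ss' < tm_tapes M then Rd q ss' else (case tm_delta M q ss' of (q', acts) \<Rightarrow> Wt q' acts), v, Stay))"
| "ctl_trans M (Wt q acts) v =
     (if tl acts = [] then Rd q [] else Wt q (tl acts), fst (hd acts), snd (hd acts))"

definition ctls :: "tm \<Rightarrow> ctl set" where
  "ctls M = {Rd q ss |q ss. q < tm_states M \<and> set ss \<subseteq> {..<tm_symbols M} \<and> length ss < tm_tapes M} \<union>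
     {Wt q acts |q acts. q < tm_states M \<and> set acts \<subseteq> {..<tm_symbols M} \<times> UNIV \<and> length acts \<le> tm_tapes M \<and> acts \<noteq> []}"

definition ctl_halt :: "tm \<Rightarrow> ctl \<Rightarrow> bool" where
  "ctl_halt M f \<longleftrightarrow> f = Rd (tm_accept M) [] \<or> f = Rd (tm_reject M) []"

lemma finite_moves: "finite (UNIV :: move set)"
proof -
  have "(UNIV :: move set) = {Left, Stay, Right}" by (auto intro: move.exhaust)
  then show ?thesis by (metis finite.emptyI finite.insertI)
qed

lemma finite_ctls: "finite (ctls M)"
proof -
  have "finite {ss. set ss \<subseteq> {..<tm_symbols M} \<and> length ss \<le> tm_tapes M}"
    by (rule finite_lists_length_le) simp
  moreover have "finite {acts. set acts \<subseteq> {..<tm_symbols M} \<times> (UNIV :: move set) \<and> length acts \<le> tm_tapes M}"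
    by (rule finite_lists_length_le) (simp add: finite_moves)
  ultimately have "finite ((\<lambda>(q, ss). Rd q ss) ` ({..<tm_states M} \<times> {ss. set ss \<subseteq> {..<tm_symbols M} \<and> length ss \<le> tm_tapes M}) \<union>
     (\<lambda>(q, acts). Wt q acts) ` ({..<tm_states M} \<times> {acts. set acts \<subseteq> {..<tm_symbols M} \<times> (UNIV :: move set) \<and> length acts \<le> tm_tapes M}))"
    by simp
  then show ?thesis by (rule rev_finite_subset) (auto simp: ctls_def)
qed

lemma ctl_trans_wf:
  assumes wf: "wf_tm M" and f: "f \<in> ctls M" and v: "v < tm_symbols M"
  shows "fst (ctl_trans M f v) \<in> ctls M" "fst (snd (ctl_trans M f v)) < tm_symbols M" "ctl_tape (tm_tapes M) f < tm_tapes M"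
proof -
  have k: "1 \<le> tm_tapes M" using wf by (simp add: wf_tm_def)
  have d: "fst (tm_delta M q ss) < tm_states M \<and> length (snd (tm_delta M q ss)) = tm_tapes M \<and>
      set (snd (tm_delta M q ss)) \<subseteq> {..<tm_symbols M} \<times> UNIV"
    if "q < tm_states M" "length ss = tm_tapes M" "set ss \<subseteq> {..<tm_symbols M}" for q ss
  proof -
    have all: "\<forall>q<tm_states M. \<forall>ss. length ss = tm_tapes M \<and> (\<forall>s\<in>set ss. s < tm_symbols M) \<longrightarrow>
        (case tm_delta M q ss of (q', acts) \<Rightarrow>
           q' < tm_states M \<and> length acts = tm_tapes M \<and> (\<forall>(s, d)\<in>set acts. s < tm_symbols M))"
      using wf unfolding wf_tm_def by (elim conjE)
    have "length ss = tm_tapes M \<and> (\<forall>s\<in>set ss. s < tm_symbols M)" using that by auto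
    from mp[OF spec[OF mp[OF spec[OF all] that(1)]] this]
    show ?thesis by (auto simp: case_prod_beta)
  qed
  show "fst (ctl_trans M f v) \<in> ctls M"
  proof (cases f)
    case (Rd q ss)
    then have q: "q < tm_states M" "set ss \<subseteq> {..<tm_symbols M}" "length ss < tm_tapes M" using f by (auto simp: ctls_def)
    show ?thesis
    proof (cases "length (ss @ [v]) < tm_tapes M")
      case True
      then show ?thesis using Rd q v by (simp add: ctls_def)
    next
      case False
      then have "length (ss @ [v]) = tm_tapes M" using q(3) by simp
      then have "fst (tm_delta M q (ss @ [v])) < tm_states M \<and> length (snd (tm_delta M q (ss @ [v]))) = tm_tapes M \<and>
        set (snd (tm_delta M q (ss @ [v]))) \<subseteq> {..<tm_symbols M} \<times> UNIV" using d[of q "ss @ [v]"] q v by simp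
      then show ?thesis using Rd False k by (auto simp: ctls_def case_prod_beta Let_def)
    qed
  next
    case (Wt q acts)
    then have "q < tm_states M" "set acts \<subseteq> {..<tm_symbols M} \<times> UNIV" "length acts \<le> tm_tapes M" "acts \<noteq> []"
      using f by (auto simp: ctls_def)
    then show ?thesis using Wt k by (cases acts) (auto simp: ctls_def)
  qed
  show "fst (snd (ctl_trans M f v)) < tm_symbols M"
    using f v by (cases f) (auto simp: ctls_def Let_def neq_Nil_conv)
  show "ctl_tape (tm_tapes M) f < tm_tapes M"
    using f k by (cases f) (auto simp: ctls_def Suc_le_eq neq_Nil_conv)
qed

definition micro :: "tm \<Rightarrow> ctl \<times> tape list \<Rightarrow> ctl \<times> tape list" where
  "micro M p = (let j = ctl_tape (tm_tapes M) (fst p); T = snd p; r = ctl_trans M (fst p) (head_sym (T ! j))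
     in (fst r, T[j := act (T ! j) (snd r)]))"

lemma act_stay: "act tp (head_sym tp, Stay) = tp"
  by (cases tp) (simp add: head_sym_def)

lemma micro_read:
  assumes "length T = tm_tapes M" "j < tm_tapes M"
  shows "(micro M ^^ j) (Rd q [], T) = (Rd q (map head_sym (take j T)), T)"
  using assms(2)
proof (induction j)
  case (Suc j)
  then show ?case
    using assms(1) by (simp add: micro_def Let_def act_stay take_Suc_conv_app_nth)
qed simp

lemma micro_last_read:
  assumes "length T = tm_tapes M" "1 \<le> tm_tapes M"
  shows "(micro M ^^ tm_tapes M) (Rd q [], T) =
     (Wt (fst (tm_delta M q (map head_sym T))) (snd (tm_delta M q (map head_sym T))), T)"
proof -
  obtain j where j: "tm_tapes M = Suc j" using assms(2) by (cases "tm_tapes M") auto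
  have T: "take (Suc j) T = T" using assms(1) j by simp
  have "map head_sym (take j T) @ [head_sym (T ! j)] = map head_sym (take (Suc j) T)"
  proof -
    have "j < length T" using assms(1) j by simp
    from take_Suc_conv_app_nth[OF this] show ?thesis by (simp only: map_append list.map)
  qed
  then have e: "map head_sym (take j T) @ [head_sym (T ! j)] = map head_sym T" unfolding T .
  have "(micro M ^^ tm_tapes M) (Rd q [], T) = micro M ((micro M ^^ j) (Rd q [], T))" unfolding j by simp
  also have "\<dots> = micro M (Rd q (map head_sym (take j T)), T)"
    using micro_read[of T M j q] assms(1) j by simp
  also have "\<dots> = (Wt (fst (tm_delta M q (map head_sym T))) (snd (tm_delta M q (map head_sym T))), T)"
  proof -
    have len: "length (map head_sym (take j T)) = j" using assms(1) j by simp
    show ?thesis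
      unfolding micro_def Let_def fst_conv snd_conv ctl_tape.simps len ctl_trans.simps e
      using assms(1) by (simp add: act_stay case_prod_beta)
  qed
  finally show ?thesis .
qed

lemma micro_Wt:
  assumes "tm_tapes M - Suc (length rest) = length A"
  shows "micro M (Wt q (a # rest), A @ t # B) =
    ((if rest = [] then Rd q [] else Wt q rest), A @ act t a # B)"
  using assms by (simp add: micro_def Let_def)

lemma micro_write:
  assumes "length T = tm_tapes M" "length acts = tm_tapes M" "j \<le> tm_tapes M"
  shows "(micro M ^^ j) (Wt q acts, T) =
    ((if j = tm_tapes M \<and> 0 < j then Rd q [] else Wt q (drop j acts)), map2 act (take j T) (take j acts) @ drop j T)"
  using assms(3)
proof (induction j)
  case (Suc j)
  have j: "j < length acts" "j < length T" using Suc.prems assms by auto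
  have "(micro M ^^ Suc j) (Wt q acts, T) = micro M ((micro M ^^ j) (Wt q acts, T))" by simp
  also have "(micro M ^^ j) (Wt q acts, T) = (Wt q (drop j acts), map2 act (take j T) (take j acts) @ drop j T)"
    using Suc by simp
  also have "drop j acts = acts ! j # drop (Suc j) acts" using j by (simp add: Cons_nth_drop_Suc)
  also have "drop j T = T ! j # drop (Suc j) T" using j by (simp add: Cons_nth_drop_Suc)
  also have "micro M (Wt q (acts ! j # drop (Suc j) acts), map2 act (take j T) (take j acts) @ T ! j # drop (Suc j) T) =
    ((if drop (Suc j) acts = [] then Rd q [] else Wt q (drop (Suc j) acts)),
      map2 act (take j T) (take j acts) @ act (T ! j) (acts ! j) # drop (Suc j) T)"
    by (rule micro_Wt) (use j assms in simp)
  also have "drop (Suc j) acts = [] \<longleftrightarrow> Suc j = tm_tapes M \<and> 0 < Suc j" using j assms(2) Suc.prems by auto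
  also have "map2 act (take j T) (take j acts) @ act (T ! j) (acts ! j) # drop (Suc j) T =
      map2 act (take (Suc j) T) (take (Suc j) acts) @ drop (Suc j) T"
    using j by (simp add: take_Suc_conv_app_nth)
  finally show ?case .
qed simp

primrec num :: "nat \<Rightarrow> nat list \<Rightarrow> nat" where
  "num W [] = 0"
| "num W (d # ds) = d + W * num W ds"

lemma num_less: "(\<And>d. d \<in> set ds \<Longrightarrow> d < W) \<Longrightarrow> num W ds < W ^ length ds"
proof (induction ds)
  case (Cons d ds)
  have "d < W" "num W ds + 1 \<le> W ^ length ds" using Cons by (auto simp: Suc_le_eq)
  then have "d + W * num W ds < W * (num W ds + 1)" by simp
  also have "\<dots> \<le> W * W ^ length ds" using \<open>num W ds + 1 \<le> W ^ length ds\<close> by (rule mult_le_mono2)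
  finally show ?case by simp
qed simp

lemma num_digit: "(\<And>d. d \<in> set ds \<Longrightarrow> d < W) \<Longrightarrow> j < length ds \<Longrightarrow> num W ds div W ^ j mod W = ds ! j"
proof (induction ds arbitrary: j)
  case (Cons d ds)
  have d: "d < W" using Cons.prems by simp
  show ?case
  proof (cases j)
    case (Suc i)
    have "(d + W * num W ds) div W = num W ds" using d by simp
    then have "num W (d # ds) div W ^ j = num W ds div W ^ i"
      unfolding Suc by (simp add: div_mult2_eq)
    then show ?thesis using Cons Suc by simp
  qed (use d in simp)
qed simp

text \<open>Replacing one digit of a little-endian number, stated as an equation of sums to avoid
  subtraction of naturals.\<close>

lemma num_update: "j < length ds \<Longrightarrow> num W (ds[j := x]) + ds ! j * W ^ j = num W ds + x * W ^ j"
proof (induction ds arbitrary: j)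
  case (Cons d ds)
  show ?case
  proof (cases j)
    case (Suc i)
    have "W * (num W (ds[i := x]) + ds ! i * W ^ i) = W * (num W ds + x * W ^ i)" using Cons Suc by simp
    then show ?thesis using Suc by (simp add: algebra_simps)
  qed simp
qed simp

text \<open>A head move on the number of all head positions changes one digit by one; no carry
  arises as long as the new position is still a digit. Written without subtraction for the same
  reason.\<close>

fun shift :: "nat \<Rightarrow> nat \<Rightarrow> move \<Rightarrow> nat \<Rightarrow> nat \<Rightarrow> bool" where
  "shift W j Stay P P' \<longleftrightarrow> P' = P"
| "shift W j Right P P' \<longleftrightarrow> P' = P + W ^ j"
| "shift W j Left P P' \<longleftrightarrow> P = P' + W ^ j"

lemma shift_unique: "shift W j d P P' \<Longrightarrow> shift W j d P P'' \<Longrightarrow> P' = P''"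
  by (cases d) auto

locale coded_machine =
  fixes M :: tm and enc :: "ctl \<Rightarrow> nat" and \<Phi> s :: nat
  assumes wf: "wf_tm M" and enc_inj: "inj_on enc (ctls M)" and enc_less: "f \<in> ctls M \<Longrightarrow> enc f < \<Phi>"
begin

abbreviation "k \<equiv> tm_tapes M"
abbreviation "g \<equiv> tm_symbols M"
text \<open>A head between \<open>-s\<close> and \<open>s\<close> has \<open>2 * s + 1\<close>
  positions. All \<open>k\<close> positions together are a number below \<open>W ^ k\<close>,
  polynomial in \<open>s\<close> because \<open>k\<close> is fixed with the machine, so they fit
  into the control state. \<open>H\<close> bounds all three kinds of indices at once: control
  states, coded values and links.\<close>

definition "W = 2 * s + 1"
definition "D = \<Phi> * W ^ k"
definition "m = k * W"
definition "H = g * (D + m + 1)"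

text \<open>The control state is an element of \<open>ctls M\<close> together with the head positions, which are the digits
  of \<open>P\<close>; a machine that has accepted goes through the control states \<open>D + 1, \<dots>, D + m\<close> while all variables
  are set to 0.\<close>

definition instr :: "nat \<Rightarrow> nat \<Rightarrow> nat \<Rightarrow> nat \<Rightarrow> nat \<Rightarrow> bool" where
  "instr c i v c' v' \<longleftrightarrow> v < g \<and>
     ((\<exists>f\<in>ctls M. \<not> ctl_halt M f \<and> (\<exists>P<W ^ k. \<exists>P'<W ^ k. c = enc f + \<Phi> * P \<and>
        i = ctl_tape k f + k * (P div W ^ ctl_tape k f mod W) \<and>
        shift W (ctl_tape k f) (snd (snd (ctl_trans M f v))) P P' \<and>
        c' = enc (fst (ctl_trans M f v)) + \<Phi> * P' \<and> v' = fst (snd (ctl_trans M f v)))) \<or>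
      (\<exists>P<W ^ k. c = enc (Rd (tm_accept M) []) + \<Phi> * P \<and> i = 0 \<and> c' = D + 1 \<and> v' = 0) \<or>
      (\<exists>t<m. 1 \<le> t \<and> c = D + t \<and> i = t \<and> c' = D + t + 1 \<and> v' = 0))"

lemma sizes: "1 \<le> k" "3 \<le> g" "0 < W ^ k" "1 \<le> m" "0 < W"
  using wf by (auto simp: wf_tm_def Suc_le_eq W_def m_def)

lemma Rd_ctls: "q < tm_states M \<Longrightarrow> Rd q [] \<in> ctls M"
  using sizes(1) by (simp add: ctls_def)

lemma code_less: "f \<in> ctls M \<Longrightarrow> P < W ^ k \<Longrightarrow> enc f + \<Phi> * P < D"
proof -
  assume f: "f \<in> ctls M" "P < W ^ k"
  have "enc f + \<Phi> * P < \<Phi> * (P + 1)" using enc_less[OF f(1)] by simp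
  also have "\<dots> \<le> \<Phi> * W ^ k" using f(2) by (intro mult_le_mono2) simp
  finally show ?thesis unfolding D_def .
qed

lemma code_inject:
  assumes "f \<in> ctls M" "f' \<in> ctls M" "enc f + \<Phi> * P = enc f' + \<Phi> * P'"
  shows "f = f' \<and> P = P'"
proof -
  have l: "enc f < \<Phi>" "enc f' < \<Phi>" using assms(1,2) enc_less by auto
  have "(enc f + \<Phi> * P) mod \<Phi> = enc f" "(enc f' + \<Phi> * P') mod \<Phi> = enc f'"
    "(enc f + \<Phi> * P) div \<Phi> = P" "(enc f' + \<Phi> * P') div \<Phi> = P'" using l by auto
  then show ?thesis using assms enc_inj by (metis inj_onD)
qed

lemma accept_ctl: "Rd (tm_accept M) [] \<in> ctls M" "ctl_halt M (Rd (tm_accept M) [])"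
  using wf by (auto simp: Rd_ctls wf_tm_def ctl_halt_def)

lemma instr_cases:
  assumes "instr c i v c' v'"
  obtains (step) f P P' where "f \<in> ctls M" "\<not> ctl_halt M f" "P < W ^ k" "P' < W ^ k" "c = enc f + \<Phi> * P"
      "i = ctl_tape k f + k * (P div W ^ ctl_tape k f mod W)"
      "shift W (ctl_tape k f) (snd (snd (ctl_trans M f v))) P P'"
      "c' = enc (fst (ctl_trans M f v)) + \<Phi> * P'" "v' = fst (snd (ctl_trans M f v))" "v < g"
  | (accept) P where "P < W ^ k" "c = enc (Rd (tm_accept M) []) + \<Phi> * P" "i = 0" "c' = D + 1" "v' = 0" "v < g"
  | (clean) t where "t < m" "1 \<le> t" "c = D + t" "i = t" "c' = D + t + 1" "v' = 0" "v < g"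
proof -
  have v: "v < g" using assms unfolding instr_def by blast
  from assms consider
      "\<exists>f\<in>ctls M. \<not> ctl_halt M f \<and> (\<exists>P<W ^ k. \<exists>P'<W ^ k. c = enc f + \<Phi> * P \<and>
        i = ctl_tape k f + k * (P div W ^ ctl_tape k f mod W) \<and>
        shift W (ctl_tape k f) (snd (snd (ctl_trans M f v))) P P' \<and>
        c' = enc (fst (ctl_trans M f v)) + \<Phi> * P' \<and> v' = fst (snd (ctl_trans M f v)))"
    | "\<exists>P<W ^ k. c = enc (Rd (tm_accept M) []) + \<Phi> * P \<and> i = 0 \<and> c' = D + 1 \<and> v' = 0"
    | "\<exists>t<m. 1 \<le> t \<and> c = D + t \<and> i = t \<and> c' = D + t + 1 \<and> v' = 0" unfolding instr_def by (elim conjE disjE) 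
  then show ?thesis
  proof cases
    case 1
    then show ?thesis by (elim bexE exE conjE) (rule that(1); (assumption | rule v))
  next
    case 2
    then show ?thesis by (elim exE conjE) (rule that(2); (assumption | rule v))
  next
    case 3
    then show ?thesis by (elim exE conjE) (rule that(3); (assumption | rule v))
  qed
qed

text \<open>The control state determines the element of \<open>ctls M\<close> and all head
  positions, hence the cell to look at. This is what keeping the heads in the control
  achieves.\<close>

lemma instr_det_var:
  assumes "instr c i v c' v'" "instr c j u d' u'"
  shows "i = j"
  using assms(1)
proof (cases rule: instr_cases)
  case s1: (step f P P')
  note c = code_less[OF s1(1,3)]
  show ?thesis
    using assms(2)
  proof (cases rule: instr_cases)
    case (step f' Q Q')
    have e: "f = f' \<and> P = Q" by (rule code_inject[OF s1(1) step(1)]) (use s1(5) step(5) in simp)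
    show ?thesis unfolding s1(6) step(6) using e by simp
  next
    case (accept Q)
    have "f = Rd (tm_accept M) [] \<and> P = Q" by (rule code_inject[OF s1(1) accept_ctl(1)]) (use s1(5) accept(2) in simp)
    then show ?thesis using s1(2) accept_ctl(2) by blast
  next
    case (clean u)
    then show ?thesis using c s1(5) by linarith
  qed
next
  case s1: (accept P)
  note c = code_less[OF accept_ctl(1) s1(1)]
  show ?thesis
    using assms(2)
  proof (cases rule: instr_cases)
    case (step f' Q Q')
    have "f' = Rd (tm_accept M) [] \<and> Q = P" by (rule code_inject[OF step(1) accept_ctl(1)]) (use s1(2) step(5) in simp)
    then show ?thesis using step(2) accept_ctl(2) by blast
  next
    case (accept Q)
    show ?thesis using s1(3) accept(3) by simp
  next
    case (clean u)
    then show ?thesis using c s1(2) by linarith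
  qed
next
  case s1: (clean t)
  show ?thesis
    using assms(2)
  proof (cases rule: instr_cases)
    case (step f' Q Q')
    then show ?thesis using code_less[OF step(1,3)] s1(3) by linarith
  next
    case (accept Q)
    then show ?thesis using code_less[OF accept_ctl(1) accept(1)] s1(3) by linarith
  next
    case (clean u)
    show ?thesis using s1(3,4) clean(3,4) by linarith
  qed
qed

lemma instr_det:
  assumes "instr c i v c' v'" "instr c i v d' u'"
  shows "c' = d' \<and> v' = u'"
  using assms(1)
proof (cases rule: instr_cases)
  case s1: (step f P P')
  note c = code_less[OF s1(1,3)]
  show ?thesis
    using assms(2)
  proof (cases rule: instr_cases)
    case (step f' Q Q')
    have e: "f = f' \<and> P = Q" by (rule code_inject[OF s1(1) step(1)]) (use s1(5) step(5) in simp)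
    have "P' = Q'" by (rule shift_unique[OF s1(7)]) (use step(7) e in simp)
    then show ?thesis unfolding s1(8,9) step(8,9) using e by simp
  next
    case (accept Q)
    have "f = Rd (tm_accept M) [] \<and> P = Q" by (rule code_inject[OF s1(1) accept_ctl(1)]) (use s1(5) accept(2) in simp)
    then show ?thesis using s1(2) accept_ctl(2) by blast
  next
    case (clean u)
    then show ?thesis using c s1(5) by linarith
  qed
next
  case s1: (accept P)
  note c = code_less[OF accept_ctl(1) s1(1)]
  show ?thesis
    using assms(2)
  proof (cases rule: instr_cases)
    case (step f' Q Q')
    have "f' = Rd (tm_accept M) [] \<and> Q = P" by (rule code_inject[OF step(1) accept_ctl(1)]) (use s1(2) step(5) in simp)
    then show ?thesis using step(2) accept_ctl(2) by blast
  next
    case (accept Q)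
    show ?thesis using s1(4,5) accept(4,5) by simp
  next
    case (clean u)
    then show ?thesis using c s1(2) by linarith
  qed
next
  case s1: (clean t)
  show ?thesis
    using assms(2)
  proof (cases rule: instr_cases)
    case (step f' Q Q')
    then show ?thesis using code_less[OF step(1,3)] s1(3) by linarith
  next
    case (accept Q)
    then show ?thesis using code_less[OF accept_ctl(1) accept(1)] s1(3) by linarith
  next
    case (clean u)
    show ?thesis using s1(3,5,6) clean(3,5,6) by linarith
  qed
qed

lemma cell_less: "j < k \<Longrightarrow> h < W \<Longrightarrow> j + k * h < m"
proof -
  assume "j < k" "h < W"
  then have "j + k * h < k * (h + 1)" "k * (h + 1) \<le> k * W" using mult_le_mono2[of "h + 1" W k] by simp_all
  then show ?thesis unfolding m_def by linarith
qed

lemma instr_range: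
  assumes "instr c i v c' v'"
  shows "c < D + m + 1 \<and> c' < D + m + 1 \<and> i < m \<and> v < g \<and> v' < g"
  using assms
proof (cases rule: instr_cases)
  case (step f P P')
  have "i < m" unfolding step(6) using ctl_trans_wf(3)[OF wf step(1,10)] sizes(5) by (intro cell_less) simp_all
  then show ?thesis using step code_less[OF step(1,3)] ctl_trans_wf(1,2)[OF wf step(1,10)]
    code_less[OF ctl_trans_wf(1)[OF wf step(1,10)] step(4)] by simp
next
  case (accept P)
  then show ?thesis using code_less[OF accept_ctl(1) accept(1)] sizes by simp
next
  case (clean t)
  then show ?thesis using sizes by simp
qed

sublocale vm: var_machine instr m g H
proof
  show "instr c i v c' v' \<Longrightarrow> instr c j u d' u' \<Longrightarrow> i = j" for c i v c' v' j u d' u' by (rule instr_det_var)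
  show "instr c i v c' v' \<Longrightarrow> instr c i v d' u' \<Longrightarrow> c' = d' \<and> v' = u'" for c i v c' v' d' u' by (rule instr_det)
  show "c < H \<and> c' < H \<and> i < m \<and> v < g \<and> v' < g \<and> v + g * c < H" if "instr c i v c' v'" for c i v c' v'
  proof -
    note r = instr_range[OF that]
    have "D + m + 1 \<le> H" unfolding H_def using mult_le_mono1[of 1 g "D + m + 1"] sizes(2) by simp
    moreover have "v + g * c < g * (c + 1)" using r by simp
    moreover have "g * (c + 1) \<le> H" unfolding H_def using r by (intro mult_le_mono2) simp
    ultimately show ?thesis using r by auto
  qed
qed

text \<open>Variable \<open>j + k * h\<close> is cell \<open>h - s\<close> of tape \<open>j\<close>;
  the shift by \<open>s\<close> makes positions natural numbers. Beyond \<open>m\<close> the value 0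
  is fixed, as \<open>vm.valid\<close> requires.\<close>

definition value_at :: "tape list \<Rightarrow> nat \<Rightarrow> nat" where
  "value_at T i = (if i < m then fst (T ! (i mod k)) (int (i div k) - int s) else 0)"

definition heads :: "tape list \<Rightarrow> nat list" where
  "heads T = map (\<lambda>t. nat (snd t + int s)) T"

definition rep :: "ctl \<times> tape list \<Rightarrow> nat \<times> (nat \<Rightarrow> nat)" where
  "rep p = (enc (fst p) + \<Phi> * num W (heads (snd p)), value_at (snd p))"

definition good :: "tape list \<Rightarrow> bool" where
  "good T \<longleftrightarrow> length T = k \<and> (\<forall>t\<in>set T. \<bar>snd t\<bar> \<le> int s \<and> (\<forall>i. fst t i < g))"

lemma heads_less: "good T \<Longrightarrow> d \<in> set (heads T) \<Longrightarrow> d < W"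
  unfolding good_def heads_def W_def by (auto simp: nat_less_iff abs_le_iff) 

lemma num_heads_less: "good T \<Longrightarrow> num W (heads T) < W ^ k"
  using num_less[of "heads T" W] heads_less[of T] by (simp add: heads_def good_def)

lemma rep_valid: "good T \<Longrightarrow> vm.valid (rep (f, T))"
proof -
  assume T: "good T"
  have "fst (T ! (i mod k)) z < g" for i z
  proof -
    have "i mod k < length T" using T sizes(1) by (simp add: good_def)
    then show ?thesis using T by (simp add: good_def)
  qed
  then show ?thesis using sizes(2) by (simp add: vm.valid_def rep_def value_at_def)
qed

text \<open>Exactly one variable changes, the cell under the head of the tape in turn, and exactly
  one digit of the head number. The tapes afterwards must be \<open>good\<close> so that this digit
  stays within the base.\<close>

lemma micro_bstep:
  assumes f: "f \<in> ctls M" "\<not> ctl_halt M f" and T: "good T" and T': "good (snd (micro M (f, T)))"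
  shows "vm.bstep (rep (f, T)) (rep (micro M (f, T)))"
proof -
  define j where "j = ctl_tape k f"
  have jk: "j < k" unfolding j_def by (rule ctl_trans_wf(3)[OF wf f(1), of 0]) (use sizes(2) in simp)
  have len: "length T = k" using T by (simp add: good_def)
  have Tj: "T ! j \<in> set T" using jk len by simp
  obtain c h where ch: "T ! j = (c, h)" by (cases "T ! j")
  have h: "\<bar>h\<bar> \<le> int s" and cg: "\<And>i. c i < g" using T Tj ch unfolding good_def by fastforce+
  define h' where "h' = nat (h + int s)"
  have h'W: "h' < W" using h by (simp add: h'_def W_def nat_less_iff)
  have h'h: "int h' - int s = h" using h by (simp add: h'_def)
  obtain f' v' d where tr: "ctl_trans M f (c h) = (f', v', d)" by (cases "ctl_trans M f (c h)")
  have mic: "micro M (f, T) = (f', T[j := (c(h := v'), move_head d h)])"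
    by (simp add: micro_def Let_def j_def[symmetric] ch head_sym_def tr)
  define T2 where "T2 = T[j := (c(h := v'), move_head d h)]"
  have T2: "good T2" using T' by (simp add: mic T2_def)
  have "(c(h := v'), move_head d h) \<in> set T2" unfolding T2_def using jk len by (simp add: set_update_memI)
  then have mh: "\<bar>move_head d h\<bar> \<le> int s" using T2 unfolding good_def by fastforce
  define P P' where "P = num W (heads T)" and "P' = num W (heads T2)"
  have P: "P < W ^ k" "P' < W ^ k" unfolding P_def P'_def using num_heads_less T T2 by auto
  have hl: "length (heads T) = k" using len by (simp add: heads_def)
  have hj: "heads T ! j = h'" using jk len ch by (simp add: heads_def h'_def)
  have dig: "P div W ^ j mod W = h'"
    unfolding P_def using num_digit[of "heads T" W j] heads_less[OF T] jk hl hj by simp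
  have "heads T2 = (heads T)[j := nat (move_head d h + int s)]"
    by (simp add: heads_def T2_def map_update)
  then have eq: "P' + h' * W ^ j = P + nat (move_head d h + int s) * W ^ j"
    unfolding P_def P'_def using num_update[of j "heads T" W] jk hl hj by simp
  have sh: "shift W j d P P'"
  proof (cases d)
    case Left
    then have "h' = nat (move_head d h + int s) + 1" using mh by (simp add: h'_def nat_eq_iff)
    then show ?thesis using eq Left by simp
  next
    case Stay
    then show ?thesis using eq by (simp add: h'_def)
  next
    case Right
    then have "nat (move_head d h + int s) = h' + 1" using mh h by (simp add: h'_def nat_eq_iff)
    then show ?thesis using eq Right by simp
  qed
  let ?i = "j + k * h'"
  have im: "?i < m" using cell_less[OF jk h'W] .
  have imod: "?i mod k = j" "?i div k = h'" using jk by auto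
  have x: "value_at T ?i = c h" using im imod ch h'h by (simp add: value_at_def)
  have upd: "value_at T2 = (value_at T)(?i := v')"
  proof
    fix i
    show "value_at T2 i = ((value_at T)(?i := v')) i"
    proof (cases "i = ?i")
      case True
      then show ?thesis using im imod h'h jk len by (simp add: value_at_def T2_def)
    next
      case False
      then have ne: "i mod k = j \<Longrightarrow> i div k \<noteq> h'" using mult_div_mod_eq[of k i] by auto
      show ?thesis
      proof (cases "i mod k = j")
        case True
        then have "int (i div k) - int s \<noteq> h" using ne h'h by linarith
        then show ?thesis using False True jk len ch by (simp add: value_at_def T2_def)
      next
        case F: False
        then show ?thesis using False by (simp add: value_at_def T2_def)
      qed
    qed
  qed
  have "instr (enc f + \<Phi> * P) ?i (c h) (enc f' + \<Phi> * P') v'"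
    unfolding instr_def
    by (intro conjI cg disjI1, rule bexI[OF _ f(1)], intro conjI f(2), rule exI[of _ P], rule conjI[OF P(1)],
        rule exI[of _ P']) (use dig sh P(2) in \<open>simp add: j_def[symmetric] tr\<close>)
  then show ?thesis
    unfolding vm.bstep_def mic T2_def[symmetric] rep_def fst_conv snd_conv P_def[symmetric] P'_def[symmetric]
    using x upd by metis
qed

text \<open>One machine step takes \<open>2 * k\<close> micro steps, reading every tape and then
  writing every tape.\<close>

lemma tm_step_bsteps:
  assumes q: "q < tm_states M" "q \<noteq> tm_accept M" "q \<noteq> tm_reject M" and T: "good T"
    and st: "step M (q, T) = (q', T')" and T': "good T'"
  shows "vm.bstep\<^sup>*\<^sup>* (rep (Rd q [], T)) (rep (Rd q' [], T'))"
proof -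
  have len: "length T = k" using T by (simp add: good_def)
  define acts where "acts = snd (tm_delta M q (map head_sym T))"
  have hs: "map (\<lambda>(c, h). c h) T = map head_sym T" by (simp add: head_sym_def case_prod_beta)
  have q': "q' = fst (tm_delta M q (map head_sym T))" and T'_eq: "T' = map2 act T acts"
    using st q(2,3) by (auto simp: step_def halted_def case_prod_beta hs acts_def)
  have syms: "set (map head_sym T) \<subseteq> {..<g}" using T unfolding good_def head_sym_def by auto
  have ss: "length (map head_sym T) = k" "\<forall>s\<in>set (map head_sym T). s < g" using syms len by auto
  have all: "\<forall>q<tm_states M. \<forall>ss. length ss = k \<and> (\<forall>s\<in>set ss. s < g) \<longrightarrow>
      (case tm_delta M q ss of (q', acts) \<Rightarrow>
         q' < tm_states M \<and> length acts = k \<and> (\<forall>(s, d)\<in>set acts. s < g))"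
    using wf unfolding wf_tm_def by (elim conjE)
  have dl': "q' < tm_states M \<and> length acts = k \<and> (\<forall>(s, d)\<in>set acts. s < g)"
    unfolding q' acts_def case_prod_beta
    using mp[OF spec[OF mp[OF spec[OF all] q(1)]] conjI[OF ss]] unfolding case_prod_beta .
  have dl: "q' < tm_states M" "length acts = k" "set acts \<subseteq> {..<g} \<times> UNIV"
  proof -
    show "q' < tm_states M" "length acts = k" using dl' by auto
    show "set acts \<subseteq> {..<g} \<times> UNIV"
    proof
      fix x assume "x \<in> set acts"
      then have "case x of (s, d) \<Rightarrow> s < g" using dl' by blast
      then show "x \<in> {..<g} \<times> UNIV" by (cases x) simp
    qed
  qed
  define cfg where "cfg n = (micro M ^^ n) (Rd q [], T)" for n
  have r: "cfg n = (Rd q (map head_sym (take n T)), T)" if "n < k" for n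
    unfolding cfg_def by (rule micro_read[OF len that])
  have w: "cfg (k + j) = ((if j = k \<and> 0 < j then Rd q' [] else Wt q' (drop j acts)), map2 act (take j T) (take j acts) @ drop j T)"
    if "j \<le> k" for j
  proof -
    have "cfg (k + j) = (micro M ^^ j) (cfg k)" unfolding cfg_def by (simp add: add.commute[of k] funpow_add)
    also have "cfg k = (Wt q' acts, T)"
      unfolding cfg_def q' acts_def by (rule micro_last_read[OF len sizes(1)])
    finally show ?thesis using micro_write[OF len dl(2) that] by simp
  qed
  \<comment> \<open>During the writing phase some tapes are new and the others old; each of them is
    bounded because it belongs to one of two good configurations.\<close>
  have mixed: "good (map2 act (take j T) (take j acts) @ drop j T)" if "j \<le> k" for j
  proof -
    have "map2 act (take j T) (take j acts) = take j T'" unfolding T'_eq by (simp add: take_map take_zip)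
    then have sub: "set (map2 act (take j T) (take j acts) @ drop j T) \<subseteq> set T' \<union> set T"
      using set_take_subset[of j T'] set_drop_subset[of j T] by (simp only: set_append) blast
    have "length (map2 act (take j T) (take j acts) @ drop j T) = k" using that len dl(2) by simp
    with sub T T' show ?thesis unfolding good_def by blast
  qed
  have g: "good (snd (cfg n))" if "n \<le> 2 * k" for n
  proof (cases "n < k")
    case True
    then show ?thesis using r T by simp
  next
    case False
    then have "n = k + (n - k)" "n - k \<le> k" using that by auto
    then show ?thesis using w[of "n - k"] mixed[of "n - k"] by simp
  qed
  \<comment> \<open>Halting is only recognised at \<open>Rd q []\<close>; this shape occurs at the
    start, where \<open>q\<close> is not halting, and again after all \<open>2 * k\<close>
    steps.\<close>
  have f: "fst (cfg n) \<in> ctls M \<and> \<not> ctl_halt M (fst (cfg n))" if "n < 2 * k" for n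
  proof (cases "n < k")
    case True
    have "set (map head_sym (take n T)) \<subseteq> {..<g}" using syms set_take_subset[of n T] by auto
    then show ?thesis using r[OF True] q True len by (simp add: ctls_def ctl_halt_def)
  next
    case False
    then have n: "n = k + (n - k)" "n - k < k" using that by auto
    have "set (drop (n - k) acts) \<subseteq> {..<g} \<times> UNIV" using dl(3) set_drop_subset[of "n - k" acts] by blast
    then show ?thesis using w[of "n - k"] n dl(1,2) by (simp add: ctls_def ctl_halt_def)
  qed
  have "vm.bstep\<^sup>*\<^sup>* (rep (cfg 0)) (rep (cfg n))" if "n \<le> 2 * k" for n
    using that
  proof (induction n)
    case (Suc n)
    have s: "cfg (Suc n) = micro M (cfg n)" by (simp add: cfg_def)
    have "vm.bstep (rep (cfg n)) (rep (cfg (Suc n)))"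
      using micro_bstep[of "fst (cfg n)" "snd (cfg n)"] f[of n] g[of n] g[of "Suc n"] Suc.prems s by simp
    then show ?case using Suc by (auto intro: rtranclp.rtrancl_into_rtrancl)
  qed simp
  from this[of "2 * k"] show ?thesis
    using w[of k] len dl(2) sizes(1) T'_eq by (simp add: cfg_def mult_2)
qed

text \<open>Acceptance may happen with many tape contents and head positions, but the
  reconfiguration target is one set. Erasing all variables one by one leads to a single final
  configuration.\<close>

lemma bsteps_cleanup:
  assumes x: "\<forall>i\<ge>m. x i = 0" "\<forall>i. x i < g" and P: "P < W ^ k"
  shows "vm.bstep\<^sup>*\<^sup>* (enc (Rd (tm_accept M) []) + \<Phi> * P, x) (D + m, \<lambda>_. 0)"
proof -
  let ?p = "(enc (Rd (tm_accept M) []) + \<Phi> * P, x)"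
  have "vm.bstep\<^sup>*\<^sup>* ?p (D + t, \<lambda>i. if i < t then 0 else x i)" if "1 \<le> t" "t \<le> m" for t
    using that
  proof (induction t rule: nat_induct_at_least)
    case base
    have "instr (fst ?p) 0 (x 0) (D + 1) 0" unfolding instr_def fst_conv using P x(2) by blast
    moreover have "(\<lambda>i. if i < 1 then 0 else x i) = x(0 := 0)" by auto
    ultimately have "vm.bstep ?p (D + 1, \<lambda>i. if i < 1 then 0 else x i)" unfolding vm.bstep_def by auto
    then show ?case by blast
  next
    case (Suc t)
    have "instr (D + t) t (x t) (D + t + 1) 0" unfolding instr_def using Suc x(2) by auto
    moreover have "(\<lambda>i. if i < Suc t then 0 else x i) = (\<lambda>i. if i < t then 0 else x i)(t := 0)" by auto
    ultimately have "vm.bstep (D + t, \<lambda>i. if i < t then 0 else x i) (D + Suc t, \<lambda>i. if i < Suc t then 0 else x i)"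
      unfolding vm.bstep_def by (intro exI[of _ t] exI[of _ 0]) auto
    then show ?case using Suc by (meson Suc_leD rtranclp.rtrancl_into_rtrancl)
  qed
  from this[of m] have "vm.bstep\<^sup>*\<^sup>* ?p (D + m, \<lambda>i. if i < m then 0 else x i)" using sizes(4) by simp
  moreover have "(\<lambda>i. if i < m then 0 else x i) = (\<lambda>_. 0)" using x(1) by (auto simp: not_less)
  ultimately show ?thesis by (simp only:)
qed

lemma stuck_end: "\<not> instr (D + m) i v c' v'"
proof
  assume "instr (D + m) i v c' v'"
  then show False
  proof (cases rule: instr_cases)
    case (step f P P')
    then show False using code_less[OF step(1,3)] by simp
  next
    case (accept P)
    then show False using code_less[OF accept_ctl(1) accept(1)] by simp
  qed simp
qed

lemma stuck_reject: "\<not> instr (enc (Rd (tm_reject M) []) + \<Phi> * P) i v c' v'" if P: "P < W ^ k"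
proof
  have rj: "Rd (tm_reject M) [] \<in> ctls M" "ctl_halt M (Rd (tm_reject M) [])" "tm_reject M \<noteq> tm_accept M"
    using wf by (auto simp: Rd_ctls wf_tm_def ctl_halt_def)
  assume "instr (enc (Rd (tm_reject M) []) + \<Phi> * P) i v c' v'"
  then show False
  proof (cases rule: instr_cases)
    case (step f Q Q')
    then show False using code_inject[OF rj(1) step(1), of P Q] rj by auto
  next
    case (accept Q)
    then show False using code_inject[OF rj(1) accept_ctl(1), of P Q] rj by auto
  next
    case (clean t)
    then show False using code_less[OF rj(1) P] by simp
  qed
qed

end

section \<open>From the space bound to head positions, and correctness of the simulation\<close>

lemma run_wf:
  assumes wf: "wf_tm M"
  shows "fst (run M w t) < tm_states M \<and> length (snd (run M w t)) = tm_tapes M \<and>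
     (\<forall>tp\<in>set (snd (run M w t)). \<forall>i. fst tp i < tm_symbols M)"
proof (induction t)
  case 0
  have "word_content u i < 3" for u i by (simp add: word_content_def)
  then have "word_content u i < tm_symbols M" for u i
    using wf unfolding wf_tm_def by (meson less_le_trans)
  then show ?case using wf by (auto simp: run_def init_config_def wf_tm_def)
next
  case (Suc t)
  obtain q T where qT: "run M w t = (q, T)" by (cases "run M w t")
  have r: "run M w (Suc t) = step M (q, T)" using qT by (simp add: run_def)
  show ?case
  proof (cases "halted M (q, T)")
    case True
    then show ?thesis using Suc r qT by (simp add: step_def)
  next
    case False
    define ss where "ss = map (\<lambda>(c, h). c h) T"
    obtain q' acts where d: "tm_delta M q ss = (q', acts)" by (cases "tm_delta M q ss")
    have ss: "length ss = tm_tapes M" "\<forall>x\<in>set ss. x < tm_symbols M" using Suc qT unfolding ss_def by auto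
    have q: "q < tm_states M" using Suc qT by simp
    have all: "\<forall>q<tm_states M. \<forall>ss. length ss = tm_tapes M \<and> (\<forall>s\<in>set ss. s < tm_symbols M) \<longrightarrow>
        (case tm_delta M q ss of (q', acts) \<Rightarrow>
           q' < tm_states M \<and> length acts = tm_tapes M \<and> (\<forall>(s, d)\<in>set acts. s < tm_symbols M))"
      using wf unfolding wf_tm_def by (elim conjE)
    have a: "q' < tm_states M" "length acts = tm_tapes M" "\<forall>(x, m)\<in>set acts. x < tm_symbols M"
      using mp[OF spec[OF mp[OF spec[OF all] q]] conjI[OF ss]] d by auto
    have "step M (q, T) = (q', map2 act T acts)" using False d by (simp add: step_def ss_def)
    moreover have "\<forall>tp\<in>set (map2 act T acts). \<forall>i. fst tp i < tm_symbols M"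
    proof
      fix tp assume "tp \<in> set (map2 act T acts)"
      then obtain tp0 a0 where z: "(tp0, a0) \<in> set (zip T acts)" "tp = act tp0 a0" by auto
      have "tp0 \<in> set T" "a0 \<in> set acts" using z(1) by (auto dest: set_zip_leftD set_zip_rightD)
      moreover obtain c h x b where "tp0 = (c, h)" "a0 = (x, b)" by (cases tp0, cases a0)
      ultimately have "\<forall>i. c i < tm_symbols M" "x < tm_symbols M" "tp = (c(h := x), move_head b h)"
        using Suc qT a(3) z(2) by fastforce+
      then show "\<forall>i. fst tp i < tm_symbols M" by simp
    qed
    ultimately show ?thesis using r a Suc qT by simp
  qed
qed

lemma head_moves_slowly:
  assumes wf: "wf_tm M" and i: "i < tm_tapes M"
  shows "\<bar>snd (snd (run M w (Suc t)) ! i) - snd (snd (run M w t) ! i)\<bar> \<le> 1"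
proof -
  obtain q T where qT: "run M w t = (q, T)" by (cases "run M w t")
  have r: "run M w (Suc t) = step M (q, T)" using qT by (simp add: run_def)
  show ?thesis
  proof (cases "halted M (q, T)")
    case True
    then show ?thesis using r qT by (simp add: step_def)
  next
    case False
    obtain q' acts where d: "tm_delta M q (map (\<lambda>(c, h). c h) T) = (q', acts)"
      by (cases "tm_delta M q (map (\<lambda>(c, h). c h) T)")
    have s: "run M w (Suc t) = (q', map2 act T acts)" using False d r by (simp add: step_def)
    have "length (map2 act T acts) = tm_tapes M" "length T = tm_tapes M"
      using run_wf[OF wf, of w "Suc t"] run_wf[OF wf, of w t] s qT by auto
    then have "map2 act T acts ! i = act (T ! i) (acts ! i)" using i by simp
    moreover have "\<bar>move_head m h - h\<bar> \<le> 1" for m h by (cases m) auto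
    ultimately show ?thesis using s qT by (cases "T ! i"; cases "acts ! i") simp
  qed
qed

text \<open>Space counts visited cells, not distances. A head starts at 0 and moves by at most one
  cell, so by the discrete intermediate value theorem it has visited everything between 0 and its
  position.\<close>

lemma head_bound:
  assumes wf: "wf_tm M" and space: "runs_in_space M w s" and i: "i < tm_tapes M"
  shows "\<bar>snd (snd (run M w t) ! i)\<bar> \<le> int s"
proof -
  define f where "f t = snd (snd (run M w t) ! i)" for t
  have slow: "\<bar>f (Suc t) - f t\<bar> \<le> 1" for t unfolding f_def by (rule head_moves_slowly[OF wf i])
  have f0: "f 0 = 0" using i by (cases i) (auto simp: f_def run_def init_config_def)
  have V: "visited_cells M w i = range f" unfolding visited_cells_def f_def by auto
  have fin: "finite (range f)" using space i unfolding runs_in_space_def V[symmetric] by blast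
  have "card (visited_cells M w i) \<le> (\<Sum>i<tm_tapes M. card (visited_cells M w i))"
    by (rule member_le_sum) (use i in auto)
  then have card: "card (range f) \<le> s" using space unfolding runs_in_space_def V[symmetric] by simp
  have "{min 0 (f t)..max 0 (f t)} \<subseteq> range f"
  proof
    fix z assume z: "z \<in> {min 0 (f t)..max 0 (f t)}"
    show "z \<in> range f"
    proof (cases "0 \<le> f t")
      case True
      then have "\<exists>i\<ge>0. i \<le> t \<and> f i = z"
        using z f0 slow by (intro nat_intermed_int_val) auto
      then show ?thesis by auto
    next
      case False
      have "\<bar>- f (Suc i) - - f i\<bar> \<le> 1" for i using slow[of i] by simp
      then have "\<exists>i\<ge>0. i \<le> t \<and> - f i = - z"
        using z f0 False by (intro nat_intermed_int_val[where f = "\<lambda>t. - f t"]) auto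
      then show ?thesis by auto
    qed
  qed
  from card_mono[OF fin this] card have "nat (max 0 (f t) - min 0 (f t) + 1) \<le> s" by simp
  then show ?thesis unfolding f_def[symmetric] by linarith
qed

context coded_machine begin

definition start_conf :: "bool list \<Rightarrow> nat \<times> (nat \<Rightarrow> nat)" where
  "start_conf w = rep (Rd (tm_start M) [], snd (init_config M w))"

definition end_conf :: "nat \<times> (nat \<Rightarrow> nat)" where
  "end_conf = (D + m, \<lambda>_. 0)"

lemma good_run: "runs_in_space M w s \<Longrightarrow> good (snd (run M w t))"
  unfolding good_def
proof (intro conjI ballI)
  assume sp: "runs_in_space M w s"
  note r = run_wf[OF wf, of w t]
  show "length (snd (run M w t)) = k" using r by simp
  fix tp assume tp: "tp \<in> set (snd (run M w t))"
  then obtain i where "i < k" "tp = snd (run M w t) ! i" using r by (metis in_set_conv_nth)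
  then show "\<bar>snd tp\<bar> \<le> int s" using head_bound[OF wf sp, of i t] by simp
  show "\<forall>i. fst tp i < g" using r tp by blast
qed

lemma conf_valid: "runs_in_space M w s \<Longrightarrow> vm.valid (start_conf w)" "vm.valid end_conf"
proof -
  show "vm.valid end_conf" using sizes(2) by (simp add: end_conf_def vm.valid_def)
  assume "runs_in_space M w s"
  from rep_valid[OF good_run[OF this, of 0]] show "vm.valid (start_conf w)" by (simp add: start_conf_def run_def)
qed

lemma run_bsteps: "runs_in_space M w s \<Longrightarrow> vm.bstep\<^sup>*\<^sup>* (start_conf w) (rep (Rd (fst (run M w t)) [], snd (run M w t)))"
proof (induction t)
  case 0
  then show ?case by (simp add: start_conf_def run_def init_config_def)
next
  case (Suc t)
  obtain q T where qT: "run M w t = (q, T)" by (cases "run M w t")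
  obtain q' T' where qT': "run M w (Suc t) = (q', T')" by (cases "run M w (Suc t)")
  have r: "step M (q, T) = (q', T')" using qT qT' by (simp add: run_def)
  show ?case
  proof (cases "halted M (q, T)")
    case True
    then show ?thesis using Suc r qT qT' by (simp add: step_def)
  next
    case False
    then have "vm.bstep\<^sup>*\<^sup>* (rep (Rd q [], T)) (rep (Rd q' [], T'))"
      using run_wf[OF wf, of w t] good_run[OF Suc.prems, of t] good_run[OF Suc.prems, of "Suc t"] qT qT' r
      by (intro tm_step_bsteps) (auto simp: halted_def)
    then show ?thesis using Suc qT qT' by simp
  qed
qed

text \<open>A rejecting run ends in a stuck configuration different from \<open>end_conf\<close>;
  since a deterministic machine reaches at most one stuck configuration, \<open>end_conf\<close> is
  out of reach.\<close>

lemma accepts_iff_toggle: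
  assumes dec: "decides M L" and space: "runs_in_space M w s"
  shows "w \<in> L \<longleftrightarrow> vm.toggle\<^sup>*\<^sup>* (vm.conf (start_conf w)) (vm.conf end_conf)"
proof -
  obtain t where t: "halted M (run M w t)" "fst (run M w t) = tm_accept M \<longleftrightarrow> w \<in> L"
    using dec unfolding decides_def by blast
  define T where "T = snd (run M w t)"
  have T: "good T" unfolding T_def by (rule good_run[OF space])
  note P = num_heads_less[OF T]
  note v = rep_valid[OF T, of "Rd (fst (run M w t)) []"]
  have run: "vm.bstep\<^sup>*\<^sup>* (start_conf w) (rep (Rd (fst (run M w t)) [], T))"
    unfolding T_def by (rule run_bsteps[OF space])
  have se: "\<not> vm.bstep end_conf r" for r unfolding vm.bstep_def end_conf_def by (simp add: stuck_end)
  have "w \<in> L \<longleftrightarrow> vm.bstep\<^sup>*\<^sup>* (start_conf w) end_conf"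
  proof (cases "fst (run M w t) = tm_accept M")
    case True
    have "vm.bstep\<^sup>*\<^sup>* (rep (Rd (tm_accept M) [], T)) end_conf"
      using bsteps_cleanup[of "value_at T", OF _ _ P] v by (simp add: rep_def end_conf_def vm.valid_def)
    then show ?thesis using t(2) True run by (metis rtranclp_trans)
  next
    case False
    then have q: "fst (run M w t) = tm_reject M" using t(1) by (simp add: halted_def)
    have sr: "\<not> vm.bstep (rep (Rd (tm_reject M) [], T)) r" for r
      unfolding vm.bstep_def rep_def by (simp add: stuck_reject[OF P])
    have "rep (Rd (tm_reject M) [], T) \<noteq> end_conf"
      using code_less[OF Rd_ctls P, of "tm_reject M"] wf by (auto simp: rep_def end_conf_def wf_tm_def)
    then have "\<not> vm.bstep\<^sup>*\<^sup>* (start_conf w) end_conf"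
      using vm.bstep_terminal_unique[OF run[unfolded q] _ sr se] by blast
    then show ?thesis using t(2) False by simp
  qed
  also have "\<dots> \<longleftrightarrow> vm.toggle\<^sup>*\<^sup>* (vm.conf (start_conf w)) (vm.conf end_conf)"
    by (rule vm.toggle_reach_iff[symmetric]) (use conf_valid(1)[OF space] conf_valid(2) stuck_end in \<open>auto simp: end_conf_def\<close>)
  finally show ?thesis .
qed

end

section \<open>Reachability of resting positions is reachability by toggles\<close>

context toggle_system begin

definition ctoggle :: "'c set \<Rightarrow> 'c set \<Rightarrow> bool" where
  "ctoggle F F' \<longleftrightarrow> F \<subseteq> C \<and> F' \<subseteq> C \<and> (\<exists>r\<in>R. \<exists>J\<subseteq>C. J \<noteq> {} \<and> card J \<le> 3 \<and> (\<Sum>j\<in>J. wt j) = card (d r) \<and>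
     (J \<subseteq> F \<and> F' = F - J \<or> J \<subseteq> F' \<and> F = F' - J))"

lemma on_cells_subset: "on_cells X \<subseteq> C"
  unfolding on_cells_def by auto

lemma move_toggles:
  assumes "move X Y" "card X = (\<Sum>j\<in>C. wt j)" "card Y = (\<Sum>j\<in>C. wt j)"
  shows "ctoggle\<^sup>*\<^sup>* (on_cells X) (on_cells Y)"
proof (cases "on_cells X = on_cells Y")
  case False
  have "ok X" "ok Y" "jump X Y" "card X = card Y" using assms by (auto simp: move_def)
  then obtain r J where J: "r \<in> R" "J \<subseteq> C" "card J \<le> 3" "(\<Sum>j\<in>J. wt j) = card (d r)"
     "J \<subseteq> on_cells X \<and> on_cells Y = on_cells X - J \<or> J \<subseteq> on_cells Y \<and> on_cells X = on_cells Y - J"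
    using toggle_sound[of X Y] assms(2,3) False by blast
  then have "J \<noteq> {}" using False by blast
  then have "ctoggle (on_cells X) (on_cells Y)"
    unfolding ctoggle_def using J on_cells_subset[of X] on_cells_subset[of Y] by (intro conjI bexI[of _ r] exI[of _ J]) auto
  then show ?thesis by blast
qed simp

text \<open>From left to right, \<open>on_cells\<close> is followed along the sequence, with the
  token count invariant under jumps as \<open>toggle_sound\<close> requires. From right to left,
  each toggle is carried out by an excursion, reversed if cells are switched on.\<close>

lemma move_reach_iff:
  assumes "F \<subseteq> C" "F' \<subseteq> C"
  shows "move\<^sup>*\<^sup>* (rest_set F) (rest_set F') \<longleftrightarrow> ctoggle\<^sup>*\<^sup>* F F'"
proof
  have "ctoggle\<^sup>*\<^sup>* F (on_cells Y) \<and> finite Y \<and> card Y = (\<Sum>j\<in>C. wt j)" if "move\<^sup>*\<^sup>* (rest_set F) Y" for Y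
    using that
  proof (induction rule: rtranclp_induct)
    case base
    have "finite (rest_set F)"
      unfolding rest_set_def using assms(1) fin finite_C finite_subset[of F C] by blast
    then show ?case using on_cells_rest_set[OF assms(1)] card_rest_set[OF assms(1)] by simp
  next
    case (step Y Y2)
    have "Y2 \<subseteq> (\<Union>j\<in>C. a j) \<union> (\<Union>j\<in>C. b j) \<union> (\<Union>r\<in>R. d r)" using step(2) unfolding move_def token_set_def by blast
    then have f: "finite Y2" by (rule finite_subset) (use fin finite_C finite_R in blast)
    then have "card Y2 = card Y" using jump_card[of Y Y2] step(2,3) unfolding move_def by simp
    then show ?case using step f move_toggles[of Y Y2] by (auto intro: rtranclp_trans)
  qed
  then show "move\<^sup>*\<^sup>* (rest_set F) (rest_set F') \<Longrightarrow> ctoggle\<^sup>*\<^sup>* F F'"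
    using on_cells_rest_set[OF assms(2)] by metis
next
  have st: "move\<^sup>*\<^sup>* (rest_set F) (rest_set F')" if "ctoggle F F'" for F F'
  proof -
    obtain r J where J: "F \<subseteq> C" "F' \<subseteq> C" "r \<in> R" "J \<subseteq> C" "J \<noteq> {}" "card J \<le> 3" "(\<Sum>j\<in>J. wt j) = card (d r)"
      "J \<subseteq> F \<and> F' = F - J \<or> J \<subseteq> F' \<and> F = F' - J" using \<open>ctoggle F F'\<close> unfolding ctoggle_def by blast
    from J(8) show ?thesis
    proof
      assume *: "J \<subseteq> F \<and> F' = F - J"
      then show ?thesis using toggle_complete[OF J(1) _ J(5,6,3,7)] by blast
    next
      assume *: "J \<subseteq> F' \<and> F = F' - J"
      then have "move\<^sup>*\<^sup>* (rest_set F') (rest_set F)" using toggle_complete[OF J(2) _ J(5,6,3,7)] by blast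
      then show ?thesis by (rule move_reach_sym)
    qed
  qed
  assume "ctoggle\<^sup>*\<^sup>* F F'"
  then show "move\<^sup>*\<^sup>* (rest_set F) (rest_set F')"
  proof (induction rule: rtranclp_induct)
    case (step F1 F2)
    show ?case by (rule rtranclp_trans[OF step.IH st[OF step.hyps(2)]])
  qed simp
qed

end

section \<open>The forest built from blocks\<close>

lemma digits_unique:
  fixes Z :: nat
  assumes "i < Z" "i' < Z" "i + Z * t = i' + Z * t'"
  shows "i = i' \<and> t = t'"
proof -
  have "(i + Z * t) mod Z = i" "(i' + Z * t') mod Z = i'" "(i + Z * t) div Z = t" "(i' + Z * t') div Z = t'"
    using assms(1,2) by auto
  then show ?thesis using assms(3) by metis
qed

text \<open>Block \<open>t\<close> occupies the vertices \<open>t * (3 * Q + 1) + o\<close>; the offset \<open>o\<close> is 0 at the root, at most \<open>Q\<close> at its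
  children that are leaves, in \<open>Q + 1, \<dots>, 2 * Q\<close> at its other children and larger at the leaves below those.\<close>

locale blocks =
  fixes B :: "nat set" and cell :: "nat \<Rightarrow> bool" and p :: "nat \<Rightarrow> nat" and Q n :: nat
  assumes fin_B: "finite B" and p_ge: "t \<in> B \<Longrightarrow> 4 \<le> p t" and p_le: "t \<in> B \<Longrightarrow> p t \<le> Q"
    and room: "t \<in> B \<Longrightarrow> (3 * Q + 1) * (t + 1) \<le> n"
begin

definition pt :: "nat \<Rightarrow> nat \<Rightarrow> nat" where "pt t i = i + (3 * Q + 1) * t"
definition kA :: "nat \<Rightarrow> nat \<Rightarrow> bool" where "kA t i \<longleftrightarrow> cell t \<and> 1 \<le> i \<and> i \<le> p t"
definition kM :: "nat \<Rightarrow> nat \<Rightarrow> bool" where "kM t i \<longleftrightarrow> Q + 1 \<le> i \<and> i \<le> Q + p t"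
definition kL :: "nat \<Rightarrow> nat \<Rightarrow> bool" where "kL t i \<longleftrightarrow> 2 * Q + 1 \<le> i \<and> i \<le> 2 * Q + p t"

definition arc :: "nat \<Rightarrow> nat \<Rightarrow> nat \<Rightarrow> bool" where
  "arc t i i' \<longleftrightarrow> i = 0 \<and> kA t i' \<or> i = 0 \<and> kM t i' \<or> kM t i \<and> i' = i + Q"

definition nb :: "nat \<Rightarrow> nat \<Rightarrow> nat \<Rightarrow> bool" where "nb t i i' \<longleftrightarrow> arc t i i' \<or> arc t i' i"

text \<open>All blocks have the same stride whatever their weight, which keeps the addresses simple.
  Addresses that no arc reaches are isolated vertices; they belong to no group and can hold no token
  in a legal set.\<close>

definition graph :: "nat graph" where
  "graph = \<lparr>verts = {..<n}, edges = {{pt t i, pt t i'} |t i i'. t \<in> B \<and> arc t i i'}\<rparr>"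

lemma verts_graph [simp]: "verts graph = {..<n}"
  by (simp add: graph_def)

lemma kinds:
  assumes "t \<in> B"
  shows "kA t i \<Longrightarrow> i \<noteq> 0 \<and> \<not> kM t i \<and> \<not> kL t i \<and> i \<le> 3 * Q" "kM t i \<Longrightarrow> i \<noteq> 0 \<and> \<not> kA t i \<and> \<not> kL t i \<and> i \<le> 3 * Q"
    "kL t i \<Longrightarrow> i \<noteq> 0 \<and> \<not> kA t i \<and> \<not> kM t i \<and> i \<le> 3 * Q"
  using p_le[OF assms] by (auto simp: kA_def kM_def kL_def)

lemma kM_kL: "kM t i \<Longrightarrow> kL t (i + Q)" "kL t i \<Longrightarrow> \<exists>j. i = j + Q \<and> kM t j"
  by (auto simp: kM_def kL_def intro!: exI[of _ "i - Q"])

lemma nb_kind: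
  assumes t: "t \<in> B"
  shows "nb t 0 j \<longleftrightarrow> kA t j \<or> kM t j" "kA t i \<Longrightarrow> nb t i j \<longleftrightarrow> j = 0" "kM t i \<Longrightarrow> nb t i j \<longleftrightarrow> j = 0 \<or> j = i + Q"
    "kM t i \<Longrightarrow> nb t (i + Q) j \<longleftrightarrow> j = i"
proof -
  note k = kinds[OF t]
  have pQ: "1 \<le> Q" using p_ge[OF t] p_le[OF t] by simp
  have n0: "\<not> kM t 0" "\<not> kA t 0" using k by blast+
  show "nb t 0 j \<longleftrightarrow> kA t j \<or> kM t j" using n0 pQ by (auto simp: nb_def arc_def)
  show "nb t i j \<longleftrightarrow> j = 0" if "kA t i"
  proof -
    have "i \<noteq> 0" "\<not> kM t i" "\<not> kL t i" using k(1)[OF that] by auto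
    moreover have "\<not> (kM t j \<and> i = j + Q)" using kM_kL(1)[of t j] calculation by auto
    ultimately show ?thesis using that by (auto simp: nb_def arc_def)
  qed
  show "nb t i j \<longleftrightarrow> j = 0 \<or> j = i + Q" if "kM t i"
  proof -
    have "i \<noteq> 0" "\<not> kA t i" "\<not> kL t i" using k(2)[OF that] by auto
    moreover have "\<not> (kM t j \<and> i = j + Q)" using kM_kL(1)[of t j] calculation by auto
    ultimately show ?thesis using that by (auto simp: nb_def arc_def)
  qed
  show "nb t (i + Q) j \<longleftrightarrow> j = i" if "kM t i"
  proof -
    have "i + Q \<noteq> 0" "\<not> kA t (i + Q)" "\<not> kM t (i + Q)" using k(3)[OF kM_kL(1)[OF that]] by auto
    then show ?thesis using that by (auto simp: nb_def arc_def)
  qed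
qed

lemma nb_cases:
  assumes "t \<in> B" "nb t i j"
  obtains "i = 0" | "kA t i" "j = 0" | "kM t i" | i' where "kM t i'" "i = i' + Q" "j = i'"
  using assms(2) unfolding nb_def arc_def by blast

lemma nb_le:
  assumes "t \<in> B" "nb t i j"
  shows "i \<le> 3 * Q"
proof (rule nb_cases[OF assms])
  fix i' assume "kM t i'" "i = i' + Q"
  then show ?thesis using kinds(3)[OF assms(1) kM_kL(1), of i'] by simp
next
  assume "kA t i"
  then show ?thesis using kinds(1)[OF assms(1), of i] by simp
next
  assume "kM t i"
  then show ?thesis using kinds(2)[OF assms(1), of i] by simp
qed simp

lemma nb_sym: "nb t i j = nb t j i"
  by (auto simp: nb_def)

lemma nb_le2: "t \<in> B \<Longrightarrow> nb t i j \<Longrightarrow> j \<le> 3 * Q"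
  using nb_le[of t j i] nb_sym[of t i j] by simp

lemma pt_inj: "i \<le> 3 * Q \<Longrightarrow> i' \<le> 3 * Q \<Longrightarrow> pt t i = pt t' i' \<longleftrightarrow> t = t' \<and> i = i'"
proof
  assume *: "i \<le> 3 * Q" "i' \<le> 3 * Q" "pt t i = pt t' i'"
  then show "t = t' \<and> i = i'" using digits_unique[of i "3 * Q + 1" i' t t'] unfolding pt_def by simp
qed simp

lemma pt_less: "t \<in> B \<Longrightarrow> i \<le> 3 * Q \<Longrightarrow> pt t i < n"
  using room[of t] by (simp add: pt_def)

lemma adj_graph: "adj graph u v \<longleftrightarrow> (\<exists>t\<in>B. \<exists>i j. u = pt t i \<and> v = pt t j \<and> nb t i j)"
  unfolding adj_def graph_def nb_def by (auto simp: doubleton_eq_iff)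

lemma adj_pt:
  assumes "i \<le> 3 * Q"
  shows "adj graph (pt t i) v \<longleftrightarrow> t \<in> B \<and> (\<exists>j. v = pt t j \<and> nb t i j)"
proof
  assume "adj graph (pt t i) v"
  then obtain t' i' j where *: "t' \<in> B" "pt t i = pt t' i'" "v = pt t' j" "nb t' i' j" unfolding adj_graph by blast
  then have "t = t' \<and> i = i'" using pt_inj[OF assms nb_le] by blast
  then show "t \<in> B \<and> (\<exists>j. v = pt t j \<and> nb t i j)" using * by blast
qed (auto simp: adj_graph)

lemma adj_pt_pt: "i \<le> 3 * Q \<Longrightarrow> j \<le> 3 * Q \<Longrightarrow> adj graph (pt t i) (pt t j) \<longleftrightarrow> t \<in> B \<and> nb t i j"
  using adj_pt[of i t "pt t j"] nb_le2[of t i] pt_inj[of j _ t t] by metis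

lemma simple: "simple_graph graph"
  unfolding simple_graph_def
proof (intro conjI ballI)
  fix e assume "e \<in> edges graph"
  then obtain t i j where e: "e = {pt t i, pt t j}" "t \<in> B" "arc t i j" unfolding graph_def by auto
  have nb: "nb t i j" "nb t j i" using e(3) by (auto simp: nb_def)
  have l: "i \<le> 3 * Q" "j \<le> 3 * Q" using nb_le[OF e(2) nb(1)] nb_le[OF e(2) nb(2)] .
  have "Q \<noteq> 0" using p_ge[OF e(2)] p_le[OF e(2)] by simp
  then have "i \<noteq> j" using e(3) kinds(1)[OF e(2), of j] kinds(2)[OF e(2), of j] unfolding arc_def by auto
  then have "pt t i \<noteq> pt t j" using pt_inj[OF l, of t t] by simp
  then show "card e = 2" using e(1) by simp
  show "e \<subseteq> verts graph" using e(1) pt_less[OF e(2)] l by simp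
qed simp

text \<open>Leaves have one neighbour, and a middle vertex has two, one of them a leaf from which
  the only way leads back. The root has at least four middle children, so two arms exist.\<close>

lemma rootv_iff: "rootv graph v \<longleftrightarrow> (\<exists>t\<in>B. v = pt t 0)"
proof
  assume "rootv graph v"
  then obtain y z y' z' where yz: "y \<noteq> y'" "adj graph v y" "adj graph v y'" "adj graph y z" "z \<noteq> v" "adj graph y' z'" "z' \<noteq> v"
    unfolding rootv_def by blast
  obtain t i j where t: "t \<in> B" "v = pt t i" "y = pt t j" "nb t i j" using yz(2) unfolding adj_graph by blast
  have i: "i \<le> 3 * Q" using nb_le[OF t(1,4)] .
  obtain j' where j': "y' = pt t j'" "nb t i j'" using yz(3)[unfolded t(2) adj_pt[OF i]] by (elim conjE exE)
  have j: "j \<le> 3 * Q" "j' \<le> 3 * Q" using nb_le2[OF t(1,4)] nb_le2[OF t(1) j'(2)] .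
  obtain l where l: "z = pt t l" "nb t j l" using yz(4)[unfolded t(3) adj_pt[OF j(1)]] by (elim conjE exE)
  obtain l' where l': "z' = pt t l'" "nb t j' l'" using yz(6)[unfolded j'(1) adj_pt[OF j(2)]] by (elim conjE exE)
  have "pt t l \<noteq> pt t i" "pt t l' \<noteq> pt t i" "pt t j \<noteq> pt t j'"
    using yz(1,5,7) unfolding t(2,3) l(1) l'(1) j'(1) by (simp_all only: not_sym simp_thms)
  then have ne: "l \<noteq> i" "l' \<noteq> i" "j \<noteq> j'" by (auto)
  have "i = 0"
  proof (rule nb_cases[OF t(1,4)])
    assume A: "kA t i"
    show ?thesis using t(4) j'(2) ne(3) unfolding nb_kind(2)[OF t(1) A] by simp
  next
    assume M: "kM t i"
    have "j = 0 \<or> j = i + Q" "j' = 0 \<or> j' = i + Q" using t(4) j'(2) unfolding nb_kind(3)[OF t(1) M] .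
    moreover have "j = i + Q \<Longrightarrow> l = i" "j' = i + Q \<Longrightarrow> l' = i" using l(2) l'(2) nb_kind(4)[OF t(1) M] by simp_all
    ultimately show ?thesis using ne by blast
  next
    fix i' assume i': "kM t i'" "i = i' + Q"
    show ?thesis using t(4) j'(2) ne(3) unfolding i'(2) nb_kind(4)[OF t(1) i'(1)] by simp
  qed simp
  then show "\<exists>t\<in>B. v = pt t 0" using t by blast
next
  assume "\<exists>t\<in>B. v = pt t 0"
  then obtain t where t: "t \<in> B" "v = pt t 0" by blast
  have M: "kM t (Q + 1)" "kM t (Q + 2)" using p_ge[OF t(1)] by (auto simp: kM_def)
  have adjM: "adj graph (pt t 0) (pt t i) \<and> adj graph (pt t i) (pt t (i + Q))" if "kM t i" for i
    unfolding adj_graph nb_def arc_def using t(1) that by blast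
  have "adj graph (pt t 0) (pt t (Q + 1))" "adj graph (pt t 0) (pt t (Q + 2))"
     "adj graph (pt t (Q + 1)) (pt t (Q + 1 + Q))" "adj graph (pt t (Q + 2)) (pt t (Q + 2 + Q))"
    using adjM[OF M(1)] adjM[OF M(2)] by blast+
  moreover have "pt t (Q + 1) \<noteq> pt t (Q + 2)" "pt t (Q + 1 + Q) \<noteq> pt t 0" "pt t (Q + 2 + Q) \<noteq> pt t 0" by (auto simp: pt_def)
  ultimately show "rootv graph v" unfolding rootv_def t(2) using adj_verts[OF simple] by blast
qed

lemma rootv_pt: "t \<in> B \<Longrightarrow> i \<le> 3 * Q \<Longrightarrow> rootv graph (pt t i) \<longleftrightarrow> i = 0"
  using rootv_iff pt_inj[of i 0 t] by auto

lemma aset_pt: "t \<in> B \<Longrightarrow> aset graph (pt t 0) = pt t ` Collect (kA t)"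
proof (intro set_eqI iffI)
  assume t: "t \<in> B"
  fix x assume "x \<in> aset graph (pt t 0)"
  then have x: "adj graph x (pt t 0)" "\<And>y. adj graph x y \<Longrightarrow> y = pt t 0"
    using adj_verts[OF simple] unfolding aset_def by blast+
  then obtain i where i: "x = pt t i" "nb t 0 i" using adj_pt[of 0 t x] adj_sym[of graph] by auto
  have le: "i \<le> 3 * Q" by (rule nb_le2[OF t i(2)])
  have "\<not> kM t i"
  proof
    assume M: "kM t i"
    have "nb t i (i + Q)" using nb_kind(3)[OF t M] by simp
    then have "adj graph x (pt t (i + Q))" unfolding i(1) adj_pt[OF le] using t by blast
    then have "pt t (i + Q) = pt t 0" using x(2) by blast
    then show False using kinds(2)[OF t M] by (simp add: pt_def)
  qed
  then show "x \<in> pt t ` Collect (kA t)" using i(1) i(2)[unfolded nb_kind(1)[OF t]] by blast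
next
  assume t: "t \<in> B"
  fix x assume "x \<in> pt t ` Collect (kA t)"
  then obtain i where i: "x = pt t i" "kA t i" by blast
  have le: "i \<le> 3 * Q" using kinds(1)[OF t i(2)] by simp
  have "adj graph x y \<longleftrightarrow> y = pt t 0" for y using adj_pt[OF le] nb_kind(2)[OF t i(2)] t i(1) by auto
  then show "x \<in> aset graph (pt t 0)" using pt_less[OF t le] rootv_pt[OF t, of 0] i(1) by (simp add: aset_def)
qed

lemma pset_pt: "t \<in> B \<Longrightarrow> pset graph (pt t 0) = pt t ` Collect (kL t)"
proof (intro set_eqI iffI)
  assume t: "t \<in> B"
  fix x assume "x \<in> pset graph (pt t 0)"
  then obtain b where x: "x \<noteq> pt t 0" "adj graph x b" "adj graph b (pt t 0)" unfolding pset_def by blast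
  then obtain j where j: "b = pt t j" "nb t 0 j" using adj_pt[of 0 t b] adj_sym[of graph] by auto
  have le: "j \<le> 3 * Q" by (rule nb_le2[OF t j(2)])
  obtain i where i: "x = pt t i" "nb t j i" using x(2) adj_pt[OF le, of t x] adj_sym[of graph] j(1) by auto
  have i0: "i \<noteq> 0" using x(1) i(1) by metis
  have "\<not> kA t j"
  proof
    assume A: "kA t j"
    show False using i(2) i0 unfolding nb_kind(2)[OF t A] by simp
  qed
  then have M: "kM t j" using j(2)[unfolded nb_kind(1)[OF t]] by simp
  then have "i = j + Q" "kL t (j + Q)" using nb_kind(3)[OF t M, of i] i(2) i0 kM_kL(1)[OF M] by simp_all
  then show "x \<in> pt t ` Collect (kL t)" using i(1) by blast
next
  assume t: "t \<in> B"
  fix x assume "x \<in> pt t ` Collect (kL t)"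
  then obtain i where i: "x = pt t (i + Q)" "kM t i" "kL t (i + Q)" using kM_kL(2) by blast
  have le: "i + Q \<le> 3 * Q" "i \<le> 3 * Q" using kinds(3)[OF t i(3)] by auto
  have "adj graph x (pt t i)" "adj graph (pt t i) (pt t 0)"
    unfolding i(1) using adj_pt_pt[OF le] adj_pt_pt[OF le(2), of 0] nb_kind(3,4)[OF t i(2)] t by auto
  moreover have "x \<noteq> pt t 0" using i(2) by (simp add: i(1) pt_def kM_def)
  ultimately show "x \<in> pset graph (pt t 0)" using pt_less[OF t] le rootv_pt[OF t, of 0] i(1) by (auto simp: pset_def)
qed

lemma aset_not_root: "\<not> rootv graph v \<Longrightarrow> aset graph v = {}"
  by (simp add: aset_def)

lemma cells_graph: "cells graph = (\<lambda>t. pt t 0) ` {t \<in> B. cell t}"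
proof -
  have "aset graph (pt t 0) \<noteq> {} \<longleftrightarrow> cell t" if "t \<in> B" for t
    using aset_pt[OF that] p_ge[OF that] by (auto simp: kA_def intro!: exI[of _ 1])
  then have ne: "aset graph (pt t 0) = {} \<longleftrightarrow> \<not> cell t" if "t \<in> B" for t using that by blast
  have *: "r \<in> cells graph \<longleftrightarrow> rootv graph r \<and> (\<exists>t\<in>B. r = pt t 0 \<and> cell t)" for r
  proof (cases "rootv graph r")
    case True
    then obtain t where t: "t \<in> B" "r = pt t 0" using rootv_iff by blast
    have "(\<exists>t'\<in>B. pt t 0 = pt t' 0 \<and> cell t') \<longleftrightarrow> cell t" using t(1) by (auto simp: pt_inj)
    then show ?thesis using True t ne[OF t(1)] pt_less[OF t(1), of 0] by (simp add: cells_def)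
  qed (simp add: cells_def aset_not_root)
  show ?thesis using rootv_iff by (auto simp: *)
qed

lemma rules_graph: "rules graph = (\<lambda>t. pt t 0) ` {t \<in> B. \<not> cell t}"
proof -
  have "aset graph (pt t 0) \<noteq> {} \<longleftrightarrow> cell t" if "t \<in> B" for t
    using aset_pt[OF that] p_ge[OF that] by (auto simp: kA_def intro!: exI[of _ 1])
  then have ne: "aset graph (pt t 0) = {} \<longleftrightarrow> \<not> cell t" if "t \<in> B" for t using that by blast
  have *: "r \<in> rules graph \<longleftrightarrow> rootv graph r \<and> (\<exists>t\<in>B. r = pt t 0 \<and> \<not> cell t)" for r
  proof (cases "rootv graph r")
    case True
    then obtain t where t: "t \<in> B" "r = pt t 0" using rootv_iff by blast
    have "(\<exists>t'\<in>B. pt t 0 = pt t' 0 \<and> \<not> cell t') \<longleftrightarrow> \<not> cell t" using t(1) by (auto simp: pt_inj)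
    then show ?thesis using True t ne[OF t(1)] pt_less[OF t(1), of 0] by (simp add: rules_def)
  qed (simp add: rules_def)
  show ?thesis using rootv_iff by (auto simp: *)
qed

lemma inj_pt: "inj_on (pt t) A"
  by (auto simp: inj_on_def pt_def)

lemma card_aset: "t \<in> B \<Longrightarrow> cell t \<Longrightarrow> card (aset graph (pt t 0)) = p t"
proof -
  assume "t \<in> B" "cell t"
  moreover have "Collect (kA t) = {1..p t}" using \<open>cell t\<close> by (auto simp: kA_def)
  ultimately show ?thesis using card_image[OF inj_pt, of t "{1..p t}"] by (simp add: aset_pt)
qed

lemma card_pset: "t \<in> B \<Longrightarrow> card (pset graph (pt t 0)) = p t"
proof -
  assume "t \<in> B"
  moreover have "Collect (kL t) = {2 * Q + 1..2 * Q + p t}" by (auto simp: kL_def)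
  ultimately show ?thesis using card_image[OF inj_pt, of t "{2 * Q + 1..2 * Q + p t}"] by (simp add: pset_pt)
qed

lemma rank_pt:
  assumes t: "t \<in> B"
  shows "rank graph (pt t 0) = 0" "kA t i \<Longrightarrow> rank graph (pt t i) = 1" "kM t i \<Longrightarrow> rank graph (pt t i) = 1"
    "kL t i \<Longrightarrow> rank graph (pt t i) = 2"
proof -
  have r0: "rootv graph (pt t 0)" using t rootv_iff by blast
  then show "rank graph (pt t 0) = 0" by (simp add: rank_def)
  have m: "rank graph (pt t i) = 1" if "i \<le> 3 * Q" "i \<noteq> 0" "nb t i 0"
  proof -
    have "adj graph (pt t i) (pt t 0)" using adj_pt_pt[OF that(1), of 0] t that(3) by simp
    then have "midv graph (pt t i)" using r0 rootv_pt[OF t that(1)] that(2) pt_less[OF t, of 0] unfolding midv_def by auto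
    then show ?thesis using rootv_pt[OF t that(1)] that(2) by (simp add: rank_def)
  qed
  show "kA t i \<Longrightarrow> rank graph (pt t i) = 1" using m kinds(1)[OF t, of i] nb_kind(2)[OF t, of i 0] by simp
  show "kM t i \<Longrightarrow> rank graph (pt t i) = 1" using m kinds(2)[OF t, of i] nb_kind(3)[OF t, of i 0] by simp
  assume L: "kL t i"
  then obtain j where j: "i = j + Q" "kM t j" using kM_kL(2) by blast
  have le: "i \<le> 3 * Q" "i \<noteq> 0" using kinds(3)[OF t L] by auto
  have "y = pt t j" if ay: "adj graph (pt t i) y" for y
  proof -
    obtain j' where "y = pt t j'" "nb t i j'" using ay[unfolded adj_pt[OF le(1)]] by (elim conjE exE)
    then show ?thesis using nb_kind(4)[OF t j(2), of j'] j(1) by simp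
  qed
  then have y: "y = pt t j" if "adj graph (pt t i) y" for y using that .
  have nr: "\<not> rootv graph (pt t j)" using rootv_pt[OF t, of j] kinds(2)[OF t j(2)] by simp
  have "\<not> midv graph (pt t i)"
  proof
    assume "midv graph (pt t i)"
    then obtain r where r: "adj graph (pt t i) r" "rootv graph r" unfolding midv_def by (elim conjE bexE)
    show False using r(2) nr unfolding y[OF r(1)] by simp
  qed
  then show "rank graph (pt t i) = 2" using rootv_pt[OF t le(1)] le(2) by (simp add: rank_def)
qed

lemma ranked_graph: "ranked graph"
  unfolding ranked_def
proof (intro conjI ballI impI)
  fix x y assume "adj graph x y"
  then obtain t i j where t: "t \<in> B" "x = pt t i" "y = pt t j" "arc t i j \<or> arc t j i" unfolding adj_graph nb_def by blast
  have "rank graph (pt t i) \<noteq> rank graph (pt t j)" if "arc t i j" for i j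
    using that rank_pt(1)[OF t(1)] rank_pt(2,3)[OF t(1), of j] rank_pt(3)[OF t(1), of i]
      rank_pt(4)[OF t(1), of j] kM_kL(1)[of t i] unfolding arc_def by auto
  then show "rank graph x \<noteq> rank graph y" using t by metis
next
  fix x y z assume *: "adj graph x y \<and> adj graph x z \<and> rank graph y < rank graph x \<and> rank graph z < rank graph x"
  then obtain t i j where t: "t \<in> B" "x = pt t i" "y = pt t j" "nb t i j" unfolding adj_graph by blast
  have i: "i \<le> 3 * Q" using nb_le[OF t(1,4)] .
  have "adj graph (pt t i) z" using * t(2) by simp
  then obtain l where l: "z = pt t l" "nb t i l" unfolding adj_pt[OF i] by (elim conjE exE)
  note rk = rank_pt[OF t(1)]
  have "j = l"
  proof (rule nb_cases[OF t(1,4)])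
    assume "i = 0"
    then show ?thesis using * t(2) rk(1) by simp
  next
    assume "kA t i"
    then show ?thesis using nb_kind(2)[OF t(1), of i] t(4) l(2) by simp
  next
    assume M: "kM t i"
    have "j \<noteq> i + Q" "l \<noteq> i + Q" using rk(3)[OF M] rk(4)[OF kM_kL(1)[OF M]] * t(2,3) l(1) by auto
    then show ?thesis using nb_kind(3)[OF t(1) M] t(4) l(2) by simp
  next
    fix i' assume i': "kM t i'" "i = i' + Q"
    show ?thesis using t(4) l(2) unfolding i'(2) nb_kind(4)[OF t(1) i'(1)] by simp
  qed
  then show "y = z" using t(3) l(1) by simp
qed

lemma sets_in_block:
  assumes "t \<in> B" "x \<in> aset graph (pt t 0) \<or> x \<in> pset graph (pt t 0)"
  shows "\<exists>i. x = pt t i \<and> i \<le> 3 * Q"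
proof -
  obtain i where "x = pt t i" "kA t i \<or> kL t i"
    using assms(2) unfolding aset_pt[OF assms(1)] pset_pt[OF assms(1)] by blast
  then show ?thesis using kinds(1,3)[OF assms(1), of i] by blast
qed

sublocale ts: toggle_system "cells graph" "rules graph" "aset graph" "pset graph" "pset graph"
proof
  show "finite (cells graph)" "finite (rules graph)" unfolding cells_graph rules_graph using fin_B by auto
  show "finite (aset graph j)" "finite (pset graph j)" for j by (auto simp: aset_def pset_def)
  show "finite (pset graph r)" for r by (simp add: pset_def)
  show "card (aset graph j) = card (pset graph j)" "4 \<le> card (aset graph j)" if "j \<in> cells graph" for j
    using that p_ge card_aset card_pset unfolding cells_graph by auto
  have d: "x \<notin> Y" if st: "t \<in> B" "t' \<in> B" "t \<noteq> t'" "x \<in> X"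
    "X = aset graph (pt t 0) \<or> X = pset graph (pt t 0)" "Y = aset graph (pt t' 0) \<or> Y = pset graph (pt t' 0)" for t t' x X Y
  proof
    assume "x \<in> Y"
    then obtain i j where "x = pt t i" "i \<le> 3 * Q" "x = pt t' j" "j \<le> 3 * Q"
      using st sets_in_block[of t x] sets_in_block[of t' x] by blast
    then have "pt t i = pt t' j" "i \<le> 3 * Q" "j \<le> 3 * Q" by simp_all
    then show False using pt_inj[of i j t t'] st(3) by simp
  qed
  have root: "\<exists>t\<in>B. i = pt t 0" if "i \<in> cells graph \<or> i \<in> rules graph" for i
    using that unfolding cells_graph rules_graph by auto
  have D: "X \<inter> Y = {}" if ij: "i \<in> cells graph \<or> i \<in> rules graph" "j \<in> cells graph \<or> j \<in> rules graph" "i \<noteq> j"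
    "X = aset graph i \<or> X = pset graph i" "Y = aset graph j \<or> Y = pset graph j" for i j X Y
  proof -
    obtain t where t: "t \<in> B" "i = pt t 0" using root[OF ij(1)] by blast
    obtain t' where t': "t' \<in> B" "j = pt t' 0" using root[OF ij(2)] by blast
    have "t \<noteq> t'" using ij(3) t t' by blast
    then show ?thesis using d[OF t(1) t'(1), of _ X Y] ij(4,5) unfolding t(2) t'(2) by blast
  qed
  have ne: "i \<noteq> j" if "i \<in> cells graph" "j \<in> rules graph" for i j using that unfolding cells_def rules_def by blast
  show "aset graph i \<inter> aset graph j = {}" if "i \<in> cells graph" "j \<in> cells graph" "i \<noteq> j" for i j using D that by blast
  show "pset graph i \<inter> pset graph j = {}" if "i \<in> cells graph" "j \<in> cells graph" "i \<noteq> j" for i j using D that by blast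
  show "pset graph i \<inter> pset graph j = {}" if "i \<in> rules graph" "j \<in> rules graph" "i \<noteq> j" for i j using D that by blast
  show "aset graph i \<inter> pset graph j = {}" if "i \<in> cells graph" "j \<in> rules graph" for i j using D[of i j] that ne[OF that] by blast
  show "pset graph i \<inter> pset graph j = {}" if "i \<in> cells graph" "j \<in> rules graph" for i j using D[of i j] that ne[OF that] by blast
  show "aset graph i \<inter> pset graph j = {}" if c: "i \<in> cells graph" "j \<in> cells graph" for i j
  proof (cases "i = j")
    case True
    obtain t where t: "t \<in> B" "i = pt t 0" using root[of i] c by blast
    have "pt t a \<noteq> pt t b" if A: "kA t a" and L: "kL t b" for a b
    proof -
      have "a \<le> 3 * Q" "b \<le> 3 * Q" "a \<noteq> b" using kinds(1)[OF t(1) A] kinds(3)[OF t(1) L] L by auto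
      then show ?thesis using pt_inj[of a b t t] by simp
    qed
    then show ?thesis unfolding True[symmetric] t(2) aset_pt[OF t(1)] pset_pt[OF t(1)] by blast
  qed (use D c in blast)
qed

lemma tj_ok_iff: "tj_ok graph X \<longleftrightarrow> ts.ok X"
proof -
  have "X \<subseteq> verts graph" if "ts.ok X"
    using that unfolding token_set_def aset_def pset_def by blast
  then show ?thesis using models_phi[of X graph] ranked_graph unfolding tj_ok_def by blast
qed

lemma tj_step_iff: "tj_step graph = ts.move"
  by (simp add: fun_eq_iff tj_step_def ts.move_def tj_ok_iff)

lemma wt_pt: "t \<in> B \<Longrightarrow> cell t \<Longrightarrow> ts.wt (pt t 0) = p t"
  by (simp add: ts.wt_def card_aset)

lemma rest_set_instance:
  assumes "F \<subseteq> cells graph" "F' \<subseteq> cells graph"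
  shows "msor1_instance phi 0 graph (ts.rest_set F) (ts.rest_set F')"
    "(\<exists>Ss. TJ_sequence graph phi 0 (ts.rest_set F) (ts.rest_set F') Ss) \<longleftrightarrow> ts.ctoggle\<^sup>*\<^sup>* F F'"
proof -
  have ok: "tj_ok graph (ts.rest_set F)" "tj_ok graph (ts.rest_set F')"
    using assms ts.ok_rest_set tj_ok_iff by auto
  then show "msor1_instance phi 0 graph (ts.rest_set F) (ts.rest_set F')"
    using simple ts.card_rest_set[OF assms(1)] ts.card_rest_set[OF assms(2)]
    unfolding msor1_instance_def tj_ok_def by simp
  show "(\<exists>Ss. TJ_sequence graph phi 0 (ts.rest_set F) (ts.rest_set F') Ss) \<longleftrightarrow> ts.ctoggle\<^sup>*\<^sup>* F F'"
    unfolding TJ_sequence_iff_reach tj_step_iff using ok(1) ts.move_reach_iff[OF assms] by simp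
qed

lemma forest_graph: "forest_of_depth 3 graph"
  by (rule ranked_forest[OF simple ranked_graph])

text \<open>That a word is a yes-instance only provides some instance with this encoding;
  injectivity of the encoding identifies it with the one at hand.\<close>

lemma encode_in_instances:
  assumes "F \<subseteq> cells graph" "F' \<subseteq> cells graph"
  defines "w \<equiv> encode_instance n graph (ts.rest_set F) (ts.rest_set F')"
  shows "w \<in> msor1_instances phi 0 (forest_of_depth 3)"
    "w \<in> msor1_yes_instances phi 0 (forest_of_depth 3) \<longleftrightarrow> ts.ctoggle\<^sup>*\<^sup>* F F'"
proof -
  note i = rest_set_instance[OF assms(1,2)]
  show "w \<in> msor1_instances phi 0 (forest_of_depth 3)"
    unfolding msor1_instances_def w_def using i(1) forest_graph verts_graph by blast
  have "ts.ctoggle\<^sup>*\<^sup>* F F'" if yes: "w \<in> msor1_yes_instances phi 0 (forest_of_depth 3)"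
  proof -
    obtain n' G S S' where *: "w = encode_instance n' G S S'" "verts G = {..<n'}" "msor1_instance phi 0 G S S'"
      "\<exists>Ss. TJ_sequence G phi 0 S S' Ss" using yes unfolding msor1_yes_instances_def by blast
    have eq: "n = n' \<and> graph = G \<and> ts.rest_set F = S \<and> ts.rest_set F' = S'"
      by (rule encode_instance_inj) (use * i(1) w_def in \<open>auto simp: msor1_instance_def\<close>)
    note e = eq[THEN conjunct2, THEN conjunct1] eq[THEN conjunct2, THEN conjunct2, THEN conjunct1]
      eq[THEN conjunct2, THEN conjunct2, THEN conjunct2]
    have "\<exists>Ss. TJ_sequence graph phi 0 (ts.rest_set F) (ts.rest_set F') Ss"
      using *(4) unfolding e(1)[symmetric] e(2)[symmetric] e(3)[symmetric] .
    then show ?thesis using i(2) by blast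
  qed
  moreover have "w \<in> msor1_yes_instances phi 0 (forest_of_depth 3)" if "ts.ctoggle\<^sup>*\<^sup>* F F'"
    unfolding msor1_yes_instances_def w_def using that i forest_graph verts_graph by blast
  ultimately show "w \<in> msor1_yes_instances phi 0 (forest_of_depth 3) \<longleftrightarrow> ts.ctoggle\<^sup>*\<^sup>* F F'" by blast
qed

end

section \<open>Weights that identify cells, and the instance for a given input\<close>

lemma three_digits:
  fixes Nb :: nat
  assumes "a < Nb" "b < Nb" "a' < Nb" "b' < Nb" "a + Nb * b + Nb * Nb * c = a' + Nb * b' + Nb * Nb * c'"
  shows "a = a' \<and> b = b' \<and> c = c'"
proof -
  have "a + Nb * (b + Nb * c) = a' + Nb * (b' + Nb * c')" using assms(5) by (simp add: algebra_simps)
  then have "a = a' \<and> b + Nb * c = b' + Nb * c'" by (rule digits_unique[OF assms(1,3)])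
  then show ?thesis using digits_unique[OF assms(2,4), of c c'] by blast
qed

text \<open>Collected by kind, the at most three weights give digits below \<open>Nb\<close>, so the
  two numbers agree digit by digit. All digits of the right side are at least 4, hence each kind
  occurs in \<open>J\<close>; with at most three cells it occurs once, and the digit is its index
  plus 4.\<close>

lemma weight_determines_triple:
  fixes J :: "(nat \<times> nat) set"
  assumes J: "finite J" "card J \<le> 3" "\<And>x. x \<in> J \<Longrightarrow> fst x < 3 \<and> snd x < H" and cfl: "c < H" "f < H" "l < H"
    and Nb: "3 * (H + 4) < Nb"
    and sum: "(\<Sum>x\<in>J. (snd x + 4) * Nb ^ fst x) = (c + 4) + Nb * (f + 4) + Nb * Nb * (l + 4)"
  shows "J = {(0, c), (1, f), (2, l)}"
proof -
  define part where "part i = (\<Sum>x\<in>J. if fst x = i then snd x + 4 else 0)" for i :: nat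
  have small: "part i < Nb" for i
  proof -
    have "part i \<le> (\<Sum>x\<in>J. H + 4)" unfolding part_def by (rule sum_mono) (use J(3) in \<open>auto intro: less_imp_le\<close>)
    also have "\<dots> \<le> 3 * (H + 4)" using mult_le_mono1[OF J(2), of "H + 4"] by simp
    finally show ?thesis using Nb by simp
  qed
  have "(\<Sum>x\<in>J. (snd x + 4) * Nb ^ fst x) =
      (\<Sum>x\<in>J. (if fst x = 0 then snd x + 4 else 0) + Nb * (if fst x = 1 then snd x + 4 else 0) +
        Nb * Nb * (if fst x = 2 then snd x + 4 else 0))"
  proof (rule sum.cong)
    fix x assume "x \<in> J"
    then have "fst x = 0 \<or> fst x = 1 \<or> fst x = 2" using J(3)[of x] by auto
    then show "(snd x + 4) * Nb ^ fst x = (if fst x = 0 then snd x + 4 else 0) + Nb * (if fst x = 1 then snd x + 4 else 0) +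
        Nb * Nb * (if fst x = 2 then snd x + 4 else 0)" by (auto simp: power2_eq_square)
  qed simp
  also have "\<dots> = part 0 + Nb * part 1 + Nb * Nb * part 2" by (simp add: part_def sum.distrib sum_distrib_left)
  finally have eq: "part 0 + Nb * part 1 + Nb * Nb * part 2 = (c + 4) + Nb * (f + 4) + Nb * Nb * (l + 4)" using sum by (rule trans[OF sym])
  have "c + 4 < Nb" using cfl(1) Nb by simp
  moreover have "f + 4 < Nb" using cfl(2) Nb by simp
  ultimately have e: "part 0 = c + 4 \<and> part 1 = f + 4 \<and> part 2 = l + 4"
    by (rule three_digits[OF small[of 0] small[of 1] _ _ eq])
  have ex: "\<exists>x\<in>J. fst x = i" if ne: "part i \<noteq> 0" for i
  proof (rule ccontr)
    assume "\<not> (\<exists>x\<in>J. fst x = i)"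
    then have "part i = 0" unfolding part_def by (intro sum.neutral) auto
    then show False using ne by simp
  qed
  obtain x0 where x0: "x0 \<in> J" "fst x0 = 0" using ex[of 0] e by auto
  obtain x1 where x1: "x1 \<in> J" "fst x1 = 1" using ex[of 1] e by auto
  obtain x2 where x2: "x2 \<in> J" "fst x2 = 2" using ex[of 2] e by auto
  have ne: "x0 \<noteq> x1" "x0 \<noteq> x2" "x1 \<noteq> x2" using x0(2) x1(2) x2(2) by auto
  have "card {x0, x1, x2} = 3" using ne by simp
  then have JE: "J = {x0, x1, x2}" using card_subset_eq[OF J(1), of "{x0, x1, x2}"] card_mono[OF J(1), of "{x0, x1, x2}"]
      x0(1) x1(1) x2(1) J(2) by simp
  have "part i = (if fst x0 = i then snd x0 + 4 else 0) + (if fst x1 = i then snd x1 + 4 else 0) + (if fst x2 = i then snd x2 + 4 else 0)" for i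
    unfolding part_def JE using ne by (simp add: add.assoc)
  then have "snd x0 = c" "snd x1 = f" "snd x2 = l" using e x0(2) x1(2) x2(2) by simp_all
  then have "x0 = (0, c)" "x1 = (1, f)" "x2 = (2, l)" using x0(2) x1(2) x2(2) by (simp_all add: prod_eq_iff)
  then show ?thesis using JE by simp
qed

context coded_machine begin

text \<open>The base exceeds three times the largest digit, so three cells of one kind produce no
  carry. The summand 4 makes every group large enough for \<open>toggle_system\<close> and every
  digit nonzero.\<close>

definition "Nb = 4 * (H + 4)"
definition "Q = (H + 4) * (1 + Nb + Nb * Nb)"
definition "Z = 3 * Q + 1"
definition "nblocks = 3 * H + H * H * H"
definition "n = Z * nblocks"

definition wgt :: "nat \<Rightarrow> nat" where
  "wgt t = (if t < H then t + 4 else if t < 2 * H then (t - H + 4) * Nb else if t < 3 * H then (t - 2 * H + 4) * (Nb * Nb)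
     else let r = t - 3 * H in (r mod H + 4) + Nb * (r div H mod H + 4) + Nb * Nb * (r div H div H + 4))"

definition rule_block :: "nat \<Rightarrow> nat \<Rightarrow> nat \<Rightarrow> nat" where
  "rule_block c f l = 3 * H + c + H * f + H * H * l"

text \<open>Every triple of indices has its reserved address, but only reactions of the machine get
  a tree there; the other addresses remain isolated vertices.\<close>

definition Bs :: "nat set" where
  "Bs = {t. t < 3 * H \<or> (\<exists>c<H. \<exists>f<H. \<exists>l<H. vm.reaction c f l \<and> t = rule_block c f l)}"

lemma H_pos: "0 < H"
  using sizes by (simp add: H_def)

lemma wgt_rule:
  assumes "c < H" "f < H"
  shows "wgt (rule_block c f l) = (c + 4) + Nb * (f + 4) + Nb * Nb * (l + 4)"
proof -
  define r where "r = c + H * (f + H * l)"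
  have r: "rule_block c f l = 3 * H + r" by (simp add: rule_block_def r_def algebra_simps)
  have "r mod H = c" "r div H = f + H * l" using assms(1) by (simp_all add: r_def)
  moreover have "(f + H * l) mod H = f" "(f + H * l) div H = l" using assms(2) by simp_all
  ultimately show ?thesis unfolding r wgt_def by simp
qed

lemma wgt_cell: "i < 3 \<Longrightarrow> j < H \<Longrightarrow> wgt (j + H * i) = (j + 4) * Nb ^ i"
proof -
  assume "i < 3" "j < H"
  then have "i = 0 \<or> i = 1 \<or> i = 2" by auto
  then show ?thesis using \<open>j < H\<close> by (auto simp: wgt_def power2_eq_square)
qed

lemma rule_block_less: "c < H \<Longrightarrow> f < H \<Longrightarrow> l < H \<Longrightarrow> rule_block c f l < nblocks"
proof -
  assume *: "c < H" "f < H" "l < H"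
  have "c + H * f < H * (f + 1)" using * by simp
  also have "\<dots> \<le> H * H" using * by (intro mult_le_mono2) simp
  finally have "c + H * f + H * H * l < H * H * (l + 1)" by simp
  also have "\<dots> \<le> H * H * H" using * by (intro mult_le_mono2) simp
  finally show ?thesis by (simp add: rule_block_def nblocks_def)
qed

lemma cell_block: "t < 3 * H \<Longrightarrow> \<exists>i<3. \<exists>j<H. t = j + H * i"
  using H_pos by (intro exI[of _ "t div H"] exI[of _ "t mod H"] conjI) (simp_all add: less_mult_imp_div_less mult.commute)

lemma block_bounds:
  assumes "t \<in> Bs"
  shows "4 \<le> wgt t" "wgt t \<le> Q" "t < nblocks"
proof -
  have N1: "1 \<le> Nb" by (simp add: Nb_def)
  have Q: "Q = (H + 4) + Nb * (H + 4) + Nb * Nb * (H + 4)" by (simp add: Q_def algebra_simps)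
  consider "t < 3 * H" | c f l where "c < H" "f < H" "l < H" "t = rule_block c f l" using assms unfolding Bs_def by blast
  then have "4 \<le> wgt t \<and> wgt t \<le> Q \<and> t < nblocks"
  proof cases
    case 1
    obtain i j where ij: "i < 3" "j < H" "t = j + H * i" using cell_block[OF 1] by blast
    have N: "1 \<le> Nb ^ i" using N1 by simp
    have lo: "(j + 4) * 1 \<le> (j + 4) * Nb ^ i" by (rule mult_le_mono2[OF N])
    have hi: "(j + 4) * Nb ^ i \<le> (H + 4) * Nb ^ i" using ij(2) by (intro mult_le_mono1) simp
    have "i = 0 \<or> i = 1 \<or> i = 2" using ij(1) by auto
    then have "Nb ^ i \<le> 1 + Nb + Nb * Nb" by (auto simp: power2_eq_square)
    then have Qle: "(H + 4) * Nb ^ i \<le> Q" unfolding Q_def by (rule mult_le_mono2)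
    have "(4 :: nat) \<le> (j + 4) * 1" by simp
    then have "4 \<le> (j + 4) * Nb ^ i" using lo by (rule le_trans)
    moreover have "(j + 4) * Nb ^ i \<le> Q" by (rule le_trans[OF hi Qle])
    moreover have "wgt t = (j + 4) * Nb ^ i" unfolding ij(3) by (rule wgt_cell[OF ij(1,2)])
    moreover have "t < nblocks" using 1 by (simp add: nblocks_def)
    ultimately show ?thesis by simp
  next
    case (2 c f l)
    have w: "wgt t = (c + 4) + Nb * (f + 4) + Nb * Nb * (l + 4)" unfolding 2(4) by (rule wgt_rule[OF 2(1,2)])
    have "wgt t \<le> Q" unfolding w Q by (intro add_le_mono mult_le_mono2) (use 2(1-3) in simp_all)
    moreover have "4 \<le> wgt t" unfolding w by simp
    moreover have "t < nblocks" unfolding 2(4) by (rule rule_block_less[OF 2(1-3)])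
    ultimately show ?thesis by simp
  qed
  then show "4 \<le> wgt t" "wgt t \<le> Q" "t < nblocks" by auto
qed

sublocale bl: blocks Bs "\<lambda>t. t < 3 * H" wgt Q n
proof
  show "finite Bs" by (rule finite_subset[of _ "{..<nblocks}"]) (use block_bounds(3) in auto)
  show "(3 * Q + 1) * (t + 1) \<le> n" if "t \<in> Bs" for t
    unfolding n_def Z_def using block_bounds(3)[OF that] by (intro mult_le_mono2) simp
qed (rule block_bounds; assumption)+

definition idx :: "nat \<times> nat \<Rightarrow> nat" where "idx x = snd x + H * fst x"
definition K :: "(nat \<times> nat) set" where "K = {..<3} \<times> {..<H}"
definition \<iota> :: "nat \<times> nat \<Rightarrow> nat" where "\<iota> x = bl.pt (idx x) 0"

lemma idx_K: "idx ` K = {..<3 * H}"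
proof
  show "idx ` K \<subseteq> {..<3 * H}"
  proof
    fix t assume "t \<in> idx ` K"
    then obtain i j where "i < 3" "j < H" "t = j + H * i" by (auto simp: K_def idx_def)
    moreover have "H * i \<le> H * 2" using \<open>i < 3\<close> by (intro mult_le_mono2) simp
    ultimately show "t \<in> {..<3 * H}" unfolding lessThan_iff by linarith
  qed
  show "{..<3 * H} \<subseteq> idx ` K"
  proof
    fix t assume "t \<in> {..<3 * H}"
    then obtain i j where "i < 3" "j < H" "t = j + H * i" using cell_block by blast
    then show "t \<in> idx ` K" by (intro image_eqI[of _ _ "(i, j)"]) (auto simp: K_def idx_def)
  qed
qed

lemma idx_inj: "inj_on idx K"
proof
  fix x y assume *: "x \<in> K" "y \<in> K" "idx x = idx y"
  then have "snd x < H" "snd y < H" "snd x + H * fst x = snd y + H * fst y" by (auto simp: K_def idx_def)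
  from digits_unique[OF this] show "x = y" by (simp add: prod_eq_iff)
qed

lemma \<iota>_inj: "inj_on \<iota> K"
  using idx_inj unfolding inj_on_def \<iota>_def by (simp add: bl.pt_inj)

lemma cells_eq: "cells bl.graph = \<iota> ` K"
proof -
  have "{t \<in> Bs. t < 3 * H} = idx ` K" unfolding idx_K by (auto simp: Bs_def)
  then show ?thesis unfolding bl.cells_graph \<iota>_def by auto
qed

lemma K_Bs: "x \<in> K \<Longrightarrow> idx x \<in> Bs \<and> idx x < 3 * H"
  using idx_K by (auto simp: Bs_def)

lemma reaction_range: "vm.reaction c f l \<Longrightarrow> c < H \<and> f < H \<and> l < H"
proof -
  assume "vm.reaction c f l"
  then obtain c0 i v c' v' where I: "instr c0 i v c' v'" "l = v + g * c0" "c = c0 \<and> f = v + g * i \<or> c = c' \<and> f = v' + g * i"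
    unfolding vm.reaction_def by blast
  note r = vm.range[OF I(1)]
  have "v + g * i < g * (i + 1)" "v' + g * i < g * (i + 1)" using r by simp_all
  moreover have "g * (i + 1) \<le> H" unfolding H_def using r by (intro mult_le_mono2) simp
  ultimately show ?thesis using r I(2,3) by auto
qed

lemma triple_K: "vm.reaction c f l \<Longrightarrow> vm.triple c f l \<subseteq> K"
  using reaction_range[of c f l] by (auto simp: vm.triple_def K_def)

lemma sum_wt: "J \<subseteq> K \<Longrightarrow> (\<Sum>j\<in>\<iota> ` J. bl.ts.wt j) = (\<Sum>x\<in>J. (snd x + 4) * Nb ^ fst x)"
proof -
  assume J: "J \<subseteq> K"
  have "(\<Sum>j\<in>\<iota> ` J. bl.ts.wt j) = (\<Sum>x\<in>J. bl.ts.wt (\<iota> x))"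
    using sum.reindex[OF inj_on_subset[OF \<iota>_inj J], of bl.ts.wt] by simp
  also have "\<dots> = (\<Sum>x\<in>J. (snd x + 4) * Nb ^ fst x)"
  proof (rule sum.cong[OF refl])
    fix x assume "x \<in> J"
    then have x: "x \<in> K" using J by blast
    then have "fst x < 3" "snd x < H" by (auto simp: K_def)
    then show "bl.ts.wt (\<iota> x) = (snd x + 4) * Nb ^ fst x"
      using bl.wt_pt[of "idx x"] K_Bs[OF x] wgt_cell[of "fst x" "snd x"] by (simp add: \<iota>_def idx_def)
  qed
  finally show ?thesis .
qed

text \<open>The meeting point of both worlds: a set of at most three cells fits the size of some
  rule tree just when it is the triple of a reaction, because the weight determines the
  triple.\<close>

lemma rule_applies_iff:
  assumes J: "J \<subseteq> K"
  shows "(\<exists>r\<in>rules bl.graph. \<iota> ` J \<noteq> {} \<and> card (\<iota> ` J) \<le> 3 \<and> (\<Sum>j\<in>\<iota> ` J. bl.ts.wt j) = card (pset bl.graph r)) \<longleftrightarrow>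
    (\<exists>c f l. vm.reaction c f l \<and> J = vm.triple c f l)"
proof
  assume "\<exists>r\<in>rules bl.graph. \<iota> ` J \<noteq> {} \<and> card (\<iota> ` J) \<le> 3 \<and> (\<Sum>j\<in>\<iota> ` J. bl.ts.wt j) = card (pset bl.graph r)"
  then obtain t where t: "t \<in> Bs" "\<not> t < 3 * H" "card (\<iota> ` J) \<le> 3" "(\<Sum>j\<in>\<iota> ` J. bl.ts.wt j) = card (pset bl.graph (bl.pt t 0))"
    unfolding bl.rules_graph by blast
  obtain c f l where r: "c < H" "f < H" "l < H" "vm.reaction c f l" "t = rule_block c f l" using t(1,2) unfolding Bs_def by blast
  have "card J \<le> 3" using t(3) card_image[OF inj_on_subset[OF \<iota>_inj J]] by simp
  moreover have "finite J" using J by (rule finite_subset) (simp add: K_def)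
  moreover have "(\<Sum>x\<in>J. (snd x + 4) * Nb ^ fst x) = (c + 4) + Nb * (f + 4) + Nb * Nb * (l + 4)"
    using t(4) sum_wt[OF J] bl.card_pset[OF t(1)] wgt_rule[OF r(1,2)] r(5) by simp
  ultimately have "J = {(0, c), (1, f), (2, l)}"
    using J r(1-3) by (intro weight_determines_triple[where H = H and Nb = Nb]) (auto simp: K_def Nb_def)
  then show "\<exists>c f l. vm.reaction c f l \<and> J = vm.triple c f l" using r(4) unfolding vm.triple_def by blast
next
  assume "\<exists>c f l. vm.reaction c f l \<and> J = vm.triple c f l"
  then obtain c f l where r: "vm.reaction c f l" and JE: "J = vm.triple c f l" by blast
  note rr = reaction_range[OF r]
  define t where "t = rule_block c f l"
  have t: "t \<in> Bs" "\<not> t < 3 * H" using r rr unfolding Bs_def t_def by (auto simp: rule_block_def)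
  have J3: "J = {(0, c), (1, f), (2, l)}" unfolding JE vm.triple_def ..
  have "card (\<iota> ` J) \<le> 3" using card_image_le[of J \<iota>] unfolding J3 by simp
  moreover have "(\<Sum>j\<in>\<iota> ` J. bl.ts.wt j) = card (pset bl.graph (bl.pt t 0))"
    unfolding sum_wt[OF J] bl.card_pset[OF t(1)] unfolding t_def J3 using wgt_rule[of c f l] rr
    by (simp add: power2_eq_square algebra_simps)
  moreover have "bl.pt t 0 \<in> rules bl.graph" unfolding bl.rules_graph using t by blast
  moreover have "\<iota> ` J \<noteq> {}" using J3 by simp
  ultimately show "\<exists>r\<in>rules bl.graph. \<iota> ` J \<noteq> {} \<and> card (\<iota> ` J) \<le> 3 \<and> (\<Sum>j\<in>\<iota> ` J. bl.ts.wt j) = card (pset bl.graph r)"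
    by blast
qed

lemma image_diff_iff:
  assumes "F \<subseteq> K" "F' \<subseteq> K" "J \<subseteq> K"
  shows "\<iota> ` J \<subseteq> \<iota> ` F \<and> \<iota> ` F' = \<iota> ` F - \<iota> ` J \<longleftrightarrow> J \<subseteq> F \<and> F' = F - J"
proof -
  have "\<iota> ` F - \<iota> ` J = \<iota> ` (F - J)"
    using inj_on_image_set_diff[OF \<iota>_inj, of F J] assms by blast
  moreover have "\<iota> ` J \<subseteq> \<iota> ` F \<longleftrightarrow> J \<subseteq> F" using \<iota>_inj assms unfolding inj_on_def by blast
  moreover have "\<iota> ` F' = \<iota> ` (F - J) \<longleftrightarrow> F' = F - J"
    by (rule inj_on_image_eq_iff[OF \<iota>_inj assms(2)]) (use assms(1) in blast)
  ultimately show ?thesis by simp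
qed

lemma ctoggle_iff:
  assumes F: "F \<subseteq> K" "F' \<subseteq> K"
  shows "bl.ts.ctoggle (\<iota> ` F) (\<iota> ` F') \<longleftrightarrow> vm.toggle F F'"
proof
  assume "bl.ts.ctoggle (\<iota> ` F) (\<iota> ` F')"
  from this[unfolded bl.ts.ctoggle_def, THEN conjunct2, THEN conjunct2]
  obtain r where r: "r \<in> rules bl.graph" and ex: "\<exists>J'\<subseteq>cells bl.graph. J' \<noteq> {} \<and> card J' \<le> 3 \<and>
    (\<Sum>j\<in>J'. bl.ts.wt j) = card (pset bl.graph r) \<and>
    (J' \<subseteq> \<iota> ` F \<and> \<iota> ` F' = \<iota> ` F - J' \<or> J' \<subseteq> \<iota> ` F' \<and> \<iota> ` F = \<iota> ` F' - J')" by (rule bexE)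
  from ex obtain J' where sub: "J' \<subseteq> cells bl.graph" and J': "J' \<noteq> {}" "card J' \<le> 3"
    "(\<Sum>j\<in>J'. bl.ts.wt j) = card (pset bl.graph r)"
    "J' \<subseteq> \<iota> ` F \<and> \<iota> ` F' = \<iota> ` F - J' \<or> J' \<subseteq> \<iota> ` F' \<and> \<iota> ` F = \<iota> ` F' - J'" by (elim exE conjE) (rule that)
  obtain J where J: "J \<subseteq> K" "J' = \<iota> ` J" using sub unfolding cells_eq by (rule subset_imageE)
  have "\<exists>r\<in>rules bl.graph. \<iota> ` J \<noteq> {} \<and> card (\<iota> ` J) \<le> 3 \<and> (\<Sum>j\<in>\<iota> ` J. bl.ts.wt j) = card (pset bl.graph r)"
    by (rule bexI[OF _ r], intro conjI) (rule J'[unfolded J(2)])+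
  from rule_applies_iff[OF J(1), THEN iffD1, OF this]
  obtain c f l where react: "vm.reaction c f l" "J = vm.triple c f l" by (elim exE conjE) (rule that)
  have "J \<subseteq> F \<and> F' = F - J \<or> J \<subseteq> F' \<and> F = F' - J"
    using J'(4) unfolding J(2) image_diff_iff[OF F J(1)] image_diff_iff[OF F(2,1) J(1)] .
  then show "vm.toggle F F'" unfolding vm.toggle_def react(2) by (intro exI conjI) (rule react(1))
next
  assume "vm.toggle F F'"
  then obtain c f l where r: "vm.reaction c f l" and t: "vm.triple c f l \<subseteq> F \<and> F' = F - vm.triple c f l \<or>
    vm.triple c f l \<subseteq> F' \<and> F = F' - vm.triple c f l" unfolding vm.toggle_def by (elim exE conjE) (rule that)
  define J where "J = vm.triple c f l"
  have J: "J \<subseteq> K" unfolding J_def by (rule triple_K[OF r])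
  have "\<exists>c f l. vm.reaction c f l \<and> J = vm.triple c f l" by (intro exI conjI) (rule r, rule J_def)
  from rule_applies_iff[OF J, THEN iffD2, OF this]
  obtain b where b: "b \<in> rules bl.graph" "\<iota> ` J \<noteq> {} \<and> card (\<iota> ` J) \<le> 3 \<and> (\<Sum>j\<in>\<iota> ` J. bl.ts.wt j) = card (pset bl.graph b)"
    by (rule bexE)
  note b2 = b(2)[THEN conjunct1] b(2)[THEN conjunct2, THEN conjunct1] b(2)[THEN conjunct2, THEN conjunct2]
  have dis: "\<iota> ` J \<subseteq> \<iota> ` F \<and> \<iota> ` F' = \<iota> ` F - \<iota> ` J \<or> \<iota> ` J \<subseteq> \<iota> ` F' \<and> \<iota> ` F = \<iota> ` F' - \<iota> ` J"
    unfolding image_diff_iff[OF F J] image_diff_iff[OF F(2,1) J] using t unfolding J_def .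
  show "bl.ts.ctoggle (\<iota> ` F) (\<iota> ` F')"
    unfolding bl.ts.ctoggle_def unfolding cells_eq
    by (intro conjI image_mono F, rule bexI[OF _ b(1)], rule exI[of _ "\<iota> ` J"], intro conjI image_mono J b2 dis)
qed

lemma toggle_K: "vm.toggle F F' \<Longrightarrow> F \<subseteq> K \<Longrightarrow> F' \<subseteq> K"
  unfolding vm.toggle_def using triple_K by blast

lemma ctoggle_reach_iff:
  assumes F: "F \<subseteq> K" "F' \<subseteq> K"
  shows "bl.ts.ctoggle\<^sup>*\<^sup>* (\<iota> ` F) (\<iota> ` F') \<longleftrightarrow> vm.toggle\<^sup>*\<^sup>* F F'"
proof
  have "\<exists>F1\<subseteq>K. Y = \<iota> ` F1 \<and> vm.toggle\<^sup>*\<^sup>* F F1" if "bl.ts.ctoggle\<^sup>*\<^sup>* (\<iota> ` F) Y" for Y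
    using that
  proof (induction rule: rtranclp_induct)
    case base
    then show ?case using F(1) by blast
  next
    case (step Y Y2)
    then obtain F1 where F1: "F1 \<subseteq> K" "Y = \<iota> ` F1" "vm.toggle\<^sup>*\<^sup>* F F1" by blast
    have "Y2 \<subseteq> cells bl.graph" using step(2) unfolding bl.ts.ctoggle_def by blast
    then obtain F2 where F2: "F2 \<subseteq> K" "Y2 = \<iota> ` F2" unfolding cells_eq by (rule subset_imageE)
    then have "vm.toggle F1 F2" using step(2) ctoggle_iff[OF F1(1) F2(1)] F1(2) by simp
    with F1(3) have "vm.toggle\<^sup>*\<^sup>* F F2" by (rule rtranclp.rtrancl_into_rtrancl)
    then show ?case using F2 by blast
  qed
  then show "bl.ts.ctoggle\<^sup>*\<^sup>* (\<iota> ` F) (\<iota> ` F') \<Longrightarrow> vm.toggle\<^sup>*\<^sup>* F F'"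
    using inj_on_image_eq_iff[OF \<iota>_inj F(2)] by metis
next
  assume "vm.toggle\<^sup>*\<^sup>* F F'"
  then have "F' \<subseteq> K \<and> bl.ts.ctoggle\<^sup>*\<^sup>* (\<iota> ` F) (\<iota> ` F')"
  proof (induction rule: rtranclp_induct)
    case base
    then show ?case using F(1) by blast
  next
    case (step Y Y2)
    then have "Y2 \<subseteq> K" "bl.ts.ctoggle (\<iota> ` Y) (\<iota> ` Y2)" using toggle_K ctoggle_iff[of Y Y2] by blast+
    then show ?case using step(3) by (meson rtranclp.rtrancl_into_rtrancl)
  qed
  then show "bl.ts.ctoggle\<^sup>*\<^sup>* (\<iota> ` F) (\<iota> ` F')" ..
qed

lemma conf_K: "vm.valid p \<Longrightarrow> fst p < H \<Longrightarrow> vm.conf p \<subseteq> K"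
proof
  fix y assume p: "vm.valid p" "fst p < H" and y: "y \<in> vm.conf p"
  have "snd p i + g * i < H" if "i < m" for i
  proof -
    have "snd p i < g" using p(1) by (simp add: vm.valid_def)
    then have "snd p i + g * i < g * (i + 1)" by simp
    also have "\<dots> \<le> H" unfolding H_def using that by (intro mult_le_mono2) simp
    finally show ?thesis .
  qed
  then show "y \<in> K" using y p(2) unfolding vm.conf_def vm.facts_def K_def by auto
qed

definition start_set :: "bool list \<Rightarrow> nat set" where "start_set w = bl.ts.rest_set (\<iota> ` vm.conf (start_conf w))"
definition end_set :: "nat set" where "end_set = bl.ts.rest_set (\<iota> ` vm.conf end_conf)"

lemma small_le_H: "x < D + m + 1 \<Longrightarrow> x < H"
proof -
  assume "x < D + m + 1"
  also have "\<dots> \<le> H" unfolding H_def using mult_le_mono1[of 1 g "D + m + 1"] sizes(2) by simp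
  finally show ?thesis .
qed

lemma conf_in_K:
  assumes "runs_in_space M w s"
  shows "vm.conf (start_conf w) \<subseteq> K" "vm.conf end_conf \<subseteq> K"
proof -
  have "Rd (tm_start M) [] \<in> ctls M" using wf Rd_ctls by (simp add: wf_tm_def)
  moreover have "good (snd (init_config M w))" using good_run[OF assms, of 0] by (simp add: run_def)
  ultimately have "fst (start_conf w) < D" unfolding start_conf_def rep_def using code_less num_heads_less by simp
  then show "vm.conf (start_conf w) \<subseteq> K" using conf_K[OF conf_valid(1)[OF assms]] small_le_H by simp
  show "vm.conf end_conf \<subseteq> K" using conf_K[OF conf_valid(2)] small_le_H[of "D + m"] by (simp add: end_conf_def)
qed

lemma reduction_correct:
  assumes dec: "decides M L" and space: "runs_in_space M w s"
  defines "u \<equiv> encode_instance n bl.graph (start_set w) end_set"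
  shows "u \<in> msor1_instances phi 0 (forest_of_depth 3)" "w \<in> L \<longleftrightarrow> u \<in> msor1_yes_instances phi 0 (forest_of_depth 3)"
proof -
  note c = conf_in_K[OF space]
  have sub: "\<iota> ` vm.conf (start_conf w) \<subseteq> cells bl.graph" "\<iota> ` vm.conf end_conf \<subseteq> cells bl.graph"
    unfolding cells_eq using c by blast+
  show "u \<in> msor1_instances phi 0 (forest_of_depth 3)"
    unfolding u_def start_set_def end_set_def by (rule bl.encode_in_instances(1)[OF sub])
  show "w \<in> L \<longleftrightarrow> u \<in> msor1_yes_instances phi 0 (forest_of_depth 3)"
    unfolding u_def start_set_def end_set_def bl.encode_in_instances(2)[OF sub] ctoggle_reach_iff[OF c]
    by (rule accepts_iff_toggle[OF dec space])
qed

text \<open>Tokens sit on the leaf children of the cells that are on and on the deep leaves of the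
  others; stated by block and offset, as the formula for the output bits will check it.\<close>

lemma mem_rest_set:
  assumes "F \<subseteq> K"
  shows "x \<in> bl.ts.rest_set (\<iota> ` F) \<longleftrightarrow> (\<exists>t<3 * H. \<exists>i. x = bl.pt t i \<and>
     (t \<in> idx ` F \<and> bl.kA t i \<or> t \<notin> idx ` F \<and> bl.kL t i))"
proof -
  have B: "t \<in> Bs" if "t < 3 * H" for t using that by (simp add: Bs_def)
  have "\<iota> ` F = (\<lambda>t. bl.pt t 0) ` (idx ` F)" by (auto simp: \<iota>_def)
  moreover have sub: "idx ` F \<subseteq> {..<3 * H}" using assms idx_K by blast
  moreover have "cells bl.graph - \<iota> ` F = (\<lambda>t. bl.pt t 0) ` ({..<3 * H} - idx ` F)"
  proof -
    have "cells bl.graph = (\<lambda>t. bl.pt t 0) ` {..<3 * H}" unfolding cells_eq idx_K[symmetric] by (auto simp: \<iota>_def)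
    moreover have inj: "inj_on (\<lambda>t. bl.pt t 0) {..<3 * H}" by (auto simp: inj_on_def bl.pt_inj)
    have "(\<lambda>t. bl.pt t 0) ` ({..<3 * H} - idx ` F) = (\<lambda>t. bl.pt t 0) ` {..<3 * H} - (\<lambda>t. bl.pt t 0) ` (idx ` F)"
      by (rule inj_on_image_set_diff[OF inj]) (use sub in blast)+
    ultimately show ?thesis unfolding \<open>\<iota> ` F = _\<close> by (simp only:)
  qed
  ultimately have "x \<in> bl.ts.rest_set (\<iota> ` F) \<longleftrightarrow>
      (\<exists>t\<in>idx ` F. x \<in> aset bl.graph (bl.pt t 0)) \<or> (\<exists>t\<in>{..<3 * H} - idx ` F. x \<in> pset bl.graph (bl.pt t 0))"
    unfolding bl.ts.rest_set_def by auto
  also have "\<dots> \<longleftrightarrow> (\<exists>t\<in>idx ` F. \<exists>i. x = bl.pt t i \<and> bl.kA t i) \<or>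
      (\<exists>t\<in>{..<3 * H} - idx ` F. \<exists>i. x = bl.pt t i \<and> bl.kL t i)"
  proof -
    have A: "x \<in> aset bl.graph (bl.pt t 0) \<longleftrightarrow> (\<exists>i. x = bl.pt t i \<and> bl.kA t i)" if "t < 3 * H" for t
      unfolding bl.aset_pt[OF B[OF that]] by blast
    have P: "x \<in> pset bl.graph (bl.pt t 0) \<longleftrightarrow> (\<exists>i. x = bl.pt t i \<and> bl.kL t i)" if "t < 3 * H" for t
      unfolding bl.pset_pt[OF B[OF that]] by blast
    have "(\<exists>t\<in>idx ` F. x \<in> aset bl.graph (bl.pt t 0)) \<longleftrightarrow> (\<exists>t\<in>idx ` F. \<exists>i. x = bl.pt t i \<and> bl.kA t i)"
      by (rule bex_cong[OF refl]) (rule A, use sub in blast)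
    moreover have "(\<exists>t\<in>{..<3 * H} - idx ` F. x \<in> pset bl.graph (bl.pt t 0)) \<longleftrightarrow>
        (\<exists>t\<in>{..<3 * H} - idx ` F. \<exists>i. x = bl.pt t i \<and> bl.kL t i)"
      by (rule bex_cong[OF refl]) (rule P, simp)
    ultimately show ?thesis by simp
  qed
  also have "\<dots> \<longleftrightarrow> (\<exists>t<3 * H. \<exists>i. x = bl.pt t i \<and> (t \<in> idx ` F \<and> bl.kA t i \<or> t \<notin> idx ` F \<and> bl.kL t i))"
    using sub by blast
  finally show ?thesis .
qed

lemma idx_conf: "t < 3 * H \<Longrightarrow> t \<in> idx ` vm.conf p \<longleftrightarrow> t = fst p \<or> (\<exists>i<m. t = H + snd p i + g * i) \<or> 2 * H \<le> t"
proof
  show "t \<in> idx ` vm.conf p \<Longrightarrow> t = fst p \<or> (\<exists>i<m. t = H + snd p i + g * i) \<or> 2 * H \<le> t"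
    by (auto simp: vm.conf_def vm.facts_def idx_def)
  assume t: "t < 3 * H" "t = fst p \<or> (\<exists>i<m. t = H + snd p i + g * i) \<or> 2 * H \<le> t"
  from t(2) show "t \<in> idx ` vm.conf p"
  proof (elim disjE exE conjE)
    assume "t = fst p"
    then show ?thesis by (intro image_eqI[of _ _ "(0, fst p)"]) (simp_all add: vm.conf_def idx_def)
  next
    fix i assume "i < m" "t = H + snd p i + g * i"
    then show ?thesis by (intro image_eqI[of _ _ "(1, snd p i + g * i)"]) (auto simp: vm.conf_def vm.facts_def idx_def)
  next
    assume "2 * H \<le> t"
    then show ?thesis using t(1) by (intro image_eqI[of _ _ "(2, t - 2 * H)"]) (auto simp: vm.conf_def idx_def)
  qed
qed

end

section \<open>The output bits of the reduction as a bounded arithmetic formula\<close>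

primrec tpow :: "trm \<Rightarrow> nat \<Rightarrow> trm" where
  "tpow t 0 = N 1"
| "tpow t (Suc j) = Ti t (tpow t j)"

lemma tval_tpow [simp]: "tval e (tpow t j) = tval e t ^ j"
  by (induction j) auto

lemma ex_poly_term: "\<exists>t. \<forall>e. tval e t = poly p (e 0)"
proof (induction p)
  case 0
  show ?case by (intro exI[of _ "N 0"]) simp
next
  case (pCons a p)
  then obtain t where "\<forall>e. tval e t = poly p (e 0)" by blast
  then show ?case by (intro exI[of _ "Pl (N a) (Ti (V 0) t)"]) simp
qed

definition fOrs :: "fm list \<Rightarrow> fm" where
  "fOrs fs = foldr fOr fs (Le (N 1) (N 0))"

lemma fsat_fOrs [simp]: "fsat A e (fOrs fs) \<longleftrightarrow> (\<exists>f\<in>set fs. fsat A e f)"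
  unfolding fOrs_def by (induction fs) auto

lemma farrs_fOrs [simp]: "farrs (fOrs fs) = (\<Union>f\<in>set fs. farrs f)"
  unfolding fOrs_def by (induction fs) auto

text \<open>Bounded arithmetic has no division: digit, remainder and quotient are guessed together,
  the quotient below a bound on \<open>P\<close>.\<close>

lemma digit_iff:
  fixes W P :: nat
  assumes "0 < W" "P < B"
  shows "(\<exists>d<W. \<exists>r<W ^ j. \<exists>q<B + 1. P = r + W ^ j * (d + W * q) \<and> i = c + k * d) \<longleftrightarrow> i = c + k * (P div W ^ j mod W)"
proof
  assume "\<exists>d<W. \<exists>r<W ^ j. \<exists>q<B + 1. P = r + W ^ j * (d + W * q) \<and> i = c + k * d"
  then obtain d r q where *: "d < W" "r < W ^ j" "P = r + W ^ j * (d + W * q)" "i = c + k * d" by blast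
  have "P div W ^ j = d + W * q" unfolding *(3) using *(2) assms(1) by simp
  then have "P div W ^ j mod W = d" using *(1) by simp
  then show "i = c + k * (P div W ^ j mod W)" using *(4) by simp
next
  assume i: "i = c + k * (P div W ^ j mod W)"
  define x where "x = P div W ^ j"
  have "P = P mod W ^ j + W ^ j * x" unfolding x_def by simp
  moreover have "x = x mod W + W * (x div W)" by simp
  ultimately have "P = P mod W ^ j + W ^ j * (x mod W + W * (x div W))" by metis
  moreover have "x \<le> P" unfolding x_def by simp
  then have "x div W \<le> P" using div_le_dividend[of x W] by linarith
  then have "x div W < B + 1" using assms(2) by linarith
  moreover have "x mod W < W" "P mod W ^ j < W ^ j" using assms(1) by simp_all
  ultimately show "\<exists>d<W. \<exists>r<W ^ j. \<exists>q<B + 1. P = r + W ^ j * (d + W * q) \<and> i = c + k * d"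
    using i unfolding x_def[symmetric] by blast
qed

text \<open>The formulas defined here are built from the machine, the code numbers and the term
  \<open>tS\<close>; the word \<open>w\<close> and the bound \<open>s\<close> occur only in the
  statements about their meaning. Thus one formula serves all inputs.\<close>

locale coded_instance = coded_machine +
  fixes tS :: trm and w :: "bool list"
  assumes tS: "e 0 = length w \<Longrightarrow> tval e tS = s"
begin

definition "tW = Pl (Ti (N 2) tS) (N 1)"
definition "tWk = tpow tW k"
definition "tD = Ti (N \<Phi>) tWk"
definition "tm = Ti (N k) tW"
definition "tH = Ti (N g) (Pl (Pl tD tm) (N 1))"
definition "tNb = Ti (N 4) (Pl tH (N 4))"
definition "tQ = Ti (Pl tH (N 4)) (Pl (Pl (N 1) tNb) (Ti tNb tNb))"
definition "tZ = Pl (Ti (N 3) tQ) (N 1)"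
definition "tB = Pl (Ti (N 3) tH) (Ti (Ti tH tH) tH)"
definition "tn = Ti tZ tB"

lemma tvals:
  assumes "e 0 = length w"
  shows "tval e tW = W" "tval e tWk = W ^ k" "tval e tD = D" "tval e tm = m" "tval e tH = H" "tval e tNb = Nb"
    "tval e tQ = Q" "tval e tZ = Z" "tval e tB = nblocks" "tval e tn = n"
proof -
  show W: "tval e tW = W" using tS[of e, OF assms] by (simp add: tW_def W_def)
  then show Wk: "tval e tWk = W ^ k" by (simp add: tWk_def)
  then show D: "tval e tD = D" by (simp add: tD_def D_def)
  show m: "tval e tm = m" using W by (simp add: tm_def m_def)
  show H: "tval e tH = H" using D m by (simp add: tH_def H_def)
  then show Nb: "tval e tNb = Nb" by (simp add: tNb_def Nb_def)
  show Q: "tval e tQ = Q" using H Nb by (simp add: tQ_def Q_def)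
  then show Z: "tval e tZ = Z" by (simp add: tZ_def Z_def)
  show B: "tval e tB = nblocks" using H by (simp add: tB_def nblocks_def)
  show "tval e tn = n" using Z B by (simp add: tn_def n_def)
qed

fun fShift :: "nat \<Rightarrow> move \<Rightarrow> fm" where
  "fShift j Stay = fEq (V 19) (V 18)"
| "fShift j Right = fEq (V 19) (Pl (V 18) (tpow tW j))"
| "fShift j Left = fEq (V 18) (Pl (V 19) (tpow tW j))"

lemma fsat_fShift: "e 0 = length w \<Longrightarrow> fsat A e (fShift j d) \<longleftrightarrow> shift W j d (e 18) (e 19)"
  by (cases d) (simp_all add: tvals)

lemma farrs_fShift: "farrs (fShift j d) = {}"
  by (cases d) simp_all

text \<open>In the formula for instructions the variables 13 to 17 are \<open>c\<close>, \<open>i\<close>, \<open>v\<close>, \<open>c'\<close> and \<open>v'\<close>.\<close>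

definition fDigit :: "nat \<Rightarrow> fm" where
  "fDigit j = Xs 20 tW (Xs 21 (tpow tW j) (Xs 22 (Pl tWk (N 1))
     (An (fEq (V 18) (Pl (V 21) (Ti (tpow tW j) (Pl (V 20) (Ti tW (V 22)))))) (fEq (V 14) (Pl (N j) (Ti (N k) (V 20)))))))"

definition fTrans :: "ctl \<times> nat \<Rightarrow> fm" where
  "fTrans x = (let f = fst x; j = ctl_tape k f; r = ctl_trans M f (snd x) in
     An (fEq (V 15) (N (snd x)))
       (Xs 18 tWk (Xs 19 tWk (An (fEq (V 13) (Pl (N (enc f)) (Ti (N \<Phi>) (V 18)))) (An (fDigit j)
         (An (fShift j (snd (snd r))) (An (fEq (V 16) (Pl (N (enc (fst r))) (Ti (N \<Phi>) (V 19))))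
           (fEq (V 17) (N (fst (snd r)))))))))))"

text \<open>For a fixed machine there are finitely many pairs of control and symbol, so the
  transition table is written out as a finite disjunction; the order of the list is
  arbitrary.\<close>

definition transitions :: "(ctl \<times> nat) list" where
  "transitions = (SOME xs. set xs = {f \<in> ctls M. \<not> ctl_halt M f} \<times> {..<g})"

lemma set_transitions: "set transitions = {f \<in> ctls M. \<not> ctl_halt M f} \<times> {..<g}"
proof -
  have "finite ({f \<in> ctls M. \<not> ctl_halt M f} \<times> {..<g})" using finite_ctls[of M] by simp
  then show ?thesis unfolding transitions_def by (rule someI_ex[OF finite_list])
qed

definition fInstr :: fm where
  "fInstr = An (fLt (V 15) (N g)) (fOr (fOrs (map fTrans transitions)) (fOr
     (Xs 18 tWk (An (fEq (V 13) (Pl (N (enc (Rd (tm_accept M) []))) (Ti (N \<Phi>) (V 18))))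
        (An (fEq (V 14) (N 0)) (An (fEq (V 16) (Pl tD (N 1))) (fEq (V 17) (N 0))))))
     (Xs 18 tm (An (Le (N 1) (V 18)) (An (fEq (V 13) (Pl tD (V 18))) (An (fEq (V 14) (V 18))
        (An (fEq (V 16) (Pl (Pl tD (V 18)) (N 1))) (fEq (V 17) (N 0)))))))))"

lemma fsat_fTrans:
  assumes e: "e 0 = length w"
  shows "fsat A e (fTrans (f, v)) \<longleftrightarrow> e 15 = v \<and>
    (\<exists>P<W ^ k. \<exists>P'<W ^ k. e 13 = enc f + \<Phi> * P \<and> e 14 = ctl_tape k f + k * (P div W ^ ctl_tape k f mod W) \<and>
      shift W (ctl_tape k f) (snd (snd (ctl_trans M f v))) P P' \<and>
      e 16 = enc (fst (ctl_trans M f v)) + \<Phi> * P' \<and> e 17 = fst (snd (ctl_trans M f v)))"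
proof -
  have d: "fsat A (e(18 := P, 19 := P')) (fDigit j) \<longleftrightarrow> e 14 = j + k * (P div W ^ j mod W)" if "P < W ^ k" for P P' j
    using digit_iff[OF sizes(5) that, of j "e 14" j k] by (simp add: fDigit_def e tvals)
  have t: "fsat A (e(18 := P, 19 := P')) (fShift j x) \<longleftrightarrow> shift W j x P P'" for P P' j x
    using fsat_fShift[of "e(18 := P, 19 := P')" A j x] e by simp
  show ?thesis
    unfolding fTrans_def Let_def fst_conv snd_conv using d by (simp add: e tvals t cong: conj_cong)
qed

lemma fsat_fInstr:
  assumes e: "e 0 = length w"
  shows "fsat A e fInstr \<longleftrightarrow> instr (e 13) (e 14) (e 15) (e 16) (e 17)"
proof -
  define T where "T f v \<longleftrightarrow> (\<exists>P<W ^ k. \<exists>P'<W ^ k. e 13 = enc f + \<Phi> * P \<and>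
      e 14 = ctl_tape k f + k * (P div W ^ ctl_tape k f mod W) \<and>
      shift W (ctl_tape k f) (snd (snd (ctl_trans M f v))) P P' \<and>
      e 16 = enc (fst (ctl_trans M f v)) + \<Phi> * P' \<and> e 17 = fst (snd (ctl_trans M f v)))" for f v
  have t: "fsat A e (fTrans (f, v)) \<longleftrightarrow> e 15 = v \<and> T f v" for f v
    unfolding T_def by (rule fsat_fTrans[where e = e, OF e])
  have 1: "(\<exists>f\<in>set (map fTrans transitions). fsat A e f) \<longleftrightarrow> (\<exists>f\<in>ctls M. \<not> ctl_halt M f \<and> T f (e 15))" if "e 15 < g"
  proof -
    have "(\<exists>f\<in>set (map fTrans transitions). fsat A e f) \<longleftrightarrow>
        (\<exists>x\<in>{f \<in> ctls M. \<not> ctl_halt M f} \<times> {..<g}. fsat A e (fTrans x))"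
      unfolding set_map set_transitions by simp
    also have "\<dots> \<longleftrightarrow> (\<exists>f\<in>ctls M. \<not> ctl_halt M f \<and> T f (e 15))" using that by (auto simp: t)
    finally show ?thesis .
  qed
  have 2: "fsat A e fInstr \<longleftrightarrow> e 15 < g \<and> ((\<exists>f\<in>set (map fTrans transitions). fsat A e f) \<or>
      (\<exists>P<W ^ k. e 13 = enc (Rd (tm_accept M) []) + \<Phi> * P \<and> e 14 = 0 \<and> e 16 = D + 1 \<and> e 17 = 0) \<or>
      (\<exists>t<m. 1 \<le> t \<and> e 13 = D + t \<and> e 14 = t \<and> e 16 = D + t + 1 \<and> e 17 = 0))"
    unfolding fInstr_def by (simp add: e tvals del: set_map)
  show ?thesis
    unfolding 2 instr_def T_def[symmetric]
    by (rule conj_cong[OF refl]) (simp only: 1)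
qed

definition fReact :: fm where
  "fReact = Xs 13 tH (Xs 14 tm (Xs 15 (N g) (Xs 16 tH (Xs 17 (N g) (An fInstr
     (An (fEq (V 12) (Pl (V 15) (Ti (N g) (V 13))))
       (fOr (An (fEq (V 10) (V 13)) (fEq (V 11) (Pl (V 15) (Ti (N g) (V 14)))))
            (An (fEq (V 10) (V 16)) (fEq (V 11) (Pl (V 17) (Ti (N g) (V 14)))))))))))) "

lemma fsat_fReact:
  assumes e: "e 0 = length w"
  shows "fsat A e fReact \<longleftrightarrow> vm.reaction (e 10) (e 11) (e 12)"
proof -
  have i: "fsat A (e(13 := c, 14 := i, 15 := v, 16 := c', 17 := v')) fInstr \<longleftrightarrow> instr c i v c' v'" for c i v c' v'
    using fsat_fInstr[of "e(13 := c, 14 := i, 15 := v, 16 := c', 17 := v')" A] e by simp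
  have "fsat A e fReact \<longleftrightarrow> (\<exists>c0<H. \<exists>i<m. \<exists>v<g. \<exists>c'<H. \<exists>v'<g. instr c0 i v c' v' \<and> e 12 = v + g * c0 \<and>
     (e 10 = c0 \<and> e 11 = v + g * i \<or> e 10 = c' \<and> e 11 = v' + g * i))"
    unfolding fReact_def by (simp add: e tvals i)
  also have "\<dots> \<longleftrightarrow> vm.reaction (e 10) (e 11) (e 12)"
    unfolding vm.reaction_def using vm.range by blast
  finally show ?thesis .
qed

text \<open>Variable 5 is a block address and variable 6 its weight; describing both together avoids
  expressing the case distinction of \<open>wgt\<close> by division. The second disjunct ranges over
  the triples and keeps those that are reactions.\<close>

definition fBlk :: fm where
  "fBlk = fOr (Xs 10 tH (fOr (An (fEq (V 5) (V 10)) (fEq (V 6) (Pl (V 10) (N 4))))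
      (fOr (An (fEq (V 5) (Pl (V 10) tH)) (fEq (V 6) (Ti (Pl (V 10) (N 4)) tNb)))
           (An (fEq (V 5) (Pl (V 10) (Ti tH (N 2)))) (fEq (V 6) (Ti (Pl (V 10) (N 4)) (Ti tNb tNb)))))))
    (Xs 10 tH (Xs 11 tH (Xs 12 tH (An fReact
      (An (fEq (V 5) (Pl (Pl (Pl (Ti (N 3) tH) (V 10)) (Ti tH (V 11))) (Ti (Ti tH tH) (V 12))))
          (fEq (V 6) (Pl (Pl (Pl (V 10) (N 4)) (Ti tNb (Pl (V 11) (N 4)))) (Ti (Ti tNb tNb) (Pl (V 12) (N 4))))))))))"

lemma fsat_fBlk:
  assumes e: "e 0 = length w"
  shows "fsat A e fBlk \<longleftrightarrow> e 5 \<in> Bs \<and> e 6 = wgt (e 5)"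
proof -
  have r: "fsat A (e(10 := c, 11 := f, 12 := l)) fReact \<longleftrightarrow> vm.reaction c f l" for c f l
    using fsat_fReact[of "e(10 := c, 11 := f, 12 := l)" A] e by simp
  have 1: "fsat A e fBlk \<longleftrightarrow>
    (\<exists>j<H. e 5 = j \<and> e 6 = j + 4 \<or> e 5 = j + H \<and> e 6 = (j + 4) * Nb \<or> e 5 = j + H * 2 \<and> e 6 = (j + 4) * (Nb * Nb)) \<or>
    (\<exists>c<H. \<exists>f<H. \<exists>l<H. vm.reaction c f l \<and> e 5 = 3 * H + c + H * f + H * H * l \<and>
      e 6 = c + 4 + Nb * (f + 4) + Nb * Nb * (l + 4))"
    unfolding fBlk_def by (simp add: e tvals r)
  have 2: "(\<exists>j<H. e 5 = j \<and> e 6 = j + 4 \<or> e 5 = j + H \<and> e 6 = (j + 4) * Nb \<or> e 5 = j + H * 2 \<and> e 6 = (j + 4) * (Nb * Nb)) \<longleftrightarrow>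
     e 5 < 3 * H \<and> e 6 = wgt (e 5)"
  proof
    assume "\<exists>j<H. e 5 = j \<and> e 6 = j + 4 \<or> e 5 = j + H \<and> e 6 = (j + 4) * Nb \<or> e 5 = j + H * 2 \<and> e 6 = (j + 4) * (Nb * Nb)"
    then obtain j where j: "j < H" "e 5 = j \<and> e 6 = j + 4 \<or> e 5 = j + H \<and> e 6 = (j + 4) * Nb \<or> e 5 = j + H * 2 \<and> e 6 = (j + 4) * (Nb * Nb)" by blast
    then show "e 5 < 3 * H \<and> e 6 = wgt (e 5)"
      using wgt_cell[of 0 j] wgt_cell[of 1 j] wgt_cell[of 2 j] by (auto simp: power2_eq_square)
  next
    assume t: "e 5 < 3 * H \<and> e 6 = wgt (e 5)"
    then obtain i j where ij: "i < 3" "j < H" "e 5 = j + H * i" using cell_block by blast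
    have "e 6 = (j + 4) * Nb ^ i" using t wgt_cell[OF ij(1,2)] ij(3) by simp
    moreover have "i = 0 \<or> i = 1 \<or> i = 2" using ij(1) by auto
    ultimately show "\<exists>j<H. e 5 = j \<and> e 6 = j + 4 \<or> e 5 = j + H \<and> e 6 = (j + 4) * Nb \<or> e 5 = j + H * 2 \<and> e 6 = (j + 4) * (Nb * Nb)"
      using ij(2,3) by (intro exI[of _ j]) (auto simp: power2_eq_square)
  qed
  have 3: "(\<exists>c<H. \<exists>f<H. \<exists>l<H. vm.reaction c f l \<and> e 5 = 3 * H + c + H * f + H * H * l \<and>
      e 6 = c + 4 + Nb * (f + 4) + Nb * Nb * (l + 4)) \<longleftrightarrow>
    (\<exists>c<H. \<exists>f<H. \<exists>l<H. vm.reaction c f l \<and> e 5 = rule_block c f l) \<and> e 6 = wgt (e 5)"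
    using wgt_rule unfolding rule_block_def by (metis (no_types, lifting))
  show ?thesis unfolding 1 2 3 Bs_def by blast
qed

definition fArc :: "nat \<Rightarrow> nat \<Rightarrow> fm" where
  "fArc x y = fOr (An (fEq (V x) (N 0)) (An (fLt (V 5) (Ti (N 3) tH)) (An (Le (N 1) (V y)) (Le (V y) (V 6)))))
    (fOr (An (fEq (V x) (N 0)) (An (Le (Pl tQ (N 1)) (V y)) (Le (V y) (Pl tQ (V 6)))))
      (An (An (Le (Pl tQ (N 1)) (V x)) (Le (V x) (Pl tQ (V 6)))) (fEq (V y) (Pl (V x) tQ))))"

lemma fsat_fArc: "e 0 = length w \<Longrightarrow> e 6 = wgt (e 5) \<Longrightarrow> fsat A e (fArc x y) \<longleftrightarrow> bl.arc (e 5) (e x) (e y)"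
  unfolding fArc_def bl.arc_def bl.kA_def bl.kM_def by (simp add: tvals)

definition fAdj :: fm where
  "fAdj = Xs 5 tB (Xs 6 (Pl tQ (N 1)) (An fBlk (Xs 7 tZ (Xs 8 tZ (An (fEq (V 2) (Pl (V 7) (Ti tZ (V 5))))
     (An (fEq (V 3) (Pl (V 8) (Ti tZ (V 5)))) (fOr (fArc 7 8) (fArc 8 7))))))))"

lemma fsat_fAdj:
  assumes e: "e 0 = length w"
  shows "fsat A e fAdj \<longleftrightarrow> adj bl.graph (e 2) (e 3)"
proof -
  have b: "fsat A (e(5 := t, 6 := p)) fBlk \<longleftrightarrow> t \<in> Bs \<and> p = wgt t" for t p
    using fsat_fBlk[of "e(5 := t, 6 := p)" A] e by simp
  have a: "fsat A (e(5 := t, 6 := wgt t, 7 := i, 8 := j)) (fArc 7 8) \<longleftrightarrow> bl.arc t i j"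
    "fsat A (e(5 := t, 6 := wgt t, 7 := i, 8 := j)) (fArc 8 7) \<longleftrightarrow> bl.arc t j i" for t i j
    using fsat_fArc[of "e(5 := t, 6 := wgt t, 7 := i, 8 := j)" A 7 8] fsat_fArc[of "e(5 := t, 6 := wgt t, 7 := i, 8 := j)" A 8 7] e by simp_all
  have "fsat A e fAdj \<longleftrightarrow> (\<exists>t<nblocks. \<exists>p<Q + 1. (t \<in> Bs \<and> p = wgt t) \<and> (\<exists>i<Z. \<exists>j<Z. e 2 = i + Z * t \<and> e 3 = j + Z * t \<and>
     (fsat A (e(5 := t, 6 := p, 7 := i, 8 := j)) (fArc 7 8) \<or> fsat A (e(5 := t, 6 := p, 7 := i, 8 := j)) (fArc 8 7))))"
    unfolding fAdj_def by (simp add: e tvals b)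
  also have "\<dots> \<longleftrightarrow> (\<exists>t\<in>Bs. \<exists>i<Z. \<exists>j<Z. e 2 = i + Z * t \<and> e 3 = j + Z * t \<and> (bl.arc t i j \<or> bl.arc t j i))"
  proof -
    have "t < nblocks \<and> wgt t < Q + 1" if "t \<in> Bs" for t using block_bounds[OF that] by simp
    then show ?thesis using a by blast
  qed
  also have "\<dots> \<longleftrightarrow> adj bl.graph (e 2) (e 3)"
  proof -
    have z: "i < Z \<and> j < Z" if "t \<in> Bs" "bl.arc t i j \<or> bl.arc t j i" for t i j
      using bl.nb_le[OF that(1), of i j] bl.nb_le2[OF that(1), of i j] that(2) unfolding bl.nb_def Z_def by simp
    show ?thesis unfolding bl.adj_graph bl.nb_def bl.pt_def Z_def[symmetric] using z by blast
  qed
  finally show ?thesis .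
qed

text \<open>The argument \<open>c\<close> decides whether the cell in variable 5 is on; the offset
  in variable 7 must then lie in the first group of leaves, otherwise in the second.\<close>

definition fMem :: "fm \<Rightarrow> fm" where
  "fMem c = Xs 5 (Ti (N 3) tH) (Xs 6 (Pl tQ (N 1)) (An fBlk (Xs 7 tZ (An (fEq (V 2) (Pl (V 7) (Ti tZ (V 5))))
     (fOr (An c (An (Le (N 1) (V 7)) (Le (V 7) (V 6))))
          (An (Ng c) (An (Le (Pl (Ti (N 2) tQ) (N 1)) (V 7)) (Le (V 7) (Pl (Ti (N 2) tQ) (V 6))))))))))"

lemma fsat_fMem:
  assumes e: "e 0 = length w" and F: "F \<subseteq> K"
    and c: "\<And>e. e 0 = length w \<Longrightarrow> e 5 < 3 * H \<Longrightarrow> fsat A e c \<longleftrightarrow> e 5 \<in> idx ` F"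
  shows "fsat A e (fMem c) \<longleftrightarrow> e 2 \<in> bl.ts.rest_set (\<iota> ` F)"
proof -
  have b: "fsat A (e(5 := t, 6 := p)) fBlk \<longleftrightarrow> t \<in> Bs \<and> p = wgt t" for t p
    using fsat_fBlk[of "e(5 := t, 6 := p)" A] e by simp
  have c': "fsat A (e(5 := t, 6 := p, 7 := i)) c \<longleftrightarrow> t \<in> idx ` F" if "t < 3 * H" for t p i
    using c[of "e(5 := t, 6 := p, 7 := i)"] e that by simp
  have "fsat A e (fMem c) \<longleftrightarrow> (\<exists>t<3 * H. \<exists>p<Q + 1. (t \<in> Bs \<and> p = wgt t) \<and> (\<exists>i<Z. e 2 = i + Z * t \<and>
      (t \<in> idx ` F \<and> 1 \<le> i \<and> i \<le> p \<or> t \<notin> idx ` F \<and> 2 * Q + 1 \<le> i \<and> i \<le> 2 * Q + p)))"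
    unfolding fMem_def by (simp add: e tvals b c' cong: conj_cong)
  also have "\<dots> \<longleftrightarrow> (\<exists>t<3 * H. \<exists>i. e 2 = i + Z * t \<and>
      (t \<in> idx ` F \<and> 1 \<le> i \<and> i \<le> wgt t \<or> t \<notin> idx ` F \<and> 2 * Q + 1 \<le> i \<and> i \<le> 2 * Q + wgt t))"
  proof -
    have B: "t \<in> Bs" if "t < 3 * H" for t using that by (simp add: Bs_def)
    have q: "wgt t < Q + 1" if "t < 3 * H" for t using block_bounds(2)[OF B[OF that]] by simp
    have z: "i < Z" if "t < 3 * H" "i \<le> wgt t \<or> i \<le> 2 * Q + wgt t" for t i using q[OF that(1)] that(2) by (auto simp: Z_def)
    show ?thesis using B q z by blast
  qed
  also have "\<dots> \<longleftrightarrow> e 2 \<in> bl.ts.rest_set (\<iota> ` F)"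
    unfolding mem_rest_set[OF F] bl.pt_def bl.kA_def bl.kL_def Z_def[symmetric] by blast
  finally show ?thesis .
qed

text \<open>All heads start at position 0, which is the digit \<open>s\<close> in base
  \<open>W\<close>.\<close>

primrec tnum :: "nat \<Rightarrow> trm" where
  "tnum 0 = N 0"
| "tnum (Suc i) = Pl tS (Ti tW (tnum i))"

lemma tval_tnum: "e 0 = length w \<Longrightarrow> tval e (tnum i) = num W (replicate i s)"
  by (induction i) (simp_all add: tvals tS)

text \<open>Variables 23 and 24 are the shifted position and the tape. Only on tape 0 at positions
  from \<open>s\<close> on can a symbol of the input occur, at index 25 of the word; reading beyond
  its end gives the blank 0. Everywhere else the value is blank.\<close>

definition fInput :: fm where
  "fInput = Xs 23 tW (Xs 24 (N k) (fOr
     (An (fEq (V 24) (N 0)) (Xs 25 tW (An (fEq (V 23) (Pl tS (V 25))) (fOr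
        (An (Sy 0 (V 25) 0) (fEq (V 5) (Pl tH (Ti (N g) (Pl (V 24) (Ti (N k) (V 23)))))))
        (fOr (An (Sy 0 (V 25) 1) (fEq (V 5) (Pl (Pl tH (N 1)) (Ti (N g) (Pl (V 24) (Ti (N k) (V 23)))))))
             (An (Sy 0 (V 25) 2) (fEq (V 5) (Pl (Pl tH (N 2)) (Ti (N g) (Pl (V 24) (Ti (N k) (V 23))))))))))))
     (An (fOr (fLt (N 0) (V 24)) (fLt (V 23) tS)) (fEq (V 5) (Pl tH (Ti (N g) (Pl (V 24) (Ti (N k) (V 23)))))))))"

definition fStart :: fm where
  "fStart = fOr (fEq (V 5) (Pl (N (enc (Rd (tm_start M) []))) (Ti (N \<Phi>) (tnum k)))) (fOr fInput (Le (Ti (N 2) tH) (V 5)))"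

definition fEnd :: fm where
  "fEnd = fOr (fEq (V 5) (Pl tD tm)) (fOr (Xs 23 tm (fEq (V 5) (Pl tH (Ti (N g) (V 23))))) (Le (Ti (N 2) tH) (V 5)))"

lemma start_value:
  assumes "j < k" "h < W"
  shows "value_at (snd (init_config M w)) (j + k * h) = (if j = 0 \<and> s \<le> h then word_content w (int (h - s)) else 0)"
proof -
  have i: "j + k * h < m" by (rule cell_less[OF assms])
  have "(j + k * h) mod k = j" "(j + k * h) div k = h" using assms(1) by auto
  then have v: "value_at (snd (init_config M w)) (j + k * h) = fst (snd (init_config M w) ! j) (int h - int s)"
    using i by (simp add: value_at_def)
  show ?thesis
  proof (cases j)
    case 0
    have "word_content w (int h - int s) = (if s \<le> h then word_content w (int (h - s)) else 0)"
      by (simp add: word_content_def of_nat_diff)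
    then show ?thesis using v 0 by (simp add: init_config_def)
  next
    case (Suc i)
    then show ?thesis using v assms(1) by (simp add: init_config_def word_content_def)
  qed
qed

lemma fsat_fInput:
  assumes e: "e 0 = length w"
  shows "fsat (word_arrays w) e fInput \<longleftrightarrow> (\<exists>i<m. e 5 = H + snd (start_conf w) i + g * i)"
proof -
  let ?v = "value_at (snd (init_config M w))"
  have wc: "word_content w z = 0 \<or> word_content w z = 1 \<or> word_content w z = 2" for z by (simp add: word_content_def)
  have "fsat (word_arrays w) e fInput \<longleftrightarrow> (\<exists>h<W. \<exists>j<k. j = 0 \<and> (\<exists>d<W. h = s + d \<and>
      (word_content w (int d) = 0 \<and> e 5 = H + g * (j + k * h) \<or> word_content w (int d) = 1 \<and> e 5 = H + 1 + g * (j + k * h) \<or>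
       word_content w (int d) = 2 \<and> e 5 = H + 2 + g * (j + k * h))) \<or> (0 < j \<or> h < s) \<and> e 5 = H + g * (j + k * h))"
    unfolding fInput_def by (simp add: e tvals tS word_arrays_def del: One_nat_def)
  also have "\<dots> \<longleftrightarrow> (\<exists>h<W. \<exists>j<k. e 5 = H + ?v (j + k * h) + g * (j + k * h))"
  proof -
    have pw: "(j = 0 \<and> (\<exists>d<W. h = s + d \<and>
      (word_content w (int d) = 0 \<and> e 5 = H + g * (j + k * h) \<or> word_content w (int d) = 1 \<and> e 5 = H + 1 + g * (j + k * h) \<or>
       word_content w (int d) = 2 \<and> e 5 = H + 2 + g * (j + k * h))) \<or> (0 < j \<or> h < s) \<and> e 5 = H + g * (j + k * h)) \<longleftrightarrow>
      e 5 = H + ?v (j + k * h) + g * (j + k * h)" if hj: "h < W" "j < k" for h j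
    proof (cases "j = 0 \<and> s \<le> h")
      case True
      define d where "d = h - s"
      have d: "d < W" "h = s + d" "\<And>d'. h = s + d' \<longleftrightarrow> d' = d" using True hj unfolding d_def by auto
      have v: "?v (j + k * h) = word_content w (int d)" unfolding start_value[OF hj(2,1)] d_def using True by simp
      have j: "j = 0" "\<not> h < s" using True by auto
      from wc[of "int d"] show ?thesis
      proof (elim disjE)
        assume c: "word_content w (int d) = 0"
        show ?thesis unfolding v d(3) c using c d(1) j by simp
      next
        assume c: "word_content w (int d) = 1"
        show ?thesis unfolding v d(3) c using c d(1) j by simp
      next
        assume c: "word_content w (int d) = 2"
        show ?thesis unfolding v d(3) c using c d(1) j by simp
      qed
    next
      case False
      have v: "?v (j + k * h) = 0" unfolding start_value[OF hj(2,1)] by (rule if_not_P[OF False])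
      have f: "0 < j \<or> h < s" "\<And>d. j = 0 \<Longrightarrow> h = s + d \<Longrightarrow> False" using False by auto
      show ?thesis unfolding v add_0_right using f by blast
    qed
    show ?thesis
      by (rule ex_cong1, rule conj_cong[OF refl], rule ex_cong1, rule conj_cong[OF refl], rule pw, assumption+)
  qed
  also have "\<dots> \<longleftrightarrow> (\<exists>i<m. e 5 = H + ?v i + g * i)"
  proof -
    have "\<exists>h<W. \<exists>j<k. i = j + k * h" if "i < m" for i
      using that sizes(1) unfolding m_def
      by (intro exI[of _ "i div k"] conjI exI[of _ "i mod k"]) (simp_all add: less_mult_imp_div_less mult.commute)
    then show ?thesis using cell_less by metis
  qed
  finally show ?thesis by (simp add: start_conf_def rep_def)
qed

lemma fsat_fStart:
  assumes e: "e 0 = length w" "e 5 < 3 * H"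
  shows "fsat (word_arrays w) e fStart \<longleftrightarrow> e 5 \<in> idx ` vm.conf (start_conf w)"
proof -
  have "heads (snd (init_config M w)) = replicate k s"
    using sizes(1) by (simp add: heads_def init_config_def map_replicate_const) (metis One_nat_def Suc_pred less_eq_Suc_le replicate_Suc)
  then have "fst (start_conf w) = enc (Rd (tm_start M) []) + \<Phi> * num W (replicate k s)"
    by (simp add: start_conf_def rep_def)
  then show ?thesis
    unfolding idx_conf[OF e(2)] fStart_def by (simp add: e(1) fsat_fInput[where e = e, OF e(1)] tval_tnum tvals)
qed

lemma fsat_fEnd:
  assumes e: "e 0 = length w" "e 5 < 3 * H"
  shows "fsat A e fEnd \<longleftrightarrow> e 5 \<in> idx ` vm.conf end_conf"
  unfolding idx_conf[OF e(2)] fEnd_def by (simp add: e(1) tvals end_conf_def)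

definition fBit :: fm where
  "fBit = fOr (fLt (V 1) tn) (fOr
     (Xs 2 tn (An (fEq (V 1) (Pl (Pl tn (N 1)) (V 2))) (fMem fStart)))
     (fOr (Xs 2 tn (An (fEq (V 1) (Pl (Pl (Ti (N 2) tn) (N 1)) (V 2))) (fMem fEnd)))
       (Xs 2 tn (Xs 3 tn (An (fEq (V 1) (Pl (Pl (Pl (Ti (N 3) tn) (N 1)) (Ti (V 2) tn)) (V 3))) fAdj)))))"

definition "tLen = Pl (Pl (Ti (N 3) tn) (N 1)) (Ti tn tn)"

text \<open>Differences and division by \<open>x\<close> are replaced by the existence of a vertex,
  or of a row and a column, with the given position.\<close>

lemma instance_bit_iff:
  assumes "i < 3 * x + 1 + x * x"
  shows "instance_bit x E S S' i \<longleftrightarrow> i < x \<or> (\<exists>v<x. i = x + 1 + v \<and> v \<in> S) \<or> (\<exists>v<x. i = 2 * x + 1 + v \<and> v \<in> S') \<or>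
    (\<exists>u<x. \<exists>v<x. i = 3 * x + 1 + u * x + v \<and> E u v)"
proof -
  have 1: "x < i \<and> i < 2 * x + 1 \<and> i - (x + 1) \<in> S \<longleftrightarrow> (\<exists>v<x. i = x + 1 + v \<and> v \<in> S)"
    by (auto intro!: exI[of _ "i - (x + 1)"])
  have 2: "2 * x + 1 \<le> i \<and> i < 3 * x + 1 \<and> i - (2 * x + 1) \<in> S' \<longleftrightarrow> (\<exists>v<x. i = 2 * x + 1 + v \<and> v \<in> S')"
    by (auto intro!: exI[of _ "i - (2 * x + 1)"])
  have 3: "3 * x + 1 \<le> i \<and> E ((i - (3 * x + 1)) div x) ((i - (3 * x + 1)) mod x) \<longleftrightarrow>
      (\<exists>u<x. \<exists>v<x. i = 3 * x + 1 + u * x + v \<and> E u v)"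
  proof
    assume *: "3 * x + 1 \<le> i \<and> E ((i - (3 * x + 1)) div x) ((i - (3 * x + 1)) mod x)"
    define y where "y = i - (3 * x + 1)"
    have y: "i = 3 * x + 1 + y" "y < x * x" using * assms by (auto simp: y_def)
    then have x: "0 < x" by (cases x) auto
    have "y div x < x" "y mod x < x" "y = y div x * x + y mod x" using y(2) x by (simp_all add: less_mult_imp_div_less)
    then show "\<exists>u<x. \<exists>v<x. i = 3 * x + 1 + u * x + v \<and> E u v"
      using * y(1) unfolding y_def[symmetric] by (intro exI[of _ "y div x"] conjI exI[of _ "y mod x"]) simp_all
  next
    assume "\<exists>u<x. \<exists>v<x. i = 3 * x + 1 + u * x + v \<and> E u v"
    then obtain u v where uv: "u < x" "v < x" "i = 3 * x + 1 + u * x + v" "E u v" by blast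
    then have "i - (3 * x + 1) = v + u * x" by simp
    then have "(i - (3 * x + 1)) div x = u" "(i - (3 * x + 1)) mod x = v" using uv(2) by simp_all
    then show "3 * x + 1 \<le> i \<and> E ((i - (3 * x + 1)) div x) ((i - (3 * x + 1)) mod x)" using uv by simp
  qed
  show ?thesis unfolding instance_bit_def 1 2 3 ..
qed

lemma fsat_fBit:
  assumes space: "runs_in_space M w s" and i: "i < 3 * n + 1 + n * n"
  shows "fsat (word_arrays w) (env (length w) i) fBit \<longleftrightarrow> instance_bit n (adj bl.graph) (start_set w) end_set i"
proof -
  let ?e = "env (length w) i"
  have e: "?e 0 = length w" "?e 1 = i" by (simp_all add: env_def)
  have s: "fsat (word_arrays w) (?e(2 := x)) (fMem fStart) \<longleftrightarrow> x \<in> start_set w" for x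
    using fsat_fMem[of "?e(2 := x)", OF _ conf_in_K(1)[OF space] fsat_fStart] e by (simp add: start_set_def)
  have t: "fsat (word_arrays w) (?e(2 := x)) (fMem fEnd) \<longleftrightarrow> x \<in> end_set" for x
    using fsat_fMem[of "?e(2 := x)", OF _ conf_in_K(2)[OF space] fsat_fEnd] e by (simp add: end_set_def)
  have a: "fsat (word_arrays w) (?e(2 := x, 3 := y)) fAdj \<longleftrightarrow> adj bl.graph x y" for x y
    using fsat_fAdj[of "?e(2 := x, 3 := y)"] e by simp
  have v: "tval (?e(2 := x, 3 := y)) tn = n" "tval (?e(2 := x)) tn = n" "tval ?e tn = n" for x y
    by (rule tvals, simp add: e)+
  show ?thesis
    unfolding instance_bit_iff[OF i] fBit_def using e(2) by (simp add: v s t a del: One_nat_def)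
qed

lemma encode_by_fBit:
  assumes "runs_in_space M w s"
  shows "map (\<lambda>i. fsat (word_arrays w) (env (length w) i) fBit) [0..<tval (env (length w) 0) tLen] =
     encode_instance n bl.graph (start_set w) end_set"
proof -
  have "tval (env (length w) 0) tLen = 3 * n + 1 + n * n" by (simp add: tLen_def tvals env_def)
  then show ?thesis unfolding encode_instance_bits using fsat_fBit[OF assms] by simp
qed

lemma farrs_fBit: "farrs fBit \<subseteq> {0}"
proof -
  have "farrs (fTrans x) = {}" for x by (simp add: fTrans_def Let_def fDigit_def farrs_fShift)
  then have "farrs fBlk = {}" by (simp add: fBlk_def fReact_def fInstr_def)
  then show ?thesis by (auto simp: fBit_def fMem_def fAdj_def fArc_def fStart_def fEnd_def fInput_def)
qed

end

text \<open>The machine and its polynomial space bound are fixed with the language, the latter as a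
  term in the input length; then one formula and one term for the length describe the instances for
  all words, and such functions are computable in polynomial time.\<close>

theorem phi_PSPACE_hard:
  "PSPACE_hard (msor1_instances phi 0 (forest_of_depth 3)) (msor1_yes_instances phi 0 (forest_of_depth 3))"
  unfolding PSPACE_hard_def
proof
  fix L assume "L \<in> PSPACE"
  then obtain M and p :: "nat poly" where wf: "wf_tm M" and dec: "decides M L"
    and space: "\<And>w. runs_in_space M w (poly p (length w))" unfolding PSPACE_def by blast
  obtain enc :: "ctl \<Rightarrow> nat" where inj: "inj_on enc (ctls M)" and less: "\<And>f. f \<in> ctls M \<Longrightarrow> enc f < card (ctls M)"
  proof -
    obtain enc where "bij_betw enc (ctls M) {0..<card (ctls M)}" using ex_bij_betw_finite_nat[OF finite_ctls[of M]] by blast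
    then have "inj_on enc (ctls M)" "\<And>f. f \<in> ctls M \<Longrightarrow> enc f < card (ctls M)"
      by (auto simp: bij_betw_def)
    then show thesis by (rule that)
  qed
  obtain tS where tS: "\<forall>e. tval e tS = poly p (e 0)" using ex_poly_term by blast
  \<comment> \<open>The parameters are the machine, its code numbers and the space term, so
    \<open>\<beta>\<close> and \<open>len\<close> are chosen before the input word.\<close>
  define \<beta> where "\<beta> = coded_instance.fBit M enc (card (ctls M)) tS"
  define len where "len = coded_instance.tLen M (card (ctls M)) tS"
  define f where "f w = map (\<lambda>i. fsat (word_arrays w) (env (length w) i) \<beta>) [0..<tval (env (length w) 0) len]" for w
  have ci: "coded_instance M enc (card (ctls M)) (poly p (length w)) tS w" for w
    by unfold_locales (use wf inj less tS in auto)
  have arrs: "farrs \<beta> \<subseteq> {0}" unfolding \<beta>_def by (rule coded_instance.farrs_fBit[OF ci])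
  have "farrs \<beta> \<subseteq> {..<3}" using arrs by auto
  then obtain m1 where m1: "fbelow m1 \<beta>" using ex_fbelow by blast
  obtain m2 where m2: "tbelow m2 len" using ex_tbelow by blast
  have "polytime_computable f"
    unfolding f_def by (rule polytime_by_formula[of "m1 + m2 + 2"])
      (use m1 m2 arrs in \<open>auto intro: fbelow_mono tbelow_mono\<close>)
  moreover have "f w \<in> msor1_instances phi 0 (forest_of_depth 3) \<and>
      (w \<in> L \<longleftrightarrow> f w \<in> msor1_yes_instances phi 0 (forest_of_depth 3))" for w
  proof -
    interpret coded_instance M enc "card (ctls M)" "poly p (length w)" tS w by (rule ci)
    have "f w = encode_instance n bl.graph (start_set w) end_set"
      unfolding f_def \<beta>_def len_def by (rule encode_by_fBit[OF space])
    then show ?thesis using reduction_correct[OF dec space] by simp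
  qed
  ultimately show "\<exists>f. polytime_computable f \<and> (\<forall>w. f w \<in> msor1_instances phi 0 (forest_of_depth 3) \<and>
      (w \<in> L \<longleftrightarrow> f w \<in> msor1_yes_instances phi 0 (forest_of_depth 3)))" by blast
qed

theorem theorem5p1:
  shows "\<exists>(\<phi> :: mso1) (X :: nat).
           free_vertex_vars \<phi> = {} \<and> free_set_vars \<phi> = {X} \<and>
           PSPACE_complete (msor1_instances \<phi> X (forest_of_depth 3))
                           (msor1_yes_instances \<phi> X (forest_of_depth 3))"
  using free_vertex_phi free_set_phi yes_instances_PSPACE phi_PSPACE_hard
  unfolding PSPACE_complete_def by blast

end
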